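(* Let $X$ be a Lévy process satisfying the standing assumptions stated in the context, let $q>0$, $\beta>1$, and let $a^\ast=\inf\{a>0:\beta\,\underline{\nu}(a)\le 1\}$, where $\underline{\nu}(a)=\mathbb{E}_a[e^{-q\kappa^{a,-}_0}]$. Then the double barrier strategy $\pi^{a^\ast}$ at $a^\ast$ is optimal: $\pi^{a^\ast}\in\mathcal{A}$ and the value function $v(x)=\sup_{\pi\in\mathcal{A}}v_\pi(x)$ is given by $$v(x)=v_{\pi^{a^\ast}}(x),\qquad x\in\mathbb{R}.$$
   Context: **Lévy process.** $X=\{X_t:t\ge0\}$ is a real-valued Lévy process; $\mathbb{P}_x$ (expectation $\mathbb{E}_x$) is its law when started at $x\in\mathbb{R}$, and $\mathcal{F}=\{\mathcal{F}_t\}$ is the filtration generated by $X$. Its characteristic exponent, defined by $e^{-t\Psi(\lambda)}=\mathbb{E}_0[e^{i\lambda X_t}]$, is $$\Psi(\lambda)=-i\gamma\lambda+\tfrac12\sigma^2\lambda^2+\int_{\mathbb{R}\setminus\{0\}}(1-e^{i\lambda x}+i\lambda x1_{\{|x|<1\}})\Pi(dx),$$ with $\gamma\in\mathbb{R}$, $\sigma\ge0$, and $\Pi$ a Lévy measure, $\int(1\wedge x^2)\Pi(dx)<\infty$. $X$ has bounded variation paths iff $\sigma=0$ and $\int_{|x|<1}|x|\Pi(dx)<\infty$; in that case set $\delta=\gamma-\int_{|x|<1}x\,\Pi(dx)$, so that $X_t=X_0+\delta t+\sum_{0<s\le t}(X_s-X_{s-})$. Put $\tau^+_x=\inf\{t>0:X_t>x\}$,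 $\tau^-_x=\inf\{t>0:X_t<x\}$. A constant $q>0$ (discount factor) is fixed. For $a>0$, $x\in\mathbb{R}$: $\overline{\varphi}_{a,0}(x)=\mathbb{E}_x[e^{-q\tau^+_a};\tau^+_a<\tau^-_0]$ and $\underline{\varphi}_{0,a}(x)=\mathbb{E}_x[e^{-q\tau^-_0};\tau^-_0<\tau^+_a]$. **Standing assumptions.** $X$ does not have monotone paths; $\mathbb{E}_0[|X_1|]<\infty$; and, if $X$ has unbounded variation paths, then for every $a>0$ the functions $\overline{\varphi}_{a,0}$ and $\underline{\varphi}_{0,a}$ have Radon–Nikodym densities with respect to Lebesgue measure on $(0,a)$ which are continuous almost everywhere and locally bounded on $(0,a)$. **Control problem.** A strategy is a pair $\pi=\{(L^\pi_t,R^\pi_t):t\ge0\}$ of non-decreasing, right-continuous, $\mathcal{F}$-adapted processes with $L^\pi_{0-}=R^\pi_{0-}=0$ (cumulative dividends and cumulative capital injections) such that $U^\pi_t:=X_t-L^\pi_t+R^\pi_t\ge0$ for all $t\ge0$ (with $U^\pi_{0-}=X_0$). Put $v^L_\pi(x)=\mathbb{E}_x[\int_{[0,\infty)}e^{-qt}dL^\pi_t]$, $v^R_\pi(x)=\mathbb{E}_x[\int_{[0,\infty)}e^{-qt}dR^\pi_t]$, where the integrals include a possible jump at time $0$. $\mathcal{A}$ (the admissible strategies) is the set of all strategies with $v^R_\pi(x)<\infty$ for all $x\in\mathbb{R}$. A constant $\beta>1$ is fixed and $v_\pi(x)=v^L_\pi(x)-\beta v^R_\pi(x)$. **Double barrier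 strategies.** For $a>0$, $\pi^a=(L^{\pi^a},R^{\pi^a})$ is the strategy making $U^{\pi^a}=X-L^{\pi^a}+R^{\pi^a}$ the process $X$ doubly reflected at $0$ and $a$, constructed as follows. (0) Let $T_0=\tau^-_0$, $T_a=\tau^+_a$, $\eta=X_{T_0\wedge T_a}$. For $t<T_0\wedge T_a$ put $L^{\pi^a}_t=R^{\pi^a}_t=0$, $U^{\pi^a}_t=X_t$. If $T_0<T_a$ go to (2); if $T_a<T_0$ go to (1). (1) For $t\ge T_a$ let $S_t=\sup_{s\in[T_a,t]}(X_s-X_{T_a})$, $L'_t=\eta-a+S_t$, $U'_t=a+X_t-X_{T_a}-S_t$. Reset $T_0=\inf\{t>T_a:U'_t<0\}$ and $\eta=U'_{T_0}$. For $t\in[T_a,T_0)$ put $U^{\pi^a}_t=U'_t$, $L^{\pi^a}_t=L^{\pi^a}_{T_a-}+L'_t$, $R^{\pi^a}_t=R^{\pi^a}_{T_a-}$. Go to (2). (2) For $t\ge T_0$ let $I_t=\inf_{s\in[T_0,t]}(X_s-X_{T_0})$, $R'_t=-\eta-I_t$, $U'_t=X_t-X_{T_0}-I_t$. Reset $T_a=\inf\{t>T_0:U'_t>a\}$ and $\eta=U'_{T_a}$. For $t\in[T_0,T_a)$ put $U^{\pi^a}_t=U'_t$, $L^{\pi^a}_t=L^{\pi^a}_{T_0-}$, $R^{\pi^a}_t=R^{\pi^a}_{T_0-}+R'_t$. Go to (1). When $X$ has bounded variation paths, $\pi^0$ is also defined, by $L^{\pi^0}_t=X_01_{\{X_0>0\}}+\delta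 t1_{\{\delta>0\}}+\sum_{0<s\le t}(X_s-X_{s-})^+$, $R^{\pi^0}_t=-X_01_{\{X_0<0\}}-\delta t1_{\{\delta<0\}}+\sum_{0<s\le t}(X_s-X_{s-})^-$ (with $y^+=y\vee0$, $y^-=(-y)\vee0$), so $U^{\pi^0}\equiv0$. **Barrier.** For $a\in\mathbb{R}$ let $Y^a_t=X_t-((\sup_{s\in[0,t]}X_s-a)\vee0)$ and $\kappa^{a,-}_x=\inf\{t>0:Y^a_t<x\}$. One has $a^\ast<\infty$, and $a^\ast>0$ when $X$ has unbounded variation paths, so $\pi^{a^\ast}$ is always defined. *)

theory Defs
  imports "HOL-Probability.Probability"
begin

section \<open>Levy processes\<close>

text \<open>A process is a function \<open>X :: real \<Rightarrow> 'w \<Rightarrow> real\<close>; only the times \<open>t \<ge> 0\<close> are relevant.\<close>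

definition cadlag :: "(real \<Rightarrow> real) \<Rightarrow> bool" where
  "cadlag f \<longleftrightarrow>
     (\<forall>t\<ge>0. continuous (at_right t) f) \<and> (\<forall>t>0. \<exists>l. (f \<longlongrightarrow> l) (at_left t))"

definition levy_process :: "'w measure \<Rightarrow> (real \<Rightarrow> 'w \<Rightarrow> real) \<Rightarrow> bool" where
  "levy_process M X \<longleftrightarrow>
     prob_space M \<and>
     (\<forall>t\<ge>0. X t \<in> borel_measurable M) \<and>
     (\<forall>\<omega>\<in>space M. cadlag (\<lambda>t. X t \<omega>)) \<and>
     (AE \<omega> in M. X 0 \<omega> = 0) \<and>
     (\<forall>(t :: nat \<Rightarrow> real) n. mono t \<and> 0 \<le> t 0 \<longrightarrow>
        prob_space.indep_vars M (\<lambda>_. borel) (\<lambda>i \<omega>. X (t (Suc i)) \<omega> - X (t i) \<omega>) {..<n}) \<and>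
     (\<forall>s\<ge>0. \<forall>h\<ge>0. distr M borel (\<lambda>\<omega>. X (s + h) \<omega> - X s \<omega>) = distr M borel (X h))"

text \<open>\<open>P x\<close> is the measure under which \<open>X\<close> starts at \<open>x\<close>. All these measures live on one measurable
  space, so that a strategy is a single object evaluated under every \<open>P x\<close>; the last clause says that
  the law of \<open>X\<close> under \<open>P x\<close> is the law of \<open>x + X\<close> under \<open>P 0\<close>.\<close>

definition levy_family :: "(real \<Rightarrow> 'w measure) \<Rightarrow> (real \<Rightarrow> 'w \<Rightarrow> real) \<Rightarrow> bool" where
  "levy_family P X \<longleftrightarrow>
     levy_process (P 0) X \<and>
     (\<forall>x. prob_space (P x) \<and> space (P x) = space (P 0) \<and> sets (P x) = sets (P 0)) \<and>
     (\<forall>x. distr (P x) (Pi\<^sub>M {0..} (\<lambda>_. borel)) (\<lambda>\<omega>. \<lambda>t\<in>{0..}. X t \<omega>) =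
          distr (P 0) (Pi\<^sub>M {0..} (\<lambda>_. borel)) (\<lambda>\<omega>. \<lambda>t\<in>{0..}. x + X t \<omega>))"

text \<open>Null mass at the origin encodes that a Levy measure lives on the reals without 0.\<close>

definition levy_measure :: "real measure \<Rightarrow> bool" where
  "levy_measure \<mu> \<longleftrightarrow>
     sets \<mu> = sets borel \<and> emeasure \<mu> {0} = 0 \<and> (\<integral>\<^sup>+ x. ennreal (min 1 (x\<^sup>2)) \<partial>\<mu>) < \<infinity>"

definition char_exponent :: "real \<Rightarrow> real \<Rightarrow> real measure \<Rightarrow> real \<Rightarrow> complex" where
  "char_exponent \<gamma> \<sigma> \<mu> \<theta> =
     - \<i> * of_real (\<gamma> * \<theta>) + of_real (\<sigma>\<^sup>2 * \<theta>\<^sup>2 / 2)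
     + (CLINT x|\<mu>. 1 - iexp (\<theta> * x) + \<i> * of_real (\<theta> * x * indicator {-1<..<1} x))"

definition levy_triplet ::
  "'w measure \<Rightarrow> (real \<Rightarrow> 'w \<Rightarrow> real) \<Rightarrow> real \<Rightarrow> real \<Rightarrow> real measure \<Rightarrow> bool" where
  "levy_triplet M X \<gamma> \<sigma> \<mu> \<longleftrightarrow>
     0 \<le> \<sigma> \<and> levy_measure \<mu> \<and>
     (\<forall>t\<ge>0. \<forall>\<theta>. char (distr M borel (X t)) \<theta> = exp (- of_real t * char_exponent \<gamma> \<sigma> \<mu> \<theta>))"

definition monotone_paths :: "'w measure \<Rightarrow> (real \<Rightarrow> 'w \<Rightarrow> real) \<Rightarrow> bool" where
  "monotone_paths M X \<longleftrightarrow>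
     (AE \<omega> in M. mono_on {0..} (\<lambda>t. X t \<omega>)) \<or> (AE \<omega> in M. antimono_on {0..} (\<lambda>t. X t \<omega>))"

definition bounded_variation_upto :: "real \<Rightarrow> (real \<Rightarrow> real) \<Rightarrow> bool" where
  "bounded_variation_upto T f \<longleftrightarrow>
     (\<exists>C. \<forall>(t :: nat \<Rightarrow> real) n. mono t \<and> 0 \<le> t 0 \<and> t n \<le> T \<longrightarrow>
            (\<Sum>i<n. \<bar>f (t (Suc i)) - f (t i)\<bar>) \<le> C)"

definition bounded_variation_paths :: "'w measure \<Rightarrow> (real \<Rightarrow> 'w \<Rightarrow> real) \<Rightarrow> bool" where
  "bounded_variation_paths M X \<longleftrightarrow>
     (AE \<omega> in M. \<forall>T\<ge>0. bounded_variation_upto T (\<lambda>t. X t \<omega>))"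

text \<open>Meaningful only for paths of bounded variation: it is then the drift \<open>\<delta>\<close> of \<open>X\<close>.\<close>

definition drift :: "real \<Rightarrow> real measure \<Rightarrow> real" where
  "drift \<gamma> \<mu> = \<gamma> - (LINT x:{-1<..<1}|\<mu>. x)"


section \<open>First passage times\<close>

text \<open>The infimum is taken in the extended reals, so it is \<open>\<infinity>\<close> when \<open>Q\<close> never holds after \<open>s\<close>.\<close>

definition first_time :: "real \<Rightarrow> (real \<Rightarrow> bool) \<Rightarrow> ereal" where
  "first_time s Q = Inf (ereal ` {t. s < t \<and> Q t})"

definition discount :: "real \<Rightarrow> ereal \<Rightarrow> real" where
  "discount q T = (if T = \<infinity> then 0 else exp (- q * real_of_ereal T))"

definition tau_above :: "(real \<Rightarrow> 'w \<Rightarrow> real) \<Rightarrow> real \<Rightarrow> 'w \<Rightarrow> ereal" where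
  "tau_above X y \<omega> = first_time 0 (\<lambda>t. X t \<omega> > y)"

definition tau_below :: "(real \<Rightarrow> 'w \<Rightarrow> real) \<Rightarrow> real \<Rightarrow> 'w \<Rightarrow> ereal" where
  "tau_below X y \<omega> = first_time 0 (\<lambda>t. X t \<omega> < y)"

definition phi_up :: "(real \<Rightarrow> 'w measure) \<Rightarrow> (real \<Rightarrow> 'w \<Rightarrow> real) \<Rightarrow> real \<Rightarrow> real \<Rightarrow> real \<Rightarrow> real" where
  "phi_up P X q a x =
     (\<integral>\<omega>. discount q (tau_above X a \<omega>) * of_bool (tau_above X a \<omega> < tau_below X 0 \<omega>) \<partial>P x)"

definition phi_down :: "(real \<Rightarrow> 'w measure) \<Rightarrow> (real \<Rightarrow> 'w \<Rightarrow> real) \<Rightarrow> real \<Rightarrow> real \<Rightarrow> real \<Rightarrow> real" where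
  "phi_down P X q a x =
     (\<integral>\<omega>. discount q (tau_below X 0 \<omega>) * of_bool (tau_below X 0 \<omega> < tau_above X a \<omega>) \<partial>P x)"

text \<open>\<open>f\<close> has on \<open>(0, a)\<close> a density with respect to Lebesgue measure that is continuous almost
  everywhere and locally bounded there. Integrability and boundedness are required on compact
  subintervals only.\<close>

definition regular_density_on :: "real \<Rightarrow> (real \<Rightarrow> real) \<Rightarrow> bool" where
  "regular_density_on a f \<longleftrightarrow>
     (\<exists>g. (\<forall>x y. 0 < x \<and> x \<le> y \<and> y < a \<longrightarrow>
             set_integrable lborel {x..y} g \<and> f y - f x = (LBINT u:{x..y}. g u) \<and>
             bounded (g ` {x..y})) \<and>
          (AE u in lborel. u \<in> {0<..<a} \<longrightarrow> isCont g u))"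

definition reflected_above :: "(real \<Rightarrow> 'w \<Rightarrow> real) \<Rightarrow> real \<Rightarrow> real \<Rightarrow> 'w \<Rightarrow> real" where
  "reflected_above X a t \<omega> = X t \<omega> - max ((SUP s\<in>{0..t}. X s \<omega>) - a) 0"

definition kappa_below :: "(real \<Rightarrow> 'w \<Rightarrow> real) \<Rightarrow> real \<Rightarrow> real \<Rightarrow> 'w \<Rightarrow> ereal" where
  "kappa_below X a y \<omega> = first_time 0 (\<lambda>t. reflected_above X a t \<omega> < y)"

definition nu_low :: "(real \<Rightarrow> 'w measure) \<Rightarrow> (real \<Rightarrow> 'w \<Rightarrow> real) \<Rightarrow> real \<Rightarrow> real \<Rightarrow> real" where
  "nu_low P X q a = (\<integral>\<omega>. discount q (kappa_below X a 0 \<omega>) \<partial>P a)"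

definition optimal_barrier ::
  "(real \<Rightarrow> 'w measure) \<Rightarrow> (real \<Rightarrow> 'w \<Rightarrow> real) \<Rightarrow> real \<Rightarrow> real \<Rightarrow> real" where
  "optimal_barrier P X q \<beta> = Inf {a. 0 < a \<and> \<beta> * nu_low P X q a \<le> 1}"


section \<open>The control problem\<close>

definition natural_filtration :: "'w set \<Rightarrow> (real \<Rightarrow> 'w \<Rightarrow> real) \<Rightarrow> real \<Rightarrow> 'w measure" where
  "natural_filtration \<Omega> X t =
     sigma \<Omega> {X s -` B \<inter> \<Omega> | s B. 0 \<le> s \<and> s \<le> t \<and> B \<in> sets borel}"

text \<open>The components of a strategy are the cumulative dividends and the cumulative injections.\<close>

type_synonym 'w strategy = "(real \<Rightarrow> 'w \<Rightarrow> real) \<times> (real \<Rightarrow> 'w \<Rightarrow> real)"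

text \<open>The value at \<open>0-\<close> is 0, so monotonicity includes \<open>f 0 \<ge> 0\<close>.\<close>

definition cumulative_path :: "(real \<Rightarrow> real) \<Rightarrow> bool" where
  "cumulative_path f \<longleftrightarrow> 0 \<le> f 0 \<and> mono_on {0..} f \<and> (\<forall>t\<ge>0. continuous (at_right t) f)"

text \<open>Adaptedness is to the filtration without completion, and the pathwise requirements hold almost
  surely under every \<open>P x\<close>.\<close>

definition strategies :: "(real \<Rightarrow> 'w measure) \<Rightarrow> (real \<Rightarrow> 'w \<Rightarrow> real) \<Rightarrow> 'w strategy set" where
  "strategies P X =
     {(L, R).
        (\<forall>t\<ge>0. L t \<in> borel_measurable (natural_filtration (space (P 0)) X t) \<and>
               R t \<in> borel_measurable (natural_filtration (space (P 0)) X t)) \<and>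
        (\<forall>x. AE \<omega> in P x.
               cumulative_path (\<lambda>t. L t \<omega>) \<and> cumulative_path (\<lambda>t. R t \<omega>) \<and>
               (\<forall>t\<ge>0. 0 \<le> X t \<omega> - L t \<omega> + R t \<omega>))}"

text \<open>Extending the path by 0 to the left of 0 makes the Stieltjes measure charge \<open>{0}\<close> with the
  initial jump.\<close>

definition discounted_integral :: "real \<Rightarrow> (real \<Rightarrow> real) \<Rightarrow> ennreal" where
  "discounted_integral q f =
     (\<integral>\<^sup>+ t\<in>{0..}. ennreal (exp (- q * t)) \<partial>interval_measure (\<lambda>t. if t < 0 then 0 else f t))"

definition expected_npv :: "(real \<Rightarrow> 'w measure) \<Rightarrow> real \<Rightarrow> (real \<Rightarrow> 'w \<Rightarrow> real) \<Rightarrow> real \<Rightarrow> ennreal" where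
  "expected_npv P q L x = (\<integral>\<^sup>+ \<omega>. discounted_integral q (\<lambda>t. L t \<omega>) \<partial>P x)"

definition admissible ::
  "(real \<Rightarrow> 'w measure) \<Rightarrow> (real \<Rightarrow> 'w \<Rightarrow> real) \<Rightarrow> real \<Rightarrow> 'w strategy set" where
  "admissible P X q = {\<pi> \<in> strategies P X. \<forall>x. expected_npv P q (snd \<pi>) x < \<infinity>}"

text \<open>On \<open>admissible\<close> the subtracted term is finite, so \<open>\<infinity> - \<infinity>\<close> does not arise.\<close>

definition strategy_value ::
  "(real \<Rightarrow> 'w measure) \<Rightarrow> real \<Rightarrow> real \<Rightarrow> 'w strategy \<Rightarrow> real \<Rightarrow> ereal" where
  "strategy_value P q \<beta> \<pi> x =
     enn2ereal (expected_npv P q (fst \<pi>) x) - ereal \<beta> * enn2ereal (expected_npv P q (snd \<pi>) x)"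

definition value_function ::
  "(real \<Rightarrow> 'w measure) \<Rightarrow> (real \<Rightarrow> 'w \<Rightarrow> real) \<Rightarrow> real \<Rightarrow> real \<Rightarrow> real \<Rightarrow> ereal" where
  "value_function P X q \<beta> x = (SUP \<pi>\<in>admissible P X q. strategy_value P q \<beta> \<pi> x)"


section \<open>Double barrier strategies\<close>

text \<open>The construction is pathwise. A path \<open>f\<close> is cut into phases; during a \<open>Top\<close> phase it is
  reflected downwards at \<open>a\<close>, during a \<open>Bottom\<close> phase upwards at 0. \<open>Phase s T \<eta> l r\<close> starts at time
  \<open>T\<close>, where \<open>\<eta>\<close> is the position of the surplus at \<open>T\<close> before the barrier acts, and \<open>l\<close> and \<open>r\<close> are
  the left limits of the two controls at \<open>T\<close>.\<close>

datatype side = Top | Bottom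

datatype phase = Phase side real real real real

fun phase_start :: "phase \<Rightarrow> real" where
  "phase_start (Phase s T \<eta> l r) = T"

fun phase_U :: "real \<Rightarrow> (real \<Rightarrow> real) \<Rightarrow> phase \<Rightarrow> real \<Rightarrow> real" where
  "phase_U a f (Phase Top T \<eta> l r) t = a + f t - f T - (SUP s\<in>{T..t}. f s - f T)"
| "phase_U a f (Phase Bottom T \<eta> l r) t = f t - f T - (INF s\<in>{T..t}. f s - f T)"

fun phase_L :: "real \<Rightarrow> (real \<Rightarrow> real) \<Rightarrow> phase \<Rightarrow> real \<Rightarrow> real" where
  "phase_L a f (Phase Top T \<eta> l r) t = l + (\<eta> - a + (SUP s\<in>{T..t}. f s - f T))"
| "phase_L a f (Phase Bottom T \<eta> l r) t = l"

fun phase_R :: "real \<Rightarrow> (real \<Rightarrow> real) \<Rightarrow> phase \<Rightarrow> real \<Rightarrow> real" where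
  "phase_R a f (Phase Top T \<eta> l r) t = r"
| "phase_R a f (Phase Bottom T \<eta> l r) t = r + (- \<eta> - (INF s\<in>{T..t}. f s - f T))"

fun phase_end :: "real \<Rightarrow> (real \<Rightarrow> real) \<Rightarrow> phase \<Rightarrow> ereal" where
  "phase_end a f (Phase Top T \<eta> l r) = first_time T (\<lambda>t. phase_U a f (Phase Top T \<eta> l r) t < 0)"
| "phase_end a f (Phase Bottom T \<eta> l r) = first_time T (\<lambda>t. phase_U a f (Phase Bottom T \<eta> l r) t > a)"

fun opposite_side :: "phase \<Rightarrow> side" where
  "opposite_side (Phase Top T \<eta> l r) = Bottom"
| "opposite_side (Phase Bottom T \<eta> l r) = Top"

definition next_phase :: "real \<Rightarrow> (real \<Rightarrow> real) \<Rightarrow> phase \<Rightarrow> phase option" where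
  "next_phase a f p =
     (if phase_end a f p = \<infinity> then None
      else let T = real_of_ereal (phase_end a f p) in
        Some (Phase (opposite_side p) T (phase_U a f p T)
               (Lim (at_left T) (phase_L a f p)) (Lim (at_left T) (phase_R a f p))))"

text \<open>Before the first exit of \<open>f\<close> from \<open>[0, a]\<close> both controls vanish; \<open>None\<close> if \<open>f\<close> never exits.\<close>

definition first_phase :: "real \<Rightarrow> (real \<Rightarrow> real) \<Rightarrow> phase option" where
  "first_phase a f =
     (let T0 = first_time 0 (\<lambda>t. f t < 0); Ta = first_time 0 (\<lambda>t. f t > a) in
      if T0 < Ta then Some (Phase Bottom (real_of_ereal T0) (f (real_of_ereal T0)) 0 0)
      else if Ta < T0 then Some (Phase Top (real_of_ereal Ta) (f (real_of_ereal Ta)) 0 0)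
      else None)"

fun nth_phase :: "real \<Rightarrow> (real \<Rightarrow> real) \<Rightarrow> nat \<Rightarrow> phase option" where
  "nth_phase a f 0 = first_phase a f"
| "nth_phase a f (Suc n) = Option.bind (nth_phase a f n) (next_phase a f)"

definition current_phase :: "real \<Rightarrow> (real \<Rightarrow> real) \<Rightarrow> real \<Rightarrow> phase \<Rightarrow> bool" where
  "current_phase a f t p \<longleftrightarrow>
     (\<exists>n. nth_phase a f n = Some p) \<and> phase_start p \<le> t \<and> ereal t < phase_end a f p"

definition barrier_L :: "real \<Rightarrow> (real \<Rightarrow> real) \<Rightarrow> real \<Rightarrow> real" where
  "barrier_L a f t =
     (if \<exists>p. current_phase a f t p then phase_L a f (THE p. current_phase a f t p) t else 0)"

definition barrier_R :: "real \<Rightarrow> (real \<Rightarrow> real) \<Rightarrow> real \<Rightarrow> real" where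
  "barrier_R a f t =
     (if \<exists>p. current_phase a f t p then phase_R a f (THE p. current_phase a f t p) t else 0)"

definition jump :: "(real \<Rightarrow> real) \<Rightarrow> real \<Rightarrow> real" where
  "jump f s = f s - Lim (at_left s) f"

definition zero_barrier_L :: "real \<Rightarrow> (real \<Rightarrow> real) \<Rightarrow> real \<Rightarrow> real" where
  "zero_barrier_L \<delta> f t =
     f 0 * of_bool (f 0 > 0) + \<delta> * t * of_bool (\<delta> > 0) + (\<Sum>\<^sub>\<infinity>s\<in>{0<..t}. max (jump f s) 0)"

definition zero_barrier_R :: "real \<Rightarrow> (real \<Rightarrow> real) \<Rightarrow> real \<Rightarrow> real" where
  "zero_barrier_R \<delta> f t =
     - f 0 * of_bool (f 0 < 0) - \<delta> * t * of_bool (\<delta> < 0) + (\<Sum>\<^sub>\<infinity>s\<in>{0<..t}. max (- jump f s) 0)"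

text \<open>\<open>\<delta>\<close> is the drift and matters only at \<open>a = 0\<close>, where the strategy is meant for paths of bounded
  variation.\<close>

definition double_barrier :: "(real \<Rightarrow> 'w \<Rightarrow> real) \<Rightarrow> real \<Rightarrow> real \<Rightarrow> 'w strategy" where
  "double_barrier X \<delta> a =
     (if a = 0
      then (\<lambda>t \<omega>. zero_barrier_L \<delta> (\<lambda>s. X s \<omega>) t, \<lambda>t \<omega>. zero_barrier_R \<delta> (\<lambda>s. X s \<omega>) t)
      else (\<lambda>t \<omega>. barrier_L a (\<lambda>s. X s \<omega>) t, \<lambda>t \<omega>. barrier_R a (\<lambda>s. X s \<omega>) t))"

end

theory Submission
  imports Defs
begin

text \<open>
  Let \<open>\<nu>(b)\<close> be the expected discount factor at the first time at which the drawdown of \<open>X\<close> exceeds \<open>b\<close>; it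
  is the function defining the optimal barrier. Let \<open>(L, R)\<close> reflect \<open>X\<close> at \<open>0\<close> and \<open>a\<close> with surplus \<open>U\<close>, and let
  \<open>(L', R')\<close> be any competitor. Since its surplus is nonnegative, \<open>L' + R <= R' + L + U\<close>. Integrate this against
  the decreasing weight \<open>d(t)\<close>, the discount factor at the first time after \<open>t\<close> at which \<open>U < a - b\<close>: the weight
  dominates the discounted drawdown time, equals it where \<open>L\<close> grows (there \<open>U = a\<close>), and equals \<open>exp (- q t)\<close>
  where \<open>R\<close> grows. By the Markov property the drawdown weight contributes a factor \<open>\<nu>(b)\<close>, so
  \<open>\<nu>(b) v\<^sub>L' + v\<^sub>R <= v\<^sub>R' + \<nu>(b) v\<^sub>L + (a - b)\<close>, and for \<open>b = a\<close> the error vanishes. At the optimal barrier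
  \<open>\<beta> \<nu>(a) <= 1\<close> while \<open>\<beta> \<nu>(b) > 1\<close> for \<open>b < a\<close>; using \<open>b = a\<close> when \<open>v\<^sub>L' <= v\<^sub>L\<close> and \<open>b\<close> close to \<open>a\<close> otherwise
  gives \<open>v\<^sub>L' - \<beta> v\<^sub>R' <= v\<^sub>L - \<beta> v\<^sub>R\<close>. If the optimal barrier is \<open>0\<close>, then \<open>\<nu>(0) < 1\<close>, so \<open>X\<close> is monotone on some
  interval \<open>[0, h]\<close> with positive probability. This bounds the expected number of negative increments along
  dyadic grids, hence the variation, and a second moment estimate for \<open>sin (\<theta> x) / \<theta>\<close> summed over the increments
  identifies \<open>X\<close> as drift plus jumps.
\<close>

section \<open>Stieltjes integrals against controls\<close>

text \<open>The inequality between the controls holds at each single time, whereas the conclusion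
  compares Stieltjes integrals. A decreasing weight makes the passage possible: its superlevel sets
  are initial segments of the half-line, and the mass of such a segment is the value of the control
  at its right end. The loss is the surplus at that end, so the weight may drop only near times
  where \<open>U\<close> is small. For \<open>b < a\<close> these are the visits below
  \<open>a - b\<close>. For \<open>b = a\<close> no level below 0 is ever visited, and the weight
  watches the growth of the injections instead; that it still agrees with the drawdown weight where
  dividends grow needs a strict drawdown, proved separately for a positive barrier and for the
  barrier 0. Infinite values are kept out of the comparison by first cutting the controls at a
  finite total: \<open>\<nu>(a) < 1\<close> bounds the cut values uniformly. The strategy at barrier
  0 is written with an explicit drift and explicit jump sums, so there the paths themselves must be
  decomposed before the pathwise comparison applies.\<close>

definition zero_extension :: "(real => real) => real => real" where
  "zero_extension F = (%t. if t < 0 then 0 else F t)"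

definition control_measure :: "(real => real) => real measure" where
  "control_measure F = interval_measure (zero_extension F)"

abbreviation mass :: "(real => real) => real set => ennreal" where
  "mass F \<equiv> emeasure (control_measure F)"

lemma sets_control_measure [simp, measurable_cong]: "sets (control_measure F) = sets borel" by (simp add: control_measure_def)

lemma space_control_measure [simp]: "space (control_measure F) = UNIV" by (simp add: control_measure_def)

lemma cumulative_pathD:
  assumes "cumulative_path F"
  shows "0 <= F 0" "0 <= s ==> s <= t ==> F s <= F t" "0 <= t ==> 0 <= F t"
    "0 <= t ==> continuous (at_right t) F"
proof -
  show 1: "0 <= F 0" "0 <= t ==> continuous (at_right t) F" for t using assms by (auto simp: cumulative_path_def)
  show 2: "0 <= s ==> s <= t ==> F s <= F t" for s t using assms by (auto simp: cumulative_path_def mono_on_def)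
  show "0 <= t ==> 0 <= F t" using 1 2[of 0 t] by linarith
qed

lemma zero_extension_mono:
  assumes "cumulative_path F" "x <= y"
  shows "zero_extension F x <= zero_extension F y" using cumulative_pathD(2,3)[OF assms(1)] assms(2) by (auto simp: zero_extension_def)

lemma zero_extension_right_continuous:
  assumes "cumulative_path F"
  shows "continuous (at_right x) (zero_extension F)"
proof (cases "x < 0")
  case True
  have "\<forall>\<^sub>F t in at_right x. t < 0" using True by (auto simp: eventually_at_right[of x 0])
  hence "((%t. if t < 0 then 0 else F t) \<longlongrightarrow> 0) (at_right x)" by (intro tendsto_eventually) (auto elim: eventually_mono)
  thus ?thesis using True by (simp add: continuous_within zero_extension_def)
next
  case False
  have "\<forall>\<^sub>F t in at_right x. (if t < 0 then 0 else F t) = F t"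
    using eventually_at_right_less[of x] by eventually_elim (use False in auto)
  moreover have "(F \<longlongrightarrow> F x) (at_right x)" using cumulative_pathD(4)[OF assms, of x] False by (simp add: continuous_within)
  ultimately show ?thesis using False by (simp add: continuous_within zero_extension_def cong: tendsto_cong)
qed

context
  fixes F assumes F: "cumulative_path F"
begin

lemma emeasure_control_zero_extension:
  "s <= t ==> mass F {s<..t} = ennreal (zero_extension F t - zero_extension F s)" unfolding control_measure_def
  by (intro emeasure_interval_measure_Ioc zero_extension_mono[OF F] zero_extension_right_continuous[OF F])

lemma emeasure_control_Ioc:
  assumes "0 <= s" "s <= t" shows "mass F {s<..t} = ennreal (F t - F s)"
  using assms by (simp add: emeasure_control_zero_extension zero_extension_def)

lemma emeasure_control_neg: "mass F {..<0} = 0"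
proof -
  \<comment> \<open>Masses are known for half-open intervals closed on the right; the right ends
    \<open>- 1 / (real n + 1)\<close> stay strictly negative, so the jump of the extension at 0 is
    never met.\<close>
  have "{..<0::real} = (\<Union>n::nat. {- real n - 1 <.. - 1 / (real n + 1)})"
  proof (intro set_eqI iffI)
    fix x :: real assume "x \<in> {..<0}"
    hence x: "x < 0" by simp
    obtain n1 where n1: "- x < real n1" using reals_Archimedean2 by blast
    obtain n2 where n2: "1 / (-x) < real n2" using reals_Archimedean2 by blast
    define n where "n = max n1 n2"
    have a: "- x < real n + 1" "1 / (-x) < real n + 1" using n1 n2 by (auto simp: n_def)
    have "1 / (real n + 1) <= - x" using a(2) x by (simp add: field_simps)
    hence "x \<in> {- real n - 1 <.. - 1 / (real n + 1)}" using a(1) by auto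
    thus "x \<in> (\<Union>n::nat. {- real n - 1 <.. - 1 / (real n + 1)})" by blast
  next
    fix x :: real assume "x \<in> (\<Union>n::nat. {- real n - 1 <.. - 1 / (real n + 1)})"
    then obtain n :: nat where "x <= - 1 / (real n + 1)" by auto
    moreover have "- 1 / (real n + 1) < 0" by (simp del: minus_divide_left)
    ultimately have "x < 0" by (rule le_less_trans)
    thus "x \<in> {..<0}" by simp
  qed
  moreover have "mass F {- real n - 1 <.. - 1 / (real n + 1)} = 0" for n :: nat
  proof -
    have "1 / (real n + 1) <= 1" "- real n - 1 < 0" "- 1 / (real n + 1) < 0" by (auto simp: divide_simps)
    hence "- real n - 1 <= - 1 / (real n + 1)" by linarith
    with \<open>- real n - 1 < 0\<close> \<open>- 1 / (real n + 1) < 0\<close> show ?thesis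
      by (simp add: emeasure_control_zero_extension zero_extension_def del: minus_divide_left)
  qed
  ultimately show ?thesis by (simp only:) (rule emeasure_UN_eq_0, auto)
qed

lemma emeasure_control_Icc:
  assumes "0 <= t" shows "mass F {0..t} = ennreal (F t)"
proof -
  have "mass F {-1<..t} = ennreal (F t)" using assms by (simp add: emeasure_control_zero_extension zero_extension_def)
  moreover have "{-1<..t} = {-1<..<0} \<union> {0..t}" using assms by auto
  moreover have "mass F {-1<..<0} = 0" by (rule emeasure_eq_0[OF _ emeasure_control_neg]) auto
  moreover have "mass F ({-1<..<0} \<union> {0..t})
      = mass F {-1<..<0} + mass F {0..t}" by (rule plus_emeasure[symmetric]) auto
  ultimately show ?thesis by simp
qed

lemma emeasure_control_zero: "mass F {0} = ennreal (F 0)" using emeasure_control_Icc[of 0] by simp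

lemma AE_control_nonneg: "AE t in control_measure F. 0 <= t" by (rule AE_I[where N="{..<0}"]) (auto simp: emeasure_control_neg)

lemma sigma_finite_control: "sigma_finite_measure (control_measure F)" unfolding control_measure_def
  by (intro sigma_finite_interval_measure zero_extension_mono[OF F] zero_extension_right_continuous[OF F])

end

section \<open>Countable exhaustion of initial segments and null sets\<close>

lemma countable_coinitial:
  fixes S :: "real set"
  shows "\<exists>C. countable C & C \<subseteq> S & (\<forall>s\<in>S. \<exists>c\<in>C. c <= s)"
proof -
  define g where "g p = (SOME c. c \<in> S & c < p)" for p :: real
  \<comment> \<open>One element below each rational that has one. A least element is added by hand,
    since the elements chosen below rationals may all lie above it.\<close>
  define C where "C = g ` {p \<in> \<rat>. \<exists>c\<in>S. c < p} \<union> {s \<in> S. \<forall>c\<in>S. s <= c}"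
  have g: "g p \<in> S & g p < p" if "\<exists>c\<in>S. c < p" for p unfolding g_def by (rule someI_ex) (use that in auto)
  have "countable {s \<in> S. \<forall>c\<in>S. s <= c}"
  proof (cases "\<exists>s\<in>S. \<forall>c\<in>S. s <= c")
    case True
    then obtain s where "s \<in> S" "\<forall>c\<in>S. s <= c" by auto
    hence "{s \<in> S. \<forall>c\<in>S. s <= c} = {s}" by (auto intro: antisym)
    thus ?thesis by simp
  next
    case False
    hence "{s \<in> S. \<forall>c\<in>S. s <= c} = {}" by auto
    thus ?thesis by (simp only: countable_empty)
  qed
  hence "countable C" unfolding C_def by (intro countable_Un countable_image) (auto intro: countable_subset[OF _ countable_rat])
  moreover have "C \<subseteq> S" using g by (auto simp: C_def)
  moreover have "\<exists>c\<in>C. c <= s" if s: "s \<in> S" for s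
  proof (cases "\<forall>c\<in>S. s <= c")
    case False
    then obtain c where c: "c \<in> S" "c < s" by auto
    obtain p where p: "p \<in> \<rat>" "c < p" "p < s" using Rats_dense_in_real[OF c(2)] by auto
    hence "g p \<in> C" "g p < p" using c g[of p] by (auto simp: C_def)
    with p show ?thesis by (intro bexI[of _ "g p"]) auto
  qed (use s in \<open>auto simp: C_def\<close>)
  ultimately show ?thesis by blast
qed

lemma countable_cofinal:
  fixes S :: "real set"
  shows "\<exists>C. countable C & C \<subseteq> S & (\<forall>s\<in>S. \<exists>c\<in>C. s <= c)"
proof -
  obtain C where C: "countable C" "C \<subseteq> uminus ` S" "\<forall>s\<in>uminus ` S. \<exists>c\<in>C. c <= s"
    using countable_coinitial[of "uminus ` S"] by auto
  show ?thesis
  proof (intro exI[of _ "uminus ` C"] conjI)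
    show "\<forall>s\<in>S. \<exists>c\<in>uminus ` C. s <= c"
    proof
      fix s assume "s \<in> S"
      then obtain c where "c \<in> C" "c <= - s" using C(3) by auto
      thus "\<exists>c\<in>uminus ` C. s <= c" by (intro bexI[of _ "- c"]) auto
    qed
  qed (use C in auto)
qed

lemma cofinal_incseq:
  fixes S :: "real set"
  assumes "S ~= {}"
  shows "\<exists>c. incseq c & range c \<subseteq> S & (\<forall>s\<in>S. \<exists>n. s <= c n)"
proof -
  obtain C where C: "countable C" "C \<subseteq> S" "\<forall>s\<in>S. \<exists>c\<in>C. s <= c" using countable_cofinal[of S] by auto
  hence "C ~= {}" using assms by auto
  define e where "e = from_nat_into C"
  have e: "range e = C" unfolding e_def by (rule range_from_nat_into) fact+
  define c where "c n = Max (e ` {..n})" for n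
  have "incseq c" unfolding c_def by (intro incseq_SucI Max_mono) auto
  moreover have "c n \<in> S" for n
  proof -
    have "c n \<in> e ` {..n}" unfolding c_def by (rule Max_in) auto
    thus ?thesis using e C(2) by auto
  qed
  moreover have "\<exists>n. s <= c n" if sS: "s \<in> S" for s
  proof -
    obtain c' where "c' \<in> C" "s <= c'" using bspec[OF C(3) sS] by blast
    moreover from \<open>c' \<in> C\<close> obtain n where "c' = e n" unfolding e[symmetric] by auto
    ultimately have "s <= e n" by simp
    thus ?thesis unfolding c_def by (intro exI[of _ n]) (auto intro: order_trans[OF _ Max_ge])
  qed
  ultimately show ?thesis by (intro exI[of _ c]) auto
qed

text \<open>The set is an uncountable union of null intervals ending at \<open>u\<close>; a
  countable coinitial subfamily already covers it.\<close>

lemma emeasure_up_closed_null: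
  assumes M: "sets M = sets borel"
  shows "{v::real. v <= u & emeasure M {v..u} = 0} \<in> null_sets M"
proof -
  let ?I = "{v. v <= u & emeasure M {v..u} = 0}"
  obtain C where C: "countable C" "C \<subseteq> ?I" "\<forall>s\<in>?I. \<exists>c\<in>C. c <= s" using countable_coinitial[of ?I] by auto
  have 1: "?I = (\<Union>c\<in>C. {c..u})"
  proof (intro set_eqI iffI)
    fix x assume "x \<in> (\<Union>c\<in>C. {c..u})"
    then obtain c where c: "c \<in> C" "c <= x" "x <= u" by auto
    have "emeasure M {x..u} = 0" using C(2) c by (subst emeasure_eq_0[of "{c..u}" M]) (auto simp: M)
    thus "x \<in> ?I" using c by simp
  next
    fix x assume x: "x \<in> ?I"
    then obtain c where "c \<in> C" "c <= x" using C(3) by blast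
    with x show "x \<in> (\<Union>c\<in>C. {c..u})" by auto
  qed
  have "(\<Union>c\<in>C. {c..u}) \<in> null_sets M" using C(1,2) by (intro null_sets_UN') (auto simp: null_sets_def M)
  thus ?thesis by (simp only: 1)
qed

text \<open>An exceptional point starts a null interval, which may be taken to end at a rational,
  and there are only countably many of those. This turns flatness conditions at single times into
  statements about where a control is carried.\<close>

lemma AE_growth_point:
  assumes M: "sets M = sets (borel :: real measure)"
  shows "AE t in M. \<forall>r>t. 0 < emeasure M {t..r}"
proof -
  have "AE t in M. \<forall>u\<in>\<rat>. t \<notin> {v. v <= u & emeasure M {v..u} = 0}"
    by (subst AE_ball_countable) (blast intro: countable_rat AE_not_in emeasure_up_closed_null[OF M])+
  thus ?thesis
  proof eventually_elim
    case (elim t)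
    show ?case
    proof (intro allI impI)
      fix r assume "t < r"
      then obtain u where u: "u \<in> \<rat>" "t < u" "u < r" using Rats_dense_in_real by blast
      have "emeasure M {t..u} ~= 0" using elim u by auto
      moreover have "emeasure M {t..u} <= emeasure M {t..r}" using u by (intro emeasure_mono) (auto simp: M)
      ultimately show "0 < emeasure M {t..r}" by (metis le_zero_eq not_gr_zero)
    qed
  qed
qed

text \<open>The cofinal sequence lets one formula cover initial segments with a closed, an open or
  an infinite right end.\<close>

lemma emeasure_control_down_closed:
  assumes F: "cumulative_path F" and A: "A ~= {}" "A \<subseteq> {0..}" and down: "\<And>s t. t \<in> A ==> 0 <= s ==> s <= t ==> s \<in> A"
    and c: "incseq c" "range c \<subseteq> A" "\<forall>s\<in>A. \<exists>n. s <= c n"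
  shows "mass F A = (SUP n. ennreal (F (c n)))"
proof -
  have 1: "A = (\<Union>n. {0..c n})"
  proof (intro set_eqI iffI)
    fix x assume "x \<in> (\<Union>n. {0..c n})"
    then obtain n where "0 <= x" "x <= c n" by auto
    thus "x \<in> A" using down[of "c n" x] c(2) by blast
  next
    fix x assume x: "x \<in> A"
    then obtain n where "x <= c n" using c(3) by blast
    thus "x \<in> (\<Union>n. {0..c n})" using x A(2) by auto
  qed
  have c0: "0 <= c n" for n using c A by auto
  have "(SUP n. mass F {0..c n}) = mass F (\<Union>n. {0..c n})"
    using c(1) by (intro SUP_emeasure_incseq) (auto simp: incseq_def)
  thus ?thesis unfolding 1[symmetric] by (simp add: emeasure_control_Icc[OF F c0])
qed

lemma down_closed_borel:
  assumes A: "(A :: real set) \<subseteq> {0..}" and down: "\<And>s t. t \<in> A ==> 0 <= s ==> s <= t ==> s \<in> A"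
  shows "A \<in> sets borel"
proof (cases "A = {}")
  case False
  then obtain c where c: "range c \<subseteq> A" "\<forall>s\<in>A. \<exists>n::nat. s <= c n" using cofinal_incseq[of A] by auto
  have "A = (\<Union>n. {0..c n})"
  proof (intro set_eqI iffI)
    fix x assume "x \<in> (\<Union>n. {0..c n})"
    then obtain n where "0 <= x" "x <= c n" by auto
    thus "x \<in> A" using down[of "c n" x] c(1) by blast
  next
    fix x assume x: "x \<in> A"
    then obtain n where "x <= c n" using c(2) by blast
    thus "x \<in> (\<Union>n. {0..c n})" using x A by auto
  qed
  thus ?thesis by (auto intro: sets.countable_UN)
qed simp

section \<open>Layer-cake integration of decreasing weights\<close>

lemma layer_cake:
  assumes "sigma_finite_measure M" and d[measurable]: "d \<in> borel_measurable M"
  shows "(\<integral>\<^sup>+x. ennreal (d x) \<partial>M) = (\<integral>\<^sup>+y. indicator {0<..} y * emeasure M {x\<in>space M. y < d x} \<partial>lborel)"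
proof -
  interpret sigma_finite_measure M by fact
  interpret pair_sigma_finite M lborel ..
  have "ennreal (d x) = (\<integral>\<^sup>+y. indicator {y. 0 < y & y < d x} y \<partial>lborel)" for x
  proof -
    have "{y. 0 < y & y < d x} = {0<..<d x}" by auto
    thus ?thesis by (cases "0 <= d x") (auto simp: ennreal_neg)
  qed
  hence "(\<integral>\<^sup>+x. ennreal (d x) \<partial>M) = (\<integral>\<^sup>+x. (\<integral>\<^sup>+y. indicator {(x, y). 0 < y & y < d x} (x, y) \<partial>lborel) \<partial>M)"
    by (simp add: indicator_def)
  also have "... = (\<integral>\<^sup>+y. (\<integral>\<^sup>+x. indicator {(x, y). 0 < y & y < d x} (x, y) \<partial>M) \<partial>lborel)"
  proof (rule Fubini'[symmetric])
    have "(%(x, y). indicator {(x, y). 0 < y & y < d x} (x, y) :: ennreal)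
        = indicator {p. 0 < snd p & snd p < d (fst p)}" by (auto simp: indicator_def fun_eq_iff)
    moreover have "{p \<in> space (M \<Otimes>\<^sub>M lborel). 0 < snd p & snd p < d (fst p)} \<in> sets (M \<Otimes>\<^sub>M lborel)"
      by measurable
    ultimately show "(%(x, y). indicator {(x, y). 0 < y & y < d x} (x, y) :: ennreal) \<in> borel_measurable (M \<Otimes>\<^sub>M lborel)"
      by (auto simp: borel_measurable_indicator_iff Int_def conj_commute)
  qed
  also have "... = (\<integral>\<^sup>+y. indicator {0<..} y * emeasure M {x\<in>space M. y < d x} \<partial>lborel)"
  proof (rule nn_integral_cong)
    fix y :: real
    have "(\<integral>\<^sup>+x. indicator {(x, y). 0 < y & y < d x} (x, y) \<partial>M)
       = (\<integral>\<^sup>+x. indicator {0<..} y * indicator {x\<in>space M. y < d x} x \<partial>M)"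
      by (intro nn_integral_cong) (auto simp: indicator_def)
    also have "... = indicator {0<..} y * emeasure M {x\<in>space M. y < d x}" by (subst nn_integral_cmult) auto
    finally show "(\<integral>\<^sup>+x. indicator {(x, y). 0 < y & y < d x} (x, y) \<partial>M)
      = indicator {0<..} y * emeasure M {x\<in>space M. y < d x}" .
  qed
  finally show ?thesis .
qed

text \<open>The weight decreases on the half-line only, so it is continued to the left by its value
  at 0 before monotonicity gives measurability.\<close>

lemma antimono_nonneg_borel:
  assumes "antimono_on {0..} (d :: real => real)"
  shows "(%t. d t * indicator {0..} t) \<in> borel_measurable borel"
proof -
  have "(%t. - d (max 0 t)) \<in> borel_measurable borel" using assms by (intro borel_measurable_mono) (auto simp: mono_def monotone_on_def)
  hence "(%t. - (- d (max 0 t)) * indicator {0..} t) \<in> borel_measurable borel" by measurable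
  moreover have "(%t. - (- d (max 0 t)) * indicator {0..} t) = (%t. d t * indicator {0..} t)"
    by (auto simp: fun_eq_iff indicator_def max_def)
  ultimately show ?thesis by simp
qed

definition weighted :: "(real => real) => (real => real) => ennreal" where
  "weighted d F = (\<integral>\<^sup>+ t\<in>{0..}. ennreal (d t) \<partial>control_measure F)"

lemma discounted_integral_weighted: "discounted_integral q F = weighted (%t. exp (- q * t)) F"
  by (simp add: discounted_integral_def weighted_def control_measure_def zero_extension_def)

lemma weighted_layer:
  assumes F: "cumulative_path F" and d: "antimono_on {0..} d"
  shows "weighted d F = (\<integral>\<^sup>+y. indicator {0<..} y * mass F {t. 0 <= t & y < d t} \<partial>lborel)"
proof -
  have "weighted d F = (\<integral>\<^sup>+ t. ennreal (d t * indicator {0..} t) \<partial>control_measure F)"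
    unfolding weighted_def by (intro nn_integral_cong) (auto simp: indicator_def)
  also have "... = (\<integral>\<^sup>+y. indicator {0<..} y * mass F
      {x\<in>space (control_measure F). y < d x * indicator {0..} x} \<partial>lborel)" by (intro layer_cake sigma_finite_control[OF F])
       (use antimono_nonneg_borel[OF d] in \<open>simp add: measurable_def\<close>)
  also have "... = (\<integral>\<^sup>+y. indicator {0<..} y * mass F {t. 0 <= t & y < d t} \<partial>lborel)"
  proof (intro nn_integral_cong)
    fix y :: real
    have "0 < y ==> {x\<in>space (control_measure F). y < d x * indicator {0..} x} = {t. 0 <= t & y < d t}"
      by (auto simp: indicator_def split: if_splits)
    thus "indicator {0<..} y * mass F
      {x\<in>space (control_measure F). y < d x * indicator {0..} x}
      = indicator {0<..} y * mass F {t. 0 <= t & y < d t}" by (cases "0 < y") auto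
  qed
  finally show ?thesis .
qed

lemma weighted_mono:
  assumes "cumulative_path F" "\<And>t. 0 <= t ==> d t <= d' t"
  shows "weighted d F <= weighted d' F"
  unfolding weighted_def using assms by (intro nn_integral_mono) (auto simp: indicator_def intro: ennreal_leI)

lemma weighted_mono_AE:
  assumes "AE t in control_measure F. 0 <= t --> d t <= d' t"
  shows "weighted d F <= weighted d' F" unfolding weighted_def using assms
  by (intro nn_integral_mono_AE, eventually_elim) (auto simp: indicator_def intro: ennreal_leI)

text \<open>Weak duality: \<open>U'\<close> bounds the loss \<open>L + R' - R - L'\<close>, and by the last hypothesis every superlevel
  set of \<open>d\<close> has, arbitrarily close to its right end, points where this bound is at most \<open>\<epsilon>\<close>.\<close>

lemma weak_duality:
  assumes cum: "cumulative_path L" "cumulative_path R" "cumulative_path L'" "cumulative_path R'"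
    and d: "antimono_on {0..} d" "\<And>t. 0 <= t ==> d t <= 1"
    and eps: "0 <= \<epsilon>"
    and bnd: "\<And>t. 0 <= t ==> L t + R' t <= R t + L' t + U' t"
    and small: "\<And>t y. 0 <= t ==> 0 < y ==> y < d t ==> \<exists>u\<ge>t. y < d u & U' u <= \<epsilon>"
  shows "weighted d L + weighted d R' <= weighted d R + weighted d L' + ennreal \<epsilon>"
proof -
  let ?A = "%y. {t. 0 <= t & y < d t}"
  let ?m = "%F y. indicator {0<..} y * mass F (?A y) :: ennreal"
  have down: "s \<in> ?A y" if "t \<in> ?A y" "0 <= s" "s <= t" for s t y using that d(1) by (auto simp: monotone_on_def intro: less_le_trans)
  \<comment> \<open>The comparison on one level: from a time \<open>c n\<close> of the segment move
    on to a time \<open>u\<close> of the same segment where the loss is at most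
    \<open>\<epsilon>\<close>, use the pointwise bound there, and pass to a later
    \<open>c m\<close>.\<close>
  have key: "mass L (?A y) + mass R' (?A y)
      <= mass R (?A y) + mass L' (?A y) + ennreal \<epsilon>"
    if y: "0 < y" for y
  proof (cases "?A y = {}")
    case False
    obtain c where c: "incseq c" "range c \<subseteq> ?A y" "\<forall>s\<in>?A y. \<exists>n. s <= c n" using cofinal_incseq[OF False] by blast
    have c0: "0 <= c n" for n using c(2) by auto
    have em: "mass F (?A y) = (SUP n. ennreal (F (c n)))" if "cumulative_path F" for F
      by (rule emeasure_control_down_closed[OF that False]) (use c down in auto)
    have inc: "incseq (%n. ennreal (F (c n)))" if F: "cumulative_path F" for F
      using c(1) c0 cumulative_pathD(2)[OF F] by (auto simp: incseq_def intro!: ennreal_leI)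
    have "mass L (?A y) + mass R' (?A y)
        = (SUP n. ennreal (L (c n)) + ennreal (R' (c n)))" using cum by (simp add: em ennreal_SUP_add inc)
    also have "... <= mass R (?A y) + mass L' (?A y) + ennreal \<epsilon>"
    proof (rule SUP_least)
      fix n
      have "0 <= c n" "y < d (c n)" using c(2) by auto
      then obtain u where u: "c n <= u" "y < d u" "U' u <= \<epsilon>" using small y by blast
      hence u0: "0 <= u" using c0[of n] by linarith
      hence "u \<in> ?A y" using u by auto
      then obtain m where m: "u <= c m" using c(3) by blast
      have "ennreal (L (c n)) + ennreal (R' (c n)) = ennreal (L (c n) + R' (c n))" using cum cumulative_pathD(3) c0 by (simp add: ennreal_plus)
      also have "... <= ennreal (R u + L' u + \<epsilon>)" using bnd[OF u0] u cumulative_pathD(2)[OF cum(1) c0[of n] u(1)]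
          cumulative_pathD(2)[OF cum(4) c0[of n] u(1)] by (intro ennreal_leI) linarith
      also have "... <= ennreal (R (c m) + L' (c m) + \<epsilon>)"
        using cumulative_pathD(2)[OF cum(2) u0 m] cumulative_pathD(2)[OF cum(3) u0 m] by (intro ennreal_leI) linarith
      also have "... = ennreal (R (c m)) + ennreal (L' (c m)) + ennreal \<epsilon>"
        using cum cumulative_pathD(3) c0 eps by (simp add: ennreal_plus)
      also have "... <= mass R (?A y) + mass L' (?A y) + ennreal \<epsilon>"
        using cum by (simp add: em) (intro add_mono SUP_upper; simp)
      finally show "ennreal (L (c n)) + ennreal (R' (c n))
        <= mass R (?A y) + mass L' (?A y) + ennreal \<epsilon>" .
    qed
    finally show ?thesis .
  next
    case True
    show ?thesis unfolding True by simp
  qed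
  have meas: "?m F \<in> borel_measurable lborel" if F: "cumulative_path F" for F
  proof -
    have "(%y. mass F (?A y)) \<in> borel_measurable borel"
    proof -
      interpret sigma_finite_measure "control_measure F" by (rule sigma_finite_control[OF F])
      have [measurable]: "(%t. d t * indicator {0..} t) \<in> borel_measurable borel" by (rule antimono_nonneg_borel[OF d(1)])
      \<comment> \<open>The superlevel sets are the sections of one planar region, so their mass
        depends measurably on the level.\<close>
      have "{p \<in> space (borel \<Otimes>\<^sub>M borel). (0::real) <= snd p & (fst p :: real) < d (snd p) * indicator {0..} (snd p)}
          \<in> sets (borel \<Otimes>\<^sub>M borel)" by measurable
      hence "(%y. mass F (Pair y -` {p. 0 <= snd p & fst p < d (snd p) * indicator {0..} (snd p)}))
         \<in> borel_measurable borel" by (intro measurable_emeasure_Pair)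
           (simp add: space_pair_measure sets_pair_measure_cong[OF refl sets_control_measure])
      moreover have "Pair y -` {p. 0 <= snd p & fst p < d (snd p) * indicator {0..} (snd p)} = ?A y" for y by auto
      ultimately show ?thesis by (simp only:)
    qed
    thus ?thesis by measurable
  qed
  note meas = meas[OF cum(1)] meas[OF cum(2)] meas[OF cum(3)] meas[OF cum(4)]
  have "weighted d L + weighted d R' = (\<integral>\<^sup>+y. ?m L y + ?m R' y \<partial>lborel)"
    unfolding weighted_layer[OF cum(1) d(1)] weighted_layer[OF cum(4) d(1)] by (rule nn_integral_add[symmetric]) (rule meas)+
  \<comment> \<open>From level 1 on the superlevel sets are empty, so the error
    \<open>\<epsilon>\<close> is paid on a unit interval of levels and integrates to
    \<open>\<epsilon>\<close>.\<close>
  also have "... <= (\<integral>\<^sup>+y. ?m R y + ?m L' y + ennreal \<epsilon> * indicator {0<..<1} y \<partial>lborel)"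
  proof (intro nn_integral_mono)
    fix y :: real
    consider "y <= 0" | "0 < y" "y < 1" | "1 <= y" by linarith
    thus "?m L y + ?m R' y <= ?m R y + ?m L' y + ennreal \<epsilon> * indicator {0<..<1} y"
    proof cases
      case 2 thus ?thesis using key[of y] by simp
    next
      case 3
      hence "?A y = {}" using d(2) by (auto simp: not_less intro: order_trans)
      thus ?thesis by (simp only: emeasure_empty) simp
    qed simp
  qed
  also have "... = weighted d R + weighted d L' + ennreal \<epsilon>" unfolding weighted_layer[OF cum(2) d(1)] weighted_layer[OF cum(3) d(1)]
    by (subst nn_integral_add, intro borel_measurable_add meas, simp,
        subst nn_integral_add, (rule meas)+, subst nn_integral_cmult, simp_all)
  finally show ?thesis .
qed

section \<open>Drawdowns and reflected paths\<close>

text \<open>The discount factor at the infimum of \<open>S\<close>, written as a supremum because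
  the exponential decreases. The inserted 0 is the value for an empty set, that is for an infinite
  time. Whether the infimum is attained never has to be discussed.\<close>

definition sup_discount :: "real => real set => real" where
  "sup_discount q S = Sup (insert 0 ((%u. exp (- q * u)) ` S))"

context
  fixes q :: real and S :: "real set"
  assumes q: "0 < q" and S: "S \<subseteq> {0..}"
begin

lemma sup_discount_bdd: "bdd_above (insert 0 ((%u. exp (- q * u)) ` S))" using q S by (intro bdd_aboveI[of _ 1]) auto

lemma sup_discount_nonneg: "0 <= sup_discount q S" unfolding sup_discount_def by (rule cSup_upper[OF _ sup_discount_bdd]) simp

lemma sup_discount_upper: "u \<in> S ==> exp (- q * u) <= sup_discount q S"
  unfolding sup_discount_def by (rule cSup_upper[OF _ sup_discount_bdd]) blast

lemma sup_discount_le: "(\<And>u. u \<in> S ==> exp (- q * u) <= c) ==> 0 <= c ==> sup_discount q S <= c"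
  unfolding sup_discount_def by (rule cSup_least) auto

lemma less_sup_discount: "y < sup_discount q S ==> 0 <= y ==> \<exists>u\<in>S. y < exp (- q * u)"
  using sup_discount_le[of y] by (force simp: not_less)

lemma sup_discount_le_1: "sup_discount q S <= 1" using q S by (intro sup_discount_le) auto

lemma sup_discount_le_exp: "(\<And>u. u \<in> S ==> t <= u) ==> sup_discount q S <= exp (- q * t)"
  using q by (intro sup_discount_le) auto

end

lemma sup_discount_mono:
  assumes "0 < q" "S' \<subseteq> {0..}" and "\<And>u. u \<in> S ==> 0 <= u ==> \<exists>u'\<in>S'. u' <= u" "S \<subseteq> {0..}"
  shows "sup_discount q S <= sup_discount q S'"
proof (rule sup_discount_le)
  fix u assume u: "u \<in> S"
  then obtain u' where "u' \<in> S'" "u' <= u" using assms by force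
  moreover from this have "exp (- q * u) <= exp (- q * u')" using assms(1) by simp
  ultimately show "exp (- q * u) <= sup_discount q S'" using sup_discount_upper[OF assms(1,2)] by (meson order_trans)
qed (use assms sup_discount_nonneg in auto)

lemma discount_first_time:
  assumes q: "0 < q" and s: "0 <= s"
  shows "discount q (first_time s Q) = sup_discount q {t. s < t & Q t}"
proof (cases "{t. s < t & Q t} = {}")
  case True
  hence "first_time s Q = \<infinity>" unfolding first_time_def True by (simp add: top_ereal_def)
  thus ?thesis unfolding True by (simp add: discount_def sup_discount_def)
next
  case False
  let ?S = "{t. s < t & Q t}"
  have bdd: "bdd_below ?S" by (rule bdd_belowI[of _ s]) auto
  have ft: "first_time s Q = ereal (Inf ?S)" unfolding first_time_def using ereal_Inf'[OF bdd False] by simp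
  have S0: "?S \<subseteq> {0..}" using s by auto
  have "sup_discount q ?S = exp (- q * Inf ?S)"
  proof (rule antisym)
    show "sup_discount q ?S <= exp (- q * Inf ?S)" by (rule sup_discount_le_exp[OF q S0]) (rule cInf_lower[OF _ bdd])
    show "exp (- q * Inf ?S) <= sup_discount q ?S"
    proof (rule ccontr)
      assume "~ ?thesis"
      hence less: "sup_discount q ?S < exp (- q * Inf ?S)" by simp
      have "((%x. exp (- q * x)) \<longlongrightarrow> exp (- q * Inf ?S)) (at_right (Inf ?S))" by (intro tendsto_intros)
      hence "\<forall>\<^sub>F x in at_right (Inf ?S). sup_discount q ?S < exp (- q * x)" using less by (rule order_tendstoD(1))
      then obtain b where b: "b > Inf ?S" "\<forall>x>Inf ?S. x < b --> sup_discount q ?S < exp (- q * x)"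
        by (auto simp: eventually_at_right[OF less_add_one])
      obtain u where u: "u \<in> ?S" "u < b" using cInf_lessD[OF False b(1)] by auto
      have "Inf ?S <= u" using u bdd by (intro cInf_lower)
      hence "sup_discount q ?S < exp (- q * u)" using b(2) less u(2) by (cases "u = Inf ?S") auto
      thus False using sup_discount_upper[OF q S0 u(1)] by simp
    qed
  qed
  thus ?thesis by (simp add: ft discount_def)
qed

text \<open>The discount factor at the first time after \<open>t\<close> at which the path is more
  than \<open>b\<close> below its maximum since \<open>t\<close>. Discounting is counted from time
  0, not from \<open>t\<close>. Quantifying over the peak \<open>r\<close> avoids the running
  maximum.\<close>

definition drawdown :: "real => real => (real => real) => real => real" where
  "drawdown q b f t = sup_discount q {u. t < u & (\<exists>r\<in>{t..u}. f r - f u > b)}"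

lemma drawdown_antimono:
  assumes "0 < q" "0 <= s" "s <= t"
  shows "drawdown q b f t <= drawdown q b f s" unfolding drawdown_def
proof (rule sup_discount_mono)
  fix u assume "u \<in> {u. t < u & (\<exists>r\<in>{t..u}. f r - f u > b)}"
  then obtain r where "t < u" "r \<in> {t..u}" "f r - f u > b" by auto
  hence "u \<in> {u. s < u & (\<exists>r\<in>{s..u}. f r - f u > b)}" using assms by auto
  thus "\<exists>u'\<in>{u. s < u & (\<exists>r\<in>{s..u}. f r - f u > b)}. u' <= u" by blast
qed (use assms in auto)

lemma drawdown_bounds:
  assumes "0 < q" "0 <= t"
  shows "0 <= drawdown q b f t" "drawdown q b f t <= exp (- q * t)" "drawdown q b f t <= 1"
proof -
  have "{u. t < u & (\<exists>r\<in>{t..u}. f r - f u > b)} \<subseteq> {0..}" using assms by auto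
  note S = assms(1) this
  show "0 <= drawdown q b f t" "drawdown q b f t <= 1"
    unfolding drawdown_def by (rule sup_discount_nonneg[OF S], rule sup_discount_le_1[OF S])
  show "drawdown q b f t <= exp (- q * t)" unfolding drawdown_def by (rule sup_discount_le_exp[OF S]) auto
qed

section \<open>Two-sided reflection and its complementarity conditions\<close>

text \<open>Complementarity is stated locally and with closed intervals: \<open>{t..r}\<close>
  contains \<open>t\<close> itself, so an atom of a control at \<open>t\<close> is excluded along
  with growth right after it.\<close>

definition skorokhod :: "real => (real => real) => (real => real) => (real => real) => bool" where
  "skorokhod a f L R \<longleftrightarrow> cumulative_path L & cumulative_path R &
     (\<forall>t\<ge>0. 0 <= f t - L t + R t & f t - L t + R t <= a) &
     (\<forall>t\<ge>0. f t - L t + R t < a --> (\<exists>r>t. mass L {t..r} = 0)) &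
     (\<forall>t\<ge>0. 0 < f t - L t + R t --> (\<exists>r>t. mass R {t..r} = 0))"

text \<open>If \<open>[v, u]\<close> is not charged, \<open>F u\<close> is the left limit of
  \<open>F\<close> at \<open>v\<close>: the masses of \<open>(w, u]\<close> decrease to the mass of
  \<open>[v, u]\<close> as \<open>w\<close> increases to \<open>v\<close>.\<close>

lemma flat_left:
  assumes F: "cumulative_path F" and v: "0 < v" "v <= u" and flat: "mass F {v..u} = 0" and e: "0 < e"
  shows "\<exists>w0<v. 0 <= w0 & (\<forall>w. w0 <= w & w < v --> F u - F w < e)"
proof -
  define w where "w n = max 0 (v - 1 / real (Suc n))" for n
  have w: "0 <= w n" "w n < v" for n using v by (auto simp: w_def)
  have inc: "decseq (%n. {w n<..u})"
  proof -
    have "w m <= w n" if "m <= n" for m n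
    proof -
      have "1 / real (Suc n) <= 1 / real (Suc m)" using that by (simp add: frac_le)
      thus ?thesis by (auto simp: w_def)
    qed
    thus ?thesis by (fastforce simp: decseq_def dest: le_less_trans)
  qed
  have eq: "(\<Inter>n. {w n<..u}) = {v..u}"
  proof (intro set_eqI iffI)
    fix x assume x: "x \<in> (\<Inter>n. {w n<..u})"
    have "v <= x"
    proof (rule ccontr)
      assume "~ v <= x"
      then obtain n where n: "1 / real (Suc n) < v - x" using nat_approx_posE[of "v - x"] by auto
      have "w n < x" using x by auto
      hence "v - 1 / real (Suc n) < x" unfolding w_def by linarith
      with n show False by linarith
    qed
    with x show "x \<in> {v..u}" by auto
  qed (use w in \<open>auto intro: less_le_trans\<close>)
  have fin: "mass F {w n<..u} = ennreal (F u - F (w n))" for n using emeasure_control_Ioc[OF F w(1)[of n]] w(2)[of n] v by simp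
  have "(INF n. mass F {w n<..u}) = mass F (\<Inter>n. {w n<..u})"
    by (rule INF_emeasure_decseq[OF _ inc]) (auto simp: fin)
  hence "(INF n. ennreal (F u - F (w n))) < ennreal e" using e by (simp add: eq flat fin)
  then obtain n where n: "ennreal (F u - F (w n)) < ennreal e" by (auto simp: INF_less_iff)
  moreover have "0 <= F u - F (w n)" using cumulative_pathD(2)[OF F w(1), of n u] w(2)[of n] v by simp
  ultimately have "F u - F (w n) < e" by (simp add: ennreal_less_iff)
  thus ?thesis using w[of n] cumulative_pathD(2)[OF F w(1)[of n]] by (intro exI[of _ "w n"]) (fastforce)
qed

locale skorokhod_path =
  fixes a :: real and f L R :: "real => real"
  assumes sk: "skorokhod a f L R"
begin

definition "U t = f t - L t + R t"
definition "K t = L t - R t"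

lemma cumL: "cumulative_path L" and cumR: "cumulative_path R" using sk by (auto simp: skorokhod_def)

lemma U_bounds: "0 <= t ==> 0 <= U t" "0 <= t ==> U t <= a"
  and flatL: "0 <= t ==> U t < a ==> \<exists>r>t. mass L {t..r} = 0"
  and flatR: "0 <= t ==> 0 < U t ==> \<exists>r>t. mass R {t..r} = 0"
  using sk by (auto simp: skorokhod_def U_def)

lemma U_K: "U t = f t - K t" by (simp add: U_def K_def)

text \<open>A growth point of \<open>L\<close> cannot satisfy \<open>U t < a\<close>, because there
  \<open>L\<close> is flat on an interval starting at \<open>t\<close>.\<close>

lemma AE_L: "AE t in control_measure L. 0 <= t & U t = a"
proof -
  have "AE t in control_measure L. \<forall>r>t. 0 < mass L {t..r}" by (rule AE_growth_point) simp
  with AE_control_nonneg[OF cumL] show ?thesis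
  proof eventually_elim
    case (elim t)
    thus ?case using flatL[of t] U_bounds(2)[of t] by (cases "U t < a") force+
  qed
qed

lemma AE_R: "AE t in control_measure R. 0 <= t & U t = 0"
proof -
  have "AE t in control_measure R. \<forall>r>t. 0 < mass R {t..r}" by (rule AE_growth_point) simp
  with AE_control_nonneg[OF cumR] show ?thesis
  proof eventually_elim
    case (elim t)
    thus ?case using flatR[of t] U_bounds(1)[of t] by (cases "0 < U t") force+
  qed
qed

lemma null_L:
  assumes "A \<in> sets borel" "\<And>t. t \<in> A ==> 0 <= t ==> U t ~= a"
  shows "mass L A = 0"
proof -
  have "AE t in control_measure L. t \<notin> A" using AE_L by eventually_elim (use assms in auto)
  thus ?thesis using assms(1) AE_iff_measurable[of A "control_measure L" "%t. t \<notin> A"] by auto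
qed

lemma null_R:
  assumes "A \<in> sets borel" "\<And>t. t \<in> A ==> 0 <= t ==> U t ~= 0"
  shows "mass R A = 0"
proof -
  have "AE t in control_measure R. t \<notin> A" using AE_R by eventually_elim (use assms in auto)
  thus ?thesis using assms(1) AE_iff_measurable[of A "control_measure R" "%t. t \<notin> A"] by auto
qed

text \<open>A maximum principle for the net control. After the last time at which \<open>K\<close>
  is at most \<open>M\<close> the hypothesis \<open>top\<close> keeps \<open>U\<close> below
  \<open>a\<close>, so \<open>L\<close> is flat and \<open>K\<close> cannot rise.\<close>

lemma K_le:
  assumes tu: "0 <= t" "t <= u" and start: "K t <= M"
    and top: "\<And>v. t < v ==> v <= u ==> (\<And>w. v <= w ==> w <= u ==> M < K w) ==> U v < a"
  shows "K u <= M"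
proof (rule ccontr)
  assume "~ ?thesis"
  hence Ku: "M < K u" by simp
  define E where "E = {v\<in>{t..u}. K v <= M}"
  have tE: "t \<in> E" using tu start by (simp add: E_def)
  have bdd: "bdd_above E" by (rule bdd_aboveI[of _ u]) (simp add: E_def)
  define v where "v = Sup E"
  have tv: "t <= v" unfolding v_def by (rule cSup_upper[OF tE bdd])
  have vu: "v <= u" unfolding v_def using tE by (intro cSup_least) (auto simp: E_def)
  have above: "M < K w" if "v < w" "w <= u" for w
  proof (rule ccontr)
    assume "~ M < K w"
    hence "w \<in> E" using that tv by (simp add: E_def)
    hence "w <= v" unfolding v_def by (rule cSup_upper[OF _ bdd])
    with that show False by simp
  qed
  show False
  proof (cases "K v <= M")
    case True
    have "U w ~= a" if "w \<in> {v<..u}" for w using top[of w] above that tv by force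
    hence "mass L {v<..u} = 0" by (intro null_L) auto
    hence "L u <= L v" using emeasure_control_Ioc[OF cumL _ vu] tu tv by (simp add: ennreal_eq_0_iff)
    moreover have "R v <= R u" using cumulative_pathD(2)[OF cumR] tu tv vu by auto
    ultimately show False using Ku True by (simp add: K_def)
  next
    \<comment> \<open>The supremum \<open>v\<close> is not in \<open>E\<close>. Then
      \<open>L\<close> does not charge the closed interval \<open>[v, u]\<close>, and times of
      \<open>E\<close> just before \<open>v\<close> take over the role of \<open>v\<close>.\<close>
    case False
    hence "t < v" using start tv by (cases "t = v") auto
    have "M < K w" if "v <= w" "w <= u" for w using above[of w] that False by (cases "w = v") auto
    hence "U w ~= a" if "w \<in> {v..u}" for w using top[of w] that \<open>t < v\<close> by force
    hence "mass L {v..u} = 0" by (intro null_L) auto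
    then obtain w0 where w0: "w0 < v" "\<And>w. w0 <= w ==> w < v ==> L u - L w < K u - M"
      using flat_left[OF cumL _ vu, of "K u - M"] \<open>t < v\<close> tu Ku by auto
    obtain w where w: "w \<in> E" "max w0 t < w" using less_cSupD[of E "max w0 t"] w0(1) \<open>t < v\<close> tE unfolding v_def by auto
    have "w < v" using w False cSup_upper[OF w(1) bdd] unfolding v_def[symmetric] by (cases "w = v") (auto simp: E_def)
    hence "L u - L w < K u - M" using w0 w by auto
    moreover have "R w <= R u" using cumulative_pathD(2)[OF cumR, of w u] w tu \<open>w < v\<close> vu by auto
    moreover have "K w <= M" using w by (simp add: E_def)
    ultimately show False by (simp add: K_def)
  qed
qed

text \<open>The maximum principle with the bound \<open>f u + b - a\<close>: if \<open>K v\<close>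
  exceeds it while the drawdown from \<open>v\<close> to \<open>u\<close> is at most
  \<open>b\<close>, then \<open>U v < a\<close>.\<close>

lemma drawdown_if_below:
  assumes t: "0 <= t" "t <= u" and Ut: "U t = a" and dd: "\<And>r. r \<in> {t..u} ==> f r - f u <= b"
  shows "a - b <= U u"
proof -
  have "K u <= f u + b - a"
  proof (rule K_le[OF t])
    show "K t <= f u + b - a" using dd[of t] t Ut by (auto simp: U_K)
    fix v assume v: "t < v" "v <= u" "\<And>w. v <= w ==> w <= u ==> f u + b - a < K w"
    show "U v < a" using dd[of v] v(1,2) v(3)[OF order_refl v(2)] by (simp add: U_K)
  qed
  thus ?thesis by (simp add: U_K)
qed

text \<open>Without injections on \<open>(r, u]\<close> the surplus falls at least as much as
  \<open>f\<close>, from a level of at most \<open>a\<close>.\<close>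

lemma drawdown_imp:
  assumes r: "0 <= r" "r <= u" and dd: "f r - f u > b" and R: "mass R {r<..u} = 0"
  shows "U u < a - b"
proof -
  have "R u <= R r" using R emeasure_control_Ioc[OF cumR r] by (simp add: ennreal_eq_0_iff)
  moreover have "L r <= L u" using cumulative_pathD(2)[OF cumL r] .
  ultimately show ?thesis using U_bounds(2)[OF r(1)] dd by (simp add: U_def)
qed

lemma R_growth_zero:
  assumes A: "A \<in> sets borel" "0 < mass R A"
  shows "\<exists>u\<in>A. 0 <= u & U u = 0" using null_R[OF A(1)] A(2) by force

text \<open>Falling from \<open>a\<close> to 0 only shows a drawdown of at least \<open>a\<close>;
  that injections really grow makes it strictly larger. Just before the first growth of
  \<open>R\<close> the net control exceeds its value at a nearby later \<open>w\<close> with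
  \<open>U w = 0\<close>, whereas drawdowns of at most \<open>a\<close> would keep it below
  \<open>f w = K w\<close>.\<close>

lemma strict_drawdown:
  assumes a: "0 < a" and t: "0 <= t" and Ut: "U t = a" and tu: "t <= u" and R: "0 < mass R {t..u}"
  shows "\<exists>v\<in>{t<..u}. \<exists>r\<in>{t..v}. f r - f v > a"
proof (rule ccontr)
  assume "~ ?thesis"
  hence no: "f r - f v <= a" if "v \<in> {t<..u}" "r \<in> {t..v}" for v r using that by force
  \<comment> \<open>\<open>U t = a > 0\<close> keeps \<open>R\<close> flat right after
    \<open>t\<close>. So the first growth of \<open>R\<close> comes strictly later, and there are
    times before it to compare with.\<close>
  obtain r0 where r0: "t < r0" "mass R {t..r0} = 0" using flatR[OF t] Ut a by auto
  have Rt: "R r0 <= R t" "mass R {t} = 0"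
  proof -
    have "mass R {t<..r0} = 0" by (rule emeasure_eq_0[OF _ r0(2)]) auto
    thus "R r0 <= R t" using emeasure_control_Ioc[OF cumR t, of r0] r0 by (simp add: ennreal_eq_0_iff)
    show "mass R {t} = 0" by (rule emeasure_eq_0[OF _ r0(2)]) (use r0 in auto)
  qed
  have Rtu: "R t < R u"
  proof (rule ccontr)
    assume "~ R t < R u"
    hence "mass R {t<..u} = 0" using emeasure_control_Ioc[OF cumR t tu] by (simp add: ennreal_neg)
    moreover have "{t..u} = {t} \<union> {t<..u}" using tu by auto
    ultimately have "mass R {t..u} = 0" using Rt(2) emeasure_subadditive[of "{t}" "control_measure R" "{t<..u}"] by simp
    with R show False by simp
  qed
  define E where "E = {v\<in>{t..u}. R t < R v}"
  have uE: "u \<in> E" using tu Rtu by (simp add: E_def)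
  have bdd: "bdd_below E" by (rule bdd_belowI[of _ t]) (simp add: E_def)
  define v where "v = Inf E"
  have vu: "v <= u" unfolding v_def by (rule cInf_lower[OF uE bdd])
  have "r0 <= v" unfolding v_def
  proof (rule cInf_greatest)
    fix x assume x: "x \<in> E"
    show "r0 <= x"
    proof (rule ccontr)
      assume "~ r0 <= x"
      hence "R x <= R r0" using cumulative_pathD(2)[OF cumR, of x r0] x t by (auto simp: E_def)
      with x Rt(1) show False by (simp add: E_def)
    qed
  qed (use uE in auto)
  hence tv: "t < v" using r0 by simp
  have below: "R w = R t" if "t <= w" "w < v" for w
  proof -
    have "w \<notin> E" using that cInf_lower[OF _ bdd, of w] unfolding v_def by auto
    hence "R w <= R t" using that vu by (simp add: E_def)
    thus ?thesis using cumulative_pathD(2)[OF cumR t that(1)] by simp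
  qed
  have grow: "R t < R w" if "v < w" for w
  proof -
    obtain x where x: "x \<in> E" "x < w" using cInf_lessD[of E w] \<open>v < w\<close> uE unfolding v_def by blast
    hence "R x <= R w" using cumulative_pathD(2)[OF cumR, of x w] t by (auto simp: E_def)
    with x show ?thesis by (simp add: E_def)
  qed
  have Uv: "U v = 0"
  proof (rule ccontr)
    assume "U v ~= 0"
    then obtain r where r: "v < r" "mass R {v..r} = 0" using flatR[of v] U_bounds(1)[of v] tv t by auto
    then obtain w0 where w0: "w0 < v" "\<And>w. w0 <= w ==> w < v ==> R r - R w < R r - R t"
      using flat_left[OF cumR _ _ r(2), of "R r - R t"] grow[of r] tv t by auto
    define w where "w = max w0 t"
    have "w < v" "w0 <= w" "t <= w" using w0(1) tv by (auto simp: w_def)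
    thus False using w0(2)[of w] below[of w] by simp
  qed
  then obtain r where r: "v < r" "mass L {v..r} = 0" using flatL[of v] a tv t by auto
  \<comment> \<open>The point \<open>w\<close> has to lie in the stretch after \<open>v\<close>
    where \<open>L\<close> is flat, with \<open>U w = 0\<close> and \<open>R\<close> already above
    its initial value. \<open>w = v\<close> serves if \<open>R v\<close> is already larger;
    otherwise \<open>R\<close> charges the stretch after \<open>v\<close> and provides such a
    point.\<close>
  define r' where "r' = min r u"
  have "\<exists>w\<in>{v..r'}. U w = 0 & R t < R w"
  proof (cases "R t < R v")
    case True
    thus ?thesis using Uv r vu by (auto simp: r'_def intro!: bexI[of _ v])
  next
    case False
    hence "v < u" using Rtu vu by (cases "v = u") auto
    hence vr: "v < r'" using r by (simp add: r'_def)
    have "R v = R t" using False cumulative_pathD(2)[OF cumR t, of v] tv by simp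
    hence "0 < mass R {v<..r'}" using emeasure_control_Ioc[OF cumR, of v r'] vr tv t grow[OF vr] by simp
    hence "\<exists>w\<in>{v<..r'}. 0 <= w & U w = 0" by (intro R_growth_zero) simp
    then obtain w where "w \<in> {v<..r'}" "U w = 0" by blast
    thus ?thesis using grow[of w] by (intro bexI[of _ w]) auto
  qed
  then obtain w where w: "v <= w" "w <= r" "w <= u" "U w = 0" "R t < R w" by (auto simp: r'_def)
  have "mass L {v..w} = 0" by (rule emeasure_eq_0[OF _ r(2)]) (use w in auto)
  then obtain w0 where w0: "w0 < v" "\<And>x. w0 <= x ==> x < v ==> L w - L x < R w - R t"
    using flat_left[OF cumL _ w(1), of "R w - R t"] w tv t by auto
  define x where "x = max w0 t"
  have x: "x < v" "w0 <= x" "t <= x" using w0(1) tv by (auto simp: x_def)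
  hence "K w < K x" using w0(2)[of x] below[of x] by (simp add: K_def)
  \<comment> \<open>The maximum principle with the bound \<open>f w\<close>: as long as no drawdown
    exceeds \<open>a\<close>, \<open>K y > f w\<close> implies \<open>U y < a\<close>.\<close>
  moreover have "K x <= f w"
  proof (rule K_le[OF t x(3)])
    have wt: "w \<in> {t<..u}" using w tv by auto
    show "K t <= f w" using no[OF wt, of t] w tv Ut by (auto simp: U_K)
    fix y assume y: "t < y" "y <= x" "\<And>z. y <= z ==> z <= x ==> f w < K z"
    show "U y < a" using no[OF wt, of y] y(1,2) y(3)[OF order_refl y(2)] w x by (auto simp: U_K)
  qed
  ultimately show False using w by (simp add: U_K)
qed

section \<open>Discount weights and pathwise dualities\<close>

definition "hit_discount q c t = sup_discount q {u. t <= u & U u < c}"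
definition "growth_discount q t = sup_discount q {u. t <= u & 0 < mass R {t..u}}"

context
  fixes q :: real assumes q: "0 < q"
begin

lemma hit_discount_antimono: "antimono_on {0..} (hit_discount q c)"
proof (rule monotone_onI)
  fix s t :: real assume st: "s \<in> {0..}" "t \<in> {0..}" "s <= t"
  show "hit_discount q c t <= hit_discount q c s" unfolding hit_discount_def
  proof (rule sup_discount_mono[OF q])
    fix u assume "u \<in> {u. t <= u & U u < c}"
    thus "\<exists>u'\<in>{u. s <= u & U u < c}. u' <= u" using st by (intro bexI[of _ u]) auto
  qed (use st in auto)
qed

lemma hit_discount_bounds:
  assumes "0 <= t"
  shows "0 <= hit_discount q c t" "hit_discount q c t <= 1" "hit_discount q c t <= exp (- q * t)"
    "U t < c ==> exp (- q * t) <= hit_discount q c t"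
proof -
  have "{u. t <= u & U u < c} \<subseteq> {0..}" using assms by auto
  note S = q this
  show "0 <= hit_discount q c t" "hit_discount q c t <= 1" "hit_discount q c t <= exp (- q * t)"
    "U t < c ==> exp (- q * t) <= hit_discount q c t" unfolding hit_discount_def
    by (rule sup_discount_nonneg[OF S], rule sup_discount_le_1[OF S], rule sup_discount_le_exp[OF S], simp,
        rule sup_discount_upper[OF S], simp)
qed

lemma growth_discount_antimono: "antimono_on {0..} (growth_discount q)"
proof (rule monotone_onI)
  fix s t :: real assume st: "s \<in> {0..}" "t \<in> {0..}" "s <= t"
  show "growth_discount q t <= growth_discount q s" unfolding growth_discount_def
  proof (rule sup_discount_mono[OF q])
    fix u assume "u \<in> {u. t <= u & 0 < mass R {t..u}}"
    moreover have "mass R {t..u} <= mass R {s..u}" using st by (intro emeasure_mono) auto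
    ultimately show "\<exists>u'\<in>{u. s <= u & 0 < mass R {s..u}}. u' <= u" using st by (intro bexI[of _ u]) auto
  qed (use st in auto)
qed

lemma growth_discount_bounds:
  assumes "0 <= t"
  shows "0 <= growth_discount q t" "growth_discount q t <= 1" "growth_discount q t <= exp (- q * t)"
    "t <= u ==> 0 < mass R {t..u} ==> exp (- q * u) <= growth_discount q t"
proof -
  have "{u. t <= u & 0 < mass R {t..u}} \<subseteq> {0..}" using assms by auto
  note S = q this
  show "0 <= growth_discount q t" "growth_discount q t <= 1" "growth_discount q t <= exp (- q * t)"
    "t <= u ==> 0 < mass R {t..u} ==> exp (- q * u) <= growth_discount q t"
    unfolding growth_discount_def by (rule sup_discount_nonneg[OF S], rule sup_discount_le_1[OF S], rule sup_discount_le_exp[OF S], simp,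
        rule sup_discount_upper[OF S], simp)
qed

text \<open>At a growth point \<open>R\<close> charges every \<open>[t, u]\<close>; letting
  \<open>u\<close> decrease to \<open>t\<close> gives the full discount.\<close>

lemma AE_growth_discount: "AE t in control_measure R. 0 <= t --> exp (- q * t) <= growth_discount q t"
proof -
  have "AE t in control_measure R. \<forall>r>t. 0 < mass R {t..r}" by (rule AE_growth_point) simp
  thus ?thesis
  proof eventually_elim
    case (elim t)
    show ?case
    proof
      assume t: "0 <= t"
      have "((%u. exp (- q * u)) \<longlongrightarrow> exp (- q * t)) (at_right t)" by (intro tendsto_intros)
      moreover have "\<forall>\<^sub>F u in at_right t. exp (- q * u) <= growth_discount q t" using eventually_at_right_less[of t]
        by eventually_elim (rule growth_discount_bounds(4)[OF t], use elim in auto)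
      ultimately show "exp (- q * t) <= growth_discount q t" by (rule tendsto_upperbound) simp
    qed
  qed
qed

text \<open>Either nothing is injected after the peak, and the surplus inherits the drawdown, or
  something is, and then \<open>U\<close> is 0 at such a time, which is below
  \<open>a - b\<close>.\<close>

lemma drawdown_le_hit:
  assumes t: "0 <= t" and b: "0 < a - b"
  shows "drawdown q b f t <= hit_discount q (a - b) t" unfolding drawdown_def hit_discount_def
proof (rule sup_discount_mono[OF q])
  fix u assume "u \<in> {u. t < u & (\<exists>r\<in>{t..u}. b < f r - f u)}"
  then obtain r where r: "t < u" "t <= r" "r <= u" "b < f r - f u" by auto
  show "\<exists>u'\<in>{u. t <= u & U u < a - b}. u' <= u"
  proof (cases "mass R {r<..u} = 0")
    case True
    hence "U u < a - b" using drawdown_imp[of r u b] r t by auto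
    thus ?thesis using r by (intro bexI[of _ u]) auto
  next
    case False
    then obtain v where "v \<in> {r<..u}" "U v = 0" using R_growth_zero[of "{r<..u}"] by (auto simp: zero_less_iff_neq_zero)
    thus ?thesis using r b by (intro bexI[of _ v]) auto
  qed
qed (use t in auto)

lemma hit_le_drawdown:
  assumes t: "0 <= t" and Ut: "U t = a" and b: "0 <= b"
  shows "hit_discount q (a - b) t <= drawdown q b f t" unfolding drawdown_def hit_discount_def
proof (rule sup_discount_mono[OF q])
  fix u assume "u \<in> {u. t <= u & U u < a - b}"
  hence u: "t <= u" "U u < a - b" by auto
  hence "t < u" using Ut b by (cases "t = u") auto
  moreover have "\<exists>r\<in>{t..u}. b < f r - f u" using drawdown_if_below[OF t u(1) Ut, of b] u(2) by (meson linorder_not_le)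
  ultimately show "\<exists>u'\<in>{u. t < u & (\<exists>r\<in>{t..u}. b < f r - f u)}. u' <= u" by (intro bexI[of _ u]) auto
qed (use t in auto)

lemma drawdown_le_growth:
  assumes t: "0 <= t"
  shows "drawdown q a f t <= growth_discount q t" unfolding drawdown_def growth_discount_def
proof (rule sup_discount_mono[OF q])
  fix u assume "u \<in> {u. t < u & (\<exists>r\<in>{t..u}. a < f r - f u)}"
  then obtain r where r: "t < u" "t <= r" "r <= u" "a < f r - f u" by auto
  have "mass R {r<..u} ~= 0" using drawdown_imp[of r u a] r t U_bounds(1)[of u] by auto
  moreover have "mass R {r<..u} <= mass R {t..u}" using r by (intro emeasure_mono) auto
  ultimately show "\<exists>u'\<in>{u. t <= u & 0 < mass R {t..u}}. u' <= u"
    using r by (intro bexI[of _ u]) (auto simp: zero_less_iff_neq_zero)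
qed (use t in auto)

context
  fixes L1 R1 assumes cum1: "cumulative_path L1" "cumulative_path R1"
    and pos: "\<And>t. 0 <= t ==> 0 <= f t - L1 t + R1 t"
begin

text \<open>The error is the bound for \<open>U\<close> at the visited times. Replacing the hitting
  weight by the drawdown weight lowers the integral against \<open>L1\<close> and costs nothing
  against \<open>L\<close>, where \<open>U = a\<close> and the two agree.\<close>

lemma hit_duality:
  assumes b: "0 <= b" "b < a"
  shows "weighted (drawdown q b f) L1 + discounted_integral q R
    <= discounted_integral q R1 + weighted (drawdown q b f) L + ennreal (a - b)"
proof -
  let ?d = "hit_discount q (a - b)"
  have "weighted ?d L1 + weighted ?d R <= weighted ?d R1 + weighted ?d L + ennreal (a - b)"
  proof (rule weak_duality[OF cum1 cumL cumR hit_discount_antimono, where U' = U])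
    fix t y assume t: "0 <= t" "0 < y" "y < ?d t"
    have "{u. t <= u & U u < a - b} \<subseteq> {0..}" using t by auto
    from less_sup_discount[OF q this, of y] t
    obtain u where "t <= u" "U u < a - b" "y < exp (- q * u)" unfolding hit_discount_def by auto
    thus "\<exists>u\<ge>t. y < ?d u & U u <= a - b" using hit_discount_bounds(4)[of u "a - b"] t by (intro exI[of _ u]) auto
  next
    fix t :: real assume "0 <= t"
    thus "L1 t + R t <= R1 t + L t + U t" using pos[of t] by (simp add: U_def)
  qed (use b hit_discount_bounds in auto)
  moreover have "weighted (drawdown q b f) L1 <= weighted ?d L1" by (rule weighted_mono[OF cum1(1)]) (use drawdown_le_hit b in auto)
  moreover have "discounted_integral q R <= weighted ?d R" unfolding discounted_integral_weighted
    by (rule weighted_mono_AE, use AE_R in eventually_elim) (use hit_discount_bounds(4) b in auto)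
  moreover have "weighted ?d R1 <= discounted_integral q R1"
    unfolding discounted_integral_weighted by (rule weighted_mono[OF cum1(2)]) (rule hit_discount_bounds)
  moreover have "weighted ?d L <= weighted (drawdown q b f) L"
    by (rule weighted_mono_AE, use AE_L in eventually_elim) (use hit_le_drawdown b in auto)
  ultimately show ?thesis by (meson add_mono order_refl order_trans)
qed

context
  assumes slack: "AE t in control_measure L. 0 <= t --> growth_discount q t <= drawdown q a f t"
begin

text \<open>\<open>slack\<close> is a hypothesis because it has two different sources: a strict
  drawdown for a positive barrier, and the sign of the drift for the barrier 0.\<close>

lemma growth_duality:
  shows "weighted (drawdown q a f) L1 + discounted_integral q R
    <= discounted_integral q R1 + weighted (drawdown q a f) L"
proof -
  let ?d = "growth_discount q"
  have "weighted ?d L1 + weighted ?d R <= weighted ?d R1 + weighted ?d L + ennreal 0"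
  proof (rule weak_duality[OF cum1 cumL cumR growth_discount_antimono, where U' = U])
    fix t y assume t: "0 <= t" "0 < y" "y < ?d t"
    have "{u. t <= u & 0 < mass R {t..u}} \<subseteq> {0..}" using t by auto
    from less_sup_discount[OF q this, of y] t
    obtain u where u: "t <= u" "0 < mass R {t..u}" "y < exp (- q * u)" unfolding growth_discount_def by auto
    \<comment> \<open>Points of \<open>[t, u]\<close> outside \<open>?N\<close> still see growth of
      \<open>R\<close> up to \<open>u\<close>. They carry all the mass, so one of them has
      \<open>U v = 0\<close>, and the loss there is 0.\<close>
    let ?N = "{v. v <= u & mass R {v..u} = 0}"
    have N: "?N \<in> null_sets (control_measure R)" by (rule emeasure_up_closed_null) simp
    hence "0 < mass R ({t..u} - ?N)" using u(2) emeasure_Diff_null_set[OF N, of "{t..u}"] by simp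
    moreover have "{t..u} - ?N \<in> sets borel" using N by (auto simp: null_sets_def)
    ultimately obtain v where v: "v \<in> {t..u} - ?N" "U v = 0" using R_growth_zero by blast
    hence "exp (- q * u) <= ?d v" using t by (intro growth_discount_bounds(4)) (auto simp: zero_less_iff_neq_zero)
    thus "\<exists>u\<ge>t. y < ?d u & U u <= 0" using u(3) v by (intro exI[of _ v]) auto
  next
    fix t :: real assume "0 <= t"
    thus "L1 t + R t <= R1 t + L t + U t" using pos[of t] by (simp add: U_def)
  qed (use growth_discount_bounds in auto)
  moreover have "weighted (drawdown q a f) L1 <= weighted ?d L1" by (rule weighted_mono[OF cum1(1)]) (use drawdown_le_growth in auto)
  moreover have "discounted_integral q R <= weighted ?d R"
    unfolding discounted_integral_weighted by (rule weighted_mono_AE) (rule AE_growth_discount)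
  moreover have "weighted ?d R1 <= discounted_integral q R1"
    unfolding discounted_integral_weighted by (rule weighted_mono[OF cum1(2)]) (rule growth_discount_bounds)
  moreover have "weighted ?d L <= weighted (drawdown q a f) L" by (rule weighted_mono_AE) (rule slack)
  ultimately show ?thesis by (simp) (meson add_mono order_refl order_trans)
qed

end

end

lemma zero_cumulative: "cumulative_path (%_. 0)" by (auto simp: cumulative_path_def monotone_on_def)

lemma growth_slack:
  assumes a: "0 < a"
  shows "AE t in control_measure L. 0 <= t --> growth_discount q t <= drawdown q a f t" using AE_L
proof eventually_elim
  case (elim t)
  show ?case
  proof
    assume t: "0 <= t"
    show "growth_discount q t <= drawdown q a f t" unfolding growth_discount_def drawdown_def
    proof (rule sup_discount_mono[OF q])
      fix u assume "u \<in> {u. t <= u & 0 < mass R {t..u}}"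
      then obtain v where "v \<in> {t<..u}" "\<exists>r\<in>{t..v}. a < f r - f v" using strict_drawdown[OF a t _, of u] elim by blast
      thus "\<exists>u'\<in>{u. t < u & (\<exists>r\<in>{t..u}. a < f r - f u)}. u' <= u" by (intro bexI[of _ v]) auto
    qed (use t in auto)
  qed
qed

text \<open>A priori bounds: \<open>Z\<close> truncates the controls, and \<open>H\<close> is a majorant of the uncontrolled path.\<close>

context
  fixes H Z :: "real => real"
  assumes H: "cumulative_path H" "\<And>t. 0 <= t ==> \<bar>f t\<bar> <= H t"
    and Z: "antimono_on {0..} Z" "\<And>t. 0 <= t ==> 0 <= Z t" "\<And>t. 0 <= t ==> Z t <= 1"
begin

text \<open>\<open>U\<close> is nonnegative and \<open>f\<close> is at most \<open>H\<close>, so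
  \<open>L\<close> is at most \<open>R + H\<close> at every time; weak duality with a zero fourth
  control integrates this.\<close>

lemma truncated_dividends_le:
  "weighted (%t. exp (- q * t) * Z t) L <= weighted (%t. exp (- q * t) * Z t) R + discounted_integral q H"
proof -
  have anti: "antimono_on {0..} (%t. exp (- q * t) * Z t)" using q Z by (auto simp: monotone_on_def intro!: mult_mono)
  have "weighted (%t. exp (- q * t) * Z t) L + weighted (%t. exp (- q * t) * Z t) (%_. 0)
     <= weighted (%t. exp (- q * t) * Z t) R + weighted (%t. exp (- q * t) * Z t) H + ennreal 0"
  proof (rule weak_duality[OF cumL cumR H(1) zero_cumulative anti, where U' = "%_. 0"])
    fix t :: real assume t: "0 <= t"
    thus "L t + 0 <= R t + H t + 0" using U_bounds(1)[of t] H(2)[of t] by (simp add: U_def)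
    show "exp (- q * t) * Z t <= 1" using t q Z by (intro mult_le_one) auto
  qed auto
  moreover have "weighted (%t. exp (- q * t) * Z t) H <= discounted_integral q H" unfolding discounted_integral_weighted
    by (rule weighted_mono[OF H(1)]) (use Z in \<open>auto simp: mult_left_le\<close>)
  ultimately show ?thesis by (simp) (meson add_mono le_add_same_cancel1 order_refl order_trans zero_le add_increasing2)
qed

text \<open>Here \<open>U <= a\<close> gives \<open>R <= H + L + a\<close>. The growth weight is
  used to gain the drawdown factor in front of \<open>L\<close>; with the plain discount the two a
  priori bounds would not close up.\<close>

lemma truncated_injections_le:
  assumes slack: "AE t in control_measure L. 0 <= t --> growth_discount q t <= drawdown q a f t"
    and a: "0 <= a"
  shows "weighted (%t. exp (- q * t) * Z t) R
    <= weighted (%t. drawdown q a f t * Z t) L + discounted_integral q H + ennreal a"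
proof -
  let ?d = "%t. growth_discount q t * Z t"
  have anti: "antimono_on {0..} ?d" using growth_discount_antimono Z growth_discount_bounds(1) by (auto simp: monotone_on_def intro!: mult_mono)
  have "weighted ?d (%_. 0) + weighted ?d R <= weighted ?d H + weighted ?d L + ennreal a"
  proof (rule weak_duality[OF zero_cumulative H(1) cumL cumR anti, where U' = "%_. a"])
    fix t :: real assume t: "0 <= t"
    thus "0 + R t <= H t + L t + a" using U_bounds(2)[of t] H(2)[of t] by (simp add: U_def)
    show "?d t <= 1" using t Z growth_discount_bounds by (intro mult_le_one) auto
  qed (use a in auto)
  moreover have "weighted ?d H <= discounted_integral q H" unfolding discounted_integral_weighted
  proof (rule weighted_mono[OF H(1)])
    fix t :: real assume t: "0 <= t"
    have "?d t <= growth_discount q t * 1" using Z t growth_discount_bounds by (intro mult_left_mono) auto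
    thus "?d t <= exp (- q * t)" using growth_discount_bounds(3)[OF t] by simp
  qed
  moreover have "weighted (%t. exp (- q * t) * Z t) R <= weighted ?d R"
    by (rule weighted_mono_AE, use AE_growth_discount in eventually_elim)
       (use Z in \<open>auto intro: mult_right_mono\<close>)
  moreover have "weighted ?d L <= weighted (%t. drawdown q a f t * Z t) L"
    by (rule weighted_mono_AE, use slack in eventually_elim) (use Z in \<open>auto intro: mult_right_mono\<close>)
  ultimately have "weighted (%t. exp (- q * t) * Z t) R
     <= discounted_integral q H + weighted (%t. drawdown q a f t * Z t) L + ennreal a"
    by (meson add_mono le_add_same_cancel1 order_refl order_trans zero_le add_increasing2 add_increasing)
  thus ?thesis by (simp add: add_ac)
qed

end

end

end

section \<open>Phases of the double barrier\<close>

lemma real_interval_induct: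
  fixes P :: "real => bool"
  assumes st: "s <= t" and base: "P s"
    and right: "\<And>u. s <= u ==> u < t ==> P u ==> \<exists>r>u. \<forall>v. u < v & v < r & v <= t --> P v"
    and left: "\<And>u. s < u ==> u <= t ==> (\<And>v. s <= v ==> v < u ==> P v) ==> P u"
  shows "P t"
proof -
  define E where "E = {u\<in>{s..t}. \<forall>v\<in>{s..u}. P v}"
  have sE: "s \<in> E" using st base by (auto simp: E_def)
  have bdd: "bdd_above E" by (rule bdd_aboveI[of _ t]) (simp add: E_def)
  define w where "w = Sup E"
  have sw: "s <= w" unfolding w_def by (rule cSup_upper[OF sE bdd])
  have wt: "w <= t" unfolding w_def using sE by (intro cSup_least) (auto simp: E_def)
  have below: "P v" if v: "s <= v" "v < w" for v
  proof -
    obtain x where "x \<in> E" "v < x" using less_cSupD[of E v] v sE unfolding w_def by blast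
    thus ?thesis using v by (auto simp: E_def)
  qed
  have Pw: "P w" using left[of w] below base sw wt by (cases "s = w") auto
  have "w = t"
  proof (rule ccontr)
    assume "w ~= t"
    hence "w < t" using wt by simp
    then obtain r where r: "w < r" "\<And>v. w < v ==> v < r ==> v <= t ==> P v" using right[OF sw _ Pw] by blast
    define x where "x = (w + min r t) / 2"
    have x: "w < x" "x < r" "x < t" using r(1) \<open>w < t\<close> by (auto simp: x_def min_def field_simps)
    have "P v" if "s <= v" "v <= x" for v using that below[of v] Pw r(2)[of v] x by (cases v w rule: linorder_cases) auto
    hence "x \<in> E" using x sw by (auto simp: E_def)
    hence "x <= w" unfolding w_def by (rule cSup_upper[OF _ bdd])
    with x show False by simp
  qed
  with Pw show ?thesis by simp
qed

lemma cadlag_right: "cadlag f ==> 0 <= t ==> (f \<longlongrightarrow> f t) (at_right t)"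
  by (auto simp: cadlag_def continuous_within)

lemma cadlag_left: "cadlag f ==> 0 < t ==> \<exists>l. (f \<longlongrightarrow> l) (at_left t)" by (auto simp: cadlag_def)

lemma cadlag_right_near:
  assumes "cadlag f" "0 <= t" "0 < e"
  shows "\<exists>r>t. \<forall>v. t <= v & v < r --> \<bar>f v - f t\<bar> < e"
proof -
  have "\<forall>\<^sub>F v in at_right t. dist (f v) (f t) < e" using cadlag_right[OF assms(1,2)] assms(3) by (rule tendstoD)
  then obtain r where "r > t" "\<forall>v>t. v < r --> dist (f v) (f t) < e" by (auto simp: eventually_at_right[OF less_add_one])
  thus ?thesis using assms(3) by (intro exI[of _ r]) (auto simp: dist_real_def le_less)
qed

lemma cadlag_uminus: "cadlag f ==> cadlag (%t. - f t)" unfolding cadlag_def by (fastforce intro: continuous_minus tendsto_minus)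

text \<open>The finite set \<open>D\<close> collects the times of large oscillation. It yields
  boundedness of the path, finiteness of the large jumps and, for phases, that they cannot
  accumulate.\<close>

lemma cadlag_partition:
  assumes f: "cadlag f" and s: "0 <= s" "s <= t" and e: "0 < e"
  shows "\<exists>D. finite D & (\<forall>x y. s <= x & x <= y & y <= t & {x<..y} \<inter> D = {} --> \<bar>f x - f y\<bar> < e)"
    (is "?P t") using s(2)
proof (rule real_interval_induct[where P = ?P])
  have "\<bar>f x - f y\<bar> < e" if "s <= x" "x <= y" "y <= s" for x y using that e by (metis abs_zero diff_self order_antisym order_trans)
  thus "?P s" by (intro exI[of _ "{}"]) auto
next
  fix u assume u: "s <= u" "u < t" "?P u"
  then obtain D where D: "finite D" "\<And>x y. s <= x ==> x <= y ==> y <= u ==> {x<..y} \<inter> D = {} ==> \<bar>f x - f y\<bar> < e"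
    by blast
  obtain r where r: "r > u" "\<And>v. u <= v ==> v < r ==> \<bar>f v - f u\<bar> < e / 2"
    using cadlag_right_near[OF f, of u "e/2"] u s e by auto
  show "\<exists>r>u. \<forall>v. u < v & v < r & v <= t --> ?P v"
  proof (intro exI[of _ r] conjI allI impI)
    fix v assume v: "u < v & v < r & v <= t"
    show "?P v"
    proof (intro exI[of _ "insert u D"] conjI allI impI)
      fix x y assume xy: "s <= x & x <= y & y <= v & {x<..y} \<inter> insert u D = {}"
      show "\<bar>f x - f y\<bar> < e"
      proof (cases "y <= u")
        case True
        thus ?thesis using D(2)[of x y] xy by auto
      next
        case False
        hence "u <= x" using xy by (auto simp: not_le)
        hence "\<bar>f x - f u\<bar> < e / 2" "\<bar>f y - f u\<bar> < e / 2" using r(2)[of x] r(2)[of y] xy v by auto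
        thus ?thesis by linarith
      qed
    qed (use D in auto)
  qed (use r in auto)
next
  fix u assume u: "s < u" "u <= t" and IH: "\<And>v. s <= v ==> v < u ==> ?P v"
  obtain l where l: "(f \<longlongrightarrow> l) (at_left u)" using cadlag_left[OF f] u s by force
  have "\<forall>\<^sub>F v in at_left u. dist (f v) l < e / 2" using l e by (intro tendstoD) auto
  then obtain w where w: "w < u" "\<And>v. w < v ==> v < u ==> dist (f v) l < e / 2"
    by (auto simp: eventually_at_left[OF minus_one_less])
  \<comment> \<open>After \<open>v\<close> the left limit at \<open>u\<close> controls the path.
    Both \<open>v\<close> and \<open>u\<close> become exceptional times, so that no interval to be
    tested straddles them.\<close>
  define v where "v = (max s w + u) / 2"
  have v: "s <= v" "w < v" "v < u" using w u by (auto simp: v_def max_def field_simps)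
  obtain D where D: "finite D" "\<And>x y. s <= x ==> x <= y ==> y <= v ==> {x<..y} \<inter> D = {} ==> \<bar>f x - f y\<bar> < e"
    using IH[OF v(1,3)] by blast
  show "?P u"
  proof (intro exI[of _ "insert u (insert v D)"] conjI allI impI)
    fix x y assume xy: "s <= x & x <= y & y <= u & {x<..y} \<inter> insert u (insert v D) = {}"
    consider "x = y" | "y <= v" | "v <= x" "y < u" using xy by fastforce
    thus "\<bar>f x - f y\<bar> < e"
    proof cases
      case 2 thus ?thesis using D(2)[of x y] xy by auto
    next
      case 3
      hence "dist (f x) l < e / 2" "dist (f y) l < e / 2" using w(2)[of x] w(2)[of y] v xy by auto
      thus ?thesis unfolding dist_real_def by linarith
    qed (use e in auto)
  qed (use D in auto)
qed

lemma cadlag_bounded: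
  assumes f: "cadlag f" and s: "0 <= s"
  shows "\<exists>B\<ge>0. \<forall>x\<in>{s..t}. \<bar>f x\<bar> <= B"
proof (cases "s <= t")
  case True
  obtain D where D: "finite D" "\<And>x y. s <= x ==> x <= y ==> y <= t ==> {x<..y} \<inter> D = {} ==> \<bar>f x - f y\<bar> < 1"
    using cadlag_partition[OF f s True, of 1] by auto
  define D' where "D' = insert s {d\<in>D. s <= d}"
  have D': "finite D'" using D by (simp add: D'_def)
  define B where "B = Max ((%d. \<bar>f d\<bar>) ` D') + 1"
  have "\<bar>f x\<bar> <= B" if x: "x \<in> {s..t}" for x
  proof -
    let ?E = "{d\<in>D'. d <= x}"
    define d where "d = Max ?E"
    have E: "finite ?E" "?E ~= {}" using D' x by (auto simp: D'_def)
    have d: "d \<in> ?E" unfolding d_def by (rule Max_in[OF E])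
    have "{d<..x} \<inter> D = {}"
    proof (rule ccontr)
      assume "{d<..x} \<inter> D ~= {}"
      then obtain y where y: "d < y" "y <= x" "y \<in> D" by auto
      hence "y \<in> ?E" using d by (auto simp: D'_def)
      hence "y <= d" unfolding d_def using E by (intro Max_ge)
      with y show False by simp
    qed
    hence "\<bar>f d - f x\<bar> < 1" using D(2)[of d x] d x by (auto simp: D'_def)
    moreover have "\<bar>f d\<bar> <= Max ((%d. \<bar>f d\<bar>) ` D')" using D' d by (intro Max_ge) auto
    ultimately show ?thesis by (simp add: B_def)
  qed
  moreover have "0 <= B" using calculation[of s] True by auto
  ultimately show ?thesis by auto
qed (auto intro: exI[of _ 0])

section \<open>Running suprema from a starting time\<close>

definition run_sup :: "(real => real) => real => real => real" where
  "run_sup g T t = (SUP s\<in>{T..t}. g s - g T)"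

context
  fixes g :: "real => real" and T :: real
  assumes g: "cadlag g" and T: "0 <= T"
begin

lemma run_sup_bdd: "bdd_above ((%s. g s - g T) ` {T..t})"
proof -
  obtain B where "\<forall>x\<in>{T..t}. \<bar>g x\<bar> <= B" using cadlag_bounded[OF g T] by auto
  thus ?thesis by (intro bdd_aboveI[of _ "B - g T"]) force
qed

lemma run_sup_upper: "T <= s ==> s <= t ==> g s - g T <= run_sup g T t"
  unfolding run_sup_def by (rule cSUP_upper[OF _ run_sup_bdd]) simp

lemma run_sup_least: "T <= t ==> (\<And>s. T <= s ==> s <= t ==> g s - g T <= c) ==> run_sup g T t <= c"
  unfolding run_sup_def by (rule cSUP_least) auto

lemma run_sup_start: "run_sup g T T = 0" unfolding run_sup_def by simp

lemma run_sup_mono: "T <= s ==> s <= t ==> run_sup g T s <= run_sup g T t"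
  by (rule run_sup_least) (auto intro: run_sup_upper)

lemma run_sup_right: 
  assumes "T <= t"
  shows "(run_sup g T \<longlongrightarrow> run_sup g T t) (at_right t)"
proof (rule tendstoI)
  fix e :: real assume e: "0 < e"
  obtain r where r: "r > t" "\<And>v. t <= v ==> v < r ==> \<bar>g v - g t\<bar> < e / 2"
    using cadlag_right_near[OF g, of t "e/2"] T assms e by auto
  show "\<forall>\<^sub>F v in at_right t. dist (run_sup g T v) (run_sup g T t) < e"
  proof (rule eventually_at_rightI[OF _ r(1)])
    fix v assume v: "v \<in> {t<..<r}"
    have "run_sup g T v <= run_sup g T t + e / 2"
    proof (rule run_sup_least)
      fix s assume s: "T <= s" "s <= v"
      show "g s - g T <= run_sup g T t + e / 2"
      proof (cases "s <= t")
        case True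
        thus ?thesis using run_sup_upper[of s t] s e by simp
      next
        case False
        hence "\<bar>g s - g t\<bar> < e / 2" using r(2)[of s] s v by auto
        thus ?thesis using run_sup_upper[of t t] assms by linarith
      qed
    qed (use v assms in auto)
    moreover have "run_sup g T t <= run_sup g T v" using v assms by (intro run_sup_mono) auto
    ultimately show "dist (run_sup g T v) (run_sup g T t) < e" using e by (simp add: dist_real_def)
  qed
qed

text \<open>Strictly below its running supremum the path cannot set a new one at once, by right
  continuity.\<close>

lemma run_sup_flat_right:
  assumes t: "T <= t" and less: "g t - g T < run_sup g T t"
  shows "\<exists>r>t. run_sup g T r = run_sup g T t"
proof -
  obtain r where r: "r > t" "\<And>v. t <= v ==> v < r ==> \<bar>g v - g t\<bar> < run_sup g T t - (g t - g T)"
    using cadlag_right_near[OF g, of t "run_sup g T t - (g t - g T)"] T t less by auto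
  define v where "v = (t + r) / 2"
  have v: "t < v" "v < r" using r(1) by (auto simp: v_def)
  have "run_sup g T v <= run_sup g T t"
  proof (rule run_sup_least)
    fix s assume "T <= s" "s <= v"
    thus "g s - g T <= run_sup g T t" using run_sup_upper[of s t] r(2)[of s] v by (cases "s <= t") auto
  qed (use v t in auto)
  thus ?thesis using run_sup_mono[of t v] v t by (intro exI[of _ v]) auto
qed

text \<open>The supremum over \<open>[T, t]\<close> is then approached strictly before
  \<open>t\<close>, up to any error.\<close>

lemma run_sup_flat_left:
  assumes t: "T < t" and less: "g t - g T < run_sup g T t"
  shows "(run_sup g T \<longlongrightarrow> run_sup g T t) (at_left t)"
proof (rule tendstoI)
  fix e :: real assume e: "0 < e"
  define e' where "e' = min e (run_sup g T t - (g t - g T))"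
  have e': "0 < e'" "e' <= e" using e less by (auto simp: e'_def)
  have "\<exists>s\<in>{T..t}. run_sup g T t - e' < g s - g T"
    using less_cSUP_iff[OF _ run_sup_bdd[of t], of "run_sup g T t - e'"] e' t unfolding run_sup_def by auto
  then obtain s where s: "T <= s" "s <= t" "run_sup g T t - e' < g s - g T" by auto
  hence st: "s < t" using less by (cases "s = t") (auto simp: e'_def)
  show "\<forall>\<^sub>F v in at_left t. dist (run_sup g T v) (run_sup g T t) < e"
  proof (rule eventually_at_leftI[OF _ st])
    fix v assume v: "v \<in> {s<..<t}"
    hence "g s - g T <= run_sup g T v" "run_sup g T v <= run_sup g T t" using s run_sup_upper[of s v] run_sup_mono[of v t] by auto
    thus "dist (run_sup g T v) (run_sup g T t) < e" using s e' by (simp add: dist_real_def)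
  qed
qed

lemma run_sup_left_limit:
  assumes t: "T < t"
  shows "\<exists>c. (run_sup g T \<longlongrightarrow> c) (at_left t) & (\<forall>v. T <= v & v < t --> run_sup g T v <= c)"
proof -
  let ?c = "SUP v\<in>{T..<t}. run_sup g T v"
  have bdd: "bdd_above (run_sup g T ` {T..<t})" by (rule bdd_aboveI[of _ "run_sup g T t"]) (auto intro: run_sup_mono)
  have up: "run_sup g T v <= ?c" if "T <= v" "v < t" for v using that by (intro cSUP_upper[OF _ bdd]) auto
  have "(run_sup g T \<longlongrightarrow> ?c) (at_left t)"
  proof (rule tendstoI)
    fix e :: real assume e: "0 < e"
    have "\<exists>s\<in>{T..<t}. ?c - e < run_sup g T s" using less_cSUP_iff[OF _ bdd, of "?c - e"] e t by auto
    then obtain s where s: "T <= s" "s < t" "?c - e < run_sup g T s" by auto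
    show "\<forall>\<^sub>F v in at_left t. dist (run_sup g T v) ?c < e"
    proof (rule eventually_at_leftI[OF _ s(2)])
      fix v assume v: "v \<in> {s<..<t}"
      hence "run_sup g T s <= run_sup g T v" "run_sup g T v <= ?c" using s run_sup_mono[of s v] up[of v] by auto
      thus "dist (run_sup g T v) ?c < e" using s by (simp add: dist_real_def)
    qed
  qed
  with up show ?thesis by blast
qed

end

lemma first_time_empty: "{t. s < t & Q t} = {} ==> first_time s Q = \<infinity>"
  unfolding first_time_def by (simp only: image_empty Inf_empty) (simp add: top_ereal_def)

lemma first_time_finite:
  assumes "first_time s Q = ereal T" "0 <= s"
  shows "s <= T" "\<And>t. s < t ==> t < T ==> ~ Q t" "\<And>r. T < r ==> \<exists>t. s < t & T <= t & t < r & Q t"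
proof -
  let ?S = "{t. s < t & Q t}"
  have ne: "?S ~= {}" using assms(1) first_time_empty[of s Q] by (metis PInfty_neq_ereal(1))
  have bdd: "bdd_below ?S" by (rule bdd_belowI[of _ s]) auto
  have T: "T = Inf ?S" using assms ereal_Inf'[OF bdd ne] by (simp add: first_time_def)
  show "s <= T" unfolding T by (rule cInf_greatest[OF ne]) auto
  show "~ Q t" if "s < t" "t < T" for t
  proof
    assume "Q t"
    hence "T <= t" unfolding T using that by (intro cInf_lower[OF _ bdd]) auto
    with that show False by simp
  qed
  show "\<exists>t. s < t & T <= t & t < r & Q t" if Tr: "T < r" for r
  proof -
    obtain t where "t \<in> ?S" "t < r" using cInf_lessD[OF ne, of r] Tr unfolding T by blast
    moreover from this have "T <= t" unfolding T by (intro cInf_lower[OF _ bdd]) auto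
    ultimately show ?thesis by auto
  qed
qed

lemma first_time_cases:
  assumes "0 <= s" obtains "first_time s Q = \<infinity>" | T where "first_time s Q = ereal T" "s <= T"
proof (cases "{t. s < t & Q t} = {}")
  case True
  hence "first_time s Q = \<infinity>" by (rule first_time_empty)
  thus ?thesis using that by blast
next
  case False
  have bdd: "bdd_below {t. s < t & Q t}" by (rule bdd_belowI[of _ s]) auto
  hence 1: "first_time s Q = ereal (Inf {t. s < t & Q t})" using ereal_Inf'[OF bdd False] by (simp add: first_time_def)
  thus ?thesis using that(2) first_time_finite(1)[OF 1 assms] by blast
qed

lemma first_time_before: "ereal t < first_time s Q ==> s < t ==> ~ Q t"
  unfolding first_time_def by (metis (mono_tags, lifting) Inf_lower image_eqI mem_Collect_eq not_less)

lemma emeasure_control_flatI: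
  assumes F: "cumulative_path F" and t: "0 <= t" "t <= r"
    and "t = 0 ==> F r = 0" "0 < t ==> (F \<longlongrightarrow> F r) (at_left t)"
  shows "mass F {t..r} = 0"
proof (cases "t = 0")
  case True
  thus ?thesis using emeasure_control_Icc[OF F, of r] assms by simp
next
  case False
  hence t0: "0 < t" using t by simp
  show ?thesis
  proof (rule ccontr)
    assume "mass F {t..r} ~= 0"
    hence "0 < mass F {t..r}" by (simp add: zero_less_iff_neq_zero)
    moreover have "mass F {t..r} <= ennreal (F r - F w)" if "0 <= w" "w < t" for w
      using emeasure_control_Ioc[OF F, of w r] that t by (metis (no_types, lifting) atLeastAtMost_iff emeasure_mono greaterThanAtMost_iff less_imp_le
          order.strict_trans1 order_trans sets_control_measure subsetI less_le_trans borel_measurable_vimage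
          greaterThanAtMost_borel)
    moreover have "mass F {t..r} < \<infinity>" using calculation(2)[of 0] t0 by (auto simp: le_less_trans top.not_eq_extremum)
    ultimately obtain c where c: "0 < c" "\<And>w. 0 <= w ==> w < t ==> ennreal c <= ennreal (F r - F w)"
      by (cases "mass F {t..r}") auto
    have "\<forall>\<^sub>F w in at_left t. dist (F w) (F r) < c" using assms(5)[OF t0] c(1) by (rule tendstoD)
    moreover have "\<forall>\<^sub>F w in at_left t. 0 < w & w < t" using t0 by (intro eventually_at_leftI[of 0]) auto
    ultimately have "\<forall>\<^sub>F w in at_left t. False"
    proof eventually_elim
      case (elim w)
      hence "ennreal (F r - F w) < ennreal c" using c(1) by (simp add: dist_real_def ennreal_less_iff ennreal_lessI)
      thus False using c(2)[of w] elim by (simp add: not_le[symmetric])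
    qed
    thus False by simp
  qed
qed

section \<open>A single phase\<close>

text \<open>The invariant handed from phase to phase: \<open>\<eta>\<close> is the surplus under the
  controls accumulated so far, and it lies on or beyond the barrier that becomes active.\<close>

fun phase_ok :: "real => (real => real) => phase => bool" where
  "phase_ok a f (Phase s T \<eta> l r) \<longleftrightarrow>
     0 <= T & \<eta> = f T - l + r & 0 <= l & 0 <= r & (case s of Top => a <= \<eta> | Bottom => \<eta> <= 0)"

fun phase_l :: "phase => real" where "phase_l (Phase s T \<eta> l r) = l"
fun phase_r :: "phase => real" where "phase_r (Phase s T \<eta> l r) = r"

text \<open>A bottom phase is governed by the running supremum of the negated path, so suprema
  suffice.\<close>

lemma INF_run_sup: "(INF s\<in>{T..t}. f s - f T) = - run_sup (%t. - f t) T t" unfolding run_sup_def by (simp add: Inf_real_def image_image)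

lemma phase_run_sup:
  "phase_U a f (Phase Top T \<eta> l r) = (%t. a + f t - f T - run_sup f T t)"
  "phase_U a f (Phase Bottom T \<eta> l r) = (%t. f t - f T + run_sup (%t. - f t) T t)"
  "phase_L a f (Phase Top T \<eta> l r) = (%t. l + (\<eta> - a + run_sup f T t))"
  "phase_L a f (Phase Bottom T \<eta> l r) = (%t. l)"
  "phase_R a f (Phase Top T \<eta> l r) = (%t. r)"
  "phase_R a f (Phase Bottom T \<eta> l r) = (%t. r + (- \<eta> + run_sup (%t. - f t) T t))"
  by (simp_all add: fun_eq_iff INF_run_sup run_sup_def)

declare phase_U.simps [simp del] phase_L.simps [simp del] phase_R.simps [simp del]

locale barrier_path =
  fixes a :: real and f :: "real => real"
  assumes a: "0 < a" and f: "cadlag f"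
begin

lemma nf: "cadlag (%t. - f t)" by (rule cadlag_uminus[OF f])

context
  fixes p :: phase assumes ok: "phase_ok a f p"
begin

lemma phase_start_nonneg: "0 <= phase_start p" using ok by (cases p) auto

lemma phase_balance: "phase_U a f p t = f t - phase_L a f p t + phase_R a f p t"
  using ok by (cases p; cases "case p of Phase s T \<eta> l r => s") (auto simp: phase_run_sup)

lemma phase_L_mono: "phase_start p <= s ==> s <= t ==> phase_L a f p s <= phase_L a f p t"
  using ok run_sup_mono[OF f, of "phase_start p" s t] by (cases p; cases "case p of Phase s T \<eta> l r => s") (auto simp: phase_run_sup)

lemma phase_R_mono: "phase_start p <= s ==> s <= t ==> phase_R a f p s <= phase_R a f p t"
  using ok run_sup_mono[OF nf, of "phase_start p" s t] by (cases p; cases "case p of Phase s T \<eta> l r => s") (auto simp: phase_run_sup)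

lemma phase_L_start: "phase_l p <= phase_L a f p (phase_start p)"
  using ok by (cases p; cases "case p of Phase s T \<eta> l r => s") (auto simp: phase_run_sup run_sup_start[OF f])

lemma phase_R_start: "phase_r p <= phase_R a f p (phase_start p)"
  using ok by (cases p; cases "case p of Phase s T \<eta> l r => s") (auto simp: phase_run_sup run_sup_start[OF nf])

lemma phase_L_right: 
  assumes t: "phase_start p <= t" shows "(phase_L a f p \<longlongrightarrow> phase_L a f p t) (at_right t)"
proof (cases p)
  case (Phase s T \<eta> l r)
  have "(run_sup f T \<longlongrightarrow> run_sup f T t) (at_right t)" using run_sup_right[OF f, of T t] t ok Phase by simp
  thus ?thesis by (cases s) (auto simp: Phase phase_run_sup intro!: tendsto_intros)
qed

lemma phase_R_right: 
  assumes t: "phase_start p <= t" shows "(phase_R a f p \<longlongrightarrow> phase_R a f p t) (at_right t)"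
proof (cases p)
  case (Phase s T \<eta> l r)
  have "(run_sup (%t. - f t) T \<longlongrightarrow> run_sup (%t. - f t) T t) (at_right t)"
    using run_sup_right[OF nf, of T t] t ok Phase by simp
  thus ?thesis by (cases s) (auto simp: Phase phase_run_sup intro!: tendsto_intros)
qed

lemma phase_L_left: 
  assumes t: "phase_start p < t"
  shows "\<exists>c. (phase_L a f p \<longlongrightarrow> c) (at_left t) & (\<forall>v. phase_start p <= v & v < t --> phase_L a f p v <= c)"
proof (cases p)
  case (Phase s T \<eta> l r)
  obtain c where c: "(run_sup f T \<longlongrightarrow> c) (at_left t)" "\<And>v. T <= v ==> v < t ==> run_sup f T v <= c"
    using run_sup_left_limit[OF f, of T t] t ok Phase by auto
  show ?thesis
  proof (cases s)
    case Top
    thus ?thesis using c by (intro exI[of _ "l + (\<eta> - a + c)"]) (auto simp: Phase phase_run_sup intro!: tendsto_intros)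
  next
    case Bottom
    thus ?thesis by (intro exI[of _ l]) (auto simp: Phase phase_run_sup)
  qed
qed

lemma phase_R_left: 
  assumes t: "phase_start p < t"
  shows "\<exists>c. (phase_R a f p \<longlongrightarrow> c) (at_left t) & (\<forall>v. phase_start p <= v & v < t --> phase_R a f p v <= c)"
proof (cases p)
  case (Phase s T \<eta> l r)
  obtain c where c: "(run_sup (%t. - f t) T \<longlongrightarrow> c) (at_left t)" "\<And>v. T <= v ==> v < t ==> run_sup (%t. - f t) T v <= c"
    using run_sup_left_limit[OF nf, of T t] t ok Phase by auto
  show ?thesis
  proof (cases s)
    case Bottom
    thus ?thesis using c by (intro exI[of _ "r + (- \<eta> + c)"]) (auto simp: Phase phase_run_sup intro!: tendsto_intros)
  next
    case Top
    thus ?thesis by (intro exI[of _ r]) (auto simp: Phase phase_run_sup)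
  qed
qed

lemma phase_U_right:
  assumes t: "phase_start p <= t" shows "(phase_U a f p \<longlongrightarrow> phase_U a f p t) (at_right t)" unfolding phase_balance
  using t phase_start_nonneg by (intro tendsto_intros cadlag_right[OF f] phase_L_right phase_R_right) auto

lemma phase_flat_L:
  assumes t: "phase_start p <= t" and U: "phase_U a f p t < a"
  shows "\<exists>r>t. phase_L a f p r = phase_L a f p t"
    and "phase_start p < t ==> (phase_L a f p \<longlongrightarrow> phase_L a f p t) (at_left t)"
    and "t = phase_start p ==> phase_L a f p t = phase_l p"
proof -
  obtain s T \<eta> l r where p: "p = Phase s T \<eta> l r" by (cases p)
  have T: "0 <= T" "T <= t" using ok t p by auto
  show "\<exists>r>t. phase_L a f p r = phase_L a f p t"
    using U run_sup_flat_right[OF f T] by (cases s) (auto simp: p phase_run_sup intro: exI[of _ "t + 1"])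
  show "(phase_L a f p \<longlongrightarrow> phase_L a f p t) (at_left t)" if "phase_start p < t"
    using U run_sup_flat_left[OF f T(1), of t] that by (cases s) (auto simp: p phase_run_sup intro!: tendsto_intros)
  show "phase_L a f p t = phase_l p" if "t = phase_start p" using U that T by (cases s) (auto simp: p phase_run_sup run_sup_start[OF f])
qed

lemma phase_flat_R:
  assumes t: "phase_start p <= t" and U: "0 < phase_U a f p t"
  shows "\<exists>r>t. phase_R a f p r = phase_R a f p t"
    and "phase_start p < t ==> (phase_R a f p \<longlongrightarrow> phase_R a f p t) (at_left t)"
    and "t = phase_start p ==> phase_R a f p t = phase_r p"
proof -
  obtain s T \<eta> l r where p: "p = Phase s T \<eta> l r" by (cases p)
  have T: "0 <= T" "T <= t" using ok t p by auto
  show "\<exists>r>t. phase_R a f p r = phase_R a f p t"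
    using U run_sup_flat_right[OF nf T] by (cases s) (auto simp: p phase_run_sup intro: exI[of _ "t + 1"])
  show "(phase_R a f p \<longlongrightarrow> phase_R a f p t) (at_left t)" if "phase_start p < t"
    using U run_sup_flat_left[OF nf T(1), of t] that by (cases s) (auto simp: p phase_run_sup intro!: tendsto_intros)
  show "phase_R a f p t = phase_r p" if "t = phase_start p" using U that T by (cases s) (auto simp: p phase_run_sup run_sup_start[OF nf])
qed

text \<open>A phase has positive length: it starts on one barrier, and right continuity delays the
  crossing of the other.\<close>

lemma phase_end_cases:
  obtains "phase_end a f p = \<infinity>" | T' where "phase_end a f p = ereal T'" "phase_start p < T'"
proof (cases p)
  case (Phase s T \<eta> l r)
  have T: "0 <= T" using ok Phase by simp
  define Q where "Q t \<longleftrightarrow> (case s of Top => phase_U a f p t < 0 | Bottom => phase_U a f p t > a)" for t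
  have pe: "phase_end a f p = first_time T Q" by (cases s) (auto simp: Phase Q_def[abs_def])
  have "\<forall>\<^sub>F t in at_right T. ~ Q t"
  proof -
    have "(phase_U a f p \<longlongrightarrow> phase_U a f p T) (at_right T)" by (rule phase_U_right) (simp add: Phase)
    thus ?thesis
    proof (cases s)
      case Top
      have "\<forall>\<^sub>F t in at_right T. 0 < phase_U a f p t"
        by (rule order_tendstoD(1)[OF phase_U_right]) (use a T in \<open>auto simp: Phase Top phase_run_sup run_sup_start[OF f]\<close>)
      thus ?thesis by eventually_elim (simp add: Q_def Top)
    next
      case Bottom
      have "\<forall>\<^sub>F t in at_right T. phase_U a f p t < a"
        by (rule order_tendstoD(2)[OF phase_U_right]) (use a T in \<open>auto simp: Phase Bottom phase_run_sup run_sup_start[OF nf]\<close>)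
      thus ?thesis by eventually_elim (simp add: Q_def Bottom)
    qed
  qed
  then obtain b where b: "b > T" "\<And>t. T < t ==> t < b ==> ~ Q t"
    by (auto simp: eventually_at_right[OF less_add_one])
  show thesis
  proof (rule first_time_cases[OF T, of Q])
    fix T' assume T': "first_time T Q = ereal T'" "T <= T'"
    have "T' ~= T"
    proof
      assume "T' = T"
      then obtain t where "T < t" "t < b" "Q t" using first_time_finite(3)[OF T'(1) T, of b] b(1) by auto
      with b(2) show False by blast
    qed
    thus thesis using that(2)[of T'] T' pe by (simp add: Phase)
  qed (use that(1) pe in simp)
qed

lemma phase_U_bounds:
  assumes t: "phase_start p <= t" "ereal t < phase_end a f p"
  shows "0 <= phase_U a f p t" "phase_U a f p t <= a"
proof -
  obtain s T \<eta> l r where p: "p = Phase s T \<eta> l r" by (cases p)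
  have T: "0 <= T" "T <= t" using ok t p by auto
  have "0 <= phase_U a f p t & phase_U a f p t <= a"
  proof (cases s)
    case Top
    have "0 <= phase_U a f p t"
    proof (cases "t = T")
      case True thus ?thesis using a T by (simp add: p Top phase_run_sup run_sup_start[OF f])
    next
      case False
      thus ?thesis using first_time_before[of t T] t(2) T by (fastforce simp: p Top)
    qed
    thus ?thesis using run_sup_upper[OF f T(1), of t t] T by (simp add: p Top phase_run_sup)
  next
    case Bottom
    have "phase_U a f p t <= a"
    proof (cases "t = T")
      case True thus ?thesis using a T by (simp add: p Bottom phase_run_sup run_sup_start[OF nf])
    next
      case False
      thus ?thesis using first_time_before[of t T] t(2) T by (fastforce simp: p Bottom)
    qed
    thus ?thesis using run_sup_upper[OF nf T(1), of t t] T by (simp add: p Bottom phase_run_sup)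
  qed
  thus "0 <= phase_U a f p t" "phase_U a f p t <= a" by auto
qed

text \<open>At the end of a phase the surplus is away from the active barrier, so the active control
  does not jump there and its left limit is its value; this passes the balance equation to the next
  phase. The last conjunct, an oscillation of more than \<open>a / 2\<close> in every phase, is what
  later prevents accumulation.\<close>

lemma phase_next:
  assumes pe: "phase_end a f p = ereal T'" and TT': "phase_start p < T'"
  shows "\<exists>p'. next_phase a f p = Some p' & phase_ok a f p' & phase_start p' = T' &
     (phase_L a f p \<longlongrightarrow> phase_l p') (at_left T') & (phase_R a f p \<longlongrightarrow> phase_r p') (at_left T') &
     (\<forall>v. phase_start p <= v & v < T' --> phase_L a f p v <= phase_l p' & phase_R a f p v <= phase_r p') &
     (\<exists>x. phase_start p <= x & x < T' & a / 2 < \<bar>f x - f T'\<bar>)"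
proof -
  obtain s T \<eta> l r where p: "p = Phase s T \<eta> l r" by (cases p)
  have T: "0 <= T" "T < T'" using ok TT' p by auto
  obtain l' where l': "(phase_L a f p \<longlongrightarrow> l') (at_left T')" "\<And>v. T <= v ==> v < T' ==> phase_L a f p v <= l'"
    using phase_L_left[OF TT'] p by auto
  obtain r' where r': "(phase_R a f p \<longlongrightarrow> r') (at_left T')" "\<And>v. T <= v ==> v < T' ==> phase_R a f p v <= r'"
    using phase_R_left[OF TT'] p by auto
  have Lim: "Lim (at_left T') (phase_L a f p) = l'" "Lim (at_left T') (phase_R a f p) = r'" using l' r' by (auto intro!: tendsto_Lim)
  have nonneg: "0 <= l'" "0 <= r'" using l'(2)[of T] r'(2)[of T] phase_L_start phase_R_start ok T by (auto simp: p)
  let ?U = "phase_U a f p"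
  have UT: "(?U \<longlongrightarrow> ?U T') (at_right T')" by (rule phase_U_right) (use TT' in simp)
  have np: "next_phase a f p = Some (Phase (opposite_side p) T' (?U T') l' r')" by (simp add: next_phase_def pe Lim)
  show ?thesis
  proof (cases s)
    case Top
    have ft: "first_time T (%t. ?U t < 0) = ereal T'" using pe by (simp add: p Top)
    have neg: "?U T' <= 0"
    proof (rule ccontr)
      assume n: "~ ?thesis"
      hence "\<forall>\<^sub>F t in at_right T'. 0 < ?U t" by (intro order_tendstoD(1)[OF UT]) simp
      then obtain b where b: "b > T'" "\<And>t. T' < t ==> t < b ==> 0 < ?U t"
        by (auto simp: eventually_at_right[OF less_add_one])
      obtain t where "T' <= t" "t < b" "?U t < 0" using first_time_finite(3)[OF ft T(1) b(1)] by auto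
      thus False using b(2)[of t] n by (cases "t = T'") auto
    qed
    hence "(phase_L a f p \<longlongrightarrow> phase_L a f p T') (at_left T')" using a TT' by (intro phase_flat_L(2)) auto
    hence l'_eq: "l' = phase_L a f p T'" using l'(1) tendsto_unique[OF trivial_limit_at_left_real] by blast
    have r'_eq: "r' = phase_R a f p T'" using tendsto_unique[OF trivial_limit_at_left_real r'(1)[unfolded p Top phase_run_sup] tendsto_const]
      by (simp add: p Top phase_run_sup)
    \<comment> \<open>The path has fallen by at least \<open>a\<close> from its supremum, which need
      not be attained; half of \<open>a\<close> leaves room to choose a point
      \<open>x\<close>.\<close>
    have "a - a / 2 < run_sup f T T' - (f T' - f T)" using neg a by (simp add: p Top phase_run_sup)
    hence "f T' - f T + a / 2 < run_sup f T T'" by simp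
    then obtain x where x: "T <= x" "x <= T'" "f T' - f T + a / 2 < f x - f T"
      using less_cSUP_iff[OF _ run_sup_bdd[OF f T(1), of T'], of "f T' - f T + a / 2"] T unfolding run_sup_def by auto
    have "x < T'" using x a by (cases "x = T'") auto
    show ?thesis
    proof (intro exI conjI)
      show "next_phase a f p = Some (Phase Bottom T' (?U T') l' r')" using np by (simp add: p Top)
      show "phase_ok a f (Phase Bottom T' (?U T') l' r')" using neg nonneg T phase_balance[of T'] by (simp add: l'_eq r'_eq)
      show "a / 2 < \<bar>f x - f T'\<bar>" using x(3) abs_ge_self[of "f x - f T'"] by linarith
    qed (use l' r' x \<open>x < T'\<close> in \<open>auto simp: p\<close>)
  next
    case Bottom
    have ft: "first_time T (%t. a < ?U t) = ereal T'" using pe by (simp add: p Bottom)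
    have pos: "a <= ?U T'"
    proof (rule ccontr)
      assume n: "~ ?thesis"
      hence "\<forall>\<^sub>F t in at_right T'. ?U t < a" by (intro order_tendstoD(2)[OF UT]) simp
      then obtain b where b: "b > T'" "\<And>t. T' < t ==> t < b ==> ?U t < a"
        by (auto simp: eventually_at_right[OF less_add_one])
      obtain t where "T' <= t" "t < b" "a < ?U t" using first_time_finite(3)[OF ft T(1) b(1)] by auto
      thus False using b(2)[of t] n by (cases "t = T'") auto
    qed
    hence "(phase_R a f p \<longlongrightarrow> phase_R a f p T') (at_left T')" using a TT' by (intro phase_flat_R(2)) auto
    hence r'_eq: "r' = phase_R a f p T'" using r'(1) tendsto_unique[OF trivial_limit_at_left_real] by blast
    have l'_eq: "l' = phase_L a f p T'" using tendsto_unique[OF trivial_limit_at_left_real l'(1)[unfolded p Bottom phase_run_sup] tendsto_const]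
      by (simp add: p Bottom phase_run_sup)
    have "a - a / 2 < run_sup (%t. - f t) T T' + (f T' - f T)" using pos a by (simp add: p Bottom phase_run_sup)
    hence "f T - f T' + a / 2 < run_sup (%t. - f t) T T'" by simp
    then obtain x where x: "T <= x" "x <= T'" "f T - f T' + a / 2 < f T - f x"
      using less_cSUP_iff[OF _ run_sup_bdd[OF nf T(1), of T'], of "f T - f T' + a / 2"] T unfolding run_sup_def by auto
    have "x < T'" using x a by (cases "x = T'") auto
    show ?thesis
    proof (intro exI conjI)
      show "next_phase a f p = Some (Phase Top T' (?U T') l' r')" using np by (simp add: p Bottom)
      show "phase_ok a f (Phase Top T' (?U T') l' r')" using pos nonneg T phase_balance[of T'] by (simp add: l'_eq r'_eq)
      show "a / 2 < \<bar>f x - f T'\<bar>" using x(3) abs_ge_minus_self[of "f x - f T'"] by linarith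
    qed (use l' r' x \<open>x < T'\<close> in \<open>auto simp: p\<close>)
  qed
qed

end

section \<open>The succession of phases\<close>

lemma first_phase_cases:
  obtains (None) "first_phase a f = None" "\<And>t. 0 <= t ==> 0 <= f t & f t <= a"
  | (Some) p where "first_phase a f = Some p" "phase_ok a f p" "phase_l p = 0" "phase_r p = 0"
      "\<And>t. 0 <= t ==> t < phase_start p ==> 0 <= f t & f t <= a"
proof -
  define T0 where "T0 = first_time 0 (%t. f t < 0)"
  define Ta where "Ta = first_time 0 (%t. f t > a)"
  have right: "f T <= 0" if T: "first_time 0 (%t. f t < 0) = ereal T" for T
  proof (rule ccontr)
    assume n: "~ ?thesis"
    have T0: "0 <= T" by (rule first_time_finite(1)[OF T]) simp
    have "\<forall>\<^sub>F t in at_right T. 0 < f t" by (rule order_tendstoD(1)[OF cadlag_right[OF f T0]]) (use n in simp)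
    then obtain b where b: "b > T" "\<And>t. T < t ==> t < b ==> 0 < f t"
      by (auto simp: eventually_at_right[OF less_add_one])
    obtain t where "T <= t" "t < b" "f t < 0" using first_time_finite(3)[OF T _ b(1)] by auto
    thus False using b(2)[of t] n by (cases "t = T") auto
  qed
  have right': "a <= f T" if T: "first_time 0 (%t. f t > a) = ereal T" for T
  proof (rule ccontr)
    assume n: "~ ?thesis"
    have T0: "0 <= T" by (rule first_time_finite(1)[OF T]) simp
    have "\<forall>\<^sub>F t in at_right T. f t < a" by (rule order_tendstoD(2)[OF cadlag_right[OF f T0]]) (use n in simp)
    then obtain b where b: "b > T" "\<And>t. T < t ==> t < b ==> f t < a"
      by (auto simp: eventually_at_right[OF less_add_one])
    obtain t where "T <= t" "t < b" "f t > a" using first_time_finite(3)[OF T _ b(1)] by auto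
    thus False using b(2)[of t] n by (cases "t = T") auto
  qed
  have inside: "0 <= f t & f t <= a" if t: "0 <= t" "ereal t < T0" "ereal t < Ta" for t
  proof -
    have pos: "0 <= f v & f v <= a" if "0 < v" "ereal v < T0" "ereal v < Ta" for v
      using first_time_before[of v 0 "%t. f t < 0"] first_time_before[of v 0 "%t. f t > a"] that by (simp add: T0_def Ta_def not_less)
    show ?thesis
    proof (cases "t = 0")
      \<comment> \<open>First passage times ignore time 0, so the bounds at 0 are obtained from
        those just after it by right continuity.\<close>
      case True
      obtain b where b: "0 < b" "ereal b < T0" "ereal b < Ta"
      proof -
        have "0 < min T0 Ta" using t True by (auto simp: zero_ereal_def)
        then obtain b where "0 < ereal b" "ereal b < min T0 Ta" using ereal_dense2 by blast
        thus ?thesis using that[of b] by auto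
      qed
      have ev: "\<forall>\<^sub>F v in at_right 0. 0 <= f v & f v <= a"
      proof (rule eventually_at_rightI[OF _ b(1)])
        fix v assume "v \<in> {0<..<b}"
        hence "ereal v < ereal b" "0 < v" by auto
        thus "0 <= f v & f v <= a" using less_trans[OF _ b(2), of "ereal v"] less_trans[OF _ b(3), of "ereal v"] by (intro pos) auto
      qed
      have "(f \<longlongrightarrow> f 0) (at_right 0)" by (rule cadlag_right[OF f]) simp
      hence "0 <= f 0" "f 0 <= a" by (rule tendsto_lowerbound, use ev in eventually_elim, simp, simp)
           (rule tendsto_upperbound[OF \<open>(f \<longlongrightarrow> f 0) (at_right 0)\<close>], use ev in eventually_elim, simp, simp)
      thus ?thesis using True by simp
    qed (use pos t in auto)
  qed
  show thesis
  proof (rule first_time_cases[of 0 "%t. f t < 0"])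
    assume inf: "first_time 0 (%t. f t < 0) = \<infinity>"
    show thesis
    proof (rule first_time_cases[of 0 "%t. f t > a"])
      assume "first_time 0 (%t. f t > a) = \<infinity>"
      thus thesis using inf inside by (intro None) (auto simp: first_phase_def T0_def Ta_def)
    next
      fix T assume T: "first_time 0 (%t. f t > a) = ereal T" "0 <= T"
      show thesis by (rule Some[of "Phase Top T (f T) 0 0"])
           (use T inf right'[OF T(1)] inside in \<open>auto simp: first_phase_def T0_def Ta_def\<close>)
    qed simp
  next
    fix S assume S: "first_time 0 (%t. f t < 0) = ereal S" "0 <= S"
    show thesis
    proof (rule first_time_cases[of 0 "%t. f t > a"])
      assume "first_time 0 (%t. f t > a) = \<infinity>"
      thus thesis by (intro Some[of "Phase Bottom S (f S) 0 0"])
           (use S right[OF S(1)] inside in \<open>auto simp: first_phase_def T0_def Ta_def\<close>)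
    next
      fix T assume T: "first_time 0 (%t. f t > a) = ereal T" "0 <= T"
      \<comment> \<open>A common first passage time would give both \<open>f S <= 0\<close> and
        \<open>f S >= a\<close>.\<close>
      have "S ~= T" using right[OF S(1)] right'[OF T(1)] a by auto
      then consider "S < T" | "T < S" by linarith
      thus thesis
      proof cases
        case 1
        thus thesis by (intro Some[of "Phase Bottom S (f S) 0 0"])
             (use S T right[OF S(1)] inside in \<open>auto simp: first_phase_def T0_def Ta_def\<close>)
      next
        case 2
        thus thesis by (intro Some[of "Phase Top T (f T) 0 0"])
             (use S T right'[OF T(1)] inside in \<open>auto simp: first_phase_def T0_def Ta_def\<close>)
      qed
    qed simp
  qed simp
qed

lemma nth_phase_ok: "nth_phase a f n = Some p ==> phase_ok a f p"
proof (induction n arbitrary: p)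
  case 0
  thus ?case by (cases rule: first_phase_cases) auto
next
  case (Suc n)
  then obtain p0 where p0: "nth_phase a f n = Some p0" "next_phase a f p0 = Some p" by (cases "nth_phase a f n") auto
  note ok = Suc.IH[OF p0(1)]
  show ?case
  proof (rule phase_end_cases[OF ok])
    assume "phase_end a f p0 = \<infinity>"
    thus ?thesis using p0(2) by (simp add: next_phase_def)
  next
    fix T' assume "phase_end a f p0 = ereal T'" "phase_start p0 < T'"
    from phase_next[OF ok this] p0(2) show ?thesis by auto
  qed
qed

lemma nth_phase_Suc:
  assumes n: "nth_phase a f n = Some p" and Suc: "nth_phase a f (Suc n) = Some p'"
  shows "phase_end a f p = ereal (phase_start p')" "phase_start p < phase_start p'"
    "(phase_L a f p \<longlongrightarrow> phase_l p') (at_left (phase_start p'))"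
    "(phase_R a f p \<longlongrightarrow> phase_r p') (at_left (phase_start p'))"
    "\<forall>v. phase_start p <= v & v < phase_start p' --> phase_L a f p v <= phase_l p' & phase_R a f p v <= phase_r p'"
    "\<exists>x. phase_start p <= x & x < phase_start p' & a / 2 < \<bar>f x - f (phase_start p')\<bar>"
proof -
  note ok = nth_phase_ok[OF n]
  have np: "next_phase a f p = Some p'" using n Suc by simp
  have "phase_end a f p = ereal (phase_start p') & phase_start p < phase_start p' &
    (phase_L a f p \<longlongrightarrow> phase_l p') (at_left (phase_start p')) &
    (phase_R a f p \<longlongrightarrow> phase_r p') (at_left (phase_start p')) &
    (\<forall>v. phase_start p <= v & v < phase_start p' --> phase_L a f p v <= phase_l p' & phase_R a f p v <= phase_r p') &
    (\<exists>x. phase_start p <= x & x < phase_start p' & a / 2 < \<bar>f x - f (phase_start p')\<bar>)"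
  proof (rule phase_end_cases[OF ok])
    assume "phase_end a f p = \<infinity>"
    thus ?thesis using np by (simp add: next_phase_def)
  next
    fix T' assume T': "phase_end a f p = ereal T'" "phase_start p < T'"
    from phase_next[OF ok T'] np obtain p2 where "p2 = p'" "phase_start p2 = T'"
      "(phase_L a f p \<longlongrightarrow> phase_l p2) (at_left T')" "(phase_R a f p \<longlongrightarrow> phase_r p2) (at_left T')"
      "\<forall>v. phase_start p <= v & v < T' --> phase_L a f p v <= phase_l p2 & phase_R a f p v <= phase_r p2"
      "\<exists>x. phase_start p <= x & x < T' & a / 2 < \<bar>f x - f T'\<bar>" by auto
    thus ?thesis using T' by blast
  qed
  thus "phase_end a f p = ereal (phase_start p')" "phase_start p < phase_start p'"
    "(phase_L a f p \<longlongrightarrow> phase_l p') (at_left (phase_start p'))"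
    "(phase_R a f p \<longlongrightarrow> phase_r p') (at_left (phase_start p'))"
    "\<forall>v. phase_start p <= v & v < phase_start p' --> phase_L a f p v <= phase_l p' & phase_R a f p v <= phase_r p'"
    "\<exists>x. phase_start p <= x & x < phase_start p' & a / 2 < \<bar>f x - f (phase_start p')\<bar>" by blast+
qed

lemma nth_phase_less:
  assumes n: "nth_phase a f n = Some p" and m: "nth_phase a f m = Some p'" and nm: "n < m"
  shows "phase_end a f p <= ereal (phase_start p')" using nm m
proof (induction m arbitrary: p')
  case (Suc m)
  then obtain p1 where p1: "nth_phase a f m = Some p1" by (cases "nth_phase a f m") auto
  show ?case
  proof (cases "n = m")
    case True
    thus ?thesis using nth_phase_Suc(1)[OF p1 Suc.prems(2)] p1 n by simp
  next
    case False
    hence "phase_end a f p <= ereal (phase_start p1)" using Suc.IH[OF _ p1] Suc.prems by simp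
    also have "... <= ereal (phase_start p')" using nth_phase_Suc(2)[OF p1 Suc.prems(2)] by simp
    finally show ?thesis .
  qed
qed simp

lemma current_phase_unique:
  assumes "current_phase a f t p" "current_phase a f t p'"
  shows "p = p'"
proof -
  obtain n m where nm: "nth_phase a f n = Some p" "nth_phase a f m = Some p'" using assms by (auto simp: current_phase_def)
  have 1: "ereal (phase_start p) <= ereal t" "ereal t < phase_end a f p"
    "ereal (phase_start p') <= ereal t" "ereal t < phase_end a f p'" using assms by (auto simp: current_phase_def)
  show ?thesis
  proof (cases n m rule: linorder_cases)
    case less
    thus ?thesis using nth_phase_less[OF nm less] 1 by (meson leD le_less_trans less_le_trans order_trans)
  next
    case greater
    thus ?thesis using nth_phase_less[OF nm(2,1) greater] 1 by (meson leD le_less_trans less_le_trans order_trans)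
  qed (use nm in auto)
qed

lemma barrier_current:
  assumes "current_phase a f t p"
  shows "barrier_L a f t = phase_L a f p t" "barrier_R a f t = phase_R a f p t"
proof -
  have "(THE p. current_phase a f t p) = p" using assms current_phase_unique by (intro the_equality) auto
  thus "barrier_L a f t = phase_L a f p t" "barrier_R a f t = phase_R a f p t" using assms by (auto simp: barrier_L_def barrier_R_def)
qed

lemma first_phase_least:
  assumes "nth_phase a f n = Some p" "first_phase a f = Some p0"
  shows "phase_start p0 <= phase_start p"
proof (cases n)
  case (Suc m)
  have p0: "nth_phase a f 0 = Some p0" using assms by simp
  have le: "phase_end a f p0 <= ereal (phase_start p)" by (rule nth_phase_less[OF p0 assms(1)]) (use Suc in simp)
  show ?thesis by (rule phase_end_cases[OF nth_phase_ok[OF p0]]) (use le in auto)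
qed (use assms in auto)

lemma first_phase_None: "first_phase a f = None ==> nth_phase a f n = None" by (induction n) auto

lemma barrier_before:
  assumes "first_phase a f = None \<or> (\<exists>p0. first_phase a f = Some p0 & t < phase_start p0)"
  shows "barrier_L a f t = 0" "barrier_R a f t = 0"
proof -
  have "~ current_phase a f t p" for p using assms first_phase_None first_phase_least by (fastforce simp: current_phase_def)
  thus "barrier_L a f t = 0" "barrier_R a f t = 0" by (auto simp: barrier_L_def barrier_R_def)
qed

text \<open>If no phase were current at \<open>t\<close>, infinitely many phases would start before
  \<open>t\<close>. Each moves the path by more than \<open>a / 2\<close> and so uses up its own
  point of a finite set of exceptional times.\<close>

lemma phases_cover:
  assumes p0: "first_phase a f = Some p0" "phase_start p0 <= t"
  shows "\<exists>p. current_phase a f t p"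
proof (rule ccontr)
  assume no: "~ ?thesis"
  have ex: "\<exists>p. nth_phase a f n = Some p & phase_start p <= t" for n
  proof (induction n)
    case (Suc n)
    then obtain p where p: "nth_phase a f n = Some p" "phase_start p <= t" by auto
    hence e: "phase_end a f p <= ereal t" using no by (auto simp: current_phase_def not_less)
    note ok = nth_phase_ok[OF p(1)]
    show ?case
    proof (rule phase_end_cases[OF ok])
      fix T' assume T': "phase_end a f p = ereal T'" "phase_start p < T'"
      from phase_next[OF ok T'] obtain p' where "next_phase a f p = Some p'" "phase_start p' = T'" by auto
      thus ?thesis using p e T' by auto
    qed (use e in auto)
  qed (use p0 in auto)
  define ph where "ph n = the (nth_phase a f n)" for n
  have ph: "nth_phase a f n = Some (ph n)" "phase_start (ph n) <= t" for n using ex[of n] by (auto simp: ph_def)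
  define T where "T n = phase_start (ph n)" for n
  have T: "0 <= T n" "T n < T (Suc n)" "T n <= t" for n
    using phase_start_nonneg[OF nth_phase_ok[OF ph(1)]] nth_phase_Suc(2)[OF ph(1) ph(1)] ph(2)[of n] by (auto simp: T_def)
  have mono: "strict_mono T" by (rule strict_monoI_Suc) (rule T)
  obtain D where D: "finite D" "\<And>x y. 0 <= x ==> x <= y ==> y <= t ==> {x<..y} \<inter> D = {} ==> \<bar>f x - f y\<bar> < a / 2"
    using cadlag_partition[OF f, of 0 t "a / 2"] a T(1,3)[of 0] by auto
  have "\<exists>d. d \<in> D & T n < d & d <= T (Suc n)" for n
  proof -
    obtain x where x: "T n <= x" "x < T (Suc n)" "a / 2 < \<bar>f x - f (T (Suc n))\<bar>"
      using nth_phase_Suc(6)[OF ph(1) ph(1), of n] by (auto simp: T_def)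
    have "{x<..T (Suc n)} \<inter> D ~= {}"
    proof
      assume "{x<..T (Suc n)} \<inter> D = {}"
      hence "\<bar>f x - f (T (Suc n))\<bar> < a / 2" using D(2)[of x "T (Suc n)"] x T(1)[of n] T(3)[of "Suc n"] by auto
      with x show False by simp
    qed
    thus ?thesis using x by force
  qed
  then obtain d where d: "\<And>n. d n \<in> D" "\<And>n. T n < d n" "\<And>n. d n <= T (Suc n)" by metis
  have "inj d"
  proof (rule linorder_injI)
    fix m n :: nat assume "m < n"
    hence "T (Suc m) <= T n" using mono by (simp add: strict_mono_less_eq Suc_leI)
    thus "d m ~= d n" using d(3)[of m] d(2)[of n] by simp
  qed
  hence "infinite (range d)" by (rule range_inj_infinite)
  moreover have "range d \<subseteq> D" using d(1) by auto
  ultimately show False using D(1) finite_subset by blast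
qed

lemma current_phase_right:
  assumes "current_phase a f t p"
  shows "\<exists>r>t. \<forall>v. t <= v & v < r --> current_phase a f v p"
proof -
  obtain n where n: "nth_phase a f n = Some p" "phase_start p <= t" "ereal t < phase_end a f p" using assms by (auto simp: current_phase_def)
  obtain r where "ereal t < ereal r" "ereal r < phase_end a f p" using ereal_dense2[OF n(3)] by auto
  thus ?thesis using n by (intro exI[of _ r]) (auto simp: current_phase_def, metis ereal_less_eq(3) le_less_trans less_imp_le)
qed

lemma phase_start_left:
  assumes n: "nth_phase a f n = Some p"
  defines "T \<equiv> phase_start p"
  shows "T = 0 ==> phase_l p = 0 & phase_r p = 0"
    "0 < T ==> (barrier_L a f \<longlongrightarrow> phase_l p) (at_left T)"
    "0 < T ==> (barrier_R a f \<longlongrightarrow> phase_r p) (at_left T)"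
    "0 < T ==> \<exists>w<T. \<forall>v. w < v & v < T --> barrier_L a f v <= phase_l p & barrier_R a f v <= phase_r p"
proof -
  have "(T = 0 --> phase_l p = 0 & phase_r p = 0) & (0 < T --> (barrier_L a f \<longlongrightarrow> phase_l p) (at_left T) &
    (barrier_R a f \<longlongrightarrow> phase_r p) (at_left T) &
    (\<exists>w<T. \<forall>v. w < v & v < T --> barrier_L a f v <= phase_l p & barrier_R a f v <= phase_r p))"
  proof (cases n)
    case 0
    hence p: "first_phase a f = Some p" using n by simp
    have "phase_l p = 0 & phase_r p = 0" by (rule first_phase_cases) (use p in auto)
    hence lr: "phase_l p = 0" "phase_r p = 0" by auto
    have zero: "barrier_L a f v = 0" "barrier_R a f v = 0" if "v < T" for v using barrier_before[of v] p that by (auto simp: T_def)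
    have "\<forall>\<^sub>F v in at_left T. barrier_L a f v = 0" "\<forall>\<^sub>F v in at_left T. barrier_R a f v = 0"
      by (auto intro!: eventually_at_leftI[of "T - 1"] zero)
    thus ?thesis using zero unfolding lr by (auto intro!: tendsto_eventually exI[of _ "T - 1"])
  next
    case (Suc m)
    then obtain p0 where p0: "nth_phase a f m = Some p0" using n by (cases "nth_phase a f m") auto
    have Sm: "nth_phase a f (Suc m) = Some p" using n Suc by simp
    note nx = nth_phase_Suc[OF p0 Sm, folded T_def]
    have cur: "current_phase a f v p0" if "phase_start p0 <= v" "v < T" for v using that p0 nx(1) by (auto simp: current_phase_def)
    have ev: "\<forall>\<^sub>F v in at_left T. phase_start p0 < v & v < T" using nx(2) by (intro eventually_at_leftI[of "phase_start p0"]) auto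
    have "(barrier_L a f \<longlongrightarrow> phase_l p) (at_left T)"
      by (rule Lim_transform_eventually[OF nx(3)], use ev in eventually_elim) (simp add: barrier_current(1)[OF cur])
    moreover have "(barrier_R a f \<longlongrightarrow> phase_r p) (at_left T)"
      by (rule Lim_transform_eventually[OF nx(4)], use ev in eventually_elim) (simp add: barrier_current(2)[OF cur])
    moreover have "barrier_L a f v <= phase_l p & barrier_R a f v <= phase_r p" if "phase_start p0 < v" "v < T" for v
      using nx(5) barrier_current[OF cur[of v]] that by auto
    ultimately show ?thesis using nx(2) phase_start_nonneg[OF nth_phase_ok[OF p0]] by auto
  qed
  thus "T = 0 ==> phase_l p = 0 & phase_r p = 0"
    "0 < T ==> (barrier_L a f \<longlongrightarrow> phase_l p) (at_left T)"
    "0 < T ==> (barrier_R a f \<longlongrightarrow> phase_r p) (at_left T)"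
    "0 < T ==> \<exists>w<T. \<forall>v. w < v & v < T --> barrier_L a f v <= phase_l p & barrier_R a f v <= phase_r p"
    by auto
qed

section \<open>Gluing the phases into one pair of controls\<close>

definition left_flat :: "(real => real) => real => bool" where
  "left_flat F t \<longleftrightarrow> (t = 0 --> F 0 = 0) & (0 < t --> (F \<longlongrightarrow> F t) (at_left t))"

text \<open>Monotonicity in a form that can be checked inside a phase and at its two ends; real
  induction makes it global.\<close>

definition locally_cumulative :: "(real => real) => real => bool" where
  "locally_cumulative F t \<longleftrightarrow> (F \<longlongrightarrow> F t) (at_right t) & (\<exists>r>t. \<forall>v. t < v & v < r --> F t <= F v) &
     (0 < t --> (\<exists>w<t. \<forall>v. w < v & v < t & 0 <= v --> F v <= F t)) & 0 <= F 0"

lemma cumulative_pathI: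
  assumes "\<And>t. 0 <= t ==> locally_cumulative F t"
  shows "cumulative_path F"
proof -
  have "F s <= F t" if st: "0 <= s" "s <= t" for s t using st(2)
  proof (rule real_interval_induct[where P = "%u. F s <= F u"])
    fix u assume u: "s <= u" "u < t" "F s <= F u"
    thus "\<exists>r>u. \<forall>v. u < v & v < r & v <= t --> F s <= F v"
      using assms[of u] st unfolding locally_cumulative_def by (meson order_trans)
  next
    fix u assume u: "s < u" "u <= t" and IH: "\<And>v. s <= v ==> v < u ==> F s <= F v"
    then obtain w where w: "w < u" "\<And>v. w < v ==> v < u ==> 0 <= v ==> F v <= F u"
      using assms[of u] st unfolding locally_cumulative_def by auto
    define v where "v = (max s w + u) / 2"
    have "s <= v" "w < v" "v < u" using w u by (auto simp: v_def max_def field_simps)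
    thus "F s <= F u" using w(2)[of v] IH[of v] st by auto
  qed simp
  moreover have "0 <= F 0" "0 <= t ==> continuous (at_right t) F" for t
    using assms[of 0] assms[of t] by (auto simp: locally_cumulative_def continuous_within)
  ultimately show ?thesis by (auto simp: cumulative_path_def monotone_on_def)
qed

text \<open>All parts of the reflection property are local at \<open>t\<close>, and near
  \<open>t\<close> at most two regimes matter: the one current at \<open>t\<close>, and the one
  before it if a phase starts exactly at \<open>t\<close>.\<close>

lemma barrier_local:
  assumes t: "0 <= t"
  defines "Lb \<equiv> barrier_L a f" and "Rb \<equiv> barrier_R a f"
  shows "locally_cumulative Lb t" "locally_cumulative Rb t"
    "0 <= f t - Lb t + Rb t" "f t - Lb t + Rb t <= a"
    "f t - Lb t + Rb t < a ==> left_flat Lb t & (\<exists>r>t. Lb r = Lb t)"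
    "0 < f t - Lb t + Rb t ==> left_flat Rb t & (\<exists>r>t. Rb r = Rb t)"
proof -
  have nonneg0: "0 <= Lb 0 & 0 <= Rb 0"
  proof (cases "\<exists>p. current_phase a f 0 p")
    case True
    then obtain p n where p: "current_phase a f 0 p" "nth_phase a f n = Some p" "phase_start p <= 0" by (auto simp: current_phase_def)
    note ok = nth_phase_ok[OF p(2)]
    have "phase_start p = 0" using phase_start_nonneg[OF ok] p(3) by simp
    moreover have "0 <= phase_l p" "0 <= phase_r p" using ok by (cases p; simp)+
    ultimately show ?thesis using phase_L_start[OF ok] phase_R_start[OF ok] by (simp add: Lb_def Rb_def barrier_current[OF p(1)])
  qed (auto simp: Lb_def Rb_def barrier_L_def barrier_R_def)
  have "locally_cumulative Lb t & locally_cumulative Rb t & 0 <= f t - Lb t + Rb t & f t - Lb t + Rb t <= a &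
    (f t - Lb t + Rb t < a --> left_flat Lb t & (\<exists>r>t. Lb r = Lb t)) &
    (0 < f t - Lb t + Rb t --> left_flat Rb t & (\<exists>r>t. Rb r = Rb t))"
  proof (cases "\<exists>p. current_phase a f t p")
    case False
    hence bef: "first_phase a f = None \<or> (\<exists>p0. first_phase a f = Some p0 & t < phase_start p0)"
      using phases_cover by (cases "first_phase a f") (auto simp: not_le[symmetric])
    have ft: "0 <= f t & f t <= a" by (cases rule: first_phase_cases) (use bef t in auto)
    have "\<exists>r>t. \<forall>v<r. Lb v = 0 & Rb v = 0" using bef
    proof
      assume "\<exists>p0. first_phase a f = Some p0 & t < phase_start p0"
      then obtain p0 where "first_phase a f = Some p0" "t < phase_start p0" by auto
      thus ?thesis using barrier_before unfolding Lb_def Rb_def by (intro exI[of _ "phase_start p0"]) auto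
    next
      assume "first_phase a f = None"
      thus ?thesis using barrier_before unfolding Lb_def Rb_def by (intro exI[of _ "t + 1"]) auto
    qed
    then obtain r where r: "r > t" "\<And>v. v < r ==> Lb v = 0 & Rb v = 0" by auto
    have z: "Lb t = 0" "Rb t = 0" using r by auto
    have "\<forall>\<^sub>F v in at_right t. Lb v = 0" "\<forall>\<^sub>F v in at_right t. Rb v = 0"
      using r by (auto intro!: eventually_at_rightI[OF _ r(1)])
    moreover have "\<forall>\<^sub>F v in at_left t. Lb v = 0" "\<forall>\<^sub>F v in at_left t. Rb v = 0"
      using r by (auto intro!: eventually_at_leftI[of "t - 1"])
    moreover have "\<exists>r>t. Lb r = 0" "\<exists>r>t. Rb r = 0" using r(1) r(2)[of "(t + r) / 2"] by (auto intro!: exI[of _ "(t + r) / 2"])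
    moreover have "\<exists>r>t. \<forall>v. t < v & v < r --> 0 <= Lb v" "\<exists>r>t. \<forall>v. t < v & v < r --> 0 <= Rb v"
      using r by (auto intro!: exI[of _ r])
    moreover have "\<exists>w<t. \<forall>v. w < v & v < t & 0 <= v --> Lb v <= 0" "\<exists>w<t. \<forall>v. w < v & v < t & 0 <= v --> Rb v <= 0"
      using r by (auto intro!: exI[of _ "t - 1"])
    ultimately show ?thesis using nonneg0 ft z by (auto simp: locally_cumulative_def left_flat_def intro: tendsto_eventually)
  next
    case True
    then obtain p n where p: "current_phase a f t p" "nth_phase a f n = Some p" "phase_start p <= t" "ereal t < phase_end a f p"
      by (auto simp: current_phase_def)
    note ok = nth_phase_ok[OF p(2)]
    note cur = barrier_current[OF p(1), folded Lb_def Rb_def]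
    obtain r where r: "r > t" "\<And>v. t <= v ==> v < r ==> current_phase a f v p"
      using current_phase_right[OF p(1)] by blast
    have LR: "Lb v = phase_L a f p v" "Rb v = phase_R a f p v" if "t <= v" "v < r" for v
      using barrier_current[OF r(2)[OF that]] by (auto simp: Lb_def Rb_def)
    have U: "f t - Lb t + Rb t = phase_U a f p t" using phase_balance[OF ok] cur by simp
    have ev: "\<forall>\<^sub>F v in at_right t. t <= v & v < r" using r(1) by (intro eventually_at_rightI[of t r]) auto
    have right: "(Lb \<longlongrightarrow> Lb t) (at_right t)" "(Rb \<longlongrightarrow> Rb t) (at_right t)" unfolding cur
      by (rule Lim_transform_eventually[OF phase_L_right[OF ok p(3)]], use ev in eventually_elim, simp add: LR,
          rule Lim_transform_eventually[OF phase_R_right[OF ok p(3)]], use ev in eventually_elim, simp add: LR)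
    have incr: "\<exists>r>t. \<forall>v. t < v & v < r --> Lb t <= Lb v" "\<exists>r>t. \<forall>v. t < v & v < r --> Rb t <= Rb v"
      using r(1) phase_L_mono[OF ok p(3)] phase_R_mono[OF ok p(3)] LR cur by (auto intro!: exI[of _ r])
    have left: "(0 < t --> (\<exists>w<t. \<forall>v. w < v & v < t & 0 <= v --> Lb v <= Lb t)) &
       (0 < t --> (\<exists>w<t. \<forall>v. w < v & v < t & 0 <= v --> Rb v <= Rb t)) &
       (phase_U a f p t < a --> left_flat Lb t) & (0 < phase_U a f p t --> left_flat Rb t)"
    proof (cases "phase_start p = t")
      \<comment> \<open>The values just before \<open>t\<close> belong to the previous phase, or to
        the initial stretch with zero controls. Their left limits are the starting values
        \<open>phase_l p\<close> and \<open>phase_r p\<close>.\<close>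
      case True
      note st = phase_start_left[OF p(2), folded Lb_def Rb_def, unfolded True]
      have ge: "phase_l p <= Lb t" "phase_r p <= Rb t" using phase_L_start[OF ok] phase_R_start[OF ok] cur True by auto
      have "\<exists>w<t. (\<forall>v. w < v & v < t & 0 <= v --> Lb v <= Lb t) & (\<forall>v. w < v & v < t & 0 <= v --> Rb v <= Rb t)" if "0 < t"
        using st(4)[OF that] ge by (meson order_trans)
      moreover have "Lb t = phase_l p" if "phase_U a f p t < a" using phase_flat_L(3)[OF ok p(3) that] True cur by simp
      moreover have "Rb t = phase_r p" if "0 < phase_U a f p t" using phase_flat_R(3)[OF ok p(3) that] True cur by simp
      ultimately show ?thesis using st(1-3) by (auto simp: left_flat_def)
    next
      case False
      hence less: "phase_start p < t" using p(3) by simp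
      have curv: "current_phase a f v p" if "phase_start p <= v" "v <= t" for v
        using that p(2,4) by (auto simp: current_phase_def) (metis ereal_less_eq(3) le_less_trans)
      have LR': "Lb v = phase_L a f p v" "Rb v = phase_R a f p v" if "phase_start p <= v" "v <= t" for v
        using barrier_current[OF curv[OF that]] by (auto simp: Lb_def Rb_def)
      have ev': "\<forall>\<^sub>F v in at_left t. phase_start p <= v & v <= t"
        using less by (intro eventually_at_leftI[of "phase_start p"]) auto
      have "left_flat Lb t" if "phase_U a f p t < a"
      proof -
        have "(Lb \<longlongrightarrow> Lb t) (at_left t)" unfolding cur
          by (rule Lim_transform_eventually[OF phase_flat_L(2)[OF ok p(3) that less]], use ev' in eventually_elim) (simp add: LR')
        thus ?thesis using less phase_start_nonneg[OF ok] by (auto simp: left_flat_def)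
      qed
      moreover have "left_flat Rb t" if "0 < phase_U a f p t"
      proof -
        have "(Rb \<longlongrightarrow> Rb t) (at_left t)" unfolding cur
          by (rule Lim_transform_eventually[OF phase_flat_R(2)[OF ok p(3) that less]], use ev' in eventually_elim) (simp add: LR')
        thus ?thesis using less phase_start_nonneg[OF ok] by (auto simp: left_flat_def)
      qed
      ultimately show ?thesis using less phase_L_mono[OF ok] phase_R_mono[OF ok] LR' by (auto intro!: exI[of _ "phase_start p"])
    qed
    have flat: "\<exists>r>t. Lb r = Lb t" if below: "phase_U a f p t < a"
    proof -
      obtain r' where r': "r' > t" "phase_L a f p r' = phase_L a f p t" using phase_flat_L(1)[OF ok p(3) below] by auto
      define v where "v = min r' ((t + r) / 2)"
      have v: "t < v" "v < r" "v <= r'" using r' r(1) by (auto simp: v_def min_def field_simps)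
      hence "Lb v = Lb t" using phase_L_mono[OF ok p(3), of v] phase_L_mono[OF ok, of v r'] r'(2) p(3) LR[of v] cur by auto
      thus ?thesis using v by auto
    qed
    have flat': "\<exists>r>t. Rb r = Rb t" if above: "0 < phase_U a f p t"
    proof -
      obtain r' where r': "r' > t" "phase_R a f p r' = phase_R a f p t" using phase_flat_R(1)[OF ok p(3) above] by auto
      define v where "v = min r' ((t + r) / 2)"
      have v: "t < v" "v < r" "v <= r'" using r' r(1) by (auto simp: v_def min_def field_simps)
      hence "Rb v = Rb t" using phase_R_mono[OF ok p(3), of v] phase_R_mono[OF ok, of v r'] r'(2) p(3) LR[of v] cur by auto
      thus ?thesis using v by auto
    qed
    show ?thesis unfolding U locally_cumulative_def using phase_U_bounds[OF ok p(3,4)] right incr left flat flat' nonneg0 by blast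
  qed
  thus "locally_cumulative Lb t" "locally_cumulative Rb t"
    "0 <= f t - Lb t + Rb t" "f t - Lb t + Rb t <= a"
    "f t - Lb t + Rb t < a ==> left_flat Lb t & (\<exists>r>t. Lb r = Lb t)"
    "0 < f t - Lb t + Rb t ==> left_flat Rb t & (\<exists>r>t. Rb r = Rb t)" by auto
qed

lemma barrier_skorokhod: "skorokhod a f (barrier_L a f) (barrier_R a f)"
proof -
  have cum: "cumulative_path (barrier_L a f)" "cumulative_path (barrier_R a f)" by (auto intro!: cumulative_pathI barrier_local)
  have flat: "\<exists>r>t. mass F {t..r} = 0"
    if F: "cumulative_path F" and t: "0 <= t" and fl: "left_flat F t & (\<exists>r>t. F r = F t)" for F t
  proof -
    obtain r where r: "r > t" "F r = F t" using fl by auto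
    have "mass F {t..r} = 0" by (rule emeasure_control_flatI[OF F t]) (use r fl in \<open>auto simp: left_flat_def\<close>)
    thus ?thesis using r by auto
  qed
  show ?thesis unfolding skorokhod_def
  proof (intro conjI allI impI cum)
    fix t :: real assume t: "0 <= t"
    note loc = barrier_local[OF t]
    show "0 <= f t - barrier_L a f t + barrier_R a f t" "f t - barrier_L a f t + barrier_R a f t <= a" by (rule loc)+
    show "\<exists>r>t. emeasure (control_measure (barrier_L a f)) {t..r} = 0" if "f t - barrier_L a f t + barrier_R a f t < a"
      by (rule flat[OF cum(1) t loc(5)[OF that]])
    show "\<exists>r>t. emeasure (control_measure (barrier_R a f)) {t..r} = 0" if "0 < f t - barrier_L a f t + barrier_R a f t"
      by (rule flat[OF cum(2) t loc(6)[OF that]])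
  qed
qed

end

section \<open>Adaptedness of the double barrier\<close>

lemma grid_integral:
  fixes g :: "real => ennreal"
  assumes F: "cumulative_path F" and h: "0 < h"
  shows "(\<integral>\<^sup>+ s\<in>{0<..}. g (h * of_int \<lceil>s / h\<rceil>) \<partial>control_measure F)
    = (\<Sum>j. g (h * real (Suc j)) * ennreal (F (h * real (Suc j)) - F (h * real j)))"
proof -
  let ?I = "%j. {h * real j<..h * real (Suc j)}"
  have disj: "disjoint_family ?I"
  proof (rule disjoint_family_on_bisimulation[where f = "%j. {real j<..real (Suc j)}"])
    show "disjoint_family (%j. {real j<..real (Suc j)})" unfolding disjoint_family_on_def
    proof (intro ballI impI)
      fix m n :: nat assume "m ~= n"
      then consider "Suc m <= n" | "Suc n <= m" by linarith
      thus "{real m<..real (Suc m)} \<inter> {real n<..real (Suc n)} = {}"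
      proof cases
        case 1 hence "real (Suc m) <= real n" by (simp only: of_nat_le_iff)
        thus ?thesis by auto
      next
        case 2 hence "real (Suc n) <= real m" by (simp only: of_nat_le_iff)
        thus ?thesis by auto
      qed
    qed
    fix m n assume e: "{real m<..real (Suc m)} \<inter> {real n<..real (Suc n)} = {}"
    show "?I m \<inter> ?I n = {}"
    proof (rule ccontr)
      assume "?I m \<inter> ?I n ~= {}"
      then obtain x where "x \<in> ?I m" "x \<in> ?I n" by blast
      hence "x / h \<in> {real m<..real (Suc m)} \<inter> {real n<..real (Suc n)}" using h by (simp add: field_simps)
      with e show False by blast
    qed
  qed
  have pt: "g (h * of_int \<lceil>s / h\<rceil>) * indicator {0<..} s = (\<Sum>j. g (h * real (Suc j)) * indicator (?I j) s)" for s
  proof (cases "0 < s")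
    case True
    define i where "i = nat (\<lceil>s / h\<rceil> - 1)"
    have c: "0 < \<lceil>s / h\<rceil>" using True h by simp
    hence i: "real (Suc i) = of_int \<lceil>s / h\<rceil>" "real i = of_int \<lceil>s / h\<rceil> - 1" by (auto simp: i_def)
    have "real i < s / h" "s / h <= real (Suc i)" unfolding i by linarith+
    hence "s \<in> ?I i" using h by (simp add: field_simps)
    hence "(\<Sum>j. g (h * real (Suc j)) * indicator (?I j) s) = g (h * real (Suc i))" using disj by (intro suminf_cmult_indicator) auto
    thus ?thesis using True unfolding i by simp
  next
    case False
    have "0 <= h * real j" for j using h by simp
    hence "s \<notin> ?I j" for j using False by (meson greaterThanAtMost_iff le_less_trans)
    thus ?thesis using False by simp
  qed
  have "(\<integral>\<^sup>+ s\<in>{0<..}. g (h * of_int \<lceil>s / h\<rceil>) \<partial>control_measure F)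
     = (\<Sum>j. \<integral>\<^sup>+ s. g (h * real (Suc j)) * indicator (?I j) s \<partial>control_measure F)"
    unfolding pt by (rule nn_integral_suminf) simp
  also have "... = (\<Sum>j. g (h * real (Suc j)) * ennreal (F (h * real (Suc j)) - F (h * real j)))"
    using h by (simp add: nn_integral_cmult_indicator emeasure_control_Ioc[OF F])
  finally show ?thesis .
qed

text \<open>Rounding is upwards throughout, because the integrands are only right
  continuous.\<close>

lemma grid_right:
  fixes h :: "nat => real"
  assumes h: "\<And>n. 0 < h n" "h \<longlonglongrightarrow> 0"
  shows "(%n. h n * of_int \<lceil>s / h n\<rceil>) \<longlonglongrightarrow> s" and "s <= h n * of_int \<lceil>s / h n\<rceil>"
proof -
  have b: "s <= h n * of_int \<lceil>s / h n\<rceil>" "h n * of_int \<lceil>s / h n\<rceil> <= s + h n" for n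
  proof -
    have "s / h n <= of_int \<lceil>s / h n\<rceil>" "of_int \<lceil>s / h n\<rceil> <= s / h n + 1" by linarith+
    from this[THEN mult_left_mono, of "h n"]
    show "s <= h n * of_int \<lceil>s / h n\<rceil>" "h n * of_int \<lceil>s / h n\<rceil> <= s + h n"
      using h(1)[of n] by (simp_all add: distrib_left)
  qed
  thus "s <= h n * of_int \<lceil>s / h n\<rceil>" by simp
  have lim: "(%n. s + h n) \<longlonglongrightarrow> s" using tendsto_add[OF tendsto_const[of s] h(2)] by simp
  show "(%n. h n * of_int \<lceil>s / h n\<rceil>) \<longlonglongrightarrow> s"
    by (rule tendsto_sandwich[OF _ _ tendsto_const lim]) (use b in auto)
qed

lemma right_continuous_seq:
  fixes G :: "real => real"
  assumes G: "(G \<longlongrightarrow> G s) (at_right s)" and x: "x \<longlonglongrightarrow> s" "\<And>n. s <= x n"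
  shows "(%n. G (x n)) \<longlonglongrightarrow> G s"
proof -
  have "continuous (at s within {s..}) G" using G by (simp add: continuous_within at_within_Ici_at_right)
  thus ?thesis by (rule continuous_within_tendsto_compose) (use x in auto)
qed

text \<open>If \<open>G\<close> vanishes where \<open>F\<close> grows, its sums taken at right end
  points tend to 0, by dominated convergence under the measure of \<open>F\<close>. This is what
  allows \<open>L\<close> to be recovered from the surplus and the net control along grids.\<close>

lemma null_grid_sums:
  assumes F: "cumulative_path F" and t: "0 < t"
    and G: "\<And>s. 0 <= s ==> (G \<longlongrightarrow> G s) (at_right s)" "\<And>s. 0 <= s ==> 0 <= G s" "\<And>s. 0 <= s ==> G s <= 1"
    and null: "AE s in control_measure F. 0 <= s --> G s = 0"
  shows "(%N. \<Sum>j<N. G (t / N * real (Suc j)) * (F (t / N * real (Suc j)) - F (t / N * real j))) \<longlonglongrightarrow> 0"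
proof -
  define S where "S N = (\<Sum>j<N. G (t / N * real (Suc j)) * (F (t / N * real (Suc j)) - F (t / N * real j)))" for N :: nat
  define k where "k N s = t / real (Suc N) * of_int \<lceil>s / (t / real (Suc N))\<rceil>" for N s
  have h: "0 < t / real (Suc N)" for N using t by simp
  have h0: "(%N. t / real (Suc N)) \<longlonglongrightarrow> 0"
    using tendsto_mult[OF tendsto_const[of t] lim_inverse_n'[THEN LIMSEQ_Suc]] by (simp add: field_simps)
  note kk = grid_right[OF h h0, folded k_def]
  \<comment> \<open>Cells beyond \<open>t\<close> are switched off, so the infinite grid sum reduces
    to the first \<open>Suc N\<close> cells.\<close>
  define g where "g x = (if x <= t then ennreal (G x) else 0)" for x
  have inc: "0 <= F (h * real (Suc j)) - F (h * real j)" if "0 < h" for h j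
    using cumulative_pathD(2)[OF F, of "h * real j" "h * real (Suc j)"] that by simp
  have eq: "ennreal (S (Suc N)) = (\<integral>\<^sup>+ s\<in>{0<..}. g (k N s) \<partial>control_measure F)" for N
  proof -
    let ?h = "t / real (Suc N)"
    have le: "?h * real (Suc j) <= t \<longleftrightarrow> j < Suc N" for j
    proof -
      have "?h * real (Suc j) <= t \<longleftrightarrow> real (Suc j) <= real (Suc N)" using t by (simp add: field_simps)
      thus ?thesis by (simp only: of_nat_le_iff) auto
    qed
    have "(\<integral>\<^sup>+ s\<in>{0<..}. g (k N s) \<partial>control_measure F)
       = (\<Sum>j. g (?h * real (Suc j)) * ennreal (F (?h * real (Suc j)) - F (?h * real j)))" unfolding k_def by (rule grid_integral[OF F h])
    also have "... = (\<Sum>j<Suc N. g (?h * real (Suc j)) * ennreal (F (?h * real (Suc j)) - F (?h * real j)))"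
    proof (rule suminf_finite)
      fix j assume "j \<notin> {..<Suc N}"
      hence z: "~ ?h * real (Suc j) <= t" using le[of j] by simp
      show "g (?h * real (Suc j)) * ennreal (F (?h * real (Suc j)) - F (?h * real j)) = 0"
        unfolding g_def using z by (simp only: if_False mult_zero_left)
    qed simp
    also have "... = (\<Sum>j<Suc N. ennreal (G (?h * real (Suc j)) * (F (?h * real (Suc j)) - F (?h * real j))))"
    proof (rule sum.cong[OF refl])
      fix j assume "j \<in> {..<Suc N}"
      hence "g (?h * real (Suc j)) = ennreal (G (?h * real (Suc j)))" unfolding g_def using le[of j] by simp
      moreover have "0 <= ?h * real (Suc j)" by (rule mult_nonneg_nonneg) (use t in auto)
      ultimately show "g (?h * real (Suc j)) * ennreal (F (?h * real (Suc j)) - F (?h * real j))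
        = ennreal (G (?h * real (Suc j)) * (F (?h * real (Suc j)) - F (?h * real j)))" using inc[OF h[of N], of j] G(2) by (simp add: ennreal_mult)
    qed
    also have "... = ennreal (S (Suc N))"
    proof -
      have "0 <= ?h * real (Suc j)" for j by (rule mult_nonneg_nonneg) (use t in auto)
      thus ?thesis unfolding S_def using inc[OF h[of N]] G(2) by (intro sum_ennreal) (auto intro!: mult_nonneg_nonneg simp del: of_nat_Suc)
    qed
    finally show ?thesis by simp
  qed
  have "(%N. \<integral>\<^sup>+ s. g (k N s) * indicator {0<..} s \<partial>control_measure F) \<longlonglongrightarrow> (\<integral>\<^sup>+ s. 0 \<partial>control_measure F)"
  proof (rule nn_integral_dominated_convergence[where w = "indicator {0<..t}"])
    show "(%s. g (k N s) * indicator {0<..} s) \<in> borel_measurable (control_measure F)" for N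
    proof -
      have "(%s. g (t / real (Suc N) * of_int \<lceil>s / (t / real (Suc N))\<rceil>)) = (%i. g (t / real (Suc N) * of_int i)) \<circ> (%s. \<lceil>s / (t / real (Suc N))\<rceil>)"
        by auto
      moreover have "... \<in> borel_measurable borel" by (rule measurable_comp[where N = "count_space UNIV"]) auto
      ultimately have "(%s. g (k N s)) \<in> borel_measurable borel" unfolding k_def by simp
      hence "(%s. g (k N s) * indicator {0<..} s) \<in> borel_measurable borel" by measurable
      thus ?thesis by (simp add: measurable_def)
    qed
    have "(\<integral>\<^sup>+ s. indicator {0<..t} s \<partial>control_measure F) = ennreal (F t - F 0)"
      using emeasure_control_Ioc[OF F, of 0 t] t by simp
    thus "(\<integral>\<^sup>+ s. indicator {0<..t} s \<partial>control_measure F) < \<infinity>" by simp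
    show "AE s in control_measure F. g (k N s) * indicator {0<..} s <= indicator {0<..t} s" for N
    proof (rule AE_I2)
      fix s :: real
      show "g (k N s) * indicator {0<..} s <= indicator {0<..t} s" using kk(2)[of s N] G(3)[of "k N s"] by (auto simp: g_def indicator_def)
    qed
    show "AE s in control_measure F. (%N. g (k N s) * indicator {0<..} s) \<longlonglongrightarrow> 0" using null
    proof eventually_elim
      case (elim s)
      show ?case
      proof (cases "0 < s")
        case True
        have "(%N. G (k N s)) \<longlonglongrightarrow> G s" by (rule right_continuous_seq[OF G(1) kk(1)]) (use True kk(2) in auto)
        hence "(%N. ennreal (G (k N s))) \<longlonglongrightarrow> ennreal 0" using elim True by (intro tendsto_ennrealI) auto
        hence lim: "(%N. ennreal (G (k N s))) \<longlonglongrightarrow> 0" by simp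
        have "(%N. g (k N s)) \<longlonglongrightarrow> 0" by (rule tendsto_sandwich[OF _ _ tendsto_const lim]) (auto simp: g_def)
        thus ?thesis using True by simp
      qed simp
    qed
  qed simp_all
  hence "(%N. ennreal (S (Suc N))) \<longlonglongrightarrow> ennreal 0" unfolding eq by simp
  moreover have "0 <= S (Suc N)" for N unfolding S_def by (intro sum_nonneg mult_nonneg_nonneg G(2) inc[OF h]) (use t in auto)
  ultimately have "(%N. S (Suc N)) \<longlonglongrightarrow> 0" by (subst (asm) tendsto_ennreal_iff) auto
  thus ?thesis unfolding S_def[symmetric] by (rule LIMSEQ_imp_Suc)
qed

section \<open>The net control as an explicit functional of the path\<close>

context skorokhod_path
begin

text \<open>Turning the strip upside down exchanges the barriers and the controls, so the maximum
  principle for \<open>K\<close> has a counterpart from below.\<close>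

lemma reflect: "skorokhod_path a (%t. a - f t) R L"
proof
  have e: "a - f t - R t + L t = a - U t" for t by (simp add: U_def)
  show "skorokhod a (%t. a - f t) R L" unfolding skorokhod_def e using cumL cumR U_bounds flatL flatR by auto
qed

lemma K_ge:
  assumes "0 <= t" "t <= u" "M <= K t"
    and "\<And>v. t < v ==> v <= u ==> (\<And>w'. v <= w' ==> w' <= u ==> K w' < M) ==> 0 < U v"
  shows "M <= K u"
proof -
  interpret refl: skorokhod_path a "%t. a - f t" R L by (rule reflect)
  have 1: "refl.K x = - K x" "refl.U x = a - U x" for x by (auto simp: refl.K_def K_def refl.U_def U_def)
  have "refl.K u <= - M" by (rule refl.K_le[OF assms(1,2)]) (use assms(3,4) in \<open>auto simp: 1\<close>)
  thus ?thesis by (simp add: 1)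
qed

lemma L_0: "U 0 ~= a ==> L 0 = 0" and R_0: "U 0 ~= 0 ==> R 0 = 0"
  using null_L[of "{0}"] null_R[of "{0}"] emeasure_control_zero[OF cumL] emeasure_control_zero[OF cumR]
    cumulative_pathD(1)[OF cumL] cumulative_pathD(1)[OF cumR] by (auto simp: ennreal_eq_0_iff)

text \<open>With \<open>K_upper\<close> this identifies \<open>K t\<close> as a supremum of levels
  \<open>c\<close> determined by the path up to \<open>t\<close>: the path has stayed at or above
  \<open>c\<close> since some time \<open>s\<close> with \<open>f s - a >= c\<close>, or since time
  0 if \<open>c <= 0\<close>.\<close>

lemma K_lower:
  assumes t: "0 <= t" and c: "c <= 0 & (\<forall>u\<in>{0..t}. c <= f u) \<or> (\<exists>s\<in>{0..t}. c <= f s - a & (\<forall>u\<in>{s..t}. c <= f u))"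
  shows "c <= K t" using c
proof (elim disjE conjE bexE)
  assume c: "c <= 0" "\<forall>u\<in>{0..t}. c <= f u"
  have pos: "0 < U v" if "0 <= v" "v <= t" "K v < c" for v using c(2) that by (force simp: U_K)
  show ?thesis
  proof (rule K_ge[OF order_refl t])
    show "c <= K 0"
    proof (rule ccontr)
      assume "~ c <= K 0"
      hence "R 0 = 0" using pos[of 0] t R_0 by auto
      thus False using \<open>~ c <= K 0\<close> c(1) cumulative_pathD(1)[OF cumL] by (simp add: K_def)
    qed
  qed (use pos in auto)
next
  fix s assume s: "s \<in> {0..t}" "c <= f s - a" "\<forall>u\<in>{s..t}. c <= f u"
  show ?thesis
  proof (rule K_ge[of s])
    show "c <= K s" using s U_bounds(2)[of s] by (simp add: U_K)
    fix v assume v: "s < v" "v <= t" "\<And>w'. v <= w' ==> w' <= t ==> K w' < c"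
    have "K v < c" "c <= f v" using v(3)[OF order_refl v(2)] s(3) v(1,2) by auto
    thus "0 < U v" by (simp add: U_K)
  qed (use s in auto)
qed

lemma K_upper:
  assumes t: "0 <= t" and c: "c < K t"
  shows "c <= 0 & (\<forall>u\<in>{0..t}. c <= f u) \<or> (\<exists>s\<in>{0..t}. c <= f s - a & (\<forall>u\<in>{s..t}. c <= f u))"
proof (rule ccontr)
  assume n: "~ ?thesis"
  have up: "K w' <= f w'" if "0 <= w'" for w' using U_bounds(1)[OF that] by (simp add: U_K)
  have no: "f s - a < c" if "0 <= s" "s <= t" and above: "\<And>w'. s <= w' ==> w' <= t ==> c < K w'" for s
  proof (rule ccontr)
    assume "~ f s - a < c"
    moreover have "c <= f u" if "u \<in> {s..t}" for u using \<open>0 <= s\<close> that up[of u] above[of u] by auto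
    moreover have "s \<in> {0..t}" using \<open>0 <= s\<close> \<open>s <= t\<close> by auto
    ultimately show False using n not_less by blast
  qed
  show False
  proof (cases "\<exists>s\<in>{0..t}. K s <= c")
    case True
    then obtain s where s: "0 <= s" "s <= t" "K s <= c" by auto
    have "K t <= c"
    proof (rule K_le[OF s])
      fix v assume v: "s < v" "v <= t" "\<And>w'. v <= w' ==> w' <= t ==> c < K w'"
      hence "f v - a < c" "c < K v" using no[of v] s by auto
      thus "U v < a" by (simp add: U_K)
    qed
    with c show False by simp
  next
    case False
    hence above: "c < K w'" if "0 <= w'" "w' <= t" for w' using that by force
    hence "\<forall>u\<in>{0..t}. c <= f u" using up by (force intro: less_imp_le less_le_trans)
    hence "0 < c" using n by auto
    moreover have "f 0 - a < c" "c < K 0" using no[of 0] above t by auto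
    hence "L 0 = 0" by (intro L_0) (simp add: U_K)
    ultimately show False using \<open>c < K 0\<close> cumulative_pathD(1)[OF cumR] by (simp add: K_def)
  qed
qed

lemma U_right:
  assumes f: "cadlag f" and t: "0 <= t"
  shows "(U \<longlongrightarrow> U t) (at_right t)"
proof -
  have "((%t. f t - L t + R t) \<longlongrightarrow> f t - L t + R t) (at_right t)"
    using cadlag_right[OF f t] cumulative_pathD(4)[OF cumL t] cumulative_pathD(4)[OF cumR t] by (intro tendsto_intros) (auto simp: continuous_within)
  thus ?thesis by (simp add: U_def[abs_def])
qed

text \<open>Since \<open>U = a\<close> where \<open>L\<close> grows and \<open>U = 0\<close> where
  \<open>R\<close> grows, \<open>L\<close> is the integral of \<open>U / a\<close> against
  \<open>K\<close>. Only the path and \<open>K\<close> enter, so once \<open>K\<close> is adapted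
  both controls are.\<close>

lemma L_limit:
  assumes f: "cadlag f" and a: "0 < a" and t: "0 <= t"
  shows "(%N. U 0 / a * K 0 + (\<Sum>j<N. U (t / N * real (Suc j)) / a * (K (t / N * real (Suc j)) - K (t / N * real j))))
    \<longlonglongrightarrow> L t"
proof -
  \<comment> \<open>At most one control jumps at 0: \<open>L 0\<close> can be nonzero only if
    \<open>U 0 = a\<close>, and \<open>R 0\<close> only if \<open>U 0 = 0\<close>, while
    \<open>a > 0\<close>.\<close>
  have zero: "U 0 / a * K 0 = L 0" using L_0 R_0 a by (cases "U 0 = a"; cases "U 0 = 0") (auto simp: K_def)
  show ?thesis
  proof (cases "t = 0")
    case True
    show ?thesis unfolding zero True by simp
  next
    case False
    hence t: "0 < t" using t by simp
    define SL where "SL N = (\<Sum>j<N. (1 - U (t / N * real (Suc j)) / a) * (L (t / N * real (Suc j)) - L (t / N * real j)))" for N :: nat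
    define SR where "SR N = (\<Sum>j<N. U (t / N * real (Suc j)) / a * (R (t / N * real (Suc j)) - R (t / N * real j)))" for N :: nat
    have "SL \<longlonglongrightarrow> 0" unfolding SL_def
    proof (rule null_grid_sums[OF cumL t])
      show "AE s in control_measure L. 0 <= s --> 1 - U s / a = 0" using AE_L by eventually_elim (use a in auto)
      show "0 <= s ==> ((%s. 1 - U s / a) \<longlongrightarrow> 1 - U s / a) (at_right s)" for s
        using U_right[OF f] a by (intro tendsto_intros) auto
    qed (use U_bounds a in auto)
    moreover have "SR \<longlonglongrightarrow> 0" unfolding SR_def
    proof (rule null_grid_sums[OF cumR t])
      show "AE s in control_measure R. 0 <= s --> U s / a = 0" using AE_R by eventually_elim auto
      show "0 <= s ==> ((%s. U s / a) \<longlongrightarrow> U s / a) (at_right s)" for s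
        using U_right[OF f] a by (intro tendsto_intros) auto
    qed (use U_bounds a in auto)
    ultimately have "(%N. L t - SL N - SR N) \<longlonglongrightarrow> L t - 0 - 0" by (intro tendsto_intros)
    moreover have "\<forall>\<^sub>F N in sequentially. L t - SL N - SR N
        = U 0 / a * K 0 + (\<Sum>j<N. U (t / N * real (Suc j)) / a * (K (t / N * real (Suc j)) - K (t / N * real j)))"
      using eventually_gt_at_top[of 0]
    proof eventually_elim
      case (elim N)
      have tel: "(\<Sum>j<N. L (t / N * real (Suc j)) - L (t / N * real j)) = L t - L 0"
        using sum_lessThan_telescope[of "%j. L (t / N * real j)" N] elim by simp
      have e: "(\<Sum>j<N. U (t / N * real (Suc j)) / a * (K (t / N * real (Suc j)) - K (t / N * real j)))
        = (\<Sum>j<N. L (t / N * real (Suc j)) - L (t / N * real j)) - SL N - SR N" unfolding SL_def SR_def sum_subtractf[symmetric] K_def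
        by (intro sum.cong refl) (simp add: algebra_simps del: of_nat_Suc)
      show ?case unfolding e tel zero by simp
    qed
    ultimately show ?thesis by (simp add: tendsto_cong)
  qed
qed

end

text \<open>\<open>M\<close> is arbitrary and will be the sigma-algebra of the past of
  \<open>t\<close>; hence measurability of \<open>X s\<close> is assumed for \<open>s <= t\<close>
  only.\<close>

lemma barrier_measurable:
  fixes X :: "real => 'w => real"
  assumes cad: "\<And>w. w \<in> space M ==> cadlag (%t. X t w)" and a: "0 < a" and t: "0 <= t"
    and X: "\<And>s. 0 <= s ==> s <= t ==> X s \<in> borel_measurable M"
  shows "(%w. barrier_L a (%s. X s w) t) \<in> borel_measurable M"
    and "(%w. barrier_R a (%s. X s w) t) \<in> borel_measurable M"
proof -
  define L where "L s w = barrier_L a (%s. X s w) s" for s w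
  define R where "R s w = barrier_R a (%s. X s w) s" for s w
  define K where "K s w = L s w - R s w" for s w
  have path: "skorokhod_path a (%t. X t w) (%t. L t w) (%t. R t w)" if "w \<in> space M" for w
    using barrier_path.barrier_skorokhod[of a "%t. X t w"] cad[OF that] a by (simp add: skorokhod_path_def L_def R_def barrier_path_def)
  have K: "K s \<in> borel_measurable M" if s: "0 <= s" "s <= t" for s
  proof (rule borel_measurableI_greater)
    fix c :: real
    \<comment> \<open>Multiples of \<open>s\<close> by rationals in the unit interval, so that the
      end point \<open>s\<close>, which cannot be approached from the right, belongs to the
      countable set.\<close>
    define Q where "Q = (%x. s * x) ` (\<rat> \<inter> {0..1})"
    have Q: "countable Q" unfolding Q_def by (intro countable_image) (auto intro: countable_subset[OF _ countable_rat])
    have Qs: "0 <= x & x <= s" if "x \<in> Q" for x using that s mult_left_le[of _ s] by (auto simp: Q_def)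
    have XQ: "X x \<in> borel_measurable M" if "x \<in> Q" for x using Qs[OF that] s X by auto
    \<comment> \<open>The existential part is strict so that it survives moving \<open>r\<close> to
      a nearby point of \<open>Q\<close>; the loss is absorbed between two levels below
      \<open>K s w\<close>.\<close>
    define B where "B d w \<longleftrightarrow> d <= 0 & (\<forall>u\<in>Q. d <= X u w) \<or> (\<exists>r\<in>Q. d < X r w - a & (\<forall>u\<in>Q. r <= u --> d <= X u w))" for d w
    have dense: "\<exists>x\<in>Q. u <= x & x < e" if u: "0 <= u" "u < e" "u <= s" for u e
    proof (cases "u = s")
      case True
      thus ?thesis using u by (intro bexI[of _ s]) (auto simp: Q_def intro!: image_eqI[of _ _ 1])
    next
      case False
      hence s0: "0 < s" and "u / s < min (e / s) 1" using u by (auto simp: field_simps)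
      then obtain x where "x \<in> \<rat>" "u / s < x" "x < min (e / s) 1" using Rats_dense_in_real by blast
      hence "x \<in> \<rat> \<inter> {0..1}" "u <= s * x" "s * x < e"
        using s0 u by (auto simp: field_simps intro: order_trans[OF divide_nonneg_pos[of u s]])
      thus ?thesis by (intro bexI[of _ "s * x"]) (auto simp: Q_def)
    qed
    have all: "d <= X u w" if w: "w \<in> space M" and r: "0 <= r" "r <= u" "u <= s" and d: "\<And>v. v \<in> Q ==> r <= v ==> d <= X v w" for d u r w
    proof (rule ccontr)
      assume n: "~ d <= X u w"
      obtain e where e: "e > u" "\<And>v. u <= v ==> v < e ==> \<bar>X v w - X u w\<bar> < d - X u w"
        using cadlag_right_near[OF cad[OF w], of u "d - X u w"] r n by auto
      obtain x where "x \<in> Q" "u <= x" "x < e" using dense[of u e] e r by auto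
      thus False using e(2)[of x] d[of x] r by auto
    qed
    have iff: "c < K s w \<longleftrightarrow> (\<exists>d\<in>\<rat> \<inter> {c<..}. B d w)" if w: "w \<in> space M" for w
    proof -
      interpret P: skorokhod_path a "%t. X t w" "%t. L t w" "%t. R t w" by (rule path[OF w])
      have KK: "K s w = P.K s" by (simp add: K_def P.K_def)
      show ?thesis
      proof
        assume "c < K s w"
        then obtain d where d: "d \<in> \<rat>" "c < d" "d < P.K s" using Rats_dense_in_real KK by auto
        then obtain d' where d': "d < d'" "d' < P.K s" using Rats_dense_in_real[OF d(3)] by blast
        from P.K_upper[OF s(1) d'(2)] have "B d w"
        proof (elim disjE conjE bexE)
          assume all': "d' <= 0" "\<forall>u\<in>{0..s}. d' <= X u w"
          have "d <= X u w" if "u \<in> Q" for u using bspec[OF all'(2), of u] Qs[OF that] d' by auto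
          thus ?thesis using d' all'(1) unfolding B_def by auto
        next
          fix r assume r: "r \<in> {0..s}" "d' <= X r w - a" "\<forall>u\<in>{r..s}. d' <= X u w"
          obtain e where e: "e > r" "\<And>v. r <= v ==> v < e ==> \<bar>X v w - X r w\<bar> < d' - d"
            using cadlag_right_near[OF cad[OF w], of r "d' - d"] r d' by auto
          obtain x where x: "x \<in> Q" "r <= x" "x < e" using dense[of r e] e r by auto
          have "d < X x w - a" using e(2)[of x] x r by auto
          moreover have "\<forall>u\<in>Q. x <= u --> d <= X u w"
          proof (intro ballI impI)
            fix u assume "u \<in> Q" "x <= u"
            hence "d' <= X u w" using r(3) x Qs[of u] by auto
            with d' show "d <= X u w" by simp
          qed
          ultimately show ?thesis using x by (auto simp: B_def)
        qed
        thus "\<exists>d\<in>\<rat> \<inter> {c<..}. B d w" using d by auto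
      next
        assume "\<exists>d\<in>\<rat> \<inter> {c<..}. B d w"
        then obtain d where "d \<in> {c<..}" and Bd: "B d w" by blast
        hence cd: "c < d" by simp
        have "d <= P.K s"
        proof (rule P.K_lower[OF s(1)])
          show "d <= 0 & (\<forall>u\<in>{0..s}. d <= X u w) \<or> (\<exists>r\<in>{0..s}. d <= X r w - a & (\<forall>u\<in>{r..s}. d <= X u w))"
            using Bd unfolding B_def
          proof (elim disjE conjE bexE)
            assume d: "d <= 0" "\<forall>u\<in>Q. d <= X u w"
            have "d <= X u w" if "u \<in> {0..s}" for u by (rule all[OF w, of 0]) (use that d in auto)
            thus ?thesis using d(1) by blast
          next
            fix r assume r: "r \<in> Q" "d < X r w - a" "\<forall>u\<in>Q. r <= u --> d <= X u w"
            have "d <= X u w" if "u \<in> {r..s}" for u by (rule all[OF w, of r]) (use that r Qs[OF r(1)] in auto)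
            moreover have "r \<in> {0..s}" "d <= X r w - a" using r Qs[OF r(1)] by auto
            ultimately show ?thesis by blast
          qed
        qed
        thus "c < K s w" using cd KK by simp
      qed
    qed
    have measB: "{w\<in>space M. B d w} \<in> sets M" for d unfolding B_def using Q XQ
      by (intro sets.sets_Collect_disj sets.sets_Collect_conj sets.sets_Collect_const
          sets.sets_Collect_countable_Ball sets.sets_Collect_countable_Bex)
        (auto intro!: sets.sets_Collect_imp sets.sets_Collect_const sets.sets_Collect_countable_Ball)
    have "countable (\<rat> \<inter> {c<..})" by (rule countable_subset[OF _ countable_rat]) auto
    hence "(\<Union>d\<in>\<rat> \<inter> {c<..}. {w\<in>space M. B d w}) \<in> sets M" using measB by (intro sets.countable_UN') auto
    moreover have "(\<Union>d\<in>\<rat> \<inter> {c<..}. {w\<in>space M. B d w}) = {w\<in>space M. \<exists>d\<in>\<rat> \<inter> {c<..}. B d w}"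
      by auto
    ultimately have "{w\<in>space M. \<exists>d\<in>\<rat> \<inter> {c<..}. B d w} \<in> sets M" by simp
    moreover have "{w\<in>space M. c < K s w} = {w\<in>space M. \<exists>d\<in>\<rat> \<inter> {c<..}. B d w}" using iff by auto
    ultimately show "{w\<in>space M. c < K s w} \<in> sets M" by simp
  qed
  define V where "V s w = (X s w - K s w) / a" for s w
  have V: "V s \<in> borel_measurable M" if "0 <= s" "s <= t" for s unfolding V_def using K[OF that] X[OF that] by measurable
  have L: "L t \<in> borel_measurable M"
  proof (rule borel_measurable_LIMSEQ_real)
    fix w assume w: "w \<in> space M"
    interpret P: skorokhod_path a "%t. X t w" "%t. L t w" "%t. R t w" by (rule path[OF w])
    have 1: "P.U s / a = V s w" "P.K s = K s w" for s by (auto simp: P.U_def V_def K_def P.K_def algebra_simps)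
    show "(%N. V 0 w * K 0 w + (\<Sum>j<N. V (t / N * real (Suc j)) w * (K (t / N * real (Suc j)) w - K (t / N * real j) w))) \<longlonglongrightarrow> L t w"
      using P.L_limit[OF cad[OF w] a t] unfolding 1 .
  next
    fix N :: nat
    have le: "0 <= t / N * real j & t / N * real j <= t" if "j <= N" for j
      using that t by (cases "N = 0") (auto simp: field_simps intro: mult_left_mono)
    show "(%w. V 0 w * K 0 w + (\<Sum>j<N. V (t / N * real (Suc j)) w * (K (t / N * real (Suc j)) w - K (t / N * real j) w))) \<in> borel_measurable M"
      using t le by (intro borel_measurable_add borel_measurable_times borel_measurable_sum borel_measurable_diff K V)
        (auto simp del: of_nat_Suc simp: Suc_le_eq)
  qed
  have "(%w. L t w - K t w) \<in> borel_measurable M" using L K[OF t order_refl] by measurable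
  moreover have "L t w - K t w = R t w" for w by (simp add: K_def)
  ultimately show "(%w. barrier_L a (%s. X s w) t) \<in> borel_measurable M"
    "(%w. barrier_R a (%s. X s w) t) \<in> borel_measurable M" using L by (simp_all add: L_def[abs_def] R_def[abs_def])
qed

section \<open>Drawdowns under the Markov property\<close>

text \<open>The process under one starting law. Stationarity refers to increments from
  \<open>X 0\<close>, because the start is \<open>x0\<close> only almost surely.\<close>

locale levy_paths = prob_space M for M :: "'w measure" +
  fixes X :: "real => 'w => real" and x0 :: real
  assumes X_measurable [measurable]: "0 <= t ==> X t \<in> borel_measurable M"
    and cadlag_X: "w \<in> space M ==> cadlag (%t. X t w)"
    and start: "AE w in M. X 0 w = x0"
    and indep_increments: "mono (s :: nat => real) ==> 0 <= s 0 ==>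
        indep_vars (%_. borel) (%i w. X (s (Suc i)) w - X (s i) w) {..<n}"
    and stationary: "0 <= t ==> 0 <= h ==>
        distr M borel (%w. X (t + h) w - X t w) = distr M borel (%w. X h w - X 0 w)"
begin

abbreviation nn_expectation :: "('w => ennreal) => ennreal" (binder "EE " 10) where
  "nn_expectation f \<equiv> integral\<^sup>N M f"

abbreviation "past t \<equiv> natural_filtration (space M) X t"

lemma space_past [simp]: "space (past t) = space M" unfolding natural_filtration_def by (rule space_measure_of) auto

lemma sets_past: "sets (past t) = sigma_sets (space M) {X s -` B \<inter> space M | s B. 0 <= s & s <= t & B \<in> sets borel}"
  unfolding natural_filtration_def by (rule sets_measure_of) auto

lemma X_past: "0 <= s ==> s <= t ==> X s \<in> borel_measurable (past t)"
  by (rule measurableI) (auto simp: sets_past)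

lemma sets_past_le: "sets (past t) \<subseteq> sets M" unfolding sets_past by (rule sets.sigma_sets_subset) auto

lemma measurable_past: "f \<in> measurable (past t) N ==> f \<in> measurable M N" using sets_past_le by (auto simp: measurable_def)

lemma past_mono:
  assumes "s <= t" and f: "f \<in> measurable (past s) N"
  shows "f \<in> measurable (past t) N"
proof -
  have "sets (past s) \<subseteq> sets (past t)" unfolding sets_past by (rule sigma_sets_mono') (use assms(1) in force)
  thus ?thesis using f by (auto simp: measurable_def)
qed

definition increments :: "real => nat => real => 'w => nat => real" where
  "increments h n t w = (\<lambda>j\<in>{..<n}. X (t + h * real (Suc j)) w - X (t + h * real j) w)"

lemma increments_measurable [measurable]:
  assumes "0 <= t" "0 < h"
  shows "increments h n t \<in> measurable M (Pi\<^sub>M {..<n} (%_. borel))"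
proof -
  have [measurable]: "X (t + h * real j) \<in> borel_measurable M" for j using assms by (intro X_measurable) auto
  show ?thesis unfolding increments_def[abs_def] by measurable
qed

text \<open>Independence is available along one deterministic sequence of times. A
  finite-dimensional event of the past is therefore placed on a sequence that runs through its times
  and then continues along the grid after \<open>t\<close>; stability under intersections extends
  the product formula to the whole past.\<close>

lemma past_increments_indep:
  assumes t: "0 <= t" and h: "0 < h" and A: "A \<in> sets (past t)" and E: "E \<in> sets (Pi\<^sub>M {..<n} (%_. borel))"
  shows "prob (A \<inter> (increments h n t -` E \<inter> space M)) = prob A * prob (increments h n t -` E \<inter> space M)"
proof -
  define G where "G = {{w\<in>space M. \<forall>s\<in>S. X s w \<in> B s} | S B. finite S & S \<subseteq> {0..t} & (\<forall>s\<in>S. B s \<in> sets borel)}"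
  define H where "H = {increments h n t -` E \<inter> space M | E. E \<in> sets (Pi\<^sub>M {..<n} (%_. borel))}"
  note [measurable] = increments_measurable[OF t h]
  have "indep_set G H"
  proof (rule indep_setI)
    show "G \<subseteq> events"
    proof
      fix A assume "A \<in> G"
      then obtain S B where A: "A = {w\<in>space M. \<forall>s\<in>S. X s w \<in> B s}" "finite S" "S \<subseteq> {0..t}" "\<forall>s\<in>S. B s \<in> sets borel"
        by (auto simp: G_def)
      show "A \<in> events" unfolding A(1) using A(2) by (rule sets.sets_Collect_finite_All[rotated]) (use A(3,4) in auto)
    qed
    show "H \<subseteq> events" unfolding H_def by auto
    fix A C assume "A \<in> G" "C \<in> H"
    then obtain S B E where A: "A = {w\<in>space M. \<forall>s\<in>S. X s w \<in> B s}" "finite S" "S \<subseteq> {0..t}" "\<forall>s\<in>S. B s \<in> sets borel"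
      and C: "C = increments h n t -` E \<inter> space M" and E: "E \<in> sets (Pi\<^sub>M {..<n} (%_. borel))" by (auto simp: G_def H_def)
    \<comment> \<open>0 is added so that values of \<open>X\<close> are sums of increments from the
      start, and \<open>t\<close> so that the sequence enters the grid exactly there.\<close>
    define T where "T = S \<union> {0, t}"
    define ts where "ts = sorted_list_of_set T"
    have T: "finite T" "T \<subseteq> {0..t}" using A t by (auto simp: T_def)
    have ts: "set ts = T" "sorted ts" using T by (auto simp: ts_def)
    define m where "m = length ts - 1"
    have len: "length ts = Suc m" using ts(1) by (cases ts) (auto simp: T_def m_def)
    have nth: "\<exists>i\<le>m. ts ! i = s" if "s \<in> T" for s using that ts(1) len by (metis in_set_conv_nth less_Suc_eq_le)
    have bound: "0 <= ts ! i & ts ! i <= t" if "i <= m" for i using that ts(1) T(2) len nth_mem[of i ts] by auto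
    have mono_ts: "ts ! i <= ts ! j" if "i <= j" "j <= m" for i j using that ts(2) len by (intro sorted_nth_mono) auto
    have tsm: "ts ! m = t"
    proof -
      obtain i where "i <= m" "ts ! i = t" using nth[of t] by (auto simp: T_def)
      thus ?thesis using mono_ts[of i m] bound[of m] by simp
    qed
    have ts0: "ts ! 0 = 0"
    proof -
      obtain i where "i <= m" "ts ! i = 0" using nth[of 0] by (auto simp: T_def)
      thus ?thesis using mono_ts[of 0 i] bound[of 0] by simp
    qed
    define \<tau> where "\<tau> i = (if i <= m then ts ! i else t + h * real (i - m))" for i
    have \<tau>m: "\<tau> (m + j) = t + h * real j" for j by (cases j) (auto simp: \<tau>_def tsm)
    have mono: "mono \<tau>"
    proof (rule monoI)
      fix i j :: nat assume ij: "i <= j"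
      consider "j <= m" | "i <= m" "m < j" | "m < i" using ij by linarith
      thus "\<tau> i <= \<tau> j"
      proof cases
        case 1 thus ?thesis using mono_ts[of i j] ij by (simp add: \<tau>_def)
      next
        case 2
        have "0 <= h * real (j - m)" using h by simp
        thus ?thesis using bound[of i] 2 by (simp add: \<tau>_def)
      next
        case 3
        have "h * real (i - m) <= h * real (j - m)" using h ij by (intro mult_left_mono) auto
        thus ?thesis using 3 ij by (simp add: \<tau>_def)
      qed
    qed
    define D where "D i w = X (\<tau> (Suc i)) w - X (\<tau> i) w" for i w
    have "indep_vars (%_. borel) D {..<m + n}" unfolding D_def by (rule indep_increments[OF mono]) (simp add: \<tau>_def ts0)
    hence iv: "indep_var (Pi\<^sub>M {..<m} (%_. borel)) (%w. \<lambda>i\<in>{..<m}. D i w)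
       (Pi\<^sub>M {m..<m + n} (%_. borel)) (%w. \<lambda>i\<in>{m..<m + n}. D i w)" by (rule indep_var_restrict) auto
    define \<psi> where "\<psi> y = (\<lambda>j\<in>{..<n}. y (m + j))" for y :: "nat => real"
    have \<psi>: "\<psi> \<in> measurable (Pi\<^sub>M {m..<m + n} (%_. borel)) (Pi\<^sub>M {..<n} (%_. borel))"
      unfolding \<psi>_def by measurable
    have incr: "increments h n t w = \<psi> (\<lambda>i\<in>{m..<m + n}. D i w)" for w
      unfolding increments_def \<psi>_def D_def using \<tau>m \<tau>m[of "Suc _"] by (auto simp: fun_eq_iff simp flip: add_Suc_right)
    define idx where "idx s = (SOME i. i <= m & ts ! i = s)" for s
    have idx: "idx s <= m" "\<tau> (idx s) = s" if "s \<in> S" for s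
    proof -
      have "idx s <= m & ts ! idx s = s" unfolding idx_def by (rule someI_ex) (use nth[of s] that in \<open>auto simp: T_def\<close>)
      thus "idx s <= m" "\<tau> (idx s) = s" by (auto simp: \<tau>_def)
    qed
    define E' where "E' = {y \<in> space (Pi\<^sub>M {..<m} (%_. borel)). \<forall>s\<in>S. x0 + (\<Sum>i<idx s. y i) \<in> B s}"
    have E': "E' \<in> sets (Pi\<^sub>M {..<m} (%_. borel :: real measure))" unfolding E'_def using A(2)
    proof (rule sets.sets_Collect_finite_All[rotated])
      fix s assume s: "s \<in> S"
      have "(%y. x0 + (\<Sum>i<idx s. y i)) \<in> borel_measurable (Pi\<^sub>M {..<m} (%_. borel :: real measure))"
        using idx(1)[OF s] by (intro borel_measurable_add borel_measurable_const borel_measurable_sum measurable_component_singleton) auto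
      from measurable_sets[OF this, of "B s"] A(4) s
      show "{y \<in> space (Pi\<^sub>M {..<m} (%_. borel)). x0 + (\<Sum>i<idx s. y i) \<in> B s} \<in> sets (Pi\<^sub>M {..<m} (%_. borel :: real measure))"
        by (simp add: vimage_def Int_def conj_commute)
    qed
    \<comment> \<open>As \<open>X 0 = x0\<close> almost surely, the event agrees almost surely with
      one written in increments alone.\<close>
    have AE_A: "AE w in M. (w \<in> A \<longleftrightarrow> (\<lambda>i\<in>{..<m}. D i w) \<in> E')" using start AE_space
    proof eventually_elim
      fix w assume x: "X 0 w = x0" and "w \<in> space M"
      have "x0 + (\<Sum>i<idx s. (\<lambda>i\<in>{..<m}. D i w) i) = X s w" if "s \<in> S" for s
      proof -
        have "(\<Sum>i<idx s. (\<lambda>i\<in>{..<m}. D i w) i) = (\<Sum>i<idx s. D i w)" using idx(1)[OF that] by (intro sum.cong) auto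
        also have "... = X (\<tau> (idx s)) w - X (\<tau> 0) w" unfolding D_def by (rule sum_lessThan_telescope)
        finally show ?thesis using idx(2)[OF that] x by (simp add: \<tau>_def ts0)
      qed
      thus "w \<in> A \<longleftrightarrow> (\<lambda>i\<in>{..<m}. D i w) \<in> E'"
        using \<open>w \<in> space M\<close> by (auto simp: A(1) E'_def space_PiM)
    qed
    let ?Y = "%w. \<lambda>i\<in>{..<m}. D i w"
    let ?E2 = "\<psi> -` E \<inter> space (Pi\<^sub>M {m..<m + n} (%_. borel :: real measure))"
    have C': "C = (%w. \<lambda>i\<in>{m..<m + n}. D i w) -` ?E2 \<inter> space M" unfolding C by (auto simp: incr space_PiM)
    have Cev: "C \<in> events" using \<open>C \<in> H\<close> \<open>H \<subseteq> events\<close> by auto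
    have Yrv: "?Y \<in> measurable M (Pi\<^sub>M {..<m} (%_. borel))" using iv by (rule indep_var_rv1)
    have A'ev: "?Y -` E' \<inter> space M \<in> events" using Yrv E' by (rule measurable_sets)
    have Aev: "A \<in> events" using \<open>A \<in> G\<close> \<open>G \<subseteq> events\<close> by auto
    have "prob (A \<inter> C) = prob ((?Y -` E' \<inter> space M) \<inter> C)"
    proof (rule measure_eq_AE)
      show "AE w in M. w \<in> A \<inter> C \<longleftrightarrow> w \<in> (?Y -` E' \<inter> space M) \<inter> C"
        using AE_A AE_space by eventually_elim auto
    qed (use Aev A'ev Cev in auto)
    also have "... = prob ((?Y -` E' \<inter> space M) \<inter> ((%w. \<lambda>i\<in>{m..<m + n}. D i w) -` ?E2 \<inter> space M))"
      unfolding C' ..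
    also have "... = prob (?Y -` E' \<inter> space M) * prob C"
    proof -
      let ?W = "%w. \<lambda>i\<in>{m..<m + n}. D i w"
      have "(?Y -` E' \<inter> space M) \<inter> (?W -` ?E2 \<inter> space M) = (%w. (?Y w, ?W w)) -` (E' \<times> ?E2) \<inter> space M"
        by auto
      thus ?thesis using indep_varD[OF iv E' measurable_sets[OF \<psi> E]] C' by simp
    qed
    also have "prob (?Y -` E' \<inter> space M) = prob A"
    proof (rule measure_eq_AE)
      show "AE w in M. w \<in> ?Y -` E' \<inter> space M \<longleftrightarrow> w \<in> A" using AE_A AE_space by eventually_elim auto
    qed (use Aev A'ev in auto)
    finally show "prob (A \<inter> C) = prob A * prob C" .
  qed
  hence "indep_set (sigma_sets (space M) G) (sigma_sets (space M) H)"
  proof (rule indep_set_sigma_sets)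
    show "Int_stable G"
    proof (rule Int_stableI)
      fix a b assume "a \<in> G" "b \<in> G"
      then obtain S B S' B' where a: "a = {w\<in>space M. \<forall>s\<in>S. X s w \<in> B s}" "finite S" "S \<subseteq> {0..t}" "\<forall>s\<in>S. B s \<in> sets borel"
        and b: "b = {w\<in>space M. \<forall>s\<in>S'. X s w \<in> B' s}" "finite S'" "S' \<subseteq> {0..t}" "\<forall>s\<in>S'. B' s \<in> sets borel"
        by (auto simp: G_def)
      let ?B = "%s. (if s \<in> S then B s else UNIV) \<inter> (if s \<in> S' then B' s else UNIV)"
      have "a \<inter> b = {w\<in>space M. \<forall>s\<in>S \<union> S'. X s w \<in> ?B s}" using a b by auto
      moreover have "finite (S \<union> S')" "S \<union> S' \<subseteq> {0..t}" "\<forall>s\<in>S \<union> S'. ?B s \<in> sets borel" using a b by auto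
      ultimately show "a \<inter> b \<in> G" unfolding G_def by (intro CollectI exI[of _ "S \<union> S'"] exI[of _ ?B] conjI)
    qed
    show "Int_stable H"
    proof (rule Int_stableI)
      fix a b assume "a \<in> H" "b \<in> H"
      then obtain E E' where e: "a = increments h n t -` E \<inter> space M" "b = increments h n t -` E' \<inter> space M"
        "E \<in> sets (Pi\<^sub>M {..<n} (%_. borel))" "E' \<in> sets (Pi\<^sub>M {..<n} (%_. borel))" by (auto simp: H_def)
      hence "a \<inter> b = increments h n t -` (E \<inter> E') \<inter> space M" by auto
      moreover have "E \<inter> E' \<in> sets (Pi\<^sub>M {..<n} (%_. borel))" using e by auto
      ultimately show "a \<inter> b \<in> H" unfolding H_def by (intro CollectI exI[of _ "E \<inter> E'"] conjI)
    qed
  qed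
  moreover have "A \<in> sigma_sets (space M) G"
  proof -
    have "sigma_sets (space M) {X s -` B \<inter> space M | s B. 0 <= s & s <= t & B \<in> sets borel} \<subseteq> sigma_sets (space M) G"
    proof (rule sigma_sets_mono')
      show "{X s -` B \<inter> space M | s B. 0 <= s & s <= t & B \<in> sets borel} \<subseteq> G"
      proof
        fix a assume "a \<in> {X s -` B \<inter> space M | s B. 0 <= s & s <= t & B \<in> sets borel}"
        then obtain s B where "a = X s -` B \<inter> space M" "0 <= s" "s <= t" "B \<in> sets borel" by auto
        thus "a \<in> G" unfolding G_def by (intro CollectI exI[of _ "{s}"] exI[of _ "%_. B"]) auto
      qed
    qed
    thus ?thesis using A unfolding sets_past by auto
  qed
  moreover have "increments h n t -` E \<inter> space M \<in> sigma_sets (space M) H" using E by (auto simp: H_def)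
  ultimately show ?thesis by (rule indep_setD)
qed

lemma increments_distr:
  assumes t: "0 <= t" and h: "0 < h" and n: "0 < n"
  shows "distr M (Pi\<^sub>M {..<n} (%_. borel)) (increments h n t)
    = Pi\<^sub>M {..<n} (%_. distr M borel (%w. X h w - X 0 w))"
proof -
  let ?D = "%i w. X (t + h * real (Suc i)) w - X (t + h * real i) w"
  have "mono (%i. t + h * real i)" using h by (auto simp: mono_def)
  from indep_increments[OF this, of n] have "indep_vars (%_. borel) ?D {..<n}" using t by simp
  moreover have rv: "?D i \<in> borel_measurable M" for i
    using t h by (intro borel_measurable_diff X_measurable) (auto intro!: add_nonneg_nonneg mult_nonneg_nonneg)
  ultimately have "distr M (Pi\<^sub>M {..<n} (%_. borel)) (%w. \<lambda>i\<in>{..<n}. ?D i w) = Pi\<^sub>M {..<n} (%i. distr M borel (?D i))"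
    using n by (subst (asm) indep_vars_iff_distr_eq_PiM') auto
  moreover have "distr M borel (?D i) = distr M borel (%w. X h w - X 0 w)" for i
    using stationary[of "t + h * real i" h] t h by (simp add: distrib_left add_ac)
  ultimately show ?thesis unfolding increments_def[abs_def] by simp
qed

text \<open>The pair of past and later increments has a product law, and stationarity moves the
  increments back to time 0.\<close>

lemma markov_increments:
  assumes t: "0 <= t" and h: "0 < h" and n: "0 < n"
    and Z: "Z \<in> borel_measurable (past t)" and \<phi>: "\<phi> \<in> borel_measurable (Pi\<^sub>M {..<n} (%_. borel))"
  shows "(EE w. Z w * \<phi> (increments h n t w)) = (EE w. Z w) * (EE w. \<phi> (increments h n 0 w))"
proof -
  let ?P = "Pi\<^sub>M {..<n} (%_. borel :: real measure)"
  note [measurable] = increments_measurable[OF t h]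
  have idm: "(%w. w) \<in> measurable M (past t)"
    using sets_past_le[of t] by (auto simp: measurable_def sets.Int_space_eq2[OF subsetD[OF sets_past_le]])
  have pm: "(%w. (w, increments h n t w)) \<in> measurable M (past t \<Otimes>\<^sub>M ?P)" using idm by measurable
  interpret D1: prob_space "distr M (past t) (%w. w)" by (rule prob_space_distr) (rule idm)
  interpret D2: prob_space "distr M ?P (increments h n t)" by (rule prob_space_distr) simp
  have eq: "distr M (past t) (%w. w) \<Otimes>\<^sub>M distr M ?P (increments h n t) = distr M (past t \<Otimes>\<^sub>M ?P) (%w. (w, increments h n t w))"
  proof (rule pair_measure_eqI)
    fix A B assume "A \<in> sets (distr M (past t) (%w. w))" "B \<in> sets (distr M ?P (increments h n t))"
    hence AB: "A \<in> sets (past t)" "B \<in> sets ?P" by auto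
    have A: "A \<subseteq> space M" using sets.sets_into_space[OF AB(1)] by simp
    have "(%w. (w, increments h n t w)) -` (A \<times> B) \<inter> space M = A \<inter> (increments h n t -` B \<inter> space M)"
      using A by auto
    hence "emeasure (distr M (past t \<Otimes>\<^sub>M ?P) (%w. (w, increments h n t w))) (A \<times> B)
      = ennreal (prob (A \<inter> (increments h n t -` B \<inter> space M)))" using AB pm by (simp add: emeasure_distr emeasure_eq_measure)
    also have "... = emeasure (distr M (past t) (%w. w)) A * emeasure (distr M ?P (increments h n t)) B"
      using AB idm A by (simp add: past_increments_indep[OF t h AB] emeasure_distr emeasure_eq_measure ennreal_mult Int_absorb2)
    finally show "emeasure (distr M (past t) (%w. w)) A * emeasure (distr M ?P (increments h n t)) B
      = emeasure (distr M (past t \<Otimes>\<^sub>M ?P) (%w. (w, increments h n t w))) (A \<times> B)" by simp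
  qed (auto intro: D1.sigma_finite_measure D2.sigma_finite_measure D1.sigma_finite_measure_axioms D2.sigma_finite_measure_axioms cong: sets_pair_measure_cong)
  have [measurable]: "Z \<in> borel_measurable (past t)" "\<phi> \<in> borel_measurable ?P" by fact+
  have "(EE w. Z w * \<phi> (increments h n t w))
     = (\<integral>\<^sup>+p. Z (fst p) * \<phi> (snd p) \<partial>distr M (past t \<Otimes>\<^sub>M ?P) (%w. (w, increments h n t w)))"
    by (subst nn_integral_distr[OF pm]) auto
  also have "... = (\<integral>\<^sup>+w. \<integral>\<^sup>+y. Z w * \<phi> y \<partial>distr M ?P (increments h n t) \<partial>distr M (past t) (%w. w))"
    unfolding eq[symmetric] by (subst D2.nn_integral_fst[symmetric]) (auto simp: measurable_cong_sets[OF sets_pair_measure_cong[OF sets_distr sets_distr] refl])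
  also have "... = (\<integral>\<^sup>+w. Z w \<partial>distr M (past t) (%w. w)) * (\<integral>\<^sup>+y. \<phi> y \<partial>distr M ?P (increments h n t))"
    by (subst nn_integral_cmult) (auto intro!: nn_integral_multc)
  also have "(\<integral>\<^sup>+w. Z w \<partial>distr M (past t) (%w. w)) = (EE w. Z w)"
    by (rule nn_integral_distr[OF idm]) simp
  also have "distr M ?P (increments h n t) = distr M ?P (increments h n 0)"
    using increments_distr[OF t h n] increments_distr[OF order_refl h n] by simp
  also have "(\<integral>\<^sup>+y. \<phi> y \<partial>distr M ?P (increments h n 0)) = (EE w. \<phi> (increments h n 0 w))"
    by (rule nn_integral_distr[OF increments_measurable]) (use h in auto)
  finally show ?thesis .
qed

end

section \<open>Dyadic approximation of drawdowns and Stieltjes integrals\<close>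

text \<open>Index pairs for a grid of mesh \<open>1 / 2 ^ m\<close> over a horizon of length
  \<open>2 ^ m\<close>: the mesh shrinks while the horizon grows, hence indices up to
  \<open>4 ^ m\<close>.\<close>

definition grid_pairs :: "nat => (nat \<times> nat) set" where
  "grid_pairs m = {(i, j). i < j & j <= 4 ^ m}"

definition grid_drawdown :: "real => real => (real => real) => real => nat => ennreal" where
  "grid_drawdown q b f t m = (SUP (i, j)\<in>grid_pairs m.
     ennreal (exp (- q * (t + real j / 2 ^ m)) * of_bool (f (t + real i / 2 ^ m) - f (t + real j / 2 ^ m) > b)))"

lemma grid_drawdown_incseq: "incseq (grid_drawdown q b f t)"
proof (rule incseq_SucI)
  fix m
  show "grid_drawdown q b f t m <= grid_drawdown q b f t (Suc m)" unfolding grid_drawdown_def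
  proof (rule SUP_mono)
    fix p assume "p \<in> grid_pairs m"
    then obtain i j where p: "p = (i, j)" "i < j" "j <= 4 ^ m" by (auto simp: grid_pairs_def)
    have "(2 * i, 2 * j) \<in> grid_pairs (Suc m)" using p by (auto simp: grid_pairs_def)
    moreover have "real (2 * k) / 2 ^ Suc m = real k / 2 ^ m" for k by simp
    ultimately show "\<exists>p'\<in>grid_pairs (Suc m). (case p of (i, j) => ennreal (exp (- q * (t + real j / 2 ^ m)) * of_bool (b < f (t + real i / 2 ^ m) - f (t + real j / 2 ^ m))))
      <= (case p' of (i, j) => ennreal (exp (- q * (t + real j / 2 ^ Suc m)) * of_bool (b < f (t + real i / 2 ^ Suc m) - f (t + real j / 2 ^ Suc m))))"
      unfolding p(1) by (intro bexI[of _ "(2 * i, 2 * j)"]) (simp_all only: prod.case order_refl)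
  qed
qed

lemma two_power_mono: "m <= n ==> (2::real) ^ m <= 2 ^ n" by (rule power_increasing) auto

text \<open>The strict inequality \<open>> b\<close> survives small shifts to the right of the peak
  and of the low point, so a dyadic pair sees the same drawdown at nearly the same discount.\<close>

lemma drawdown_grid:
  assumes q: "0 < q" and b: "0 <= b" and f: "cadlag f" and t: "0 <= t"
  shows "ennreal (drawdown q b f t) = (SUP m. grid_drawdown q b f t m)"
proof (rule antisym)
  let ?S = "{u. t < u & (\<exists>r\<in>{t..u}. f r - f u > b)}"
  have S: "?S \<subseteq> {0..}" using t by auto
  show "(SUP m. grid_drawdown q b f t m) <= ennreal (drawdown q b f t)" unfolding grid_drawdown_def
  proof (intro SUP_least)
    fix m p assume "p \<in> grid_pairs m"
    then obtain i j where p: "p = (i, j)" "i < j" by (auto simp: grid_pairs_def)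
    have ij: "real i / 2 ^ m < real j / 2 ^ m" "0 <= real i / 2 ^ m" using p by (auto simp: divide_strict_right_mono)
    have "exp (- q * (t + real j / 2 ^ m)) * of_bool (f (t + real i / 2 ^ m) - f (t + real j / 2 ^ m) > b)
      <= drawdown q b f t"
    proof (cases "f (t + real i / 2 ^ m) - f (t + real j / 2 ^ m) > b")
      case True
      moreover have "t < t + real j / 2 ^ m" using p(2) by simp
      moreover have "t + real i / 2 ^ m \<in> {t..t + real j / 2 ^ m}" using ij by auto
      ultimately have "t + real j / 2 ^ m \<in> ?S" by blast
      from sup_discount_upper[OF q S this] show ?thesis using True by (simp add: drawdown_def)
    qed (use drawdown_bounds(1)[OF q t] in simp)
    thus "(case p of (i, j) => ennreal (exp (- q * (t + real j / 2 ^ m)) * of_bool (b < f (t + real i / 2 ^ m) - f (t + real j / 2 ^ m))))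
      <= ennreal (drawdown q b f t)" unfolding p(1) prod.case by (rule ennreal_leI)
  qed
  show "ennreal (drawdown q b f t) <= (SUP m. grid_drawdown q b f t m)"
  proof (rule ccontr)
    assume "~ ?thesis"
    hence less: "(SUP m. grid_drawdown q b f t m) < ennreal (drawdown q b f t)" by simp
    then obtain y where y: "0 <= y" "(SUP m. grid_drawdown q b f t m) = ennreal y"
      by (cases "SUP m. grid_drawdown q b f t m") (auto simp: ennreal_less_top)
    have "y < drawdown q b f t" using less y by (simp add: ennreal_less_iff)
    then obtain u r where u: "t < u" "t <= r" "r <= u" "f r - f u > b" "y < exp (- q * u)"
      using less_sup_discount[OF q S, of y] y(1) unfolding drawdown_def by auto
    have ru: "r < u" using u b by (cases "r = u") auto
    define e where "e = (f r - f u - b) / 2"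
    have e: "0 < e" using u by (simp add: e_def)
    obtain r1 where r1: "r1 > r" "\<And>v. r <= v ==> v < r1 ==> \<bar>f v - f r\<bar> < e"
      using cadlag_right_near[OF f _ e, of r] u t by auto
    obtain u1 where u1: "u1 > u" "\<And>v. u <= v ==> v < u1 ==> \<bar>f v - f u\<bar> < e"
      using cadlag_right_near[OF f _ e, of u] u t by auto
    have "((%x. exp (- q * x)) \<longlongrightarrow> exp (- q * u)) (at_right u)" by (intro tendsto_intros)
    from order_tendstoD(1)[OF this u(5)]
    obtain u2 where u2: "u2 > u" "\<And>v. u < v ==> v < u2 ==> y < exp (- q * v)"
      by (auto simp: eventually_at_right[OF less_add_one])
    \<comment> \<open>How far peak and low point may be moved: within both oscillation bounds,
      without the peak passing the low point and without losing the discount level \<open>y\<close>.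
      The 1 is for the horizon.\<close>
    define d where "d = Min {r1 - r, u - r, u1 - u, u2 - u, 1}"
    have d: "0 < d" "d <= r1 - r" "d <= u - r" "d <= u1 - u" "d <= u2 - u" "d <= 1" unfolding d_def using r1 u1 u2 ru by auto
    obtain m0 where m0: "1 / d < 2 ^ m0" using real_arch_pow[of 2 "1/d"] by auto
    obtain m1 where m1: "u - t + 1 < 2 ^ m1" using real_arch_pow[of 2 "u - t + 1"] by auto
    define m where "m = max m0 m1"
    have pow: "1 / d < 2 ^ m" "u - t + 1 < 2 ^ m" using less_le_trans[OF m0 two_power_mono[of m0 m]] less_le_trans[OF m1 two_power_mono[of m1 m]]
      by (auto simp: m_def)
    have hd: "1 / 2 ^ m < d" using pow(1) d(1) by (simp add: field_simps)
    define i where "i = nat \<lceil>(r - t) * 2 ^ m\<rceil>"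
    define j where "j = nat \<lceil>(u - t) * 2 ^ m\<rceil>"
    have i: "(r - t) * 2 ^ m <= real i" "real i < (r - t) * 2 ^ m + 1" using u by (auto simp: i_def of_nat_ceiling) linarith
    have j: "(u - t) * 2 ^ m <= real j" "real j < (u - t) * 2 ^ m + 1" using u by (auto simp: j_def of_nat_ceiling) linarith
    have grid: "x <= t + real k / 2 ^ m & t + real k / 2 ^ m < x + d"
      if "(x - t) * 2 ^ m <= real k" "real k < (x - t) * 2 ^ m + 1" for x k
    proof -
      have "x - t <= real k / 2 ^ m" using that(1) by (simp add: pos_le_divide_eq)
      moreover have "real k / 2 ^ m < ((x - t) * 2 ^ m + 1) / 2 ^ m" using that(2) by (intro divide_strict_right_mono) auto
      moreover have "((x - t) * 2 ^ m + 1) / 2 ^ m = (x - t) + 1 / 2 ^ m" by (simp add: add_divide_distrib)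
      ultimately show ?thesis using hd by linarith
    qed
    have ri: "r <= t + real i / 2 ^ m" "t + real i / 2 ^ m < r + d" using grid[OF i] by auto
    have uj: "u <= t + real j / 2 ^ m" "t + real j / 2 ^ m < u + d" using grid[OF j] by auto
    have "t + real i / 2 ^ m < t + real j / 2 ^ m" using ri uj d by linarith
    hence "i < j" by (simp add: divide_less_cancel)
    moreover have "j <= 4 ^ m"
    proof -
      have "real j / 2 ^ m < 2 ^ m" using uj(2) d(6) pow(2) by linarith
      hence "real j < 2 ^ m * 2 ^ m" by (simp add: field_simps)
      also have "... = real (4 ^ m)" by (simp flip: power_mult_distrib)
      finally show ?thesis by simp
    qed
    ultimately have ij: "(i, j) \<in> grid_pairs m" by (simp add: grid_pairs_def)
    have "\<bar>f (t + real i / 2 ^ m) - f r\<bar> < e" "\<bar>f (t + real j / 2 ^ m) - f u\<bar> < e"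
      using r1(2)[of "t + real i / 2 ^ m"] u1(2)[of "t + real j / 2 ^ m"] ri uj d by auto
    moreover have "f r - f u = b + 2 * e" by (simp add: e_def field_simps)
    ultimately have big: "f (t + real i / 2 ^ m) - f (t + real j / 2 ^ m) > b" by linarith
    have "y < exp (- q * (t + real j / 2 ^ m))" using u2(2)[of "t + real j / 2 ^ m"] uj d u(5) by (cases "t + real j / 2 ^ m = u") auto
    hence "ennreal y < ennreal (exp (- q * (t + real j / 2 ^ m)) * of_bool (f (t + real i / 2 ^ m) - f (t + real j / 2 ^ m) > b))"
      using big y(1) by (simp add: ennreal_less_iff)
    also have "... <= grid_drawdown q b f t m" unfolding grid_drawdown_def by (rule SUP_upper2[OF ij]) simp
    also have "... <= (SUP m. grid_drawdown q b f t m)" by (rule SUP_upper) simp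
    finally show False using y by simp
  qed
qed

text \<open>A drawdown with its peak at \<open>t\<close> itself is also realised with a slightly
  later peak, again because the excess over \<open>b\<close> is strict.\<close>

lemma drawdown_right:
  assumes q: "0 < q" and b: "0 <= b" and f: "cadlag f" and t: "0 <= t"
  shows "(drawdown q b f \<longlongrightarrow> drawdown q b f t) (at_right t)"
proof (rule order_tendstoI)
  fix y assume y: "y < drawdown q b f t"
  show "\<forall>\<^sub>F s in at_right t. y < drawdown q b f s"
  proof (cases "0 <= y")
    case True
    let ?S = "{u. t < u & (\<exists>r\<in>{t..u}. f r - f u > b)}"
    have "?S \<subseteq> {0..}" using t by auto
    from less_sup_discount[OF q this y[unfolded drawdown_def] True]
    obtain u r where u: "t < u" "t <= r" "r <= u" "f r - f u > b" "y < exp (- q * u)" by auto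
    have "\<exists>r'>t. r' <= u & f r' - f u > b"
    proof (cases "r = t")
      case True
      obtain r1 where r1: "r1 > r" "\<And>v. r <= v ==> v < r1 ==> \<bar>f v - f r\<bar> < f r - f u - b"
        using cadlag_right_near[OF f, of r "f r - f u - b"] u t by auto
      define v where "v = min u ((t + r1) / 2)"
      have "t < v" "v < r1" "v <= u" using r1(1) True u(1) by (auto simp: v_def min_def field_simps)
      thus ?thesis using r1(2)[of v] True by (intro exI[of _ v]) auto
    next
      case False
      thus ?thesis using u by (intro exI[of _ r]) auto
    qed
    then obtain r' where r': "t < r'" "r' <= u" "f r' - f u > b" by auto
    hence "r' < u" using b by (cases "r' = u") auto
    have "y < drawdown q b f s" if s: "s \<in> {t<..<r'}" for s
    proof -
      have "{u. s < u & (\<exists>r\<in>{s..u}. f r - f u > b)} \<subseteq> {0..}" using s t by auto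
      hence "exp (- q * u) <= drawdown q b f s" unfolding drawdown_def using s r' \<open>r' < u\<close>
        by (intro sup_discount_upper[OF q]) (auto intro!: bexI[of _ r'])
      with u(5) show ?thesis by simp
    qed
    thus ?thesis by (rule eventually_at_rightI[OF _ r'(1)])
  next
    case False
    have "\<forall>\<^sub>F s in at_right t. t < s" by (rule eventually_at_right_less)
    thus ?thesis
    proof eventually_elim
      case (elim s)
      thus ?case using False t drawdown_bounds(1)[OF q, of s b f] by linarith
    qed
  qed
next
  fix y assume y: "drawdown q b f t < y"
  show "\<forall>\<^sub>F s in at_right t. drawdown q b f s < y" using eventually_at_right_less[of t]
  proof eventually_elim
    case (elim s)
    thus ?case using y drawdown_antimono[OF q t, of s b f] by linarith
  qed
qed

definition dyadic_sum :: "(real => real) => (real => real) => nat => ennreal" where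
  "dyadic_sum d F n = ennreal (d 0) * ennreal (F 0) +
     (\<Sum>j. ennreal (d (real (Suc j) / 2 ^ n)) * ennreal (F (real (Suc j) / 2 ^ n) - F (real j / 2 ^ n)))"

text \<open>The rounded times decrease as the grid is refined and the weight is decreasing, so
  monotone convergence applies.\<close>

lemma weighted_dyadic:
  assumes F: "cumulative_path F" and d: "antimono_on {0..} d" "\<And>t. 0 <= t ==> (d \<longlongrightarrow> d t) (at_right t)"
  shows "weighted d F = (SUP n. dyadic_sum d F n)" "incseq (dyadic_sum d F)"
proof -
  define k :: "nat => real => real" where "k n s = 1 / 2 ^ n * of_int \<lceil>s / (1 / 2 ^ n)\<rceil>" for n s
  have h: "(0::real) < 1 / 2 ^ n" "(%n. (1::real) / 2 ^ n) \<longlonglongrightarrow> 0" for n :: nat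
    using LIMSEQ_divide_realpow_zero[of 2 1] by auto
  note kk = grid_right[of "%n. 1 / 2 ^ n", OF h, folded k_def]
  have kdec: "k (Suc n) s <= k n s" for n s
  proof -
    have "\<lceil>2 * x\<rceil> <= 2 * \<lceil>x\<rceil>" for x :: real
    proof -
      have "2 * x <= of_int (2 * \<lceil>x\<rceil>)" by simp
      thus ?thesis by (simp only: ceiling_le)
    qed
    hence "real_of_int \<lceil>2 * (s * 2 ^ n)\<rceil> <= real_of_int (2 * \<lceil>s * 2 ^ n\<rceil>)" by (simp only: of_int_le_iff)
    thus ?thesis by (simp add: k_def field_simps)
  qed
  define G where "G n s = ennreal (d (k n s)) * indicator {0<..} s" for n s
  have Ginc: "G n s <= G (Suc n) s" for n s unfolding G_def using kdec[of n s] kk(2)[of s "Suc n"] kk(2)[of s n] d(1)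
    by (auto simp: indicator_def monotone_on_def intro!: ennreal_leI)
  have Gsup: "(SUP n. G n s) = ennreal (d s) * indicator {0<..} s" for s
  proof (cases "0 < s")
    case True
    have "(%n. d (k n s)) \<longlonglongrightarrow> d s" by (rule right_continuous_seq[OF d(2) kk(1)]) (use True kk(2) in auto)
    hence "(%n. G n s) \<longlonglongrightarrow> ennreal (d s)" using True by (auto simp: G_def intro: tendsto_ennrealI)
    moreover have "(%n. G n s) \<longlonglongrightarrow> (SUP n. G n s)" by (rule LIMSEQ_SUP) (auto intro: incseq_SucI Ginc)
    ultimately show ?thesis using True LIMSEQ_unique by (simp) blast
  qed (simp add: G_def)
  have Gm: "G n \<in> borel_measurable (control_measure F)" for n
  proof -
    have "(%s. ennreal (d (k n s))) = (%i. ennreal (d (1 / 2 ^ n * of_int i))) \<circ> (%s. \<lceil>s / (1 / 2 ^ n)\<rceil>)"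
      by (auto simp: k_def)
    moreover have "... \<in> borel_measurable borel" by (rule measurable_comp[where N = "count_space UNIV"]) auto
    ultimately have "(%s. ennreal (d (k n s))) \<in> borel_measurable borel" by simp
    hence "G n \<in> borel_measurable borel" unfolding G_def[abs_def] by measurable
    thus ?thesis by (simp add: measurable_def)
  qed
  have Gint: "(\<integral>\<^sup>+ s. G n s \<partial>control_measure F)
      = (\<Sum>j. ennreal (d (real (Suc j) / 2 ^ n)) * ennreal (F (real (Suc j) / 2 ^ n) - F (real j / 2 ^ n)))" for n
    using grid_integral[OF F h(1)[of n], of "%s. ennreal (d s)"] by (simp add: G_def k_def)
  have dm: "(%t. ennreal (d t) * indicator {0..} t) \<in> borel_measurable (control_measure F)"
  proof -
    have "(%t. ennreal (d t * indicator {0..} t)) \<in> borel_measurable borel" using antimono_nonneg_borel[OF d(1)] by measurable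
    moreover have "ennreal (d t * indicator {0..} t) = ennreal (d t) * indicator {0..} t" for t by (auto simp: indicator_def)
    ultimately show ?thesis by (simp add: measurable_def)
  qed
  have "weighted d F = (\<integral>\<^sup>+ s. ennreal (d 0) * indicator {0} s + (SUP n. G n s) \<partial>control_measure F)"
    unfolding weighted_def Gsup by (intro nn_integral_cong) (auto simp: indicator_def)
  also have "... = ennreal (d 0) * ennreal (F 0) + (\<integral>\<^sup>+ s. (SUP n. G n s) \<partial>control_measure F)"
    using Gm by (subst nn_integral_add) (auto simp: nn_integral_cmult_indicator emeasure_control_zero[OF F])
  also have "(\<integral>\<^sup>+ s. (SUP n. G n s) \<partial>control_measure F) = (SUP n. \<integral>\<^sup>+ s. G n s \<partial>control_measure F)"
    using Gm Ginc by (intro nn_integral_monotone_convergence_SUP) (auto intro!: incseq_SucI simp: le_fun_def)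
  also have "ennreal (d 0) * ennreal (F 0) + (SUP n. \<integral>\<^sup>+ s. G n s \<partial>control_measure F) = (SUP n. dyadic_sum d F n)"
    unfolding dyadic_sum_def Gint by (subst ennreal_SUP_add_right) (auto simp: )
  finally show "weighted d F = (SUP n. dyadic_sum d F n)" .
  show "incseq (dyadic_sum d F)" unfolding dyadic_sum_def Gint[symmetric] by (intro incseq_SucI add_left_mono nn_integral_mono Ginc)
qed

context levy_paths
begin

lemma grid_drawdown_measurable:
  assumes t: "0 <= t"
  shows "(%w. grid_drawdown q b (%s. X s w) t m) \<in> borel_measurable M"
proof -
  have [measurable]: "X (t + real j / 2 ^ m) \<in> borel_measurable M" for j using t by (intro X_measurable) auto
  show ?thesis unfolding grid_drawdown_def by (intro borel_measurable_SUP) (auto simp: grid_pairs_def intro: countable_subset[OF subset_UNIV])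
qed

lemma drawdown_measurable:
  assumes q: "0 < q" and b: "0 <= b" and t: "0 <= t"
  shows "(%w. ennreal (drawdown q b (%s. X s w) t)) \<in> borel_measurable M"
proof -
  have "(%w. SUP m. grid_drawdown q b (%s. X s w) t m) \<in> borel_measurable M"
    by (intro borel_measurable_SUP grid_drawdown_measurable[OF t]) auto
  thus ?thesis by (rule measurable_cong[THEN iffD1, rotated]) (simp add: drawdown_grid[OF q b cadlag_X t])
qed

definition nu :: "real => real => ennreal" where
  "nu q b = (EE w. ennreal (drawdown q b (%s. X s w) 0))"

text \<open>On each grid the drawdown discount after \<open>t\<close> is
  \<open>exp (- q * t)\<close> times a function of the increments after \<open>t\<close>, hence
  independent of \<open>Z\<close> up to that factor; monotone convergence removes the grid.\<close>

lemma markov_drawdown: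
  assumes q: "0 < q" and b: "0 <= b" and t: "0 <= t" and Z: "Z \<in> borel_measurable (past t)"
  shows "(EE w. Z w * ennreal (drawdown q b (%s. X s w) t))
    = nu q b * (EE w. ennreal (exp (- q * t)) * Z w)"
proof -
  have [measurable]: "Z \<in> borel_measurable M" by (rule measurable_past[OF Z])
  define \<phi> where "\<phi> m y = (SUP (i, j)\<in>grid_pairs m.
     ennreal (exp (- q * (real j / 2 ^ m)) * of_bool (- (\<Sum>k\<in>{i..<j}. y k) > b)))" for m and y :: "nat => real"
  have \<phi>m: "\<phi> m \<in> borel_measurable (Pi\<^sub>M {..<4 ^ m} (%_. borel))" for m unfolding \<phi>_def
  proof (intro borel_measurable_SUP)
    show "countable (grid_pairs m)" by (rule countable_subset[OF subset_UNIV]) auto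
    fix p assume "p \<in> grid_pairs m"
    then obtain i j where p: "p = (i, j)" "i < j" "j <= 4 ^ m" by (auto simp: grid_pairs_def)
    have [measurable]: "(%y. \<Sum>k\<in>{i..<j}. y k) \<in> borel_measurable (Pi\<^sub>M {..<4 ^ m} (%_. borel :: real measure))"
      using p by (intro borel_measurable_sum measurable_component_singleton) auto
    show "(%y. case p of (i, j) => ennreal (exp (- q * (real j / 2 ^ m)) * of_bool (b < - sum y {i..<j})))
      \<in> borel_measurable (Pi\<^sub>M {..<4 ^ m} (%_. borel))" unfolding p(1) prod.case by measurable
  qed
  have gd: "grid_drawdown q b (%s. X s w) s m = ennreal (exp (- q * s)) * \<phi> m (increments (1 / 2 ^ m) (4 ^ m) s w)" for s m w
  proof -
    have tel: "- (\<Sum>k\<in>{i..<j}. increments (1 / 2 ^ m) (4 ^ m) s w k) = X (s + real i / 2 ^ m) w - X (s + real j / 2 ^ m) w"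
      if "(i, j) \<in> grid_pairs m" for i j
    proof -
      have "(\<Sum>k\<in>{i..<j}. increments (1 / 2 ^ m) (4 ^ m) s w k)
         = (\<Sum>k\<in>{i..<j}. X (s + 1 / 2 ^ m * real (Suc k)) w - X (s + 1 / 2 ^ m * real k) w)"
        using that by (intro sum.cong) (auto simp: increments_def grid_pairs_def)
      also have "... = X (s + 1 / 2 ^ m * real j) w - X (s + 1 / 2 ^ m * real i) w"
        using that by (intro sum_Suc_diff') (auto simp: grid_pairs_def)
      finally show ?thesis by simp
    qed
    have "grid_drawdown q b (%s. X s w) s m = (SUP p\<in>grid_pairs m. ennreal (exp (- q * s)) *
       (case p of (i, j) => ennreal (exp (- q * (real j / 2 ^ m)) * of_bool (- (\<Sum>k\<in>{i..<j}. increments (1 / 2 ^ m) (4 ^ m) s w k) > b))))"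
      unfolding grid_drawdown_def
    proof (rule SUP_cong[OF refl])
      fix p assume "p \<in> grid_pairs m"
      then obtain i j where p: "p = (i, j)" "(i, j) \<in> grid_pairs m" by (cases p) auto
      have "exp (- q * (s + real j / 2 ^ m)) = exp (- q * s) * exp (- q * (real j / 2 ^ m))"
        by (simp add: distrib_left exp_add[symmetric] ring_distribs)
      thus "(case p of (i, j) => ennreal (exp (- q * (s + real j / 2 ^ m)) * of_bool (b < X (s + real i / 2 ^ m) w - X (s + real j / 2 ^ m) w)))
        = ennreal (exp (- q * s)) * (case p of (i, j) => ennreal (exp (- q * (real j / 2 ^ m)) * of_bool (- (\<Sum>k\<in>{i..<j}. increments (1 / 2 ^ m) (4 ^ m) s w k) > b)))"
        unfolding p(1) prod.case tel[OF p(2)] by (simp add: ennreal_mult mult.assoc)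
    qed
    also have "... = ennreal (exp (- q * s)) * \<phi> m (increments (1 / 2 ^ m) (4 ^ m) s w)"
      unfolding \<phi>_def by (rule SUP_mult_left_ennreal[symmetric])
    finally show ?thesis .
  qed
  have one: "(EE w. Z w * grid_drawdown q b (%s. X s w) t m)
     = (EE w. grid_drawdown q b (%s. X s w) 0 m) * (EE w. ennreal (exp (- q * t)) * Z w)" for m
  proof -
    have "(EE w. Z w * grid_drawdown q b (%s. X s w) t m)
      = (EE w. (ennreal (exp (- q * t)) * Z w) * \<phi> m (increments (1 / 2 ^ m) (4 ^ m) t w))"
      unfolding gd by (intro nn_integral_cong) (simp add: mult_ac)
    also have "... = (EE w. ennreal (exp (- q * t)) * Z w) * (EE w. \<phi> m (increments (1 / 2 ^ m) (4 ^ m) 0 w))"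
      by (rule markov_increments[OF t _ _ _ \<phi>m]) (use Z in auto)
    finally show ?thesis unfolding gd by (simp add: mult.commute)
  qed
  have mono: "incseq (%m w. Z w * grid_drawdown q b (%s. X s w) t m)" for t
    by (auto simp: incseq_def le_fun_def intro!: mult_left_mono incseqD[OF grid_drawdown_incseq])
  have mono': "incseq (%m w. grid_drawdown q b (%s. X s w) 0 m)"
    by (auto simp: incseq_def le_fun_def intro!: incseqD[OF grid_drawdown_incseq])
  have "(EE w. Z w * ennreal (drawdown q b (%s. X s w) t))
    = (EE w. (SUP m. Z w * grid_drawdown q b (%s. X s w) t m))"
    by (intro nn_integral_cong) (simp add: drawdown_grid[OF q b cadlag_X t] SUP_mult_left_ennreal)
  also have "... = (SUP m. \<integral>\<^sup>+w. Z w * grid_drawdown q b (%s. X s w) t m \<partial>M)"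
    using grid_drawdown_measurable[OF t] by (intro nn_integral_monotone_convergence_SUP mono) auto
  also have "... = (SUP m. \<integral>\<^sup>+w. grid_drawdown q b (%s. X s w) 0 m \<partial>M) * (EE w. ennreal (exp (- q * t)) * Z w)"
    unfolding one by (rule SUP_mult_right_ennreal[symmetric])
  also have "(SUP m. \<integral>\<^sup>+w. grid_drawdown q b (%s. X s w) 0 m \<partial>M) = (EE w. (SUP m. grid_drawdown q b (%s. X s w) 0 m))"
    using grid_drawdown_measurable[of 0] by (intro nn_integral_monotone_convergence_SUP[symmetric] mono') auto
  also have "... = nu q b" unfolding nu_def by (intro nn_integral_cong) (simp add: drawdown_grid[OF q b cadlag_X])
  finally show ?thesis .
qed

text \<open>Conditioning at deterministic times suffices: along dyadic grids the drawdown discount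
  increases to its value at each time.\<close>

lemma expected_drawdown_weight:
  assumes q: "0 < q" and b: "0 <= b"
    and L: "\<And>t. 0 <= t ==> L t \<in> borel_measurable (past t)" "AE w in M. cumulative_path (%t. L t w)"
    and Z: "\<And>t. 0 <= t ==> Z t \<in> borel_measurable (past t)" "\<And>t w. 0 <= t ==> 0 <= Z t w"
      "AE w in M. antimono_on {0..} (%t. Z t w) & (\<forall>t\<ge>0. ((%s. Z s w) \<longlongrightarrow> Z t w) (at_right t))"
  shows "(EE w. weighted (%t. drawdown q b (%s. X s w) t * Z t w) (%t. L t w))
    = nu q b * (EE w. weighted (%t. exp (- q * t) * Z t w) (%t. L t w))"
proof -
  let ?dd = "%t w. drawdown q b (%s. X s w) t"
  define D where "D j n w = ennreal (L (real (Suc j) / 2 ^ n) w - L (real j / 2 ^ n) w)" for j n w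
  have [measurable]: "L t \<in> borel_measurable M" "Z t \<in> borel_measurable M" if "0 <= t" for t
    using L(1)[OF that] Z(1)[OF that] by (auto intro: measurable_past)
  have [measurable]: "(%w. ennreal (?dd t w)) \<in> borel_measurable M" if "0 <= t" for t by (rule drawdown_measurable[OF q b that])
  \<comment> \<open>The increment of \<open>L\<close> over a dyadic cell is known at the right end
    of the cell, and the weight is evaluated there; so the drawdown lies entirely in the
    future.\<close>
  have Dm: "D j n \<in> borel_measurable (past (real (Suc j) / 2 ^ n))" for j n
  proof -
    have "L (real (Suc j) / 2 ^ n) \<in> borel_measurable (past (real (Suc j) / 2 ^ n))" by (rule L(1)) simp
    moreover have "L (real j / 2 ^ n) \<in> borel_measurable (past (real (Suc j) / 2 ^ n))"
      by (rule past_mono[OF _ L(1)]) (auto simp: divide_right_mono)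
    ultimately show ?thesis unfolding D_def[abs_def] by measurable
  qed
  have [measurable]: "D j n \<in> borel_measurable M" for j n by (rule measurable_past[OF Dm])
  have split: "dyadic_sum (%t. d t w * Z t w) (%t. L t w) n
     = ennreal (Z 0 w) * ennreal (L 0 w) * ennreal (d 0 w)
       + (\<Sum>j. ennreal (Z (real (Suc j) / 2 ^ n) w) * D j n w * ennreal (d (real (Suc j) / 2 ^ n) w))"
    if "\<And>t. 0 <= t ==> 0 <= d t w" for d n w using that Z(2) by (simp add: dyadic_sum_def D_def ennreal_mult mult_ac)
  \<comment> \<open>Stated for a general weight because it is used twice, with the drawdown and with
    the plain discount.\<close>
  have main: "(EE w. weighted (%t. d t w * Z t w) (%t. L t w)) = (SUP n.
      (EE w. ennreal (Z 0 w) * ennreal (L 0 w) * ennreal (d 0 w))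
       + (\<Sum>j. \<integral>\<^sup>+w. ennreal (Z (real (Suc j) / 2 ^ n) w) * D j n w * ennreal (d (real (Suc j) / 2 ^ n) w) \<partial>M))"
    if d: "\<And>t w. 0 <= t ==> 0 <= d t w" "\<And>w. w \<in> space M ==> antimono_on {0..} (%t. d t w)"
      "\<And>t w. w \<in> space M ==> 0 <= t ==> ((%t. d t w) \<longlongrightarrow> d t w) (at_right t)"
      and dm: "\<And>t. 0 <= t ==> (%w. ennreal (d t w)) \<in> borel_measurable M" for d
  proof -
    note [measurable] = dm
    have path: "AE w in M. weighted (%t. d t w * Z t w) (%t. L t w) = (SUP n. dyadic_sum (%t. d t w * Z t w) (%t. L t w) n)
        & incseq (dyadic_sum (%t. d t w * Z t w) (%t. L t w))" using L(2) Z(3) AE_space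
    proof eventually_elim
      case (elim w)
      have "antimono_on {0..} (%t. d t w * Z t w)" using elim d(1,2) Z(2) by (auto simp: monotone_on_def intro!: mult_mono)
      moreover have "((%t. d t w * Z t w) \<longlongrightarrow> d t w * Z t w) (at_right t)" if "0 <= t" for t
        using elim d(3) that by (intro tendsto_mult) auto
      ultimately show ?case using weighted_dyadic[OF elim(1)] by blast
    qed
    have split': "dyadic_sum (%t. d t w * Z t w) (%t. L t w) n
     = ennreal (Z 0 w) * ennreal (L 0 w) * ennreal (d 0 w)
       + (\<Sum>j. ennreal (Z (real (Suc j) / 2 ^ n) w) * D j n w * ennreal (d (real (Suc j) / 2 ^ n) w))" for n w by (rule split) (rule d(1))
    have sm: "(%w. dyadic_sum (%t. d t w * Z t w) (%t. L t w) n) \<in> borel_measurable M" for n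
      unfolding split' by measurable
    have "(EE w. weighted (%t. d t w * Z t w) (%t. L t w)) = (EE w. (SUP n. dyadic_sum (%t. d t w * Z t w) (%t. L t w) n))"
      by (rule nn_integral_cong_AE) (use path in eventually_elim, simp)
    also have "... = (SUP n. \<integral>\<^sup>+w. dyadic_sum (%t. d t w * Z t w) (%t. L t w) n \<partial>M)"
      by (rule nn_integral_monotone_convergence_SUP_AE[OF _ sm]) (use path in eventually_elim, auto simp: incseq_Suc_iff)
    also have "... = (SUP n. (EE w. ennreal (Z 0 w) * ennreal (L 0 w) * ennreal (d 0 w))
       + (\<Sum>j. \<integral>\<^sup>+w. ennreal (Z (real (Suc j) / 2 ^ n) w) * D j n w * ennreal (d (real (Suc j) / 2 ^ n) w) \<partial>M))"
      unfolding split' by (subst nn_integral_add, measurable, subst nn_integral_suminf, measurable)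
    finally show ?thesis .
  qed
  have t0: "0 <= real (Suc j) / 2 ^ n" for j n :: nat by simp
  have mk: "(EE w. ennreal (Z (real (Suc j) / 2 ^ n) w) * D j n w * ennreal (?dd (real (Suc j) / 2 ^ n) w))
     = nu q b * (EE w. ennreal (Z (real (Suc j) / 2 ^ n) w) * D j n w * ennreal (exp (- q * (real (Suc j) / 2 ^ n))))" for j n
    using markov_drawdown[OF q b t0, of "%w. ennreal (Z (real (Suc j) / 2 ^ n) w) * D j n w" j n] Dm[of j n] Z(1)[OF t0, of j n]
    by (simp add: mult_ac)
  have mk0: "(EE w. ennreal (Z 0 w) * ennreal (L 0 w) * ennreal (?dd 0 w))
     = nu q b * (EE w. ennreal (Z 0 w) * ennreal (L 0 w) * ennreal (exp (- q * 0)))"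
    using markov_drawdown[OF q b order_refl, of "%w. ennreal (Z 0 w) * ennreal (L 0 w)"] L(1)[of 0] Z(1)[of 0] by (simp add: mult_ac)
  have expm: "((%t. exp (- q * t)) \<longlongrightarrow> exp (- q * t)) (at_right t)" "antimono_on {0..} (%t. exp (- q * t))" for t
    using q by (auto intro!: tendsto_intros simp: monotone_on_def)
  have "(EE w. weighted (%t. ?dd t w * Z t w) (%t. L t w)) = (SUP n. nu q b *
      ((EE w. ennreal (Z 0 w) * ennreal (L 0 w) * ennreal (exp (- q * 0)))
       + (\<Sum>j. \<integral>\<^sup>+w. ennreal (Z (real (Suc j) / 2 ^ n) w) * D j n w * ennreal (exp (- q * (real (Suc j) / 2 ^ n))) \<partial>M)))"
  proof (subst main[of ?dd])
    show "antimono_on {0..} (%t. ?dd t w)" for w using drawdown_antimono[OF q] by (auto simp: monotone_on_def)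
    show "(SUP n. (EE w. ennreal (Z 0 w) * ennreal (L 0 w) * ennreal (?dd 0 w))
       + (\<Sum>j. \<integral>\<^sup>+w. ennreal (Z (real (Suc j) / 2 ^ n) w) * D j n w * ennreal (?dd (real (Suc j) / 2 ^ n) w) \<partial>M))
      = (SUP n. nu q b * ((EE w. ennreal (Z 0 w) * ennreal (L 0 w) * ennreal (exp (- q * 0)))
       + (\<Sum>j. \<integral>\<^sup>+w. ennreal (Z (real (Suc j) / 2 ^ n) w) * D j n w * ennreal (exp (- q * (real (Suc j) / 2 ^ n))) \<partial>M)))"
      unfolding mk mk0 distrib_left ennreal_suminf_cmult ..
  qed (rule drawdown_bounds(1)[OF q] drawdown_right[OF q b cadlag_X] drawdown_measurable[OF q b]; assumption)+
  also have "... = nu q b * (SUP n. ((EE w. ennreal (Z 0 w) * ennreal (L 0 w) * ennreal (exp (- q * 0)))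
       + (\<Sum>j. \<integral>\<^sup>+w. ennreal (Z (real (Suc j) / 2 ^ n) w) * D j n w * ennreal (exp (- q * (real (Suc j) / 2 ^ n))) \<partial>M)))"
    by (rule SUP_mult_left_ennreal[symmetric])
  also have "... = nu q b * (EE w. weighted (%t. exp (- q * t) * Z t w) (%t. L t w))"
    by (subst main[of "%t w. exp (- q * t)"]) (use expm in auto)
  finally show ?thesis .
qed

end

section \<open>Dependence on the starting point\<close>

lemma grid_drawdown_shift: "grid_drawdown q b (%s. x + f s) t m = grid_drawdown q b f t m" by (simp add: grid_drawdown_def)

lemma grid_drawdown_restrict: "0 <= t ==> grid_drawdown q b (\<lambda>s\<in>{0..}. f s) t m = grid_drawdown q b f t m"
  by (simp add: grid_drawdown_def)

lemma levy_family_law: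
  assumes "levy_family P X" and \<phi>: "\<phi> \<in> measurable (Pi\<^sub>M {0..} (%_. borel)) N"
  shows "distr (P x) N (%w. \<phi> (\<lambda>t\<in>{0..}. X t w)) = distr (P 0) N (%w. \<phi> (\<lambda>t\<in>{0..}. x + X t w))"
    and "(%w. \<lambda>t\<in>{0..}. X t w) \<in> measurable (P x) (Pi\<^sub>M {0..} (%_. borel))"
    and "(%w. \<lambda>t\<in>{0..}. x + X t w) \<in> measurable (P 0) (Pi\<^sub>M {0..} (%_. borel))"
proof -
  have sets: "sets (P y) = sets (P 0)" and X: "0 <= t ==> X t \<in> borel_measurable (P 0)"
    and eq: "distr (P x) (Pi\<^sub>M {0..} (%_. borel)) (%w. \<lambda>t\<in>{0..}. X t w) =
          distr (P 0) (Pi\<^sub>M {0..} (%_. borel)) (%w. \<lambda>t\<in>{0..}. x + X t w)" for t y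
    using assms(1) by (auto simp: levy_family_def levy_process_def)
  have X': "0 <= t ==> X t \<in> borel_measurable (P x)" for t using X[of t] by (simp add: measurable_cong_sets[OF sets[of x] refl])
  show m1: "(%w. \<lambda>t\<in>{0..}. X t w) \<in> measurable (P x) (Pi\<^sub>M {0..} (%_. borel))"
    by (rule measurable_restrict) (use X' in auto)
  show m2: "(%w. \<lambda>t\<in>{0..}. x + X t w) \<in> measurable (P 0) (Pi\<^sub>M {0..} (%_. borel))"
    by (rule measurable_restrict) (use X in auto)
  have "distr (P x) N (\<phi> \<circ> (%w. \<lambda>t\<in>{0..}. X t w)) = distr (P 0) N (\<phi> \<circ> (%w. \<lambda>t\<in>{0..}. x + X t w))"
    using distr_distr[OF \<phi> m1] distr_distr[OF \<phi> m2] eq by simp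
  thus "distr (P x) N (%w. \<phi> (\<lambda>t\<in>{0..}. X t w)) = distr (P 0) N (%w. \<phi> (\<lambda>t\<in>{0..}. x + X t w))"
    by (simp add: comp_def)
qed

text \<open>The hypotheses relate only the laws under \<open>P x\<close> and \<open>P 0\<close>.
  Path regularity holds at every point of the common space; independence under \<open>P x\<close> is
  recovered from the product form of the joint law of the increments.\<close>

lemma levy_family_paths:
  assumes fam: "levy_family P X"
  shows "levy_paths (P x) X x"
proof -
  have ps: "prob_space (P y)" "space (P y) = space (P 0)" "sets (P y) = sets (P 0)" for y using fam by (auto simp: levy_family_def)
  have lp: "levy_process (P 0) X" using fam by (auto simp: levy_family_def)
  have X0: "0 <= t ==> X t \<in> borel_measurable (P 0)" for t using lp by (auto simp: levy_process_def)
  have X: "0 <= t ==> X t \<in> borel_measurable (P x)" for t using X0[of t] by (simp add: measurable_cong_sets[OF ps(3)[of x] refl])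
  have st0: "AE w in P 0. X 0 w = 0" using lp by (auto simp: levy_process_def)
  note law = levy_family_law[OF fam]
  interpret P0: prob_space "P 0" by (rule ps)
  interpret Px: prob_space "P x" by (rule ps)
  have incr_law: "distr (P x) borel (%w. X t w - X s w) = distr (P 0) borel (%w. X t w - X s w)"
    if "0 <= s" "0 <= t" for s t using law(1)[of "%g. g t - g s" borel x] that
    by (simp add: measurable_component_singleton borel_measurable_diff)
  show ?thesis
  proof (intro levy_paths.intro levy_paths_axioms.intro)
    show "prob_space (P x)" by (rule ps)
    show "cadlag (%t. X t w)" if "w \<in> space (P x)" for w using that lp ps(2) by (auto simp: levy_process_def)
    show "AE w in P x. X 0 w = x"
    proof -
      have "AE z in distr (P 0) borel (%w. x + X 0 w). z = x" using st0 X0[of 0] by (subst AE_distr_iff) auto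
      also have "distr (P 0) borel (%w. x + X 0 w) = distr (P x) borel (X 0)"
        using law(1)[of "%g. g 0" borel x] by (simp add: measurable_component_singleton)
      finally show ?thesis using X[of 0] by (subst (asm) AE_distr_iff) auto
    qed
    show "distr (P x) borel (%w. X (t + h) w - X t w) = distr (P x) borel (%w. X h w - X 0 w)"
      if "0 <= t" "0 <= h" for t h
    proof -
      have "distr (P 0) borel (X h) = distr (P 0) borel (%w. X h w - X 0 w)" using st0 X0[of h] X0[of 0] that by (intro distr_cong_AE) auto
      thus ?thesis using lp that by (simp add: incr_law levy_process_def)
    qed
    fix s :: "nat => real" and n :: nat assume s: "mono s" "0 <= s 0"
    have s0: "0 <= s i" for i using s monoD[of s 0 i] by linarith
    let ?D = "%i w. X (s (Suc i)) w - X (s i) w"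
    show "Px.indep_vars (%_. borel) ?D {..<n}"
    proof (cases "n = 0")
      \<comment> \<open>The criterion by product laws asks for a nonempty index set.\<close>
      case True
      thus ?thesis by (simp add: Px.indep_vars_def2 Px.indep_sets_def)
    next
      case False
      hence ne: "{..<n} ~= {}" by auto
      have "P0.indep_vars (%_. borel) ?D {..<n}" using lp s by (simp add: levy_process_def)
      hence "distr (P 0) (Pi\<^sub>M {..<n} (%_. borel)) (%w. \<lambda>i\<in>{..<n}. ?D i w) = Pi\<^sub>M {..<n} (%i. distr (P 0) borel (?D i))"
        using X0 s0 by (subst (asm) P0.indep_vars_iff_distr_eq_PiM'[OF ne]) auto
      moreover have "distr (P x) (Pi\<^sub>M {..<n} (%_. borel)) (%w. \<lambda>i\<in>{..<n}. ?D i w)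
         = distr (P 0) (Pi\<^sub>M {..<n} (%_. borel)) (%w. \<lambda>i\<in>{..<n}. ?D i w)"
      proof -
        have "(%g. \<lambda>i\<in>{..<n}. g (s (Suc i)) - g (s i)) \<in> measurable (Pi\<^sub>M {0..} (%_. borel :: real measure)) (Pi\<^sub>M {..<n} (%_. borel))"
          using s0 by (intro measurable_restrict borel_measurable_diff measurable_component_singleton) auto
        from law(1)[OF this, of x] show ?thesis using s0 by (simp cong: restrict_cong)
      qed
      ultimately have "distr (P x) (Pi\<^sub>M {..<n} (%_. borel)) (%w. \<lambda>i\<in>{..<n}. ?D i w) = Pi\<^sub>M {..<n} (%i. distr (P x) borel (?D i))"
        using s0 by (simp add: incr_law)
      thus ?thesis using X s0 by (subst Px.indep_vars_iff_distr_eq_PiM'[OF ne]) auto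
    qed
  qed (rule X)
qed

text \<open>Drawdowns do not change when the path is shifted by a constant.\<close>

lemma levy_family_nu:
  assumes fam: "levy_family P X" and q: "0 < q" and b: "0 <= b"
  shows "levy_paths.nu (P x) X q b = levy_paths.nu (P 0) X q b"
proof -
  interpret Px: levy_paths "P x" X x by (rule levy_family_paths[OF fam])
  interpret P0: levy_paths "P 0" X 0 by (rule levy_family_paths[OF fam])
  define \<phi> where "\<phi> g = (SUP m. grid_drawdown q b g 0 m)" for g
  have \<phi>: "\<phi> \<in> borel_measurable (Pi\<^sub>M {0..} (%_. borel))"
  proof -
    have [measurable]: "(\<lambda>g :: real => real. g (real j / 2 ^ m)) \<in> borel_measurable (Pi\<^sub>M {0..} (%_. borel))" for j m
      by (rule measurable_component_singleton) simp
    show ?thesis unfolding \<phi>_def grid_drawdown_def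
      by (intro borel_measurable_SUP) (auto simp: grid_pairs_def intro: countable_subset[OF subset_UNIV])
  qed
  note law = levy_family_law[OF fam \<phi>, of x]
  have "Px.nu q b = (\<integral>\<^sup>+w. \<phi> (\<lambda>t\<in>{0..}. X t w) \<partial>P x)" unfolding Px.nu_def \<phi>_def
    by (intro nn_integral_cong) (simp add: grid_drawdown_restrict drawdown_grid[OF q b Px.cadlag_X])
  also have "... = (\<integral>\<^sup>+z. z \<partial>distr (P x) borel (%w. \<phi> (\<lambda>t\<in>{0..}. X t w)))"
    using measurable_compose[OF law(2) \<phi>] by (simp add: nn_integral_distr)
  also have "... = (\<integral>\<^sup>+w. \<phi> (\<lambda>t\<in>{0..}. x + X t w) \<partial>P 0)"
    unfolding law(1) using measurable_compose[OF law(3) \<phi>] by (simp add: nn_integral_distr)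
  also have "... = P0.nu q b" unfolding P0.nu_def \<phi>_def
    by (intro nn_integral_cong) (simp add: grid_drawdown_restrict grid_drawdown_shift drawdown_grid[OF q b P0.cadlag_X])
  finally show ?thesis .
qed

section \<open>The drawdown transform as a function of the barrier\<close>

lemma drawdown_barrier_mono:
  assumes "0 < q" "b <= b'" "0 <= t"
  shows "drawdown q b' f t <= drawdown q b f t" unfolding drawdown_def
proof (rule sup_discount_mono)
  fix u assume "u \<in> {u. t < u & (\<exists>r\<in>{t..u}. b' < f r - f u)}"
  hence "u \<in> {u. t < u & (\<exists>r\<in>{t..u}. b < f r - f u)}" using assms(2) by force
  thus "\<exists>u'\<in>{u. t < u & (\<exists>r\<in>{t..u}. b < f r - f u)}. u' <= u" by blast
qed (use assms in auto)

text \<open>A drawdown exceeding \<open>b\<close> also exceeds \<open>b + 1 / real (Suc n)\<close>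
  for some \<open>n\<close>. This right continuity carries the inequality that defines the optimal
  barrier over to the infimum.\<close>

lemma drawdown_barrier_right:
  assumes q: "0 < q"
  shows "ennreal (drawdown q b f 0) = (SUP n. ennreal (drawdown q (b + 1 / real (Suc n)) f 0))"
proof (rule antisym)
  show "(SUP n. ennreal (drawdown q (b + 1 / real (Suc n)) f 0)) <= ennreal (drawdown q b f 0)"
    by (intro SUP_least ennreal_leI drawdown_barrier_mono[OF q]) auto
  show "ennreal (drawdown q b f 0) <= (SUP n. ennreal (drawdown q (b + 1 / real (Suc n)) f 0))"
  proof (rule ccontr)
    assume "~ ?thesis"
    hence less: "(SUP n. ennreal (drawdown q (b + 1 / real (Suc n)) f 0)) < ennreal (drawdown q b f 0)" by simp
    define s where "s = (SUP n. ennreal (drawdown q (b + 1 / real (Suc n)) f 0))"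
    have "s < ennreal (drawdown q b f 0)" using less by (simp only: s_def)
    then obtain y where y: "0 <= y" "s = ennreal y" by (cases s) auto
    note y = y[unfolded s_def]
    have yd: "y < drawdown q b f 0" using less y by (simp add: ennreal_less_iff)
    have "{u. 0 < u & (\<exists>r\<in>{0..u}. b < f r - f u)} \<subseteq> {0..}" by auto
    from less_sup_discount[OF q this yd[unfolded drawdown_def] y(1)]
    obtain u r where u: "0 < u" "0 <= r" "r <= u" "b < f r - f u" "y < exp (- q * u)" by auto
    obtain n where n: "1 / real (Suc n) < f r - f u - b" using nat_approx_posE[of "f r - f u - b"] u by auto
    have S: "{u. 0 < u & (\<exists>r\<in>{0..u}. b + 1 / real (Suc n) < f r - f u)} \<subseteq> {0..}" by auto
    have "exp (- q * u) <= drawdown q (b + 1 / real (Suc n)) f 0" unfolding drawdown_def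
      by (rule sup_discount_upper[OF q S]) (use u n in \<open>auto intro!: bexI[of _ r]\<close>)
    hence "ennreal y < ennreal (drawdown q (b + 1 / real (Suc n)) f 0)" using u y by (simp add: ennreal_less_iff)
    also have "... <= (SUP n. ennreal (drawdown q (b + 1 / real (Suc n)) f 0))" by (rule SUP_upper) simp
    finally show False using y by simp
  qed
qed

context levy_paths
begin

lemma nu_le_1: "0 < q ==> nu q b <= 1"
proof -
  assume "0 < q"
  hence "nu q b <= (EE w. 1)"
    unfolding nu_def by (intro nn_integral_mono) (use drawdown_bounds(3)[of q 0] in \<open>auto simp: ennreal_le_1\<close>)
  thus ?thesis by (simp add: emeasure_space_1)
qed

lemma nu_antimono: "0 < q ==> b <= b' ==> nu q b' <= nu q b"
  unfolding nu_def by (intro nn_integral_mono ennreal_leI drawdown_barrier_mono) auto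

lemma nu_right:
  assumes q: "0 < q" and b: "0 <= b"
  shows "nu q b = (SUP n. nu q (b + 1 / real (Suc n)))"
proof -
  have "incseq (%n w. ennreal (drawdown q (b + 1 / real (Suc n)) (%s. X s w) 0))"
    by (intro incseq_SucI le_funI ennreal_leI drawdown_barrier_mono[OF q]) (auto simp: frac_le)
  thus ?thesis unfolding nu_def drawdown_barrier_right[OF q, of b]
    by (intro nn_integral_monotone_convergence_SUP drawdown_measurable[OF q]) (use b in auto)
qed

text \<open>A path bounded by \<open>B\<close> on \<open>[0, T]\<close> has no drawdown of more than
  \<open>2 * B\<close> before \<open>T\<close>. Hence large barriers satisfy the defining
  inequality, and the optimal barrier is the infimum of a nonempty set.\<close>

lemma nu_small:
  assumes q: "0 < q" and e: "0 < (e :: real)"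
  shows "\<exists>b>0. nu q b < ennreal e"
proof -
  have "(%n. \<integral>\<^sup>+w. ennreal (drawdown q (real n) (%s. X s w) 0) \<partial>M) \<longlonglongrightarrow> (EE w. 0)"
  proof (rule nn_integral_dominated_convergence[where w = "%_. 1"])
    show "AE w in M. (%n. ennreal (drawdown q (real n) (%s. X s w) 0)) \<longlonglongrightarrow> 0"
    proof (rule AE_I2)
      fix w assume w: "w \<in> space M"
      have "(%n. drawdown q (real n) (%s. X s w) 0) \<longlonglongrightarrow> 0"
      proof (rule LIMSEQ_I)
        fix y :: real assume y: "0 < y"
        define T where "T = max 0 (- ln y / q) + 1"
        have T: "0 < T" "exp (- q * T) < y"
        proof -
          show "0 < T" by (simp add: T_def)
          have "- ln y / q < T" by (simp add: T_def)
          hence "- q * T < ln y" using q by (simp add: field_simps)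
          hence "exp (- q * T) < exp (ln y)" by simp
          thus "exp (- q * T) < y" using y by simp
        qed
        obtain B where B: "0 <= B" "\<And>v. v \<in> {0..T} ==> \<bar>X v w\<bar> <= B"
          using cadlag_bounded[OF cadlag_X[OF w] order_refl, of T] by auto
        obtain n0 where n0: "2 * B < real n0" using reals_Archimedean2 by blast
        have "\<bar>drawdown q (real n) (%s. X s w) 0 - 0\<bar> < y" if "n0 <= n" for n
        proof -
          have "{u. 0 < u & (\<exists>r\<in>{0..u}. real n < X r w - X u w)} \<subseteq> {0..}" by auto
          hence "drawdown q (real n) (%s. X s w) 0 <= exp (- q * T)" unfolding drawdown_def
          proof (rule sup_discount_le_exp[OF q])
            fix u assume "u \<in> {u. 0 < u & (\<exists>r\<in>{0..u}. real n < X r w - X u w)}"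
            then obtain v where v: "0 < u" "0 <= v" "v <= u" "real n < X v w - X u w" by auto
            show "T <= u"
            proof (rule ccontr)
              assume "~ T <= u"
              hence "\<bar>X u w\<bar> <= B" "\<bar>X v w\<bar> <= B" using B(2)[of u] B(2)[of v] v by auto
              moreover have "real n0 <= real n" using that by simp
              ultimately show False using v(4) n0 by linarith
            qed
          qed
          with T(2) drawdown_bounds(1)[OF q, of 0] show ?thesis by simp
        qed
        thus "\<exists>n0. \<forall>n\<ge>n0. norm (drawdown q (real n) (%s. X s w) 0 - 0) < y" by auto
      qed
      hence "(%n. ennreal (drawdown q (real n) (%s. X s w) 0)) \<longlonglongrightarrow> ennreal 0" by (rule tendsto_ennrealI)
      thus "(%n. ennreal (drawdown q (real n) (%s. X s w) 0)) \<longlonglongrightarrow> 0" by simp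
    qed
  qed (use drawdown_bounds(3)[OF q, of 0] in \<open>auto simp: ennreal_le_1 emeasure_space_1 intro!: drawdown_measurable[OF q]\<close>)
  hence "(%n. nu q (real n)) \<longlonglongrightarrow> 0" by (simp add: nu_def)
  hence "\<forall>\<^sub>F n in sequentially. nu q (real n) < ennreal e" by (rule order_tendstoD) (use e in simp)
  hence "\<forall>\<^sub>F n in sequentially. nu q (real n) < ennreal e & 0 < n" using eventually_gt_at_top[of 0] by eventually_elim simp
  then obtain n where "nu q (real n) < ennreal e" "0 < n" by (auto dest: eventually_happens)
  thus ?thesis by (intro exI[of _ "real n"]) auto
qed

text \<open>Started at \<open>b\<close>, the running maximum is at least \<open>b\<close>, so the
  positive part in the reflection is inactive and passing below 0 is a drawdown of more than
  \<open>b\<close>.\<close>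

lemma kappa_drawdown:
  assumes w: "w \<in> space M" and x: "X 0 w = b" and q: "0 < q"
  shows "discount q (kappa_below X b 0 w) = drawdown q b (%s. X s w) 0"
proof -
  have "reflected_above X b t w < 0 \<longleftrightarrow> (\<exists>r\<in>{0..t}. b < X r w - X t w)" if t: "0 < t" for t
  proof -
    obtain B where "\<forall>v\<in>{0..t}. \<bar>X v w\<bar> <= B" using cadlag_bounded[OF cadlag_X[OF w] order_refl, of t] by blast
    hence bdd: "bdd_above ((%s. X s w) ` {0..t})" by (intro bdd_aboveI[of _ B]) force
    have "b <= (SUP s\<in>{0..t}. X s w)" unfolding x[symmetric] using t by (intro cSUP_upper[OF _ bdd]) auto
    hence "reflected_above X b t w < 0 \<longleftrightarrow> X t w + b < (SUP s\<in>{0..t}. X s w)" by (simp add: reflected_above_def) linarith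
    also have "... \<longleftrightarrow> (\<exists>r\<in>{0..t}. X t w + b < X r w)" using t by (intro less_cSUP_iff[OF _ bdd]) auto
    finally show ?thesis by (simp add: algebra_simps)
  qed
  hence "{t. 0 < t & reflected_above X b t w < 0} = {t. 0 < t & (\<exists>r\<in>{0..t}. b < X r w - X t w)}" by blast
  thus ?thesis unfolding kappa_below_def discount_first_time[OF q order_refl] drawdown_def by simp
qed

text \<open>Measurability concerns the whole space, also the null set where \<open>X 0\<close>
  differs from \<open>b\<close>. There the running maximum may stay below \<open>b\<close>, which
  accounts for the alternative \<open>X t w < 0\<close>.\<close>

lemma kappa_measurable:
  assumes q: "0 < q"
  shows "(%w. discount q (kappa_below X b 0 w)) \<in> borel_measurable M"
proof (rule borel_measurableI_greater)
  fix y :: real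
  define Q where "Q = \<rat> \<inter> {0::real..}"
  have Q: "countable Q" unfolding Q_def by (rule countable_subset[OF _ countable_rat]) auto
  have XQ[measurable]: "X t \<in> borel_measurable M" if "t \<in> Q" for t using that by (intro X_measurable) (auto simp: Q_def)
  have kd: "discount q (kappa_below X b 0 w) = sup_discount q {t. 0 < t & reflected_above X b t w < 0}" for w
    unfolding kappa_below_def by (rule discount_first_time[OF q order_refl])
  have S: "{t. 0 < t & reflected_above X b t w < 0} \<subseteq> {0..}" for w by auto
  show "{w\<in>space M. y < discount q (kappa_below X b 0 w)} \<in> sets M"
  proof (cases "0 <= y")
    case False
    hence "y < discount q (kappa_below X b 0 w)" for w unfolding kd using sup_discount_nonneg[OF q S[of w]] by linarith
    hence "{w\<in>space M. y < discount q (kappa_below X b 0 w)} = space M" by simp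
    thus ?thesis by simp
  next
    case True
    have refl: "reflected_above X b t w < 0 \<longleftrightarrow> X t w < 0 \<or> (\<exists>r\<in>{0..t}. X t w + b < X r w)"
      if w: "w \<in> space M" and t: "0 < t" for t w
    proof -
      obtain B where "\<forall>v\<in>{0..t}. \<bar>X v w\<bar> <= B" using cadlag_bounded[OF cadlag_X[OF w] order_refl, of t] by blast
      hence bdd: "bdd_above ((%s. X s w) ` {0..t})" by (intro bdd_aboveI[of _ B]) force
      have "reflected_above X b t w < 0 \<longleftrightarrow> X t w < 0 \<or> X t w + b < (SUP s\<in>{0..t}. X s w)"
        by (simp add: reflected_above_def) linarith
      also have "X t w + b < (SUP s\<in>{0..t}. X s w) \<longleftrightarrow> (\<exists>r\<in>{0..t}. X t w + b < X r w)"
        using t by (intro less_cSUP_iff[OF _ bdd]) auto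
      finally show ?thesis .
    qed
    have eq: "{w\<in>space M. y < discount q (kappa_below X b 0 w)}
      = (\<Union>t\<in>Q. {w\<in>space M. 0 < t & y < exp (- q * t) & X t w < 0})
        \<union> (\<Union>t\<in>Q. \<Union>r\<in>Q. {w\<in>space M. 0 < t & r <= t & y < exp (- q * t) & X t w + b < X r w})" (is "?A = ?B")
    proof (intro set_eqI iffI)
      fix w assume "w \<in> ?A"
      hence w: "w \<in> space M" and less: "y < sup_discount q {t. 0 < t & reflected_above X b t w < 0}" by (auto simp: kd)
      from less_sup_discount[OF q S less True] obtain t where t: "0 < t" "reflected_above X b t w < 0" "y < exp (- q * t)" by auto
      have "((%x. exp (- q * x)) \<longlongrightarrow> exp (- q * t)) (at_right t)" by (intro tendsto_intros)
      from order_tendstoD(1)[OF this t(3)]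
      obtain t1 where t1: "t1 > t" "\<And>v. t < v ==> v < t1 ==> y < exp (- q * v)"
        by (auto simp: eventually_at_right[OF less_add_one])
      note near = cadlag_right_near[OF cadlag_X[OF w]]
      from t(2) refl[OF w t(1)] consider "X t w < 0" | r where "0 <= r" "r <= t" "X t w + b < X r w" by auto
      thus "w \<in> ?B"
      proof cases
        case 1
        obtain t2 where t2: "t2 > t" "\<And>v. t <= v ==> v < t2 ==> \<bar>X v w - X t w\<bar> < - X t w"
          using near[of t "- X t w"] t 1 by auto
        obtain v where v: "v \<in> \<rat>" "t < v" "v < min t1 t2" using Rats_dense_in_real[of t "min t1 t2"] t1 t2 by auto
        hence "X v w < 0" using t2(2)[of v] by auto
        thus ?thesis using v t1(2)[of v] t w by (auto simp: Q_def intro!: bexI[of _ v])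
      next
        case 2
        define e where "e = (X r w - (X t w + b)) / 2"
        have e: "0 < e" using 2 by (simp add: e_def)
        obtain t2 where t2: "t2 > t" "\<And>v. t <= v ==> v < t2 ==> \<bar>X v w - X t w\<bar> < e"
          using near[of t e] t e by auto
        obtain v where v: "v \<in> \<rat>" "t < v" "v < min t1 t2" using Rats_dense_in_real[of t "min t1 t2"] t1 t2 by auto
        obtain r2 where r2: "r2 > r" "\<And>v. r <= v ==> v < r2 ==> \<bar>X v w - X r w\<bar> < e"
          using near[of r e] 2 e by auto
        obtain w' where w': "w' \<in> \<rat>" "r < w'" "w' < min r2 v" using Rats_dense_in_real[of r "min r2 v"] r2 v 2 by auto
        have "\<bar>X v w - X t w\<bar> < e" "\<bar>X w' w - X r w\<bar> < e" using t2(2)[of v] r2(2)[of w'] v w' by auto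
        moreover have "X r w = X t w + b + 2 * e" by (simp add: e_def field_simps)
        ultimately have "X v w + b < X w' w" by linarith
        moreover have "v \<in> Q" "w' \<in> Q" "0 < v" "w' <= v" "y < exp (- q * v)" using v w' 2 t t1(2)[of v] by (auto simp: Q_def)
        ultimately show ?thesis using w by blast
      qed
    next
      fix w assume B: "w \<in> ?B"
      have hit: "w \<in> ?A" if t: "w \<in> space M" "0 < t" "y < exp (- q * t)" "X t w < 0 \<or> (\<exists>r\<in>{0..t}. X t w + b < X r w)" for t
      proof -
        have "t \<in> {t. 0 < t & reflected_above X b t w < 0}" using refl t by auto
        from sup_discount_upper[OF q S this] show "w \<in> ?A" using t by (simp add: kd)
      qed
      from B show "w \<in> ?A"
      proof (elim UnE UN_E CollectE conjE)
        fix t r assume "t \<in> Q" "r \<in> Q" "w \<in> space M" "0 < t" "r <= t" "y < exp (- q * t)" "X t w + b < X r w"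
        thus ?thesis by (intro hit[of t]) (auto simp: Q_def)
      qed (rule hit, auto)
    qed
    have "{w\<in>space M. 0 < t & y < exp (- q * t) & X t w < 0} \<in> sets M" if "t \<in> Q" for t using XQ[OF that] by measurable
    moreover have "{w\<in>space M. 0 < t & r <= t & y < exp (- q * t) & X t w + b < X r w} \<in> sets M" if "t \<in> Q" "r \<in> Q" for t r
      using XQ[OF that(1)] XQ[OF that(2)] by measurable
    ultimately show ?thesis unfolding eq by (intro sets.Un sets.countable_UN'[OF Q]) (auto intro!: sets.countable_UN'[OF Q])
  qed
qed

end

lemma nu_low_eq:
  assumes fam: "levy_family P X" and q: "0 < q" and b: "0 <= b"
  shows "ennreal (nu_low P X q b) = levy_paths.nu (P 0) X q b"
proof -
  interpret Pb: levy_paths "P b" X b by (rule levy_family_paths[OF fam])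
  have AE: "AE w in P b. discount q (kappa_below X b 0 w) = drawdown q b (%s. X s w) 0"
    using Pb.start AE_space by eventually_elim (rule Pb.kappa_drawdown[OF _ _ q])
  have m: "(%w. drawdown q b (%s. X s w) 0) \<in> borel_measurable (P b)"
  proof -
    have "(%w. enn2real (ennreal (drawdown q b (%s. X s w) 0))) \<in> borel_measurable (P b)"
      using Pb.drawdown_measurable[OF q b order_refl] by measurable
    thus ?thesis using drawdown_bounds(1)[OF q order_refl] by simp
  qed
  have "nu_low P X q b = (\<integral>w. drawdown q b (%s. X s w) 0 \<partial>P b)"
    unfolding nu_low_def by (rule integral_cong_AE[OF Pb.kappa_measurable[OF q] m AE])
  moreover have "integrable (P b) (%w. drawdown q b (%s. X s w) 0)" using drawdown_bounds[OF q order_refl] m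
    by (intro Pb.integrable_const_bound[where B = 1]) auto
  ultimately have "ennreal (nu_low P X q b) = (\<integral>\<^sup>+w. ennreal (drawdown q b (%s. X s w) 0) \<partial>P b)"
    using drawdown_bounds(1)[OF q order_refl] by (simp add: nn_integral_eq_integral)
  thus ?thesis using levy_family_nu[OF fam q b, of b] by (simp add: Pb.nu_def)
qed

section \<open>Integrable majorant of the path\<close>

text \<open>Within a unit cell the discount is at most the one at its left end, which turns the
  integral into a series.\<close>

lemma discounted_integral_grid:
  assumes F: "cumulative_path F" and q: "0 < q"
  shows "discounted_integral q F <= ennreal (F 0) + (\<Sum>j. ennreal (exp (- q * real j)) * ennreal (F (real (Suc j)) - F (real j)))"
proof -
  let ?g = "%s. ennreal (exp (- q * (s - 1)))"
  have "discounted_integral q F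
     <= (\<integral>\<^sup>+ s. indicator {0} s + ?g (1 * of_int \<lceil>s / 1\<rceil>) * indicator {0<..} s \<partial>control_measure F)"
    unfolding discounted_integral_weighted weighted_def
  proof (intro nn_integral_mono)
    fix s :: real
    show "ennreal (exp (- q * s)) * indicator {0..} s <= indicator {0} s + ?g (1 * of_int \<lceil>s / 1\<rceil>) * indicator {0<..} s"
    proof (cases "0 < s")
      case True
      have "real_of_int \<lceil>s\<rceil> - 1 <= s" by linarith
      hence "q * (real_of_int \<lceil>s\<rceil> - 1) <= q * s" using q by simp
      hence "exp (- q * s) <= exp (- q * (real_of_int \<lceil>s\<rceil> - 1))" by simp
      thus ?thesis using True by (simp add: ennreal_leI)
    qed (auto simp: indicator_def)
  qed
  also have "... = ennreal (F 0) + (\<integral>\<^sup>+ s. ?g (1 * of_int \<lceil>s / 1\<rceil>) * indicator {0<..} s \<partial>control_measure F)"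
  proof (subst nn_integral_add)
    have "(\<lambda>s::real. ?g (1 * of_int \<lceil>s / 1\<rceil>)) = (%i. ?g (1 * of_int i)) \<circ> (\<lambda>s::real. \<lceil>s / 1\<rceil>)" by auto
    moreover have "... \<in> borel_measurable borel" by (rule measurable_comp[where N = "count_space UNIV"]) auto
    ultimately have "(\<lambda>s::real. ?g (1 * of_int \<lceil>s / 1\<rceil>)) \<in> borel_measurable borel" by simp
    hence "(\<lambda>s::real. ?g (1 * of_int \<lceil>s / 1\<rceil>) * indicator {0<..} s) \<in> borel_measurable borel" by measurable
    thus "(\<lambda>s::real. ?g (1 * of_int \<lceil>s / 1\<rceil>) * indicator {0<..} s) \<in> borel_measurable (control_measure F)"
      by (simp add: measurable_def)
  qed (auto simp: emeasure_control_zero[OF F])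
  also have "(\<integral>\<^sup>+ s. ?g (1 * of_int \<lceil>s / 1\<rceil>) * indicator {0<..} s \<partial>control_measure F)
    = (\<Sum>j. ?g (1 * real (Suc j)) * ennreal (F (1 * real (Suc j)) - F (1 * real j)))" by (rule grid_integral[OF F]) simp
  finally show ?thesis by simp
qed

context levy_paths
begin

text \<open>The largest displacement from \<open>X k\<close> during the unit time after
  \<open>k\<close>, along dyadic times so that it is measurable; by right continuity nothing is
  lost.\<close>

definition block :: "real => 'w => ennreal" where
  "block k w = (SUP n. SUP j\<in>{..(2::nat) ^ n}. ennreal \<bar>X (k + real j / 2 ^ n) w - X k w\<bar>)"

lemma block_measurable [measurable]: "0 <= k ==> block k \<in> borel_measurable M"
proof -
  assume k: "0 <= k"
  have [measurable]: "X (k + real j / 2 ^ n) \<in> borel_measurable M" "X k \<in> borel_measurable M" for j n using k by (auto intro!: X_measurable)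
  show ?thesis unfolding block_def[abs_def] by measurable
qed

lemma block_upper:
  assumes w: "w \<in> space M" and k: "0 <= k" and s: "0 <= s" "s <= 1"
  shows "ennreal \<bar>X (k + s) w - X k w\<bar> <= block k w"
proof -
  define x :: "nat => real" where "x n = 1 / 2 ^ n * of_int \<lceil>s / (1 / 2 ^ n)\<rceil>" for n
  have h: "(0::real) < 1 / 2 ^ n" "(%n. (1::real) / 2 ^ n) \<longlonglongrightarrow> 0" for n :: nat
    using LIMSEQ_divide_realpow_zero[of 2 1] by auto
  note xx = grid_right[of "%n. 1 / 2 ^ n", OF h, where s = s, folded x_def]
  have "(%n. k + x n) \<longlonglongrightarrow> k + s" using xx(1) by (intro tendsto_intros)
  from right_continuous_seq[OF cadlag_right[OF cadlag_X[OF w]] this]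
  have "(%n. X (k + x n) w) \<longlonglongrightarrow> X (k + s) w" using k s xx(2) by auto
  hence "(%n. \<bar>X (k + x n) w - X k w\<bar>) \<longlonglongrightarrow> \<bar>X (k + s) w - X k w\<bar>" by (intro tendsto_intros)
  hence lim: "(%n. ennreal \<bar>X (k + x n) w - X k w\<bar>) \<longlonglongrightarrow> ennreal \<bar>X (k + s) w - X k w\<bar>" by (rule tendsto_ennrealI)
  have le: "ennreal \<bar>X (k + x n) w - X k w\<bar> <= block k w" for n
  proof -
    define j where "j = nat \<lceil>s / (1 / 2 ^ n)\<rceil>"
    have "s / (1 / 2 ^ n) <= of_int (2 ^ n)" using s by simp
    hence le: "\<lceil>s / (1 / 2 ^ n)\<rceil> <= 2 ^ n" by (simp only: ceiling_le)
    have pos: "0 <= \<lceil>s / (1 / 2 ^ n)\<rceil>" using s by (simp add: zero_le_ceiling less_le_trans[of _ 0])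
    have "j <= 2 ^ n" using le by (simp add: j_def nat_le_iff)
    moreover have "x n = real j / 2 ^ n" unfolding x_def j_def using pos by (simp add: of_nat_nat)
    ultimately show ?thesis unfolding block_def by (intro SUP_upper2[of n] SUP_upper2[of j]) auto
  qed
  show ?thesis by (rule LIMSEQ_le_const2[OF lim]) (use le in blast)
qed

lemma block_finite:
  assumes w: "w \<in> space M" and k: "0 <= k"
  shows "block k w < \<top>"
proof -
  obtain B where B: "0 <= B" "\<forall>x\<in>{0..k + 1}. \<bar>X x w\<bar> <= B"
    using cadlag_bounded[OF cadlag_X[OF w] order_refl, of "k + 1"] by blast
  have "block k w <= ennreal (2 * B)" unfolding block_def
  proof (intro SUP_least ennreal_leI)
    fix n j assume "j \<in> {..(2::nat) ^ n}"
    hence "real j <= 2 ^ n" by (metis atMost_iff of_nat_le_iff of_nat_numeral of_nat_power)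
    hence "real j / 2 ^ n <= 1" by simp
    hence "\<bar>X (k + real j / 2 ^ n) w\<bar> <= B" "\<bar>X k w\<bar> <= B" using B(2) k by auto
    thus "\<bar>X (k + real j / 2 ^ n) w - X k w\<bar> <= 2 * B" by linarith
  qed
  also have "... < \<top>" by simp
  finally show ?thesis .
qed

lemma increment_law:
  assumes t: "0 <= t" and s: "0 <= s" and B: "B \<in> sets borel"
  shows "prob {w\<in>space M. X (t + s) w - X t w \<in> B} = prob {w\<in>space M. X s w - X 0 w \<in> B}"
proof -
  have [measurable]: "X (t + s) \<in> borel_measurable M" "X t \<in> borel_measurable M" "X s \<in> borel_measurable M" "X 0 \<in> borel_measurable M"
    using t s by auto
  have "measure (distr M borel (%w. X (t + s) w - X t w)) B = measure (distr M borel (%w. X s w - X 0 w)) B"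
    using stationary[OF t s] by simp
  thus ?thesis using B by (simp add: measure_distr vimage_def Int_def conj_commute)
qed

lemma increment_indep:
  assumes t: "0 <= t" and s: "0 < s" and A: "A \<in> sets (past t)" and B: "B \<in> sets borel"
  shows "prob (A \<inter> {w\<in>space M. X (t + s) w - X t w \<in> B}) = prob A * prob {w\<in>space M. X s w - X 0 w \<in> B}"
proof -
  let ?E = "{y \<in> space (Pi\<^sub>M {..<1::nat} (%_. borel :: real measure)). y 0 \<in> B}"
  have "(%y. y 0) \<in> borel_measurable (Pi\<^sub>M {..<1::nat} (%_. borel :: real measure))"
    by (rule measurable_component_singleton) simp
  from measurable_sets[OF this B] have E: "?E \<in> sets (Pi\<^sub>M {..<1::nat} (%_. borel :: real measure))"
    by (simp add: vimage_def Int_def conj_commute)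
  have "increments s 1 t -` ?E \<inter> space M = {w\<in>space M. X (t + s) w - X t w \<in> B}" by (auto simp: increments_def space_PiM)
  thus ?thesis using past_increments_indep[OF t s A E] increment_law[OF t _ B, of s] s by simp
qed

text \<open>One constant for all \<open>s\<close> in the unit interval: the block maximum is finite
  at every sample point, so it exceeds a large \<open>n\<close> with probability below one
  half.\<close>

lemma tight: "\<exists>c\<ge>0. \<forall>s\<in>{0..1}. prob {w\<in>space M. \<bar>X s w - X 0 w\<bar> > c} <= 1 / 2"
proof -
  define A where "A n = {w\<in>space M. block 0 w > of_nat n}" for n :: nat
  have A: "A n \<in> events" for n unfolding A_def by measurable
  have "(%n. prob (A n)) \<longlonglongrightarrow> prob (\<Inter>n. A n)"
  proof (rule finite_Lim_measure_decseq)
    show "decseq A" unfolding A_def decseq_def by (auto intro: le_less_trans[rotated] simp: of_nat_mono)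
  qed (use A in auto)
  moreover have "(\<Inter>n. A n) = {}"
  proof (rule ccontr)
    assume "(\<Inter>n. A n) ~= {}"
    then obtain w where w: "\<And>n. w \<in> A n" by auto
    hence *: "w \<in> space M" "\<And>n. of_nat n < block 0 w" by (auto simp: A_def)
    then obtain r where r: "0 <= r" "block 0 w = ennreal r" using block_finite[of w 0] by (cases "block 0 w") auto
    obtain n where "r < real n" using reals_Archimedean2 by blast
    thus False using *(2)[of n] r by (simp add: ennreal_of_nat_eq_real_of_nat ennreal_less_iff)
  qed
  ultimately have "(%n. prob (A n)) \<longlonglongrightarrow> 0" by simp
  hence "\<forall>\<^sub>F n in sequentially. prob (A n) < 1 / 2" by (rule order_tendstoD) simp
  then obtain n where n: "prob (A n) < 1 / 2" by (auto dest: eventually_happens)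
  show ?thesis
  proof (intro exI[of _ "real n"] conjI ballI)
    fix s :: real assume s: "s \<in> {0..1}"
    have "{w\<in>space M. \<bar>X s w - X 0 w\<bar> > real n} \<subseteq> A n"
    proof
      fix w assume w: "w \<in> {w\<in>space M. \<bar>X s w - X 0 w\<bar> > real n}"
      hence "ennreal (real n) < ennreal \<bar>X s w - X 0 w\<bar>" by (simp add: ennreal_less_iff)
      also have "... <= block 0 w" using block_upper[of w 0 s] s w by simp
      finally show "w \<in> A n" using w by (simp add: A_def ennreal_of_nat_eq_real_of_nat)
    qed
    hence "prob {w\<in>space M. \<bar>X s w - X 0 w\<bar> > real n} <= prob (A n)" using A by (intro finite_measure_mono)
    thus "prob {w\<in>space M. \<bar>X s w - X 0 w\<bar> > real n} <= 1 / 2" using n by simp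
  qed simp
qed

text \<open>Ottaviani's inequality. At the first grid time with displacement above
  \<open>u + c\<close> the remaining increment is independent of the past and at most
  \<open>c\<close> with probability at least one half; then the final displacement is still above
  \<open>u\<close>.\<close>

lemma ottaviani:
  assumes k: "0 <= k" and c: "0 <= c" "\<And>s. s \<in> {0..1} ==> prob {w\<in>space M. \<bar>X s w - X 0 w\<bar> > c} <= 1 / 2"
    and u: "0 <= u"
  shows "prob {w\<in>space M. \<exists>j\<le>(2::nat) ^ n. \<bar>X (k + real j / 2 ^ n) w - X k w\<bar> > u + c}
    <= 2 * prob {w\<in>space M. \<bar>X (k + 1) w - X k w\<bar> > u}"
proof -
  let ?N = "(2::nat) ^ n"
  define T where "T j = k + real j / 2 ^ n" for j :: nat
  define S where "S j w = X (T j) w - X k w" for j w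
  have T: "0 <= T j" for j using k by (simp add: T_def)
  have TN: "T ?N = k + 1" by (simp add: T_def)
  have Tmono: "i <= j ==> T i <= T j" for i j by (simp add: T_def divide_right_mono)
  have kT: "k <= T j" for j by (simp add: T_def)
  define A where "A j = {w\<in>space M. \<bar>S j w\<bar> > u + c & (\<forall>i\<in>{..<j}. \<bar>S i w\<bar> <= u + c)}" for j
  have Apast: "A j \<in> sets (past (T j))" for j
  proof -
    have Sm: "S i \<in> borel_measurable (past (T j))" if "i <= j" for i
      unfolding S_def using Tmono[OF that] T k kT by (intro borel_measurable_diff X_past) auto
    note [measurable] = Sm[OF order_refl]
    have "{w\<in>space (past (T j)). \<bar>S j w\<bar> > u + c} \<in> sets (past (T j))" by measurable
    moreover have "{w\<in>space (past (T j)). \<forall>i\<in>{..<j}. \<bar>S i w\<bar> <= u + c} \<in> sets (past (T j))"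
    proof (rule sets.sets_Collect_finite_All)
      fix i assume "i \<in> {..<j}"
      hence [measurable]: "S i \<in> borel_measurable (past (T j))" by (intro Sm) auto
      show "{w\<in>space (past (T j)). \<bar>S i w\<bar> <= u + c} \<in> sets (past (T j))" by measurable
    qed simp
    ultimately have "{w\<in>space (past (T j)). \<bar>S j w\<bar> > u + c} \<inter> {w\<in>space (past (T j)). \<forall>i\<in>{..<j}. \<bar>S i w\<bar> <= u + c} \<in> sets (past (T j))"
      by (rule sets.Int)
    moreover have "A j = {w\<in>space (past (T j)). \<bar>S j w\<bar> > u + c} \<inter> {w\<in>space (past (T j)). \<forall>i\<in>{..<j}. \<bar>S i w\<bar> <= u + c}"
      by (auto simp: A_def)
    ultimately show ?thesis by simp
  qed
  have Aev: "A j \<in> events" for j using Apast sets_past_le by auto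
  have Xm[measurable]: "X (T j) \<in> borel_measurable M" "X (k + 1) \<in> borel_measurable M" "X k \<in> borel_measurable M" for j using T k by auto
  define E where "E j = {w\<in>space M. \<bar>X (k + 1) w - X (T j) w\<bar> <= c}" for j
  have Eev: "E j \<in> events" for j unfolding E_def by measurable
  have half: "prob (A j) <= 2 * prob (A j \<inter> E j)" if j: "j <= ?N" for j
  proof (cases "j = ?N")
    \<comment> \<open>At the last grid point no time remains, so the independence argument, which
      needs a positive remaining length, is replaced by a trivial one.\<close>
    case True
    have "E j = space M" using c by (auto simp: E_def True TN)
    thus ?thesis using Aev[of j] sets.sets_into_space[of "A j" M] by (simp add: Int_absorb2)
  next
    case False
    hence "real j < 2 ^ n" using j by (metis le_neq_implies_less of_nat_less_iff of_nat_numeral of_nat_power)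
    hence s: "0 < 1 - real j / 2 ^ n" "1 - real j / 2 ^ n <= 1" by simp_all
    let ?s = "1 - real j / 2 ^ n"
    have Ts: "T j + ?s = k + 1" by (simp add: T_def)
    have prod: "prob (A j \<inter> E j) = prob (A j) * prob {w\<in>space M. X ?s w - X 0 w \<in> {-c..c}}"
    proof -
      have "E j = {w\<in>space M. X (T j + ?s) w - X (T j) w \<in> {-c..c}}" unfolding Ts E_def by auto
      thus ?thesis using increment_indep[OF T s(1) Apast, of "{-c..c}" j] by simp
    qed
    have "1 / 2 <= prob {w\<in>space M. X ?s w - X 0 w \<in> {-c..c}}"
    proof -
      have [measurable]: "X ?s \<in> borel_measurable M" "X 0 \<in> borel_measurable M" using s by auto
      have "prob {w\<in>space M. ~ \<bar>X ?s w - X 0 w\<bar> > c} = 1 - prob {w\<in>space M. \<bar>X ?s w - X 0 w\<bar> > c}"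
        by (rule prob_neg) measurable
      moreover have "{w\<in>space M. X ?s w - X 0 w \<in> {-c..c}} = {w\<in>space M. ~ \<bar>X ?s w - X 0 w\<bar> > c}" by auto
      ultimately show ?thesis using c(2)[of ?s] s by simp
    qed
    from mult_left_mono[OF this measure_nonneg[of M "A j"]]
    show ?thesis unfolding prod by linarith
  qed
  have disj: "disjoint_family_on A {..?N}" unfolding disjoint_family_on_def
  proof (intro ballI impI)
    fix i j :: nat assume "i ~= j"
    then consider "i < j" | "j < i" by linarith
    thus "A i \<inter> A j = {}" by cases (force simp: A_def)+
  qed
  have "{w\<in>space M. \<exists>j\<le>?N. \<bar>X (k + real j / 2 ^ n) w - X k w\<bar> > u + c} \<subseteq> (\<Union>j\<in>{..?N}. A j)"
  proof
    fix w assume "w \<in> {w\<in>space M. \<exists>j\<le>?N. \<bar>X (k + real j / 2 ^ n) w - X k w\<bar> > u + c}"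
    hence w: "w \<in> space M" "\<exists>j. j <= ?N & \<bar>S j w\<bar> > u + c" by (auto simp: S_def T_def)
    define j where "j = (LEAST j. j <= ?N & \<bar>S j w\<bar> > u + c)"
    have j: "j <= ?N" "\<bar>S j w\<bar> > u + c" using LeastI_ex[OF w(2)] by (auto simp: j_def)
    have "\<bar>S i w\<bar> <= u + c" if "i < j" for i
      using not_less_Least[of i "%j. j <= ?N & \<bar>S j w\<bar> > u + c"] that j(1) by (force simp: j_def[symmetric])
    thus "w \<in> (\<Union>j\<in>{..?N}. A j)" using w j by (auto simp: A_def)
  qed
  hence "prob {w\<in>space M. \<exists>j\<le>?N. \<bar>X (k + real j / 2 ^ n) w - X k w\<bar> > u + c} <= prob (\<Union>j\<in>{..?N}. A j)"
    using Aev by (intro finite_measure_mono) auto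
  also have "... = (\<Sum>j\<le>?N. prob (A j))" using Aev disj by (intro finite_measure_finite_Union) auto
  also have "... <= (\<Sum>j\<le>?N. 2 * prob (A j \<inter> E j))" using half by (intro sum_mono) auto
  also have "... = 2 * prob (\<Union>j\<in>{..?N}. A j \<inter> E j)" unfolding sum_distrib_left[symmetric]
  proof (subst finite_measure_finite_Union)
    show "disjoint_family_on (%j. A j \<inter> E j) {..?N}" using disj unfolding disjoint_family_on_def by blast
  qed (use Aev Eev in auto)
  also have "prob (\<Union>j\<in>{..?N}. A j \<inter> E j) <= prob {w\<in>space M. \<bar>X (k + 1) w - X k w\<bar> > u}"
  proof (rule finite_measure_mono)
    show "(\<Union>j\<in>{..?N}. A j \<inter> E j) \<subseteq> {w\<in>space M. \<bar>X (k + 1) w - X k w\<bar> > u}"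
    proof
      fix w assume "w \<in> (\<Union>j\<in>{..?N}. A j \<inter> E j)"
      then obtain j where "w \<in> space M" "\<bar>X (T j) w - X k w\<bar> > u + c" "\<bar>X (k + 1) w - X (T j) w\<bar> <= c"
        by (auto simp: A_def E_def S_def)
      moreover from this have "\<bar>X (k + 1) w - X k w\<bar> > u" by linarith
      ultimately show "w \<in> {w\<in>space M. \<bar>X (k + 1) w - X k w\<bar> > u}" by simp
    qed
  qed measurable
  finally show ?thesis by simp
qed

text \<open>Integrating the tail inequality over \<open>u\<close> bounds the mean by
  \<open>c\<close> plus twice the mean of \<open>\<bar>X 1 w - X 0 w\<bar>\<close>, uniformly in
  \<open>k\<close> and in the grid.\<close>

lemma block_bound:
  assumes int: "(EE w. ennreal \<bar>X 1 w - X 0 w\<bar>) < \<top>"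
  shows "\<exists>C<\<top>. \<forall>k\<ge>0. (EE w. block k w) <= C"
proof -
  obtain c where c: "0 <= c" "\<And>s. s \<in> {0..1} ==> prob {w\<in>space M. \<bar>X s w - X 0 w\<bar> > c} <= 1 / 2"
    using tight by auto
  define C where "C = ennreal c + 2 * (EE w. ennreal \<bar>X 1 w - X 0 w\<bar>)"
  have "(EE w. block k w) <= C" if k: "0 <= k" for k
  proof -
    have Xm[measurable]: "X (k + real j / 2 ^ n) \<in> borel_measurable M" "X (k + 1) \<in> borel_measurable M" "X k \<in> borel_measurable M" for j n
      using k by auto
    define m where "m n w = Max ((%j. \<bar>X (k + real j / 2 ^ n) w - X k w\<bar>) ` {..(2::nat) ^ n})" for n w
    have mm[measurable]: "m n \<in> borel_measurable M" for n unfolding m_def[abs_def] by measurable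
    have msup: "(SUP j\<in>{..(2::nat) ^ n}. ennreal \<bar>X (k + real j / 2 ^ n) w - X k w\<bar>) = ennreal (m n w)" for n w
    proof (rule antisym)
      show "(SUP j\<in>{..(2::nat) ^ n}. ennreal \<bar>X (k + real j / 2 ^ n) w - X k w\<bar>) <= ennreal (m n w)"
        unfolding m_def by (intro SUP_least ennreal_leI Max_ge) auto
      have "m n w \<in> (%j. \<bar>X (k + real j / 2 ^ n) w - X k w\<bar>) ` {..(2::nat) ^ n}" unfolding m_def by (rule Max_in) auto
      then obtain j where "j \<in> {..(2::nat) ^ n}" "m n w = \<bar>X (k + real j / 2 ^ n) w - X k w\<bar>" by auto
      thus "ennreal (m n w) <= (SUP j\<in>{..(2::nat) ^ n}. ennreal \<bar>X (k + real j / 2 ^ n) w - X k w\<bar>)" by (intro SUP_upper2[of j]) auto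
    qed
    have mle: "(EE w. ennreal (m n w)) <= C" for n
    proof -
      have law: "(EE w. ennreal \<bar>X (k + 1) w - X k w\<bar>) = (EE w. ennreal \<bar>X 1 w - X 0 w\<bar>)"
      proof -
        have "(EE w. ennreal \<bar>X (k + 1) w - X k w\<bar>) = (\<integral>\<^sup>+z. ennreal \<bar>z\<bar> \<partial>distr M borel (%w. X (k + 1) w - X k w))"
          by (subst nn_integral_distr) auto
        also have "... = (\<integral>\<^sup>+z. ennreal \<bar>z\<bar> \<partial>distr M borel (%w. X 1 w - X 0 w))"
          using stationary[OF k, of 1] by simp
        also have "... = (EE w. ennreal \<bar>X 1 w - X 0 w\<bar>)" by (subst nn_integral_distr) auto
        finally show ?thesis .
      qed
      \<comment> \<open>\<open>ennreal\<close> cuts negative values to 0, so this is the mean of the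
        excess over \<open>c\<close>.\<close>
      have "(EE w. ennreal (m n w - c)) = (\<integral>\<^sup>+y. indicator {0<..} y * emeasure M {w\<in>space M. y < m n w - c} \<partial>lborel)"
        by (rule layer_cake) (auto simp: sigma_finite_measure_axioms)
      also have "... <= (\<integral>\<^sup>+y. 2 * (indicator {0<..} y * emeasure M {w\<in>space M. y < \<bar>X (k + 1) w - X k w\<bar>}) \<partial>lborel)"
      proof (intro nn_integral_mono)
        fix y :: real
        show "indicator {0<..} y * emeasure M {w\<in>space M. y < m n w - c}
          <= 2 * (indicator {0<..} y * emeasure M {w\<in>space M. y < \<bar>X (k + 1) w - X k w\<bar>})"
        proof (cases "0 < y")
          case True
          have "{w\<in>space M. y < m n w - c} = {w\<in>space M. \<exists>j\<le>(2::nat) ^ n. \<bar>X (k + real j / 2 ^ n) w - X k w\<bar> > y + c}"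
            unfolding m_def by (subst less_diff_eq, subst Max_gr_iff) auto
          hence "prob {w\<in>space M. y < m n w - c} <= 2 * prob {w\<in>space M. \<bar>X (k + 1) w - X k w\<bar> > y}"
            using ottaviani[OF k c, of y n] True by simp
          hence "ennreal (prob {w\<in>space M. y < m n w - c}) <= ennreal (2 * prob {w\<in>space M. \<bar>X (k + 1) w - X k w\<bar> > y})"
            by (rule ennreal_leI)
          also have "... = 2 * ennreal (prob {w\<in>space M. \<bar>X (k + 1) w - X k w\<bar> > y})" by (simp add: ennreal_mult')
          finally have "ennreal (prob {w\<in>space M. y < m n w - c}) <= 2 * ennreal (prob {w\<in>space M. \<bar>X (k + 1) w - X k w\<bar> > y})" .
          thus ?thesis using True by (simp add: emeasure_eq_measure)
        qed simp
      qed
      also have "... = 2 * (EE w. ennreal \<bar>X (k + 1) w - X k w\<bar>)"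
      proof -
        have "(%y. indicator {0<..} y * emeasure M {w\<in>space M. y < \<bar>X (k + 1) w - X k w\<bar>}) \<in> borel_measurable lborel"
        proof -
          have "{p \<in> space (borel \<Otimes>\<^sub>M M). (fst p :: real) < \<bar>X (k + 1) (snd p) - X k (snd p)\<bar>} \<in> sets (borel \<Otimes>\<^sub>M M)"
            by measurable
          from measurable_emeasure_Pair[OF this]
          have "(%y. emeasure M {w\<in>space M. y < \<bar>X (k + 1) w - X k w\<bar>}) \<in> borel_measurable borel"
            by (simp add: space_pair_measure vimage_def)
          thus ?thesis by measurable
        qed
        thus ?thesis by (subst nn_integral_cmult) (auto simp: layer_cake[OF sigma_finite_measure_axioms])
      qed
      finally have le: "(EE w. ennreal (m n w - c)) <= 2 * (EE w. ennreal \<bar>X 1 w - X 0 w\<bar>)"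
        unfolding law .
      have "(EE w. ennreal (m n w)) <= (EE w. ennreal c + ennreal (m n w - c))"
      proof (intro nn_integral_mono)
        fix w
        have "ennreal (m n w) <= ennreal (c + max 0 (m n w - c))" by (intro ennreal_leI) auto
        also have "... = ennreal c + ennreal (max 0 (m n w - c))" using c by (intro ennreal_plus) auto
        also have "ennreal (max 0 (m n w - c)) = ennreal (m n w - c)" by (auto simp: max_def ennreal_neg)
        finally show "ennreal (m n w) <= ennreal c + ennreal (m n w - c)" .
      qed
      also have "... = ennreal c + (EE w. ennreal (m n w - c))"
        by (subst nn_integral_add) (auto simp: emeasure_space_1)
      also have "... <= C" unfolding C_def using le by (rule add_left_mono)
      finally show ?thesis .
    qed
    have minc: "m n w <= m (Suc n) w" for n w
    proof -
      have "\<bar>X (k + real j / 2 ^ n) w - X k w\<bar> <= m (Suc n) w" if "j <= 2 ^ n" for j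
      proof -
        have "real (2 * j) / 2 ^ Suc n = real j / 2 ^ n" by simp
        moreover have "\<bar>X (k + real (2 * j) / 2 ^ Suc n) w - X k w\<bar> <= m (Suc n) w"
          unfolding m_def by (intro Max_ge finite_imageI finite_atMost imageI) (use that in simp)
        ultimately show ?thesis by simp
      qed
      thus ?thesis unfolding m_def[of n] by (intro Max.boundedI) auto
    qed
    have "(EE w. block k w) = (EE w. (SUP n. ennreal (m n w)))" unfolding block_def msup ..
    also have "... = (SUP n. \<integral>\<^sup>+w. ennreal (m n w) \<partial>M)"
      using minc by (intro nn_integral_monotone_convergence_SUP) (auto intro!: incseq_SucI le_funI ennreal_leI)
    also have "... <= C" by (rule SUP_least) (rule mle)
    finally show ?thesis .
  qed
  moreover have "C < \<top>" using int by (simp add: C_def ennreal_mult_less_top)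
  ultimately show ?thesis by blast
qed

text \<open>A nondecreasing step function above the path, constant on \<open>[k, k + 1)\<close>. The
  \<open>Suc\<close> includes the block in progress, which keeps the function right continuous and
  above the path inside the block.\<close>

definition envelope :: "'w => real => real" where
  "envelope w t = \<bar>X 0 w\<bar> + (\<Sum>i<Suc (nat \<lfloor>t\<rfloor>). enn2real (block (real i) w))"

lemma envelope_cumulative: "cumulative_path (envelope w)" unfolding cumulative_path_def
proof (intro conjI allI impI)
  show "0 <= envelope w 0" by (simp add: envelope_def)
  show "mono_on {0..} (envelope w)"
  proof (rule monotone_onI)
    fix x y :: real assume "x <= y"
    hence "nat \<lfloor>x\<rfloor> <= nat \<lfloor>y\<rfloor>" by (simp add: nat_mono floor_mono)
    thus "envelope w x <= envelope w y" unfolding envelope_def by (intro add_left_mono sum_mono2) auto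
  qed
  fix t :: real assume t: "0 <= t"
  have "\<forall>\<^sub>F v in at_right t. envelope w v = envelope w t"
  proof (rule eventually_at_rightI)
    show "t < of_int (\<lfloor>t\<rfloor> + 1)" by linarith
    fix v assume "v \<in> {t<..<of_int (\<lfloor>t\<rfloor> + 1)}"
    hence "\<lfloor>v\<rfloor> = \<lfloor>t\<rfloor>" by (intro floor_unique) (auto, linarith)
    thus "envelope w v = envelope w t" by (simp add: envelope_def)
  qed
  thus "continuous (at_right t) (envelope w)" by (simp add: continuous_within tendsto_eventually)
qed

lemma envelope_upper:
  assumes w: "w \<in> space M" and t: "0 <= t"
  shows "\<bar>X t w\<bar> <= envelope w t"
proof -
  have b: "\<bar>X (k + s) w - X k w\<bar> <= enn2real (block k w)" if "0 <= k" "0 <= s" "s <= 1" for k s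
    using block_upper[OF w that] block_finite[OF w that(1)] by (metis abs_ge_zero enn2real_ennreal enn2real_mono)
  have step: "\<bar>X (real k) w\<bar> <= \<bar>X 0 w\<bar> + (\<Sum>i<k. enn2real (block (real i) w))" for k
  proof (induction k)
    case (Suc k)
    have "\<bar>X (real k + 1) w - X (real k) w\<bar> <= enn2real (block (real k) w)" by (rule b) auto
    with Suc show ?case by (simp add: add.commute)
  qed simp
  define k where "k = nat \<lfloor>t\<rfloor>"
  have k: "real k <= t" "t <= real k + 1" using t by (auto simp: k_def)
  have "\<bar>X (real k + (t - real k)) w - X (real k) w\<bar> <= enn2real (block (real k) w)" by (rule b) (use k in auto)
  with step[of k] show ?thesis unfolding envelope_def k_def[symmetric] by simp
qed

definition envelope_bound :: "real => 'w => ennreal" where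
  "envelope_bound q w = ennreal \<bar>X 0 w\<bar> + block 0 w + (\<Sum>j. ennreal (exp (- q * real j)) * block (real (Suc j)) w)"

lemma envelope_bound_measurable [measurable]: "envelope_bound q \<in> borel_measurable M" unfolding envelope_bound_def[abs_def] by measurable

lemma envelope_discounted:
  assumes w: "w \<in> space M" and q: "0 < q"
  shows "discounted_integral q (envelope w) <= envelope_bound q w"
proof -
  have e: "ennreal (enn2real (block (real j) w)) = block (real j) w" for j using block_finite[OF w, of "real j"] by simp
  have step: "envelope w (real (Suc j)) - envelope w (real j) = enn2real (block (real (Suc j)) w)" for j
  proof -
    have "nat \<lfloor>real (Suc j)\<rfloor> = Suc j" "nat \<lfloor>real j\<rfloor> = j" by linarith+
    thus ?thesis unfolding envelope_def by simp
  qed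
  have "discounted_integral q (envelope w) <= ennreal (envelope w 0)
     + (\<Sum>j. ennreal (exp (- q * real j)) * ennreal (envelope w (real (Suc j)) - envelope w (real j)))"
    by (rule discounted_integral_grid[OF envelope_cumulative q])
  also have "ennreal (envelope w 0) = ennreal \<bar>X 0 w\<bar> + block 0 w" using e[of 0] by (simp add: envelope_def ennreal_plus)
  finally show ?thesis unfolding envelope_bound_def step e .
qed

text \<open>The means of the blocks are bounded uniformly, so the discounted series is dominated by
  a geometric one.\<close>

lemma envelope_bound_finite:
  assumes int: "(EE w. ennreal \<bar>X 1 w - X 0 w\<bar>) < \<top>" and q: "0 < q"
  shows "(EE w. envelope_bound q w) < \<top>"
proof -
  obtain C where C: "C < \<top>" "\<And>k. 0 <= k ==> (EE w. block k w) <= C" using block_bound[OF int] by auto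
  have "(EE w. envelope_bound q w) = (EE w. ennreal \<bar>X 0 w\<bar>) + (EE w. block 0 w)
     + (\<Sum>j. ennreal (exp (- q * real j)) * (EE w. block (real (Suc j)) w))" unfolding envelope_bound_def
    by (simp add: nn_integral_add nn_integral_suminf nn_integral_cmult del: of_nat_Suc)
  also have "(EE w. ennreal \<bar>X 0 w\<bar>) = ennreal \<bar>x0\<bar>"
  proof -
    have "(EE w. ennreal \<bar>X 0 w\<bar>) = (EE w. ennreal \<bar>x0\<bar>)"
      using start by (intro nn_integral_cong_AE) auto
    thus ?thesis by (simp add: emeasure_space_1)
  qed
  also have "(\<Sum>j. ennreal (exp (- q * real j)) * (EE w. block (real (Suc j)) w)) <= (\<Sum>j. ennreal (exp (- q) ^ j) * C)"
    using C(2) by (intro suminf_le mult_mono) (auto simp: exp_of_nat_mult[symmetric] mult.commute)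
  also have "... = (\<Sum>j. ennreal (exp (- q) ^ j)) * C" by simp
  also have "(\<Sum>j. ennreal (exp (- q) ^ j)) = ennreal (1 / (1 - exp (- q)))" using q by (intro suminf_ennreal_eq geometric_sums) auto
  finally have "(EE w. envelope_bound q w) <= ennreal \<bar>x0\<bar> + (EE w. block 0 w) + ennreal (1 / (1 - exp (- q))) * C"
    by simp
  also have "... < \<top>" using C(1) C(2)[of 0] by (auto simp: ennreal_mult_less_top intro: le_less_trans)
  finally show ?thesis .
qed

end

section \<open>Expected dualities and finiteness\<close>

text \<open>Controls are cumulative only almost surely, so their Stieltjes integrals agree with
  measurable limits only almost everywhere. Measurability for the completion is enough to add
  integrals.\<close>

lemma measurable_completion_AE:
  fixes f g :: "'a => 'b :: topological_space"
  assumes g: "g \<in> borel_measurable M" and fg: "AE x in M. f x = g x"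
  shows "f \<in> borel_measurable (completion M)"
proof (rule measurableI)
  fix B :: "'b set" assume B: "B \<in> sets borel"
  have ae: "AE x in completion M. x \<in> g -` B \<inter> space M \<longleftrightarrow> x \<in> f -` B \<inter> space M"
    unfolding AE_completion_iff using fg by eventually_elim auto
  have "g -` B \<inter> space M \<in> sets (completion M)" using measurable_sets[OF g B] by (rule sets_completionI_sets)
  from completion.in_sets_AE[OF ae this]
  show "f -` B \<inter> space (completion M) \<in> sets (completion M)" by simp
qed simp

lemma discounted_mono_cumulative:
  fixes q :: real
  assumes "0 < q"
  shows "antimono_on {0..} (%t. exp (- q * t))" "((%t. exp (- q * t)) \<longlongrightarrow> exp (- q * t)) (at_right t)"
proof -
  show "antimono_on {0..} (%t. exp (- q * t))" using assms by (intro monotone_onI) (simp add: mult_left_mono)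
  show "((%t. exp (- q * t)) \<longlongrightarrow> exp (- q * t)) (at_right t)" by (intro tendsto_intros)
qed

lemma nn_integral_add_completion:
  assumes "f \<in> borel_measurable (completion M)" "g \<in> borel_measurable (completion M)"
  shows "(\<integral>\<^sup>+x. f x + g x \<partial>M) = (\<integral>\<^sup>+x. f x \<partial>M) + (\<integral>\<^sup>+x. g x \<partial>M)"
  using nn_integral_add[OF assms] by (simp add: nn_integral_completion)

context levy_paths
begin

definition control :: "(real => 'w => real) => bool" where
  "control L \<longleftrightarrow> (\<forall>t\<ge>0. L t \<in> borel_measurable (past t)) & (AE w in M. cumulative_path (%t. L t w))"

abbreviation npv :: "real => (real => 'w => real) => ennreal" where
  "npv q L \<equiv> (EE w. discounted_integral q (%t. L t w))"

lemma controlD: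
  assumes "control L"
  shows "0 <= t ==> L t \<in> borel_measurable (past t)" "0 <= t ==> L t \<in> borel_measurable M"
    "AE w in M. cumulative_path (%t. L t w)" using assms measurable_past by (auto simp: control_def)

lemma weighted_measurable:
  assumes L: "control L" and d: "\<And>t. 0 <= t ==> (%w. ennreal (d t w)) \<in> borel_measurable M"
    and path: "AE w in M. antimono_on {0..} (%t. d t w) & (\<forall>t\<ge>0. ((%s. d s w) \<longlongrightarrow> d t w) (at_right t))"
  shows "(%w. weighted (%t. d t w) (%t. L t w)) \<in> borel_measurable (completion M)"
proof (rule measurable_completion_AE)
  note [measurable] = d controlD(2)[OF L]
  show "(%w. SUP n. dyadic_sum (%t. d t w) (%t. L t w) n) \<in> borel_measurable M" unfolding dyadic_sum_def by measurable
  show "AE w in M. weighted (%t. d t w) (%t. L t w) = (SUP n. dyadic_sum (%t. d t w) (%t. L t w) n)"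
    using path controlD(3)[OF L] by eventually_elim (blast intro: weighted_dyadic)
qed

lemma discounted_measurable:
  assumes "control L" "0 < q"
  shows "(%w. discounted_integral q (%t. L t w)) \<in> borel_measurable (completion M)" unfolding discounted_integral_weighted
  by (rule weighted_measurable[OF assms(1)]) (use discounted_mono_cumulative[OF assms(2)] in auto)

lemma weighted_drawdown_measurable:
  assumes "control L" "0 < q" "0 <= b"
  shows "(%w. weighted (drawdown q b (%s. X s w)) (%t. L t w)) \<in> borel_measurable (completion M)"
proof (rule weighted_measurable[OF assms(1)])
  show "AE w in M. antimono_on {0..} (drawdown q b (%s. X s w)) &
     (\<forall>t\<ge>0. (drawdown q b (%s. X s w) \<longlongrightarrow> drawdown q b (%s. X s w) t) (at_right t))"
    using AE_space
  proof eventually_elim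
    case (elim w)
    thus ?case using drawdown_antimono[OF assms(2)] drawdown_right[OF assms(2,3) cadlag_X] by (auto simp: monotone_on_def)
  qed
qed (rule drawdown_measurable[OF assms(2,3)])

lemma expected_drawdown:
  assumes "control L" "0 < q" "0 <= b"
  shows "(EE w. weighted (drawdown q b (%s. X s w)) (%t. L t w)) = nu q b * npv q L"
  using expected_drawdown_weight[OF assms(2,3), of L "%_ _. 1"] assms(1)
  by (simp add: control_def discounted_integral_weighted monotone_on_def)

context
  fixes q a :: real and L1 R1 L R
  assumes q: "0 < q"
    and L1: "control L1" and R1: "control R1" and pos1: "AE w in M. \<forall>t\<ge>0. 0 <= X t w - L1 t w + R1 t w"
    and L: "control L" and R: "control R"
    and reflected: "AE w in M. skorokhod a (%t. X t w) (%t. L t w) (%t. R t w)"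
begin

lemma expected_duality:
  assumes b: "0 <= b" and c: "0 <= c"
    and le: "AE w in M. weighted (drawdown q b (%s. X s w)) (%t. L1 t w) + discounted_integral q (%t. R t w)
      <= discounted_integral q (%t. R1 t w) + weighted (drawdown q b (%s. X s w)) (%t. L t w) + ennreal c"
  shows "nu q b * npv q L1 + npv q R <= npv q R1 + nu q b * npv q L + ennreal c"
proof -
  note [measurable] = weighted_drawdown_measurable[OF L1 q b] weighted_drawdown_measurable[OF L q b]
    discounted_measurable[OF R q] discounted_measurable[OF R1 q]
  note ex = expected_drawdown[OF L1 q b] expected_drawdown[OF L q b]
  have "(EE w. weighted (drawdown q b (%s. X s w)) (%t. L1 t w) + discounted_integral q (%t. R t w))
    <= (EE w. discounted_integral q (%t. R1 t w) + weighted (drawdown q b (%s. X s w)) (%t. L t w) + ennreal c)"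
    using le by (rule nn_integral_mono_AE)
  also have "... = npv q R1 + nu q b * npv q L + ennreal c" by (simp add: nn_integral_add_completion ex emeasure_space_1)
  also have "(EE w. weighted (drawdown q b (%s. X s w)) (%t. L1 t w) + discounted_integral q (%t. R t w))
    = nu q b * npv q L1 + npv q R" by (simp add: nn_integral_add_completion ex)
  finally show ?thesis .
qed

lemma expected_hit_duality:
  assumes b: "0 <= b" "b < a"
  shows "nu q b * npv q L1 + npv q R <= npv q R1 + nu q b * npv q L + ennreal (a - b)"
proof (rule expected_duality)
  show "AE w in M. weighted (drawdown q b (%s. X s w)) (%t. L1 t w) + discounted_integral q (%t. R t w)
      <= discounted_integral q (%t. R1 t w) + weighted (drawdown q b (%s. X s w)) (%t. L t w) + ennreal (a - b)"
    using reflected pos1 controlD(3)[OF L1] controlD(3)[OF R1]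
  proof eventually_elim
    case (elim w)
    show ?case by (rule skorokhod_path.hit_duality[OF skorokhod_path.intro[OF elim(1)] q elim(3,4) _ b]) (use elim(2) in auto)
  qed
qed (use b in auto)

lemma expected_growth_duality:
  assumes a: "0 <= a"
    and slack: "AE w in M. AE t in control_measure (%t. L t w). 0 <= t -->
      skorokhod_path.growth_discount (%t. R t w) q t <= drawdown q a (%t. X t w) t"
  shows "nu q a * npv q L1 + npv q R <= npv q R1 + nu q a * npv q L"
proof -
  have "nu q a * npv q L1 + npv q R <= npv q R1 + nu q a * npv q L + ennreal 0"
  proof (rule expected_duality)
    show "AE w in M. weighted (drawdown q a (%s. X s w)) (%t. L1 t w) + discounted_integral q (%t. R t w)
        <= discounted_integral q (%t. R1 t w) + weighted (drawdown q a (%s. X s w)) (%t. L t w) + ennreal 0"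
      using reflected pos1 controlD(3)[OF L1] controlD(3)[OF R1] slack
    proof eventually_elim
      case (elim w)
      have "weighted (drawdown q a (%s. X s w)) (%t. L1 t w) + discounted_integral q (%t. R t w)
        <= discounted_integral q (%t. R1 t w) + weighted (drawdown q a (%s. X s w)) (%t. L t w)"
        by (rule skorokhod_path.growth_duality[OF skorokhod_path.intro[OF elim(1)] q elim(3,4) _ elim(5)]) (use elim(2) in auto)
      thus ?case by simp
    qed
  qed (use a in auto)
  thus ?thesis by simp
qed

text \<open>At barrier 0 the reflected surplus vanishes identically, so the plain discount serves as
  weight without any loss. The coefficient 1 plays the part that \<open>\<nu>(b)\<close> with
  \<open>b < a\<close> plays for a positive barrier.\<close>

lemma expected_zero_duality:
  assumes a: "a = 0"
  shows "npv q L1 + npv q R <= npv q R1 + npv q L"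
proof -
  note [measurable] = discounted_measurable[OF L q] discounted_measurable[OF L1 q]
    discounted_measurable[OF R q] discounted_measurable[OF R1 q]
  have "(EE w. discounted_integral q (%t. L1 t w) + discounted_integral q (%t. R t w))
    <= (EE w. discounted_integral q (%t. R1 t w) + discounted_integral q (%t. L t w))"
  proof (rule nn_integral_mono_AE)
    show "AE w in M. discounted_integral q (%t. L1 t w) + discounted_integral q (%t. R t w)
      <= discounted_integral q (%t. R1 t w) + discounted_integral q (%t. L t w)"
      using reflected pos1 controlD(3)[OF L1] controlD(3)[OF R1] controlD(3)[OF L] controlD(3)[OF R]
    proof eventually_elim
      case (elim w)
      have "weighted (%t. exp (- q * t)) (%t. L1 t w) + weighted (%t. exp (- q * t)) (%t. R t w)
        <= weighted (%t. exp (- q * t)) (%t. R1 t w) + weighted (%t. exp (- q * t)) (%t. L t w) + ennreal 0"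
      proof (rule weak_duality[OF elim(3-6) discounted_mono_cumulative(1)[OF q], where U' = "%_. 0"])
        fix t :: real assume t: "0 <= t"
        have "X t w - L t w + R t w = 0" using elim(1) t a by (force simp: skorokhod_def)
        thus "L1 t w + R t w <= R1 t w + L t w + 0" using elim(2) t by force
        show "exp (- q * t) <= 1" using q t by simp
      qed auto
      thus ?case by (simp add: discounted_integral_weighted)
    qed
  qed
  thus ?thesis by (simp add: nn_integral_add_completion)
qed

end

section \<open>Cutting the controls, and finiteness of the values\<close>

lemma cut_path:
  assumes L: "cumulative_path F" and G: "cumulative_path G"
  shows "antimono_on {0..} (%t. of_bool (F t + G t < m) :: real)"
    and "0 <= t ==> ((%s. of_bool (F s + G s < m) :: real) \<longlongrightarrow> of_bool (F t + G t < m)) (at_right t)"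
proof -
  have mono: "F s + G s <= F t + G t" if "0 <= s" "s <= t" for s t
    using cumulative_pathD(2)[OF L that] cumulative_pathD(2)[OF G that] by simp
  thus "antimono_on {0..} (%t. of_bool (F t + G t < m) :: real)" by (fastforce simp: monotone_on_def)
  assume t: "0 <= t"
  have "((%s. F s + G s) \<longlongrightarrow> F t + G t) (at_right t)"
    using cumulative_pathD(4)[OF L t] cumulative_pathD(4)[OF G t] by (intro tendsto_add) (auto simp: continuous_within)
  note lim = this
  have "\<forall>\<^sub>F s in at_right t. (of_bool (F s + G s < m) :: real) = of_bool (F t + G t < m)"
  proof (cases "F t + G t < m")
    case True
    from order_tendstoD(2)[OF lim True] show ?thesis by eventually_elim (use True in auto)
  next
    case False
    have "\<forall>\<^sub>F s in at_right t. t < s" by (simp add: eventually_at_filter)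
    thus ?thesis
    proof eventually_elim
      case (elim s)
      thus ?case using False mono[OF t, of s] by simp
    qed
  qed
  thus "((%s. of_bool (F s + G s < m) :: real) \<longlongrightarrow> of_bool (F t + G t < m)) (at_right t)" by (rule tendsto_eventually)
qed

text \<open>While the total is below \<open>m\<close>, so is \<open>F\<close>; thus the cut value is
  finite before anything is known about the uncut one.\<close>

lemma weighted_cut_le:
  assumes F: "cumulative_path F" and G: "cumulative_path G" and q: "0 < q" and m: "0 <= m"
  shows "weighted (%t. exp (- q * t) * of_bool (F t + G t < m)) F <= ennreal m"
proof -
  let ?A = "{t. 0 <= t & F t + G t < m}"
  have mono: "F s + G s <= F t + G t" if "0 <= s" "s <= t" for s t
    using cumulative_pathD(2)[OF F that] cumulative_pathD(2)[OF G that] by simp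
  have down: "s \<in> ?A" if "t \<in> ?A" "0 <= s" "s <= t" for s t using that mono[of s t] by auto
  have A: "?A \<in> sets borel" by (rule down_closed_borel) (use down in auto)
  have "weighted (%t. exp (- q * t) * of_bool (F t + G t < m)) F <= (\<integral>\<^sup>+t. indicator ?A t \<partial>control_measure F)"
    unfolding weighted_def by (intro nn_integral_mono) (use q in \<open>auto simp: indicator_def ennreal_le_1\<close>)
  also have "... = mass F ?A" using A by simp
  also have "... <= ennreal m"
  proof (cases "?A = {}")
    case False
    obtain c where c: "incseq c" "range c \<subseteq> ?A" "\<forall>s\<in>?A. \<exists>n. s <= c n" using cofinal_incseq[OF False] by blast
    have le: "F (c n) <= m" for n
    proof -
      have "c n \<in> ?A" using c(2) by blast
      thus ?thesis using cumulative_pathD(3)[OF G, of "c n"] by auto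
    qed
    have "mass F ?A = (SUP n. ennreal (F (c n)))" by (rule emeasure_control_down_closed[OF F False _ down c]) auto
    also have "... <= ennreal m" using le by (intro SUP_least ennreal_leI)
    finally show ?thesis .
  qed (simp only:, simp)
  finally show ?thesis .
qed

lemma weighted_cut_SUP:
  assumes F: "cumulative_path F" and G: "cumulative_path G" and q: "0 < q"
  shows "discounted_integral q F = (SUP m::nat. weighted (%t. exp (- q * t) * of_bool (F t + G t < real m)) F)"
    and "incseq (\<lambda>m::nat. weighted (%t. exp (- q * t) * of_bool (F t + G t < real m)) F)"
proof -
  show inc: "incseq (\<lambda>m::nat. weighted (%t. exp (- q * t) * of_bool (F t + G t < real m)) F)"
    by (intro incseq_SucI weighted_mono[OF F]) auto
  let ?g = "%m t. ennreal (exp (- q * t) * of_bool (F t + G t < real m)) * indicator {0..} t"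
  have bm: "?g m \<in> borel_measurable (control_measure F)" for m
  proof -
    have "antimono_on {0..} (%t. exp (- q * t) * of_bool (F t + G t < real m))"
      using cut_path(1)[OF F G, of "real m"] discounted_mono_cumulative(1)[OF q] by (auto simp: monotone_on_def intro!: mult_mono)
    from antimono_nonneg_borel[OF this]
    have "(%t. ennreal (exp (- q * t) * of_bool (F t + G t < real m) * indicator {0..} t)) \<in> borel_measurable borel" by measurable
    also have "(%t. ennreal (exp (- q * t) * of_bool (F t + G t < real m) * indicator {0..} t)) = ?g m" by (auto simp: indicator_def)
    finally show ?thesis by simp
  qed
  have "ennreal (exp (- q * t)) * indicator {0..} t = (SUP m. ?g m t)" for t :: real
  proof (rule antisym)
    obtain m :: nat where "F t + G t < real m" using reals_Archimedean2 by blast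
    thus "ennreal (exp (- q * t)) * indicator {0..} t <= (SUP m. ?g m t)" by (intro SUP_upper2[of m]) auto
    show "(SUP m. ?g m t) <= ennreal (exp (- q * t)) * indicator {0..} t" by (rule SUP_least) (auto simp: indicator_def)
  qed
  hence "discounted_integral q F = (\<integral>\<^sup>+t. (SUP m. ?g m t) \<partial>control_measure F)"
    by (simp add: discounted_integral_weighted weighted_def)
  also have "... = (SUP m. \<integral>\<^sup>+t. ?g m t \<partial>control_measure F)" by (rule nn_integral_monotone_convergence_SUP[OF _ bm])
      (auto intro!: incseq_SucI le_funI simp: indicator_def)
  finally show "discounted_integral q F = (SUP m::nat. weighted (%t. exp (- q * t) * of_bool (F t + G t < real m)) F)"
    by (simp add: weighted_def)
qed

context
  fixes q a :: real and L R
  assumes q: "0 < q" and a: "0 <= a" and L: "control L" and R: "control R"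
    and reflected: "AE w in M. skorokhod a (%t. X t w) (%t. L t w) (%t. R t w)"
    and int: "(EE w. ennreal \<bar>X 1 w - X 0 w\<bar>) < \<top>"
begin

lemma dividends_finite:
  assumes fin: "npv q R < \<top>"
  shows "npv q L < \<top>"
proof -
  have "npv q L <= (EE w. discounted_integral q (%t. R t w) + envelope_bound q w)"
  proof (rule nn_integral_mono_AE)
    show "AE w in M. discounted_integral q (%t. L t w) <= discounted_integral q (%t. R t w) + envelope_bound q w"
      using reflected AE_space
    proof eventually_elim
      case (elim w)
      have "weighted (%t. exp (- q * t) * 1) (%t. L t w)
        <= weighted (%t. exp (- q * t) * 1) (%t. R t w) + discounted_integral q (envelope w)"
        by (rule skorokhod_path.truncated_dividends_le[OF skorokhod_path.intro[OF elim(1)] q envelope_cumulative])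
          (use envelope_upper[OF elim(2)] in \<open>auto simp: monotone_on_def\<close>)
      also have "... <= weighted (%t. exp (- q * t) * 1) (%t. R t w) + envelope_bound q w"
        by (intro add_left_mono envelope_discounted[OF elim(2) q])
      finally show ?case by (simp add: discounted_integral_weighted)
    qed
  qed
  also have "... = npv q R + (EE w. envelope_bound q w)"
    using discounted_measurable[OF R q] by (simp add: nn_integral_add_completion measurable_completion)
  also have "... < \<top>" using fin envelope_bound_finite[OF int q] by simp
  finally show ?thesis .
qed

text \<open>For the cut values, \<open>l <= r + h\<close> and
  \<open>r <= nu q a * l + h + a\<close>. As \<open>nu q a < 1\<close>, inserting the first into the
  second bounds \<open>r\<close>, provided \<open>r\<close> is finite, which the cut guarantees. The
  bound does not depend on the cut, so the cut can be removed.\<close>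

lemma injections_finite:
  assumes nu: "nu q a < 1"
    and slack: "AE w in M. AE t in control_measure (%t. L t w). 0 <= t -->
      skorokhod_path.growth_discount (%t. R t w) q t <= drawdown q a (%t. X t w) t"
  shows "npv q R < \<top>"
proof -
  \<comment> \<open>The cut depends on the controls up to \<open>t\<close> only, and it decreases
    and is right continuous in \<open>t\<close>: what the Markov argument and weak duality ask of a
    factor of the weight.\<close>
  define Z where "Z m t w = (of_bool (R t w + L t w < real m) :: real)" for m :: nat and t w
  define r where "r m = (EE w. weighted (%t. exp (- q * t) * Z m t w) (%t. R t w))" for m
  define l where "l m = (EE w. weighted (%t. exp (- q * t) * Z m t w) (%t. L t w))" for m
  define h where "h = (EE w. envelope_bound q w)"
  have h: "h < \<top>" unfolding h_def by (rule envelope_bound_finite[OF int q])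
  have Zb: "0 <= Z m t w" "Z m t w <= 1" for m t w by (auto simp: Z_def)
  have Zp: "AE w in M. antimono_on {0..} (%t. Z m t w) & (\<forall>t\<ge>0. ((%s. Z m s w) \<longlongrightarrow> Z m t w) (at_right t))" for m
    using controlD(3)[OF L] controlD(3)[OF R] unfolding Z_def by eventually_elim (rule conjI cut_path allI impI | assumption)+
  have Zm: "Z m t \<in> borel_measurable (past t)" if t: "0 <= t" for m t
  proof -
    note [measurable] = controlD(1)[OF L t] controlD(1)[OF R t]
    show ?thesis unfolding Z_def by measurable
  qed
  have Zm': "Z m t \<in> borel_measurable M" if t: "0 <= t" for m t by (rule measurable_past[OF Zm[OF t]])
  have expZ: "AE w in M. antimono_on {0..} (%t. exp (- q * t) * Z m t w)
      & (\<forall>t\<ge>0. ((%s. exp (- q * s) * Z m s w) \<longlongrightarrow> exp (- q * t) * Z m t w) (at_right t))" for m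
    using Zp[of m]
  proof eventually_elim
    case (elim w)
    have "antimono_on {0..} (%t. exp (- q * t) * Z m t w)"
      using elim Zb discounted_mono_cumulative(1)[OF q] by (auto simp: monotone_on_def intro!: mult_mono)
    moreover have "((%s. exp (- q * s) * Z m s w) \<longlongrightarrow> exp (- q * t) * Z m t w) (at_right t)" if "0 <= t" for t
      using elim that discounted_mono_cumulative(2)[OF q, of t] by (intro tendsto_mult) auto
    ultimately show ?case by blast
  qed
  have ddZ: "AE w in M. antimono_on {0..} (%t. drawdown q a (%s. X s w) t * Z m t w)
      & (\<forall>t\<ge>0. ((%s. drawdown q a (%s. X s w) s * Z m s w) \<longlongrightarrow> drawdown q a (%s. X s w) t * Z m t w) (at_right t))" for m
    using Zp[of m] AE_space
  proof eventually_elim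
    case (elim w)
    have "antimono_on {0..} (%t. drawdown q a (%s. X s w) t * Z m t w)"
      using elim(1) Zb drawdown_antimono[OF q] drawdown_bounds(1)[OF q] by (auto simp: monotone_on_def intro!: mult_mono)
    moreover have "((%s. drawdown q a (%s. X s w) s * Z m s w) \<longlongrightarrow> drawdown q a (%s. X s w) t * Z m t w) (at_right t)" if "0 <= t" for t
      using elim that drawdown_right[OF q a cadlag_X[OF elim(2)] that] by (intro tendsto_mult) auto
    ultimately show ?case by blast
  qed
  have mr: "(%w. weighted (%t. exp (- q * t) * Z m t w) (%t. F t w)) \<in> borel_measurable (completion M)"
    if "control F" for m F by (rule weighted_measurable[OF that _ expZ]) (use Zm' in measurable)
  have md: "(%w. weighted (%t. drawdown q a (%s. X s w) t * Z m t w) (%t. L t w)) \<in> borel_measurable (completion M)" for m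
  proof (rule weighted_measurable[OF L _ ddZ])
    fix t :: real assume t: "0 <= t"
    note [measurable] = drawdown_measurable[OF q a t] Zm'[OF t]
    have "(%w. ennreal (drawdown q a (%s. X s w) t) * ennreal (Z m t w)) \<in> borel_measurable M" by measurable
    thus "(%w. ennreal (drawdown q a (%s. X s w) t * Z m t w)) \<in> borel_measurable M"
      using drawdown_bounds(1)[OF q t] Zb by (simp add: ennreal_mult)
  qed
  have lr: "l m <= r m + h" for m
  proof -
    have "l m <= (EE w. weighted (%t. exp (- q * t) * Z m t w) (%t. R t w) + envelope_bound q w)"
      unfolding l_def
    proof (rule nn_integral_mono_AE)
      show "AE w in M. weighted (%t. exp (- q * t) * Z m t w) (%t. L t w)
        <= weighted (%t. exp (- q * t) * Z m t w) (%t. R t w) + envelope_bound q w" using reflected AE_space Zp[of m]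
      proof eventually_elim
        case (elim w)
        have "weighted (%t. exp (- q * t) * Z m t w) (%t. L t w)
          <= weighted (%t. exp (- q * t) * Z m t w) (%t. R t w) + discounted_integral q (envelope w)"
          by (rule skorokhod_path.truncated_dividends_le[OF skorokhod_path.intro[OF elim(1)] q envelope_cumulative])
            (use envelope_upper[OF elim(2)] elim(3) Zb in auto)
        also have "... <= weighted (%t. exp (- q * t) * Z m t w) (%t. R t w) + envelope_bound q w"
          by (intro add_left_mono envelope_discounted[OF elim(2) q])
        finally show ?case .
      qed
    qed
    also have "... = r m + h" using mr[OF R] by (simp add: nn_integral_add_completion measurable_completion r_def h_def)
    finally show ?thesis .
  qed
  have rl: "r m <= nu q a * l m + h + ennreal a" for m
  proof -
    have "r m <= (EE w. weighted (%t. drawdown q a (%s. X s w) t * Z m t w) (%t. L t w) + envelope_bound q w + ennreal a)"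
      unfolding r_def
    proof (rule nn_integral_mono_AE)
      show "AE w in M. weighted (%t. exp (- q * t) * Z m t w) (%t. R t w)
        <= weighted (%t. drawdown q a (%s. X s w) t * Z m t w) (%t. L t w) + envelope_bound q w + ennreal a"
        using reflected AE_space Zp[of m] slack
      proof eventually_elim
        case (elim w)
        have "weighted (%t. exp (- q * t) * Z m t w) (%t. R t w)
          <= weighted (%t. drawdown q a (%s. X s w) t * Z m t w) (%t. L t w) + discounted_integral q (envelope w) + ennreal a"
          by (rule skorokhod_path.truncated_injections_le[OF skorokhod_path.intro[OF elim(1)] q envelope_cumulative _ _ _ _ elim(4) a])
            (use envelope_upper[OF elim(2)] elim(3) Zb in auto)
        also have "... <= weighted (%t. drawdown q a (%s. X s w) t * Z m t w) (%t. L t w) + envelope_bound q w + ennreal a"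
          by (intro add_left_mono add_right_mono envelope_discounted[OF elim(2) q])
        finally show ?case .
      qed
    qed
    also have "... = nu q a * l m + h + ennreal a" using measurable_completion[OF envelope_bound_measurable, of q] md[of m]
        borel_measurable_add[OF md[of m] measurable_completion[OF envelope_bound_measurable, of q]]
        expected_drawdown_weight[OF q a controlD(1)[OF L] controlD(3)[OF L] Zm Zb(1) Zp, of m]
      by (simp add: nn_integral_add_completion measurable_completion l_def h_def emeasure_space_1)
    finally show ?thesis .
  qed
  have rm: "r m < \<top>" for m
  proof -
    have "r m <= (EE w. ennreal (real m))" unfolding r_def
      by (rule nn_integral_mono_AE, use controlD(3)[OF L] controlD(3)[OF R] in eventually_elim)
        (unfold Z_def, rule weighted_cut_le[OF _ _ q], simp_all)
    thus ?thesis by (simp add: emeasure_space_1 le_less_trans)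
  qed
  obtain n where n: "nu q a = ennreal n" "0 <= n" "n < 1" using nu by (cases "nu q a") (auto simp: ennreal_less_one_iff)
  obtain h' where h': "h = ennreal h'" "0 <= h'" using h by (cases h) auto
  have bound: "r m <= ennreal ((n * h' + h' + a) / (1 - n))" for m
  proof -
    obtain x where x: "r m = ennreal x" "0 <= x" using rm[of m] by (cases "r m") auto
    have "nu q a * l m <= nu q a * (r m + h)" by (rule mult_left_mono[OF lr]) simp
    hence "r m <= nu q a * (r m + h) + h + ennreal a" using rl[of m] by (meson add_right_mono order_trans)
    also have "... = ennreal (n * (x + h') + h' + a)" using n h' x a by (simp add: ennreal_mult ennreal_plus)
    finally have "x <= n * (x + h') + h' + a" unfolding x(1) using n h' x a by (subst (asm) ennreal_le_iff) auto
    hence "x * (1 - n) <= n * h' + h' + a" by (simp add: algebra_simps)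
    hence "x <= (n * h' + h' + a) / (1 - n)" using n by (simp add: pos_le_divide_eq)
    thus ?thesis unfolding x(1) by (rule ennreal_leI)
  qed
  have sup: "AE w in M. discounted_integral q (%t. R t w) = (SUP m. weighted (%t. exp (- q * t) * Z m t w) (%t. R t w))
      & incseq (%m. weighted (%t. exp (- q * t) * Z m t w) (%t. R t w))" using controlD(3)[OF L] controlD(3)[OF R]
    by eventually_elim (simp only: Z_def weighted_cut_SUP[OF _ _ q] simp_thms)
  have "npv q R = (\<integral>\<^sup>+w. (SUP m. weighted (%t. exp (- q * t) * Z m t w) (%t. R t w)) \<partial>completion M)"
    unfolding nn_integral_completion by (rule nn_integral_cong_AE) (use sup in eventually_elim, simp)
  also have "... = (SUP m. \<integral>\<^sup>+w. weighted (%t. exp (- q * t) * Z m t w) (%t. R t w) \<partial>completion M)"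
  proof (rule nn_integral_monotone_convergence_SUP_AE)
    show "AE w in completion M. weighted (%t. exp (- q * t) * Z m t w) (%t. R t w)
       <= weighted (%t. exp (- q * t) * Z (Suc m) t w) (%t. R t w)" for m
      unfolding AE_completion_iff using sup by eventually_elim (simp add: incseq_Suc_iff)
  qed (rule mr[OF R])
  also have "... <= ennreal ((n * h' + h' + a) / (1 - n))" using bound by (intro SUP_least) (simp add: r_def nn_integral_completion)
  also have "... < \<top>" by simp
  finally show ?thesis .
qed

end

end

section \<open>From the two dualities to a comparison of values\<close>

lemma mixed_comparison:
  fixes A A1 B B1 :: ennreal and n n' \<beta> \<epsilon> :: real
  assumes fin: "A < \<top>" "B < \<top>" "B1 < \<top>" and \<beta>: "0 < \<beta>" and \<epsilon>: "0 <= \<epsilon>"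
    and n: "0 <= n" "\<beta> * n <= 1" and n': "1 <= \<beta> * n'"
    and 1: "ennreal n * A1 + B <= B1 + ennreal n * A" and 2: "ennreal n' * A1 + B <= B1 + ennreal n' * A + ennreal \<epsilon>"
  shows "enn2ereal A1 - ereal \<beta> * enn2ereal B1 <= enn2ereal A - ereal \<beta> * enn2ereal B + ereal (\<beta> * \<epsilon>)"
proof -
  have n'0: "0 < n'" using n' \<beta> by (metis less_eq_real_def linorder_not_le mult_nonneg_nonpos not_one_le_zero order_trans)
  \<comment> \<open>The dividends of the competitor are not assumed finite; the second duality, with
    its positive coefficient and finite right-hand side, shows that they are.\<close>
  have "ennreal n' * A1 <= B1 + ennreal n' * A + ennreal \<epsilon>" using 2 by (rule order_trans[rotated]) simp
  also have "... < \<top>" using fin by (simp add: ennreal_mult_less_top)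
  finally have "A1 < \<top>" using n'0 by (auto simp: ennreal_mult_less_top)
  then obtain x1 x y1 y where x: "A1 = ennreal x1" "A = ennreal x" "B1 = ennreal y1" "B = ennreal y"
    and nn: "0 <= x1" "0 <= x" "0 <= y1" "0 <= y" using fin by (cases A1; cases A; cases B1; cases B) auto
  have i1: "n * x1 + y <= y1 + n * x" using 1 nn n unfolding x by (simp flip: ennreal_mult ennreal_plus)
  have i2: "n' * x1 + y <= y1 + n' * x + \<epsilon>" using 2 nn n'0 \<epsilon> unfolding x by (simp flip: ennreal_mult ennreal_plus)
  have "x1 - x <= \<beta> * (y1 - y + \<epsilon>)"
  proof (cases "x1 <= x")
    case True
    have "(x - x1) * (\<beta> * n) <= (x - x1) * 1" using True n by (intro mult_left_mono) auto
    moreover have "\<beta> * (n * (x1 - x)) <= \<beta> * (y1 - y)" using i1 \<beta> by (intro mult_left_mono) (auto simp: algebra_simps)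
    moreover have "0 <= \<beta> * \<epsilon>" using \<beta> \<epsilon> by simp
    ultimately show ?thesis by (simp add: algebra_simps)
  next
    case False
    have "(x1 - x) * 1 <= (x1 - x) * (\<beta> * n')" using False n' by (intro mult_left_mono) auto
    moreover have "\<beta> * (n' * (x1 - x)) <= \<beta> * (y1 - y + \<epsilon>)" using i2 \<beta> by (intro mult_left_mono) (auto simp: algebra_simps)
    ultimately show ?thesis by (simp add: algebra_simps)
  qed
  hence "x1 - \<beta> * y1 <= x - \<beta> * y + \<beta> * \<epsilon>" by (simp add: algebra_simps)
  thus ?thesis using nn \<beta> unfolding x by (simp add: enn2ereal_ennreal)
qed

section \<open>Verification\<close>

lemma levy_family_space:
  assumes "levy_family P X"
  shows "space (P x) = space (P 0)" "sets (P x) = sets (P 0)" using assms by (auto simp: levy_family_def)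

lemma strategies_control:
  assumes fam: "levy_family P X" and \<pi>: "(L, R) \<in> strategies P X"
  shows "levy_paths.control (P x) X L" "levy_paths.control (P x) X R"
    "AE w in P x. \<forall>t\<ge>0. 0 <= X t w - L t w + R t w"
proof -
  interpret levy_paths "P x" X x by (rule levy_family_paths[OF fam])
  have AE: "AE w in P x. cumulative_path (%t. L t w) & cumulative_path (%t. R t w) & (\<forall>t\<ge>0. 0 <= X t w - L t w + R t w)"
    using \<pi> by (auto simp: strategies_def)
  show "control L" "control R" using \<pi> AE unfolding control_def strategies_def levy_family_space(1)[OF fam, of x] by auto
  show "AE w in P x. \<forall>t\<ge>0. 0 <= X t w - L t w + R t w" using AE by eventually_elim auto
qed

lemma strategiesI:
  assumes "\<And>t. 0 <= t ==> L t \<in> borel_measurable (natural_filtration (space (P 0)) X t)"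
    and "\<And>t. 0 <= t ==> R t \<in> borel_measurable (natural_filtration (space (P 0)) X t)"
    and "\<And>x. AE w in P x. skorokhod a (%t. X t w) (%t. L t w) (%t. R t w)"
  shows "(L, R) \<in> strategies P X" using assms by (auto simp: strategies_def skorokhod_def intro: eventually_mono[OF assms(3)])

lemma increment_integrable:
  assumes fam: "levy_family P X" and int: "integrable (P 0) (%w. \<bar>X 1 w\<bar>)"
  shows "(\<integral>\<^sup>+w. ennreal \<bar>X 1 w - X 0 w\<bar> \<partial>P x) < \<top>"
proof -
  interpret levy_paths "P 0" X 0 by (rule levy_family_paths[OF fam])
  interpret x: levy_paths "P x" X x by (rule levy_family_paths[OF fam])
  have \<phi>: "(%w'. w' (1::real) - w' 0) \<in> measurable (Pi\<^sub>M {0..} (%_. borel)) (borel :: real measure)"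
    by (intro borel_measurable_diff measurable_component_singleton) auto
  note law = levy_family_law(1)[OF fam \<phi>, of x]
  have "(\<integral>\<^sup>+w. ennreal \<bar>X 1 w - X 0 w\<bar> \<partial>P x) = (\<integral>\<^sup>+z. ennreal \<bar>z\<bar> \<partial>distr (P x) borel (%w. X 1 w - X 0 w))"
    by (subst nn_integral_distr) auto
  also have "... = (\<integral>\<^sup>+z. ennreal \<bar>z\<bar> \<partial>distr (P 0) borel (%w. X 1 w - X 0 w))" using law by simp
  also have "... = (\<integral>\<^sup>+w. ennreal \<bar>X 1 w - X 0 w\<bar> \<partial>P 0)" by (subst nn_integral_distr) auto
  also have "... = (\<integral>\<^sup>+w. ennreal \<bar>X 1 w\<bar> \<partial>P 0)"
    by (rule nn_integral_cong_AE) (use start in eventually_elim, simp)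
  also have "... < \<top>" using int by (simp add: integrable_iff_bounded)
  finally show ?thesis .
qed

context
  fixes P :: "real => 'w measure" and X :: "real => 'w => real" and q \<beta> :: real
  assumes fam: "levy_family P X" and q: "0 < q" and \<beta>: "1 < \<beta>"
begin

lemma nu_low_antimono: "0 <= b ==> b <= c ==> nu_low P X q c <= nu_low P X q b"
  and nu_low_nonneg: "0 <= nu_low P X q b"
proof -
  interpret levy_paths "P 0" X 0 by (rule levy_family_paths[OF fam])
  show nn: "0 <= nu_low P X q b" for b unfolding nu_low_def by (rule Bochner_Integration.integral_nonneg) (simp add: discount_def)
  show "nu_low P X q c <= nu_low P X q b" if "0 <= b" "b <= c"
    using nu_antimono[OF q that(2)] nu_low_eq[OF fam q that(1)] nu_low_eq[OF fam q, of c] that nn by (metis ennreal_le_iff order_trans)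
qed

text \<open>Elements of the defining set come arbitrarily close to the infimum from above, so right
  continuity of \<open>\<nu>\<close> gives the inequality at the infimum itself, also if it is
  0.\<close>

lemma optimal_barrier_nonneg: "0 <= optimal_barrier P X q \<beta>"
  and optimal_barrier_le: "\<beta> * nu_low P X q (optimal_barrier P X q \<beta>) <= 1"
  and below_optimal_barrier: "0 < b ==> b < optimal_barrier P X q \<beta> ==> 1 < \<beta> * nu_low P X q b"
proof -
  interpret levy_paths "P 0" X 0 by (rule levy_family_paths[OF fam])
  let ?S = "{a. 0 < a & \<beta> * nu_low P X q a <= 1}" and ?a = "optimal_barrier P X q \<beta>"
  have bdd: "bdd_below ?S" by (rule bdd_belowI[of _ 0]) auto
  have ne: "?S ~= {}"
  proof -
    obtain b where b: "0 < b" "nu q b < ennreal (1 / \<beta>)" using nu_small[OF q, of "1 / \<beta>"] \<beta> by auto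
    hence "ennreal (nu_low P X q b) < ennreal (1 / \<beta>)" using nu_low_eq[OF fam q, of b] by simp
    hence "nu_low P X q b < 1 / \<beta>" using nu_low_nonneg by (simp add: ennreal_less_iff)
    hence "\<beta> * nu_low P X q b <= 1" using \<beta> by (simp add: field_simps)
    with b(1) show ?thesis by blast
  qed
  show a0: "0 <= ?a" unfolding optimal_barrier_def by (rule cInf_greatest[OF ne]) auto
  have le: "nu q (?a + 1 / real (Suc n)) <= ennreal (1 / \<beta>)" for n
  proof -
    have "Inf ?S < ?a + 1 / real (Suc n)" by (simp add: optimal_barrier_def)
    from cInf_lessD[OF ne this] obtain s where s: "0 < s" "\<beta> * nu_low P X q s <= 1" "s < ?a + 1 / real (Suc n)" by blast
    have "nu q (?a + 1 / real (Suc n)) <= nu q s" using s by (intro nu_antimono[OF q]) auto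
    also have "... = ennreal (nu_low P X q s)" using nu_low_eq[OF fam q] s by simp
    also have "... <= ennreal (1 / \<beta>)" using s(2) \<beta> by (intro ennreal_leI) (simp add: field_simps)
    finally show ?thesis .
  qed
  have "nu q ?a <= ennreal (1 / \<beta>)" unfolding nu_right[OF q a0] by (rule SUP_least) (rule le)
  hence "ennreal (nu_low P X q ?a) <= ennreal (1 / \<beta>)" using nu_low_eq[OF fam q a0] by simp
  hence "nu_low P X q ?a <= 1 / \<beta>" using \<beta> by (simp add: ennreal_le_iff)
  thus "\<beta> * nu_low P X q ?a <= 1" using \<beta> by (simp add: field_simps)
  show "1 < \<beta> * nu_low P X q b" if b: "0 < b" "b < ?a"
  proof (rule ccontr)
    assume "~ ?thesis"
    hence "b \<in> ?S" using b by simp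
    from cInf_lower[OF this bdd] show False using b(2) by (simp add: optimal_barrier_def)
  qed
qed

text \<open>One argument for both kinds of barrier. The condition \<open>zero_or\<close> says where
  the coefficient of at least \<open>1 / \<beta>\<close> comes from: a barrier \<open>b\<close>
  below \<open>a\<close> if there is room, the coefficient 1 if \<open>a = 0\<close>.\<close>

lemma verification:
  assumes int: "integrable (P 0) (%w. \<bar>X 1 w\<bar>)" and a: "0 <= a" and opt: "\<beta> * nu_low P X q a <= 1"
    and zero_or: "a = 0 \<or> (\<forall>b. 0 < b & b < a --> 1 < \<beta> * nu_low P X q b)"
    and L: "\<And>t. 0 <= t ==> L t \<in> borel_measurable (natural_filtration (space (P 0)) X t)"
    and R: "\<And>t. 0 <= t ==> R t \<in> borel_measurable (natural_filtration (space (P 0)) X t)"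
    and refl: "\<And>x. AE w in P x. skorokhod a (%t. X t w) (%t. L t w) (%t. R t w)"
    and slack: "\<And>x. AE w in P x. AE t in control_measure (%t. L t w). 0 <= t -->
      skorokhod_path.growth_discount (%t. R t w) q t <= drawdown q a (%t. X t w) t"
  shows "(L, R) \<in> admissible P X q" "value_function P X q \<beta> x = strategy_value P q \<beta> (L, R) x"
proof -
  have strat: "(L, R) \<in> strategies P X" by (rule strategiesI[where a = a]; fact L R refl)
  note nnl = nu_low_nonneg
  have fin: "expected_npv P q R x < \<top>" "expected_npv P q L x < \<top>" for x
  proof -
    interpret levy_paths "P x" X x by (rule levy_family_paths[OF fam])
    note con = strategies_control[OF fam strat, of x]
    have "nu_low P X q a <= 1 / \<beta>" using opt \<beta> by (simp add: field_simps)
    also have "... < 1" using \<beta> by simp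
    finally have "nu q a < 1"
      unfolding levy_family_nu[OF fam q a, of x] nu_low_eq[OF fam q a, symmetric] using nnl by (simp add: ennreal_less_one_iff)
    from injections_finite[OF q a con(1,2) refl increment_integrable[OF fam int] this slack]
    show "expected_npv P q R x < \<top>" by (simp add: expected_npv_def)
    with dividends_finite[OF q a con(1,2) refl increment_integrable[OF fam int]]
    show "expected_npv P q L x < \<top>" by (simp add: expected_npv_def)
  qed
  show adm: "(L, R) \<in> admissible P X q" using strat fin by (simp add: admissible_def)
  have "strategy_value P q \<beta> \<pi> x <= strategy_value P q \<beta> (L, R) x" if \<pi>: "\<pi> \<in> admissible P X q" for \<pi>
  proof (cases \<pi>)
    case (Pair L1 R1)
    interpret levy_paths "P x" X x by (rule levy_family_paths[OF fam])
    have s1: "(L1, R1) \<in> strategies P X" and fin1: "expected_npv P q R1 x < \<top>" using \<pi> Pair by (auto simp: admissible_def)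
    note con = strategies_control[OF fam strat, of x] and con1 = strategies_control[OF fam s1, of x]
    note nu_eq = levy_family_nu[OF fam q, of _ x] nu_low_eq[OF fam q, symmetric]
    have top: "ennreal (nu_low P X q a) * npv q L1 + npv q R <= npv q R1 + ennreal (nu_low P X q a) * npv q L"
      using expected_growth_duality[OF q con1 con(1,2) refl a slack] a by (simp add: nu_eq)
    show ?thesis
    proof (rule ereal_le_epsilon2)
      fix e :: real assume e: "0 < e"
      obtain n' \<epsilon> where n': "1 <= \<beta> * n'" "0 <= \<epsilon>" "\<beta> * \<epsilon> <= e"
        "ennreal n' * npv q L1 + npv q R <= npv q R1 + ennreal n' * npv q L + ennreal \<epsilon>"
      proof (cases "a = 0")
        case True
        from expected_zero_duality[OF q con1 con(1,2) refl True] show ?thesis using \<beta> e by (intro that[of 1 0]) auto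
      next
        case False
        \<comment> \<open>\<open>a / 2\<close> keeps \<open>b\<close> positive, and
          \<open>a - e / \<beta>\<close> makes the error \<open>\<beta> * (a - b)\<close> at most
          \<open>e\<close>.\<close>
        define b where "b = max (a / 2) (a - e / \<beta>)"
        have b: "0 < b" "b < a" "a - b <= e / \<beta>" using False a e \<beta> by (auto simp: b_def)
        have "\<beta> * (a - b) <= e" using b(3) \<beta> by (simp add: field_simps)
        moreover have "ennreal (nu_low P X q b) * npv q L1 + npv q R <= npv q R1 + ennreal (nu_low P X q b) * npv q L + ennreal (a - b)"
          using expected_hit_duality[OF q con1 con(1,2) refl _ b(2)] b by (simp add: nu_eq)
        ultimately show ?thesis using b zero_or False by (intro that[of "nu_low P X q b" "a - b"]) auto
      qed
      have "enn2ereal (npv q L1) - ereal \<beta> * enn2ereal (npv q R1)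
        <= enn2ereal (npv q L) - ereal \<beta> * enn2ereal (npv q R) + ereal (\<beta> * \<epsilon>)"
        by (rule mixed_comparison[OF _ _ _ _ n'(2) nnl opt n'(1) top n'(4)])
          (use fin fin1 \<beta> in \<open>auto simp: expected_npv_def\<close>)
      also have "... <= enn2ereal (npv q L) - ereal \<beta> * enn2ereal (npv q R) + ereal e" using n'(3) by (intro add_left_mono) simp
      finally show "strategy_value P q \<beta> \<pi> x <= strategy_value P q \<beta> (L, R) x + ereal e"
        by (simp add: strategy_value_def expected_npv_def Pair)
    qed
  qed
  thus "value_function P X q \<beta> x = strategy_value P q \<beta> (L, R) x" unfolding value_function_def by (intro antisym SUP_least SUP_upper adm)
qed

lemma positive_barrier_optimal:
  assumes int: "integrable (P 0) (%w. \<bar>X 1 w\<bar>)" and pos: "0 < optimal_barrier P X q \<beta>"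
  shows "double_barrier X \<delta> (optimal_barrier P X q \<beta>) \<in> admissible P X q"
    "value_function P X q \<beta> x = strategy_value P q \<beta> (double_barrier X \<delta> (optimal_barrier P X q \<beta>)) x"
proof -
  let ?a = "optimal_barrier P X q \<beta>"
  let ?L = "%t w. barrier_L ?a (%s. X s w) t" and ?R = "%t w. barrier_R ?a (%s. X s w) t"
  interpret levy_paths "P 0" X 0 by (rule levy_family_paths[OF fam])
  have L: "?L t \<in> borel_measurable (past t)" and R: "?R t \<in> borel_measurable (past t)" if "0 <= t" for t
    by (rule barrier_measurable[OF _ pos that X_past]; simp add: cadlag_X)+
  have path: "AE w in P x. skorokhod ?a (%t. X t w) (%t. ?L t w) (%t. ?R t w)" for x using AE_space
  proof eventually_elim
    case (elim w)
    hence "cadlag (%t. X t w)" using cadlag_X[of w] levy_family_space(1)[OF fam, of x] by blast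
    then interpret barrier_path ?a "%t. X t w" using pos by unfold_locales
    show ?case by (rule barrier_skorokhod)
  qed
  have slack: "AE w in P x. AE t in control_measure (%t. ?L t w). 0 <= t -->
      skorokhod_path.growth_discount (%t. ?R t w) q t <= drawdown q ?a (%t. X t w) t" for x using path[of x]
    by eventually_elim (rule skorokhod_path.growth_slack[OF skorokhod_path.intro q pos])
  have eq: "double_barrier X \<delta> ?a = (?L, ?R)" using pos by (simp add: double_barrier_def)
  have below: "?a = 0 \<or> (\<forall>b. 0 < b & b < ?a --> 1 < \<beta> * nu_low P X q b)" using below_optimal_barrier by blast
  note v = verification[where a = ?a and L = ?L and R = ?R, OF int optimal_barrier_nonneg optimal_barrier_le below]
  have "(?L, ?R) \<in> admissible P X q"
  proof (rule v(1), goal_cases)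
    case (1 t) show ?case by (rule L[OF 1]) next
    case (2 t) show ?case by (rule R[OF 2]) next
    case (3 x) show ?case by (rule path) next
    case (4 x) show ?case by (rule slack)
  qed
  thus "double_barrier X \<delta> ?a \<in> admissible P X q" unfolding eq .
  have "value_function P X q \<beta> x = strategy_value P q \<beta> (?L, ?R) x"
  proof (rule v(2), goal_cases)
    case (1 t) show ?case by (rule L[OF 1]) next
    case (2 t) show ?case by (rule R[OF 2]) next
    case (3 x) show ?case by (rule path) next
    case (4 x) show ?case by (rule slack)
  qed
  thus "value_function P X q \<beta> x = strategy_value P q \<beta> (double_barrier X \<delta> ?a) x" unfolding eq .
qed

end

section \<open>Jumps along grids\<close>

lemma jump_left_limit:
  assumes f: "cadlag f" and s: "0 < s"
  shows "(f \<longlongrightarrow> f s - jump f s) (at_left s)"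
proof -
  obtain l where l: "(f \<longlongrightarrow> l) (at_left s)" using cadlag_left[OF f s] by blast
  have "Lim (at_left s) f = l" using l by (intro tendsto_Lim) auto
  thus ?thesis using l by (simp add: jump_def)
qed

text \<open>Between the last exceptional time before \<open>s\<close> and \<open>s\<close> the path
  stays within \<open>e\<close> of \<open>f s\<close>, and this passes to the left limit.\<close>

lemma small_jump:
  assumes f: "cadlag f" and D: "finite D" "\<And>x y. 0 <= x ==> x <= y ==> y <= T ==> {x<..y} \<inter> D = {} ==> \<bar>f x - f y\<bar> < e"
    and s: "0 < s" "s <= T" "s \<notin> D"
  shows "\<bar>jump f s\<bar> <= e"
proof -
  define u where "u = Max (insert 0 {x\<in>D. x < s})"
  have u: "u < s" "0 <= u" unfolding u_def using D(1) s by (auto simp: Max_less_iff)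
  have no: "{x<..s} \<inter> D = {}" if "u <= x" for x
  proof -
    have "y <= u" if "y \<in> D" "y < s" for y unfolding u_def using D(1) that by (intro Max_ge) auto
    thus ?thesis using that s(3) by force
  qed
  have "((%x. \<bar>f x - f s\<bar>) \<longlongrightarrow> \<bar>f s - jump f s - f s\<bar>) (at_left s)"
    by (intro tendsto_intros jump_left_limit[OF f s(1)])
  moreover have "\<forall>\<^sub>F x in at_left s. \<bar>f x - f s\<bar> <= e" using eventually_at_left_real[OF u(1)]
  proof eventually_elim
    case (elim x)
    thus ?case using D(2)[of x s] no[of x] s u by simp
  qed
  ultimately have "\<bar>f s - jump f s - f s\<bar> <= e" by (rule tendsto_upperbound) simp
  thus ?thesis by simp
qed

lemma infsum_tail:
  fixes w :: "'a => real"
  assumes w: "w summable_on A" "\<And>x. x \<in> A ==> 0 <= w x" and e: "0 < e"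
  shows "\<exists>G. finite G & G \<subseteq> A & (\<forall>B\<subseteq>A - G. infsum w B <= e)"
proof -
  obtain G where G: "finite G" "G \<subseteq> A" "dist (sum w G) (infsum w A) <= e" using infsum_finite_approximation[OF w(1) e] by blast
  have "infsum w B <= e" if B: "B \<subseteq> A - G" for B
  proof -
    have sB: "w summable_on B" "w summable_on G" "w summable_on (G \<union> B)" using B G by (auto intro: summable_on_subset_banach[OF w(1)])
    have "sum w G + infsum w B = infsum w (G \<union> B)"
    proof -
      have "G \<inter> B = {}" using B by blast
      thus ?thesis using infsum_Un_disjoint[OF sB(2,1)] G(1) by simp
    qed
    also have "... <= infsum w A" by (rule infsum_mono_neutral[OF sB(3) w(1)]) (use B G w(2) in auto)
    finally show ?thesis using G(3) by (simp add: dist_real_def)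
  qed
  with G show ?thesis by blast
qed

context
  fixes f :: "real => real" and T :: real and d :: "nat => real" and N :: "nat => nat"
  assumes f: "cadlag f" and T: "0 < T" and d: "\<And>n. 0 < d n" "d \<longlonglongrightarrow> 0" and N: "\<And>n. real (N n) * d n = T"
begin

abbreviation inc :: "nat => nat => real" where
  "inc n k \<equiv> f (d n * real (Suc k)) - f (d n * real k)"

text \<open>The index \<open>k n\<close> belongs to the cell, open on the left, that contains
  \<open>s\<close>. Its right end tends to \<open>s\<close> from the right and its left end strictly
  from the left, which produces the value and the left limit.\<close>

lemma inc_jump:
  assumes s: "0 < s" "s <= T"
  defines "k \<equiv> %n. nat (\<lceil>s / d n\<rceil> - 1)"
  shows "d n * real (k n) < s" "s <= d n * real (Suc (k n))" "k n < N n" "(%n. inc n (k n)) \<longlonglongrightarrow> jump f s"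
proof -
  have pos: "0 < \<lceil>s / d n\<rceil>" for n using s d(1)[of n] by (simp add: zero_less_ceiling)
  have k: "real (k n) = of_int \<lceil>s / d n\<rceil> - 1" for n using pos[of n] unfolding k_def by simp
  show lo: "d n * real (k n) < s" for n
  proof -
    have "real (k n) < s / d n" unfolding k by linarith
    thus ?thesis using d(1)[of n] by (simp add: field_simps)
  qed
  show hi: "s <= d n * real (Suc (k n))" for n
  proof -
    have "s / d n <= real (Suc (k n))" unfolding of_nat_Suc k by linarith
    thus ?thesis using d(1)[of n] by (simp add: field_simps)
  qed
  have "d n * real (k n) < real (N n) * d n" using lo[of n] s N[of n] by simp
  thus "k n < N n" using d(1)[of n] by (simp add: mult.commute)
  have gap: "d n * real (Suc (k n)) = d n * real (k n) + d n" for n by (simp add: algebra_simps)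
  have hilim: "(%n. d n * real (Suc (k n))) \<longlonglongrightarrow> s"
  proof (rule tendsto_sandwich)
    show "\<forall>\<^sub>F n in sequentially. s <= d n * real (Suc (k n))" using hi by simp
    show "\<forall>\<^sub>F n in sequentially. d n * real (Suc (k n)) <= s + d n"
      using lo gap by (intro always_eventually allI) (simp add: less_imp_le)
    show "(%n. s + d n) \<longlonglongrightarrow> s" using tendsto_add[OF tendsto_const[of s] d(2)] by simp
  qed simp
  have lolim: "(%n. d n * real (k n)) \<longlonglongrightarrow> s" using tendsto_diff[OF hilim d(2)] unfolding gap by simp
  have "(%n. f (d n * real (Suc (k n)))) \<longlonglongrightarrow> f s" using right_continuous_seq[OF cadlag_right[OF f] hilim hi] s by simp
  moreover have "(%n. f (d n * real (k n))) \<longlonglongrightarrow> f s - jump f s"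
  proof -
    have "filterlim (%n. d n * real (k n)) (at_left s) sequentially"
      unfolding filterlim_at using lolim lo by (auto intro!: always_eventually simp: less_imp_neq)
    from filterlim_compose[OF jump_left_limit[OF f s(1)] this] show ?thesis .
  qed
  ultimately have "(%n. inc n (k n)) \<longlonglongrightarrow> f s - (f s - jump f s)" by (rule tendsto_diff)
  thus "(%n. inc n (k n)) \<longlonglongrightarrow> jump f s" by simp
qed

text \<open>As \<open>g\<close> vanishes on small arguments, only finitely many times count. On fine
  grids they lie in different cells, and every other cell has an increment below
  \<open>e\<close>.\<close>

lemma grid_jumps:
  fixes g :: "real => real"
  assumes g: "continuous_on UNIV g" and e: "0 < e" "\<And>x. \<bar>x\<bar> <= e ==> g x = 0"
  shows "finite {s\<in>{0<..T}. g (jump f s) ~= 0}"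
    and "(%n. \<Sum>k<N n. g (inc n k)) \<longlonglongrightarrow> infsum (%s. g (jump f s)) {0<..T}"
proof -
  obtain D0 where D0: "finite D0" "\<And>x y. 0 <= x ==> x <= y ==> y <= T ==> {x<..y} \<inter> D0 = {} ==> \<bar>f x - f y\<bar> < e"
    using cadlag_partition[OF f order_refl less_imp_le[OF T] e(1)] by blast
  define D where "D = D0 \<inter> {0<..T}"
  have D: "finite D" "D \<subseteq> {0<..T}" using D0(1) by (auto simp: D_def)
  have out: "g (jump f s) = 0" if "s \<in> {0<..T}" "s \<notin> D" for s
  proof (rule e(2))
    have "0 < s" "s <= T" "s \<notin> D0" using that unfolding D_def by simp_all
    from small_jump[OF f D0 this] show "\<bar>jump f s\<bar> <= e" .
  qed
  hence "{s\<in>{0<..T}. g (jump f s) ~= 0} \<subseteq> D" by auto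
  thus "finite {s\<in>{0<..T}. g (jump f s) ~= 0}" using D(1) finite_subset by blast
  have sum: "infsum (%s. g (jump f s)) {0<..T} = (\<Sum>s\<in>D. g (jump f s))"
  proof -
    have "infsum (%s. g (jump f s)) {0<..T} = infsum (%s. g (jump f s)) D" by (rule infsum_cong_neutral) (use out D in auto)
    thus ?thesis using D(1) by simp
  qed
  define k where "k s n = nat (\<lceil>s / d n\<rceil> - 1)" for s n
  have k: "d n * real (k s n) < s" "s <= d n * real (Suc (k s n))" "k s n < N n" "(%n. inc n (k s n)) \<longlonglongrightarrow> jump f s"
    if "s \<in> D" for s n
  proof -
    have s: "0 < s" "s <= T" using subsetD[OF D(2) that] by simp_all
    show "d n * real (k s n) < s" "s <= d n * real (Suc (k s n))" "k s n < N n" "(%n. inc n (k s n)) \<longlonglongrightarrow> jump f s"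
      unfolding k_def by (rule inc_jump[OF s])+
  qed
  have "\<forall>\<^sub>F n in sequentially. \<forall>s\<in>D. \<forall>s'\<in>D. s ~= s' --> k s n ~= k s' n"
  proof (intro eventually_ball_finite D(1) ballI)
    fix s s' assume s: "s \<in> D" "s' \<in> D"
    show "\<forall>\<^sub>F n in sequentially. s ~= s' --> k s n ~= k s' n"
    proof (cases "s = s'")
      case False
      hence "\<forall>\<^sub>F n in sequentially. d n < \<bar>s - s'\<bar>" using order_tendstoD(2)[OF d(2), of "\<bar>s - s'\<bar>"] by simp
      thus ?thesis
      proof eventually_elim
        case (elim n)
        show ?case
        proof (intro impI notI)
          assume "k s n = k s' n"
          hence "\<bar>s - s'\<bar> < d n" using k(1,2)[OF s(1), of n] k(1,2)[OF s(2), of n] by (simp add: algebra_simps abs_less_iff)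
          thus False using elim by simp
        qed
      qed
    qed simp
  qed
  hence "\<forall>\<^sub>F n in sequentially. (\<Sum>k<N n. g (inc n k)) = (\<Sum>s\<in>D. g (inc n (k s n)))"
  proof eventually_elim
    case (elim n)
    hence inj: "inj_on (%s. k s n) D" by (auto simp: inj_on_def)
    have "(\<Sum>j<N n. g (inc n j)) = (\<Sum>j\<in>(%s. k s n) ` D. g (inc n j))"
    proof (rule sum.mono_neutral_right)
      show "(%s. k s n) ` D \<subseteq> {..<N n}" using k(3) by auto
      show "\<forall>j\<in>{..<N n} - (%s. k s n) ` D. g (inc n j) = 0"
      proof
        fix j assume j: "j \<in> {..<N n} - (%s. k s n) ` D"
        have le: "d n * real (Suc j) <= T"
        proof -
          have "real (Suc j) <= real (N n)" using j by auto
          hence "d n * real (Suc j) <= d n * real (N n)" using d(1)[of n] by (intro mult_left_mono) auto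
          thus ?thesis using N[of n] by (simp add: mult.commute)
        qed
        have "{d n * real j<..d n * real (Suc j)} \<inter> D0 = {}"
        proof (rule ccontr)
          assume "~ ?thesis"
          then obtain s where s: "s \<in> D0" "d n * real j < s" "s <= d n * real (Suc j)" by auto
          have "0 < s" using s(2) d(1)[of n] by (intro le_less_trans[OF _ s(2)]) (simp add: less_imp_le)
          hence sD: "s \<in> D" using s le by (simp add: D_def)
          have "real j < real (Suc (k s n))" "real (k s n) < real (Suc j)"
            using less_le_trans[OF s(2) k(2)[OF sD, of n]] less_le_trans[OF k(1)[OF sD, of n] s(3)] d(1)[of n]
            by (simp_all only: mult_less_cancel_left_pos)
          hence "j = k s n" by simp
          thus False using j sD by blast
        qed
        hence "\<bar>f (d n * real j) - f (d n * real (Suc j))\<bar> < e"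
          using D0(2)[of "d n * real j" "d n * real (Suc j)"] le d(1)[of n] by (simp add: less_imp_le)
        thus "g (inc n j) = 0" by (intro e(2)) (simp add: abs_minus_commute)
      qed
    qed simp
    also have "... = (\<Sum>s\<in>D. g (inc n (k s n)))" by (simp add: sum.reindex[OF inj])
    finally show ?case .
  qed
  moreover have "(%n. \<Sum>s\<in>D. g (inc n (k s n))) \<longlonglongrightarrow> (\<Sum>s\<in>D. g (jump f s))"
  proof (rule tendsto_sum)
    fix s assume "s \<in> D"
    have "isCont g (jump f s)" using g by (simp add: continuous_on_eq_continuous_at)
    from isCont_tendsto_compose[OF this k(4)[OF \<open>s \<in> D\<close>]] show "(%n. g (inc n (k s n))) \<longlonglongrightarrow> g (jump f s)" .
  qed
  ultimately show "(%n. \<Sum>k<N n. g (inc n k)) \<longlonglongrightarrow> infsum (%s. g (jump f s)) {0<..T}"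
    unfolding sum by (simp add: tendsto_cong)
qed

lemma jumps_countable: "countable {s\<in>{0<..T}. jump f s ~= 0}"
proof -
  define g where "g e x = max (\<bar>x\<bar> - e) 0" for e x :: real
  have "countable (\<Union>n::nat. {s\<in>{0<..T}. g (1 / real (Suc n)) (jump f s) ~= 0})"
  proof (rule countable_UN)
    fix n :: nat
    have "finite {s\<in>{0<..T}. g (1 / real (Suc n)) (jump f s) ~= 0}"
      by (rule grid_jumps(1)[where e = "1 / real (Suc n)"]) (auto simp: g_def intro!: continuous_intros)
    thus "countable {s\<in>{0<..T}. g (1 / real (Suc n)) (jump f s) ~= 0}" by (rule countable_finite)
  qed simp
  moreover have "{s\<in>{0<..T}. jump f s ~= 0} \<subseteq> (\<Union>n::nat. {s\<in>{0<..T}. g (1 / real (Suc n)) (jump f s) ~= 0})"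
  proof
    fix s assume s: "s \<in> {s\<in>{0<..T}. jump f s ~= 0}"
    then obtain n where "1 / real (Suc n) < \<bar>jump f s\<bar>" using reals_Archimedean[of "\<bar>jump f s\<bar>"] by (auto simp: inverse_eq_divide)
    hence "g (1 / real (Suc n)) (jump f s) ~= 0" by (simp add: g_def)
    thus "s \<in> (\<Union>n::nat. {s\<in>{0<..T}. g (1 / real (Suc n)) (jump f s) ~= 0})" using s by blast
  qed
  ultimately show ?thesis by (rule countable_subset[rotated])
qed

section \<open>Jump sums under a bound on the variation along grids\<close>

context
  fixes V :: real
  assumes V: "\<And>n. (\<Sum>k<N n. \<bar>inc n k\<bar>) <= V"
begin

text \<open>Lowering the jump sizes by \<open>e\<close> makes the summand vanish near 0, so the
  limit along grids applies; on a finite set the lowering costs at most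
  \<open>card F * e\<close>.\<close>

lemma jumps_le_variation:
  assumes F: "finite F" "F \<subseteq> {0<..T}"
  shows "(\<Sum>s\<in>F. \<bar>jump f s\<bar>) <= V"
proof (rule field_le_epsilon)
  fix \<eta> :: real assume \<eta>: "0 < \<eta>"
  define e where "e = \<eta> / (real (card F) + 1)"
  have e: "0 < e" using \<eta> by (simp add: e_def)
  define g where "g x = max (\<bar>x\<bar> - e) 0" for x
  note gj = grid_jumps[of g e, OF _ e]
  have gc: "continuous_on UNIV g" unfolding g_def by (intro continuous_intros)
  have lim: "(%n. \<Sum>k<N n. g (inc n k)) \<longlonglongrightarrow> infsum (%s. g (jump f s)) {0<..T}"
    and fin: "finite {s\<in>{0<..T}. g (jump f s) ~= 0}" using gj gc by (auto simp: g_def)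
  have "infsum (%s. g (jump f s)) {0<..T} <= V"
  proof (rule LIMSEQ_le_const2[OF lim], intro exI allI impI)
    fix n :: nat
    have "(\<Sum>k<N n. g (inc n k)) <= (\<Sum>k<N n. \<bar>inc n k\<bar>)" using e by (intro sum_mono) (auto simp: g_def)
    thus "(\<Sum>k<N n. g (inc n k)) <= V" using V[of n] by linarith
  qed
  moreover have "(\<Sum>s\<in>F. g (jump f s)) <= infsum (%s. g (jump f s)) {0<..T}"
  proof (rule finite_sum_le_infsum[OF _ F])
    have "(%s. g (jump f s)) summable_on {s\<in>{0<..T}. g (jump f s) ~= 0}" using fin by simp
    thus "(%s. g (jump f s)) summable_on {0<..T}" by (rule summable_on_cong_neutral[THEN iffD1, rotated -1]) auto
  qed (simp add: g_def)
  moreover have "(\<Sum>s\<in>F. \<bar>jump f s\<bar>) <= (\<Sum>s\<in>F. g (jump f s) + e)" by (intro sum_mono) (auto simp: g_def)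
  moreover have "(\<Sum>s\<in>F. g (jump f s) + e) = (\<Sum>s\<in>F. g (jump f s)) + real (card F) * e" by (simp add: sum.distrib)
  moreover have "real (card F) * e <= \<eta>" using \<eta> by (simp add: e_def field_simps)
  ultimately show "(\<Sum>s\<in>F. \<bar>jump f s\<bar>) <= V + \<eta>" by linarith
qed

lemma abs_jumps_summable: "(%s. \<bar>jump f s\<bar>) summable_on {0<..T}"
  using jumps_le_variation by (intro nonneg_bdd_above_summable_on bdd_aboveI[of _ V]) auto

lemma jumps_summable:
  assumes "\<And>x. \<bar>w x\<bar> <= K * \<bar>x\<bar>"
  shows "(%s. w (jump f s)) summable_on {0<..T}"
    and "\<bar>infsum (%s. w (jump f s)) {0<..T}\<bar> <= K * V"
proof -
  have Ks: "(%s. K * \<bar>jump f s\<bar>) summable_on {0<..T}" by (rule summable_on_cmult_right[OF abs_jumps_summable])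
  have as: "(%s. \<bar>w (jump f s)\<bar>) summable_on {0<..T}" by (rule summable_on_comparison_test[OF Ks]) (use assms in auto)
  thus s: "(%s. w (jump f s)) summable_on {0<..T}" by (subst summable_on_iff_abs_summable_on_real) simp
  have "\<bar>infsum (%s. w (jump f s)) {0<..T}\<bar> <= infsum (%s. \<bar>w (jump f s)\<bar>) {0<..T}"
    using norm_infsum_bound[of "%s. w (jump f s)" "{0<..T}"] as by simp
  also have "... <= infsum (%s. K * \<bar>jump f s\<bar>) {0<..T}" by (rule infsum_mono[OF as Ks]) (use assms in auto)
  also have "... = K * infsum (%s. \<bar>jump f s\<bar>) {0<..T}" by (rule infsum_cmult_right) (simp add: abs_jumps_summable)
  also have "... <= K * V"
  proof (rule mult_left_mono)
    show "infsum (%s. \<bar>jump f s\<bar>) {0<..T} <= V" by (rule infsum_le_finite_sums[OF abs_jumps_summable]) (rule jumps_le_variation)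
    show "0 <= K" using assms[of 1] by simp
  qed
  finally show "\<bar>infsum (%s. w (jump f s)) {0<..T}\<bar> <= K * V" .
qed

text \<open>\<open>w\<close> need not vanish near 0, so its argument is clamped to
  \<open>[- e, e]\<close>: the clamped part is at most \<open>C * e * \<bar>x\<bar>\<close> and
  contributes at most \<open>C * e * V\<close> to the sums and to the limit, while the difference
  vanishes on \<open>[- e, e]\<close>.\<close>

lemma grid_jumps_variation:
  assumes w: "continuous_on UNIV w" "\<And>x. \<bar>w x\<bar> <= C * x\<^sup>2" "\<And>x. \<bar>w x\<bar> <= K * \<bar>x\<bar>"
  shows "(%n. \<Sum>k<N n. w (inc n k)) \<longlonglongrightarrow> infsum (%s. w (jump f s)) {0<..T}"
proof (rule metric_LIMSEQ_I)
  fix r :: real assume r: "0 < r"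
  have C0: "0 <= C" using w(2)[of 1] by simp
  have V0: "0 <= V" using order_trans[OF sum_nonneg V[of 0]] by simp
  \<comment> \<open>This makes \<open>C * e * V\<close> at most \<open>r / 4\<close>; the added ones
    exclude a zero denominator.\<close>
  define e where "e = r / (4 * (C + 1) * (V + 1))"
  have e: "0 < e" using r C0 V0 by (simp add: e_def)
  define c where "c x = max (- e) (min e x)" for x
  define v where "v x = w (c x)" for x
  have vb: "\<bar>v x\<bar> <= C * e * \<bar>x\<bar>" for x
  proof -
    have "\<bar>v x\<bar> <= C * (c x)\<^sup>2" unfolding v_def by (rule w(2))
    also have "(c x)\<^sup>2 = \<bar>c x\<bar> * \<bar>c x\<bar>" by (simp add: power2_eq_square)
    also have "... <= e * \<bar>x\<bar>" using e by (intro mult_mono) (auto simp: c_def)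
    finally show ?thesis using C0 by (simp add: mult_left_mono mult.assoc)
  qed
  have small: "C * e * V < r / 2"
  proof -
    have "C * V <= (C + 1) * (V + 1)" using C0 V0 by (simp add: algebra_simps)
    moreover have "0 < (C + 1) * (V + 1)" using C0 V0 by simp
    ultimately have "r * (C * V) <= r * ((C + 1) * (V + 1))" using r by (intro mult_left_mono) auto
    hence "r * (C * V) / (4 * ((C + 1) * (V + 1))) <= r / 4" using \<open>0 < (C + 1) * (V + 1)\<close> by (subst pos_divide_le_eq) auto
    moreover have "e * (C * V) = r * (C * V) / (4 * ((C + 1) * (V + 1)))" unfolding e_def by (simp only: times_divide_eq_left mult.assoc)
    ultimately have "e * (C * V) <= r / 4" by simp
    thus ?thesis using r by (simp add: mult_ac)
  qed
  define g where "g x = w x - v x" for x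
  have cc: "continuous_on UNIV c" unfolding c_def by (intro continuous_intros)
  have "continuous_on UNIV v" unfolding v_def by (rule continuous_on_compose2[OF w(1) cc]) auto
  hence gc: "continuous_on UNIV g" unfolding g_def by (intro continuous_intros w(1))
  have g0: "g x = 0" if "\<bar>x\<bar> <= e" for x using that by (simp add: g_def v_def c_def)
  have "(%n. \<Sum>k<N n. g (inc n k)) \<longlonglongrightarrow> infsum (%s. g (jump f s)) {0<..T}"
    by (rule grid_jumps(2)[OF gc e g0])
  from metric_LIMSEQ_D[OF this, of "r / 2 - C * e * V"] small
  obtain n0 where n0: "\<And>n. n0 <= n ==> dist (\<Sum>k<N n. g (inc n k)) (infsum (%s. g (jump f s)) {0<..T}) < r / 2 - C * e * V"
    by auto
  note vs = jumps_summable[of v "C * e", OF vb] and ws = jumps_summable[of w K, OF w(3)]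
  have split: "infsum (%s. g (jump f s)) {0<..T} = infsum (%s. w (jump f s)) {0<..T} - infsum (%s. v (jump f s)) {0<..T}"
  proof -
    have "\<bar>g x\<bar> <= (K + C * e) * \<bar>x\<bar>" for x using w(3)[of x] vb[of x] unfolding g_def distrib_right by linarith
    from infsum_add[OF jumps_summable(1)[of g, OF this] vs(1)] show ?thesis by (simp add: g_def)
  qed
  have "dist (\<Sum>k<N n. w (inc n k)) (infsum (%s. w (jump f s)) {0<..T}) < r" if n: "n0 <= n" for n
  proof -
    have "\<bar>\<Sum>k<N n. v (inc n k)\<bar> <= (\<Sum>k<N n. C * e * \<bar>inc n k\<bar>)" by (rule order_trans[OF sum_abs]) (intro sum_mono vb)
    also have "... = C * e * (\<Sum>k<N n. \<bar>inc n k\<bar>)" by (simp add: sum_distrib_left)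
    also have "... <= C * e * V" using V[of n] C0 e by (intro mult_left_mono) auto
    finally have "\<bar>\<Sum>k<N n. v (inc n k)\<bar> <= C * e * V" .
    moreover have "(\<Sum>k<N n. g (inc n k)) = (\<Sum>k<N n. w (inc n k)) - (\<Sum>k<N n. v (inc n k))" by (simp add: g_def sum_subtractf)
    ultimately show ?thesis using n0[OF n] vs(2) unfolding split dist_real_def by linarith
  qed
  thus "\<exists>no. \<forall>n\<ge>no. dist (\<Sum>k<N n. w (inc n k)) (infsum (%s. w (jump f s)) {0<..T}) < r" by blast
qed

end

end

section \<open>Reflection at zero\<close>

context
  fixes w' :: "real => real" and c b :: real
  assumes w': "\<And>s. 0 <= w' s" and summable: "\<And>T. w' summable_on {0<..T}" and c: "0 <= c" and b: "0 <= b"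
begin

lemma sum_process_diff:
  assumes "0 <= s" "s <= t"
  shows "(c + b * t + infsum w' {0<..t}) - (c + b * s + infsum w' {0<..s}) = b * (t - s) + infsum w' {s<..t}"
proof -
  have "w' summable_on {s<..t}" by (rule summable_on_subset_banach[OF summable[of t]]) (use assms in auto)
  moreover have "{0<..t} = {0<..s} \<union> {s<..t}" "{0<..s} \<inter> {s<..t} = {}" using assms by auto
  ultimately have "infsum w' {0<..t} = infsum w' {0<..s} + infsum w' {s<..t}" using infsum_Un_disjoint[OF summable] by metis
  thus ?thesis by (simp add: algebra_simps)
qed

lemma sum_process_cumulative: "cumulative_path (%t. c + b * t + infsum w' {0<..t})" unfolding cumulative_path_def
proof (intro conjI allI impI)
  show "0 <= c + b * 0 + infsum w' {0<..0}" using c by simp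
  show "mono_on {0..} (%t. c + b * t + infsum w' {0<..t})"
  proof (rule monotone_onI)
    fix s t :: real assume st: "s \<in> {0..}" "t \<in> {0..}" "s <= t"
    have "0 <= b * (t - s) + infsum w' {s<..t}" using b w' st by (intro add_nonneg_nonneg infsum_nonneg) auto
    thus "c + b * s + infsum w' {0<..s} <= c + b * t + infsum w' {0<..t}" using sum_process_diff[of s t] st by simp
  qed
  fix t :: real assume t: "0 <= t"
  show "continuous (at_right t) (%t. c + b * t + infsum w' {0<..t})" unfolding continuous_within
  proof (rule tendstoI)
    fix e :: real assume e: "0 < e"
    obtain G where G: "finite G" "G \<subseteq> {0<..t + 1}" "\<And>B. B \<subseteq> {0<..t + 1} - G ==> infsum w' B <= e / 2"
      using infsum_tail[OF summable[of "t + 1"] w', of "e / 2"] e by auto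
    define v where "v = Min (insert (t + 1) {x\<in>G. t < x})"
    have v: "t < v" "v <= t + 1" unfolding v_def using G(1) by auto
    have no: "{t<..u} \<inter> G = {}" if "u < v" for u
    proof -
      have "v <= y" if "y \<in> G" "t < y" for y unfolding v_def using G(1) that by (intro Min_le) auto
      thus ?thesis using that by force
    qed
    have "((%u. b * (u - t)) \<longlongrightarrow> b * (t - t)) (at_right t)" by (intro tendsto_intros)
    hence "\<forall>\<^sub>F u in at_right t. b * (u - t) < e / 2" using e by (intro order_tendstoD) auto
    with eventually_at_right_real[OF v(1)]
    show "\<forall>\<^sub>F u in at_right t. dist (c + b * u + infsum w' {0<..u}) (c + b * t + infsum w' {0<..t}) < e"
    proof eventually_elim
      case (elim u)
      have sub: "{t<..u} \<subseteq> {0<..t + 1} - G" using no[of u] elim v t by auto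
      have "infsum w' {t<..u} <= e / 2" by (rule G(3)[OF sub])
      moreover have "0 <= infsum w' {t<..u}" "0 <= b * (u - t)" using w' b elim by (auto intro: infsum_nonneg)
      ultimately show ?case using sum_process_diff[of t u] t elim unfolding dist_real_def by simp
    qed
  qed
qed

text \<open>Finitely many jumps carry all but \<open>e / 2\<close> of the total, and none of them
  lies just before \<open>t\<close>; over a short interval the drift adds at most
  \<open>e / 2\<close>.\<close>

lemma sum_process_atom:
  assumes t: "0 < t" "w' t = 0"
  shows "emeasure (control_measure (%t. c + b * t + infsum w' {0<..t})) {t} = 0"
proof -
  let ?\<mu> = "control_measure (%t. c + b * t + infsum w' {0<..t})"
  have "emeasure ?\<mu> {t} <= 0 + ennreal e" if e: "0 < e" for e
  proof -
    obtain G where G: "finite G" "G \<subseteq> {0<..t}" "\<And>B. B \<subseteq> {0<..t} - G ==> infsum w' B <= e / 2"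
      using infsum_tail[OF summable[of "t"] w', of "e / 2"] e by auto
    define v where "v = Max (insert (t - e / (2 * (b + 1))) (insert 0 {x\<in>G. x < t}))"
    have v: "v < t" unfolding v_def using G(1) t e b by (auto simp: Max_less_iff)
    have v': "0 <= v" "t - e / (2 * (b + 1)) <= v" unfolding v_def using G(1) by (intro Max_ge; simp)+
    note v = v v'
    have "{v<..<t} \<inter> G = {}"
    proof -
      have "y <= v" if "y \<in> G" "y < t" for y unfolding v_def using G(1) that by (intro Max_ge) auto
      thus ?thesis by force
    qed
    hence sub: "{v<..<t} \<subseteq> {0<..t} - G" using v by auto
    have "infsum w' {v<..t} = infsum w' {v<..<t}" by (rule infsum_cong_neutral) (use t in auto)
    hence le: "infsum w' {v<..t} <= e / 2" using G(3)[OF sub] by simp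
    have "b * (t - v) <= (b + 1) * (e / (2 * (b + 1)))" using b v by (intro mult_mono) auto
    also have "... = e / 2" using b by (simp add: divide_simps)
    finally have bl: "b * (t - v) <= e / 2" .
    have "emeasure ?\<mu> {t} <= emeasure ?\<mu> {v<..t}" using v by (intro emeasure_mono) auto
    also have "... = ennreal (b * (t - v) + infsum w' {v<..t})"
      using emeasure_control_Ioc[OF sum_process_cumulative v(2), of t] sum_process_diff[of v t] v by simp
    also have "... <= ennreal e" using le bl by (intro ennreal_leI) simp
    finally show ?thesis by simp
  qed
  hence "emeasure ?\<mu> {t} <= 0" by (rule ennreal_le_epsilon)
  thus ?thesis by simp
qed

end

text \<open>Valid also without summability: the supremum is then infinite, and \<open>infsum\<close>
  and \<open>enn2real\<close> both return 0. Measurability of jump sums is thereby available at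
  every sample point.\<close>

lemma infsum_truncated:
  fixes j :: "'a => real"
  assumes j: "\<And>s. 0 <= j s" and fin: "\<And>m::nat. finite {s\<in>A. max (j s - 1 / real (Suc m)) 0 ~= 0}"
  shows "infsum j A = enn2real (SUP m. ennreal (infsum (%s. max (j s - 1 / real (Suc m)) 0) A))"
proof -
  define i where "i m = infsum (%s. max (j s - 1 / real (Suc m)) 0) A" for m
  have summ: "(%s. max (j s - 1 / real (Suc m)) 0) summable_on A" for m
  proof -
    have "(%s. max (j s - 1 / real (Suc m)) 0) summable_on {s\<in>A. max (j s - 1 / real (Suc m)) 0 ~= 0}" using fin[of m] by simp
    thus ?thesis by (rule summable_on_cong_neutral[THEN iffD1, rotated -1]) auto
  qed
  have i0: "0 <= i m" for m unfolding i_def by (rule infsum_nonneg) simp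
  have fin_le: "ennreal (sum j F) <= (SUP m. ennreal (i m))" if F: "finite F" "F \<subseteq> A" for F
  proof (rule LIMSEQ_le_const2)
    have "(%m. sum j F - real (card F) * inverse (real (Suc m))) \<longlonglongrightarrow> sum j F - real (card F) * 0"
      by (intro tendsto_intros LIMSEQ_inverse_real_of_nat)
    thus "(%m. ennreal (sum j F - real (card F) * inverse (real (Suc m)))) \<longlonglongrightarrow> ennreal (sum j F)"
      by (intro tendsto_ennrealI) simp
    show "\<exists>n. \<forall>m\<ge>n. ennreal (sum j F - real (card F) * inverse (real (Suc m))) <= (SUP m. ennreal (i m))"
    proof (intro exI[of _ 0] allI impI)
      fix m :: nat
      have "sum j F <= (\<Sum>s\<in>F. max (j s - 1 / real (Suc m)) 0 + inverse (real (Suc m)))" by (intro sum_mono) (simp add: inverse_eq_divide)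
      also have "... = (\<Sum>s\<in>F. max (j s - 1 / real (Suc m)) 0) + real (card F) * inverse (real (Suc m))" by (simp add: sum.distrib)
      also have "(\<Sum>s\<in>F. max (j s - 1 / real (Suc m)) 0) <= i m" unfolding i_def by (rule finite_sum_le_infsum[OF summ F]) simp
      finally have "sum j F - real (card F) * inverse (real (Suc m)) <= i m" by simp
      thus "ennreal (sum j F - real (card F) * inverse (real (Suc m))) <= (SUP m. ennreal (i m))" by (intro SUP_upper2[of m] ennreal_leI) auto
    qed
  qed
  show ?thesis
  proof (cases "j summable_on A")
    case True
    have "(SUP m. ennreal (i m)) <= ennreal (infsum j A)"
    proof (intro SUP_least ennreal_leI)
      fix m show "i m <= infsum j A" unfolding i_def by (rule infsum_mono[OF summ True]) (simp add: j)
    qed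
    then obtain r where r: "(SUP m. ennreal (i m)) = ennreal r" "0 <= r" "r <= infsum j A"
      using infsum_nonneg[of A j] j by (cases "SUP m. ennreal (i m)") (auto simp: top_unique)
    have "infsum j A <= r"
    proof (rule infsum_le_finite_sums[OF True])
      fix F assume "finite F" "F \<subseteq> A"
      from fin_le[OF this] show "sum j F <= r" using r(2) by (simp add: r(1))
    qed
    thus ?thesis using r unfolding i_def[symmetric] by simp
  next
    case False
    have top: "(SUP m. ennreal (i m)) = \<top>"
    proof (rule ccontr)
      assume "(SUP m. ennreal (i m)) ~= \<top>"
      then obtain r where r: "(SUP m. ennreal (i m)) = ennreal r" "0 <= r" by (cases "SUP m. ennreal (i m)") auto
      have "sum j F <= r" if "finite F" "F \<subseteq> A" for F using fin_le[OF that] r by simp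
      hence "j summable_on A" using j by (intro nonneg_bdd_above_summable_on bdd_aboveI[of _ r]) auto
      thus False using False by simp
    qed
    show ?thesis unfolding i_def[symmetric] top infsum_not_exists[OF False] by simp
  qed
qed

lemma dyadic_mesh: "0 < (t :: real) ==> 0 < t / 2 ^ n" "(%n. t / 2 ^ n) \<longlonglongrightarrow> 0" "real (2 ^ n) * (t / 2 ^ n) = t"
  using LIMSEQ_divide_realpow_zero[of 2 t] by auto

text \<open>Each truncated summand vanishes near 0, so its jump sum is a limit of grid sums of
  values up to \<open>t\<close>; a supremum then removes the truncation.\<close>

lemma jump_sum_measurable:
  fixes X :: "real => 'w => real"
  assumes cad: "\<And>w. w \<in> space M ==> cadlag (%t. X t w)" and t: "0 <= t"
    and X: "\<And>s. 0 <= s ==> s <= t ==> X s \<in> borel_measurable M"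
    and h: "continuous_on UNIV h" "\<And>x. 0 <= h x" "\<And>x. h x <= \<bar>x\<bar>"
  shows "(%w. infsum (%s. h (jump (%t. X t w) s)) {0<..t}) \<in> borel_measurable M"
proof (cases "t = 0")
  case False
  hence t: "0 < t" using t by simp
  define g where "g m x = max (h x - 1 / real (Suc m)) 0" for m x
  have gc: "continuous_on UNIV (g m)" for m unfolding g_def by (intro continuous_intros h(1))
  have g0: "g m x = 0" if "\<bar>x\<bar> <= 1 / real (Suc m)" for m x using h(3)[of x] that by (simp add: g_def)
  have e: "0 < 1 / real (Suc m)" for m by simp
  note gj = grid_jumps[OF cad t dyadic_mesh(1)[OF t] dyadic_mesh(2) dyadic_mesh(3) gc e g0]
  have grid: "X (t / 2 ^ n * real k) \<in> borel_measurable M" if "k <= 2 ^ n" for n k :: nat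
  proof (rule X)
    have "real k <= 2 ^ n" using that by (metis of_nat_le_iff of_nat_numeral of_nat_power)
    thus "t / 2 ^ n * real k <= t" using t by (simp add: field_simps)
  qed (use t in simp)
  have [measurable]: "(%w. infsum (%s. g m (jump (%t. X t w) s)) {0<..t}) \<in> borel_measurable M" for m
  proof (rule borel_measurable_LIMSEQ_real)
    show "(%n. \<Sum>k<2 ^ n. g m (X (t / 2 ^ n * real (Suc k)) w - X (t / 2 ^ n * real k) w))
      \<longlonglongrightarrow> infsum (%s. g m (jump (%t. X t w) s)) {0<..t}" if "w \<in> space M" for w by (rule gj(2)[OF that])
    show "(%w. \<Sum>k<2 ^ n. g m (X (t / 2 ^ n * real (Suc k)) w - X (t / 2 ^ n * real k) w)) \<in> borel_measurable M" for n
    proof (rule borel_measurable_sum)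
      fix k assume k: "k \<in> {..<(2::nat) ^ n}"
      have [measurable]: "X (t / 2 ^ n * real (Suc k)) \<in> borel_measurable M" "X (t / 2 ^ n * real k) \<in> borel_measurable M"
        by (rule grid; use k in simp)+
      have [measurable]: "g m \<in> borel_measurable borel" by (rule borel_measurable_continuous_onI[OF gc])
      show "(%w. g m (X (t / 2 ^ n * real (Suc k)) w - X (t / 2 ^ n * real k) w)) \<in> borel_measurable M" by measurable
    qed
  qed
  have "(%w. enn2real (SUP m. ennreal (infsum (%s. g m (jump (%t. X t w) s)) {0<..t}))) \<in> borel_measurable M"
    by measurable
  also have "?this \<longleftrightarrow> ?thesis"
  proof (rule measurable_cong)
    fix w assume w: "w \<in> space M"
    show "enn2real (SUP m. ennreal (infsum (%s. g m (jump (%t. X t w) s)) {0<..t}))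
      = infsum (%s. h (jump (%t. X t w) s)) {0<..t}" unfolding g_def
      by (rule infsum_truncated[symmetric, OF h(2)]) (use gj(1)[OF w] in \<open>simp only: g_def\<close>)
  qed
  finally show ?thesis .
qed simp

lemma zero_barrier_measurable:
  fixes X :: "real => 'w => real"
  assumes cad: "\<And>w. w \<in> space M ==> cadlag (%t. X t w)" and t: "0 <= t"
    and X: "\<And>s. 0 <= s ==> s <= t ==> X s \<in> borel_measurable M"
  shows "(%w. zero_barrier_L \<delta> (%s. X s w) t) \<in> borel_measurable M"
    and "(%w. zero_barrier_R \<delta> (%s. X s w) t) \<in> borel_measurable M"
proof -
  have [measurable]: "X 0 \<in> borel_measurable M" using t by (intro X) auto
  have [measurable]: "(%w. infsum (%s. max (jump (%t. X t w) s) 0) {0<..t}) \<in> borel_measurable M"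
    by (rule jump_sum_measurable[OF cad t X, where h = "%x. max x 0"]) (auto intro!: continuous_intros)
  have [measurable]: "(%w. infsum (%s. max (- jump (%t. X t w) s) 0) {0<..t}) \<in> borel_measurable M"
    by (rule jump_sum_measurable[OF cad t X, where h = "%x. max (- x) 0"]) (auto intro!: continuous_intros)
  show "(%w. zero_barrier_L \<delta> (%s. X s w) t) \<in> borel_measurable M" unfolding zero_barrier_L_def by measurable
  show "(%w. zero_barrier_R \<delta> (%s. X s w) t) \<in> borel_measurable M" unfolding zero_barrier_R_def by measurable
qed

section \<open>Reflection at zero for a path made of drift and jumps\<close>

context
  fixes f :: "real => real" and \<delta> :: real
  assumes f: "cadlag f" and summable: "\<And>T. (%s. \<bar>jump f s\<bar>) summable_on {0<..T}"
    and decomposition: "\<And>t. 0 <= t ==> f t = f 0 + \<delta> * t + infsum (jump f) {0<..t}"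
begin

lemma jump_parts_summable:
  "(%s. max (jump f s) 0) summable_on {0<..T}" "(%s. max (- jump f s) 0) summable_on {0<..T}"
  by (rule summable_on_comparison_test[OF summable]; auto)+

lemma zero_barrier_sum_process:
  "zero_barrier_L \<delta> f = (%t. max (f 0) 0 + max \<delta> 0 * t + infsum (%s. max (jump f s) 0) {0<..t})"
  "zero_barrier_R \<delta> f = (%t. max (- f 0) 0 + max (- \<delta>) 0 * t + infsum (%s. max (- jump f s) 0) {0<..t})"
  by (auto simp: zero_barrier_L_def zero_barrier_R_def max_def fun_eq_iff)

lemma zero_barrier_cumulative: "cumulative_path (zero_barrier_L \<delta> f)" "cumulative_path (zero_barrier_R \<delta> f)"
  unfolding zero_barrier_sum_process by (rule sum_process_cumulative[OF _ jump_parts_summable(1)] sum_process_cumulative[OF _ jump_parts_summable(2)]; simp)+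

lemma zero_barrier_cancels:
  assumes "0 <= t"
  shows "f t - zero_barrier_L \<delta> f t + zero_barrier_R \<delta> f t = 0"
proof -
  have "infsum (%s. max (jump f s) 0) {0<..t} = infsum (%s. jump f s + max (- jump f s) 0) {0<..t}"
    by (rule infsum_cong) (auto simp: max_def)
  also have "... = infsum (jump f) {0<..t} + infsum (%s. max (- jump f s) 0) {0<..t}"
  proof (rule infsum_add[OF _ jump_parts_summable(2)])
    show "jump f summable_on {0<..t}" using summable[of t] by (subst summable_on_iff_abs_summable_on_real) simp
  qed
  finally show ?thesis using decomposition[OF assms] unfolding zero_barrier_sum_process by (auto simp: max_def algebra_simps)
qed

lemma zero_barrier_skorokhod: "skorokhod 0 f (zero_barrier_L \<delta> f) (zero_barrier_R \<delta> f)"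
  unfolding skorokhod_def using zero_barrier_cumulative zero_barrier_cancels by auto

text \<open>With a nonnegative drift \<open>R\<close> grows after time 0 by negative jumps only. The
  countably many atoms of \<open>R\<close> are not charged by \<open>L\<close>. From any other
  \<open>t\<close>, growth of \<open>R\<close> up to \<open>u\<close> means a negative jump strictly
  after \<open>t\<close>, and the path just before that jump is the peak of a drawdown.\<close>

lemma zero_barrier_slack:
  assumes \<delta>: "0 <= \<delta>" and q: "0 < q"
  shows "AE t in control_measure (zero_barrier_L \<delta> f). 0 <= t -->
    skorokhod_path.growth_discount (zero_barrier_R \<delta> f) q t <= drawdown q 0 f t"
proof -
  let ?L = "zero_barrier_L \<delta> f" and ?R = "zero_barrier_R \<delta> f"
  interpret skorokhod_path 0 f ?L ?R by unfold_locales (rule zero_barrier_skorokhod)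
  \<comment> \<open>The times where \<open>R\<close> has an atom; at time 0 a negative initial
    position plays the role of the jump.\<close>
  define A where "A = {s. s = 0 & f 0 < 0 \<or> 0 < s & jump f s < 0}"
  have "countable A"
  proof (rule countable_subset)
    show "A \<subseteq> insert 0 (\<Union>n::nat. {s\<in>{0<..real (Suc n)}. jump f s ~= 0})"
    proof
      fix s assume s: "s \<in> A"
      obtain n where "s < real n" using reals_Archimedean2 by blast
      thus "s \<in> insert 0 (\<Union>n::nat. {s\<in>{0<..real (Suc n)}. jump f s ~= 0})" using s by (auto simp: A_def intro!: exI[of _ n])
    qed
    have "countable {s\<in>{0<..real (Suc n)}. jump f s ~= 0}" for n by (rule jumps_countable[OF f _ dyadic_mesh]) auto
    thus "countable (insert 0 (\<Union>n::nat. {s\<in>{0<..real (Suc n)}. jump f s ~= 0}))" by (intro countable_insert countable_UN) auto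
  qed
  hence "(\<Union>t\<in>A. {t}) \<in> null_sets (control_measure ?L)"
  proof (rule null_sets_UN')
    fix t assume t: "t \<in> A"
    have "mass ?L {t} = 0"
    proof (cases "t = 0")
      case True
      hence "?L 0 = 0" using t by (auto simp: A_def zero_barrier_sum_process)
      thus ?thesis using emeasure_control_zero[OF cumL] True by simp
    next
      case False
      thus ?thesis unfolding zero_barrier_sum_process by (intro sum_process_atom jump_parts_summable) (use t in \<open>auto simp: A_def\<close>)
    qed
    thus "{t} \<in> null_sets (control_measure ?L)" by (intro null_setsI) auto
  qed
  hence "AE t in control_measure ?L. t \<notin> A" using AE_not_in by fastforce
  thus ?thesis
  proof eventually_elim
    case (elim t)
    show ?case
    proof
      assume t: "0 <= t"
      show "growth_discount q t <= drawdown q 0 f t" unfolding growth_discount_def drawdown_def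
      proof (rule sup_discount_mono[OF q])
        fix u assume u: "u \<in> {u. t <= u & 0 < mass ?R {t..u}}"
        have atom: "mass ?R {t} = 0"
        proof (cases "t = 0")
          case True
          hence "?R 0 = 0" using elim by (auto simp: A_def zero_barrier_sum_process)
          thus ?thesis using emeasure_control_zero[OF cumR] True by simp
        next
          case False
          thus ?thesis unfolding zero_barrier_sum_process
            by (intro sum_process_atom jump_parts_summable) (use t elim in \<open>auto simp: A_def\<close>)
        qed
        have "{t..u} = {t} \<union> {t<..u}" using u by auto
        hence "mass ?R {t..u} <= mass ?R {t} + mass ?R {t<..u}"
          by (simp only:) (rule emeasure_subadditive; simp)
        hence "0 < mass ?R {t<..u}" using u atom by (auto intro: less_le_trans)
        hence "0 < ?R u - ?R t" using emeasure_control_Ioc[OF cumR t, of u] u by simp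
        also have "?R u - ?R t = infsum (%s. max (- jump f s) 0) {t<..u}" unfolding zero_barrier_sum_process
          by (subst sum_process_diff[OF _ jump_parts_summable(2)]) (use t u \<delta> in auto)
        finally have "infsum (%s. max (- jump f s) 0) {t<..u} ~= 0" by simp
        then obtain s where s: "s \<in> {t<..u}" "jump f s < 0" by (metis (mono_tags, lifting) infsum_0 linorder_not_le max.absorb2 neg_le_0_iff_le)
        have "\<forall>\<^sub>F x in at_left s. f s < f x" using jump_left_limit[OF f, of s] s t by (intro order_tendstoD) auto
        moreover have "\<forall>\<^sub>F x in at_left s. x \<in> {t<..<s}" using s by (intro eventually_at_left_real) simp
        ultimately have "\<forall>\<^sub>F x in at_left s. f s < f x & x \<in> {t<..<s}" by (rule eventually_conj)
        then obtain r where "f s < f r" "r \<in> {t<..<s}" using eventually_happens'[OF trivial_limit_at_left_real] by blast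
        thus "\<exists>u'\<in>{u. t < u & (\<exists>r\<in>{t..u}. 0 < f r - f u)}. u' <= u" using s by (intro bexI[of _ s]) auto
      qed (use t in auto)
    qed
  qed
qed

end

section \<open>Paths with a monotone start\<close>

text \<open>Each coarse cell splits into two fine ones, and the triangle inequality applies.\<close>

lemma finer_variation:
  fixes f :: "real => real"
  shows "(\<Sum>k<m * 2 ^ n. \<bar>f (h / 2 ^ n * real (Suc k)) - f (h / 2 ^ n * real k)\<bar>)
    <= (\<Sum>k<m * 2 ^ Suc n. \<bar>f (h / 2 ^ Suc n * real (Suc k)) - f (h / 2 ^ Suc n * real k)\<bar>)" (is "?l <= ?r")
proof -
  let ?a = "%k. f (h / 2 ^ Suc n * real k)"
  have e: "h / 2 ^ n * real k = h / 2 ^ Suc n * real (2 * k)" for k by simp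
  have "?r = (\<Sum>j<m * 2 ^ n. sum (%k. \<bar>?a (Suc k) - ?a k\<bar>) {j * 2..<j * 2 + 2})"
    using sum.nat_group[of "%k. \<bar>?a (Suc k) - ?a k\<bar>" 2 "m * 2 ^ n"] by (simp add: mult.commute mult.left_commute)
  also have "... = (\<Sum>j<m * 2 ^ n. \<bar>?a (Suc (2 * j)) - ?a (2 * j)\<bar> + \<bar>?a (Suc (Suc (2 * j))) - ?a (Suc (2 * j))\<bar>)"
    by (simp add: numeral_2_eq_2 mult.commute del: of_nat_Suc power_Suc)
  also have "... >= ?l"
  proof (rule sum_mono)
    fix j
    have "2 * Suc j = Suc (Suc (2 * j))" by simp
    thus "\<bar>f (h / 2 ^ n * real (Suc j)) - f (h / 2 ^ n * real j)\<bar>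
      <= \<bar>?a (Suc (2 * j)) - ?a (2 * j)\<bar> + \<bar>?a (Suc (Suc (2 * j))) - ?a (Suc (2 * j))\<bar>" unfolding e by simp
  qed
  finally show ?thesis .
qed

lemma telescope: "(\<Sum>k<n. f (d * real (Suc k)) - f (d * real k)) = f (d * real n) - (f 0 :: real)"
  using sum_lessThan_telescope[of "%k. f (d * real k)" n] by simp

context levy_paths
begin

lemma increments_product:
  assumes h: "0 < h" and N: "0 < N" and \<phi>: "\<phi> \<in> borel_measurable borel"
  shows "(EE w. (\<Prod>k<N. \<phi> (X (h * real (Suc k)) w - X (h * real k) w))) = (EE w. \<phi> (X h w - X 0 w)) ^ N"
proof -
  let ?D = "distr M borel (%w. X h w - X 0 w)"
  have Xm[measurable]: "X h \<in> borel_measurable M" "X 0 \<in> borel_measurable M" using h by auto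
  interpret D: prob_space ?D by (rule prob_space_distr) measurable
  interpret product_sigma_finite "\<lambda>_::nat. ?D" by standard
  have p: "(%y. \<Prod>k<N. \<phi> (y k)) \<in> borel_measurable (Pi\<^sub>M {..<N} (%_. borel))"
  proof -
    note [measurable] = \<phi>
    show ?thesis by measurable
  qed
  have "(EE w. (\<Prod>k<N. \<phi> (X (h * real (Suc k)) w - X (h * real k) w)))
    = (EE w. (\<Prod>k<N. \<phi> (increments h N 0 w k)))" by (simp add: increments_def del: of_nat_Suc)
  also have "... = (\<integral>\<^sup>+y. (\<Prod>k<N. \<phi> (y k)) \<partial>distr M (Pi\<^sub>M {..<N} (%_. borel)) (increments h N 0))"
    by (rule nn_integral_distr[symmetric, OF increments_measurable]) (use h p in auto)
  also have "... = (\<integral>\<^sup>+y. (\<Prod>k<N. \<phi> (y k)) \<partial>Pi\<^sub>M {..<N} (%_. ?D))"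
    by (simp add: increments_distr[OF order_refl h N])
  also have "... = (\<Prod>k<N. \<integral>\<^sup>+z. \<phi> z \<partial>?D)" by (rule product_nn_integral_prod) (use \<phi> in auto)
  also have "... = (EE w. \<phi> (X h w - X 0 w)) ^ N" using \<phi> by (simp add: nn_integral_distr)
  finally show ?thesis .
qed

lemma nn_integral_increment:
  assumes t: "0 <= t" and s: "0 <= s" and \<phi>: "\<phi> \<in> borel_measurable borel"
  shows "(EE w. \<phi> (X (t + s) w - X t w)) = (EE w. \<phi> (X s w - X 0 w))"
proof -
  have [measurable]: "X (t + s) \<in> borel_measurable M" "X t \<in> borel_measurable M" "X s \<in> borel_measurable M" "X 0 \<in> borel_measurable M"
    using t s by auto
  show ?thesis
    using nn_integral_distr[of "%w. X (t + s) w - X t w" M borel \<phi>] nn_integral_distr[of "%w. X s w - X 0 w" M borel \<phi>]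
      stationary[OF t s] \<phi> by simp
qed

text \<open>If almost every path had arbitrarily early drawdowns, the discount would be 1 and so
  would its mean. Hence with positive probability nothing decreases before some
  \<open>1 / real (Suc n)\<close>; half of this length is kept to make the contradiction
  strict.\<close>

lemma monotone_start:
  assumes q: "0 < q" and nu: "nu q 0 < 1"
  shows "\<exists>h>0. \<exists>A\<in>events. 0 < prob A & (\<forall>w\<in>A. mono_on {0..h} (%t. X t w))"
proof -
  let ?d = "%w. drawdown q 0 (%s. X s w) 0"
  have [measurable]: "(%w. ennreal (?d w)) \<in> borel_measurable M" by (rule drawdown_measurable[OF q]) auto
  define A where "A n = {w\<in>space M. ennreal (?d w) <= ennreal (exp (- q * (1 / real (Suc n))))}" for n
  have A[measurable]: "A n \<in> events" for n unfolding A_def by measurable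
  have "\<exists>n. prob (A n) ~= 0"
  proof (rule ccontr)
    assume "~ ?thesis"
    hence "AE w in M. w \<notin> A n" for n using A by (subst prob_eq_0[symmetric]) auto
    hence "AE w in M. \<forall>n. w \<notin> A n" by (simp add: AE_all_countable)
    with AE_space have "AE w in M. 1 <= ennreal (?d w)"
    proof eventually_elim
      case (elim w)
      have lim: "(%n. exp (- q * inverse (real (Suc n)))) \<longlonglongrightarrow> exp (- q * 0)"
        by (intro tendsto_intros LIMSEQ_inverse_real_of_nat)
      have "exp (- q * 0) <= ?d w"
      proof (rule LIMSEQ_le_const2[OF lim], intro exI allI impI)
        fix n :: nat
        have "~ ennreal (?d w) <= ennreal (exp (- q * (1 / real (Suc n))))" using elim unfolding A_def by blast
        hence "ennreal (exp (- q * (1 / real (Suc n)))) < ennreal (?d w)" by (simp only: not_le)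
        hence "exp (- q * (1 / real (Suc n))) < ?d w" by (subst (asm) ennreal_less_iff) auto
        thus "exp (- q * inverse (real (Suc n))) <= ?d w" by (simp add: inverse_eq_divide)
      qed
      thus ?case by simp
    qed
    hence "(EE w. 1) <= nu q 0" unfolding nu_def by (rule nn_integral_mono_AE)
    thus False using nu by (simp add: emeasure_space_1)
  qed
  then obtain n where n: "prob (A n) ~= 0" by blast
  show ?thesis
  proof (intro exI[of _ "1 / real (Suc n) / 2"] conjI bexI[of _ "A n"] ballI)
    show "0 < prob (A n)" using n by (simp add: zero_less_measure_iff)
    fix w assume "w \<in> A n"
    hence le: "?d w <= exp (- q * (1 / real (Suc n)))" by (simp add: A_def)
    show "mono_on {0..1 / real (Suc n) / 2} (%t. X t w)"
    proof (rule monotone_onI, rule ccontr)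
      fix r u assume ru: "r \<in> {0..1 / real (Suc n) / 2}" "u \<in> {0..1 / real (Suc n) / 2}" "r <= u" "~ X r w <= X u w"
      have "0 < u" using ru by (cases "u = 0") auto
      have "exp (- q * u) <= ?d w" unfolding drawdown_def
        by (rule sup_discount_upper[OF q]) (use ru \<open>0 < u\<close> in \<open>auto intro!: bexI[of _ r]\<close>)
      hence "exp (- q * u) <= exp (- q * (1 / real (Suc n)))" using le by linarith
      hence "q * (1 / real (Suc n)) <= q * u" by simp
      hence "1 / real (Suc n) <= u" using q by (simp only: mult_le_cancel_left_pos)
      moreover have "u <= 1 / real (Suc n) / 2" using ru by auto
      moreover have "z / 2 < z" if "0 < z" for z :: real using that by simp
      ultimately show False by (metis linorder_not_le of_nat_0_less_iff order_trans zero_less_Suc zero_less_divide_1_iff)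
    qed
  qed auto
qed

end

locale monotone_start_paths = levy_paths +
  fixes h :: real and A
  assumes h: "0 < h" and A: "A \<in> events" "0 < prob A" and mono: "\<And>w. w \<in> A ==> mono_on {0..h} (%t. X t w)"
begin

abbreviation increment :: "nat => nat => 'a => real" where
  "increment n k w \<equiv> X (h / 2 ^ n * real (Suc k)) w - X (h / 2 ^ n * real k) w"

lemma mesh: "0 < h / 2 ^ n" "(%n. h / 2 ^ n) \<longlonglongrightarrow> 0" "real (m * 2 ^ n) * (h / 2 ^ n) = real m * h"
  using dyadic_mesh(1)[OF h] dyadic_mesh(2)[of h] by auto

lemma X_mesh [measurable]: "X (h / 2 ^ n * real k) \<in> borel_measurable M" "X (h / 2 ^ n) \<in> borel_measurable M" "X 0 \<in> borel_measurable M"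
  using h by auto

lemma nn_integral_mesh:
  assumes "\<phi> \<in> borel_measurable borel"
  shows "(EE w. \<phi> (increment n k w)) = (EE w. \<phi> (X (h / 2 ^ n) w - X 0 w))"
proof -
  have "h / 2 ^ n * real (Suc k) = h / 2 ^ n * real k + h / 2 ^ n" by (simp only: of_nat_Suc distrib_left mult_1_right add.commute)
  thus ?thesis using nn_integral_increment[of "h / 2 ^ n * real k" "h / 2 ^ n" \<phi>] assms h by simp
qed

text \<open>Let \<open>\<rho>\<close> be the probability of a nonnegative increment and
  \<open>N = 2 ^ n\<close>. Independence gives \<open>prob A <= \<rho> ^ N\<close>, and
  \<open>N * (1 - \<rho>) <= - N * ln \<rho> <= - ln (prob A)\<close> bounds the mean number of
  negative increments per length \<open>h\<close>, whatever the grid.\<close>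

lemma negative_increments_bound:
  "(EE w. (\<Sum>k<m * 2 ^ n. indicator {..<0} (increment n k w))) <= ennreal (real m * (- ln (prob A)))"
proof -
  let ?N = "(2::nat) ^ n" and ?D = "%w. X (h / 2 ^ n) w - X 0 w"
  define \<rho> where "\<rho> = prob {w\<in>space M. 0 <= ?D w}"
  have \<rho>: "(EE w. indicator {0..} (?D w)) = ennreal \<rho>"
  proof -
    have "(EE w. indicator {0..} (?D w)) = (EE w. indicator {w\<in>space M. 0 <= ?D w} w)"
      by (rule nn_integral_cong) (auto simp: indicator_def)
    thus ?thesis by (simp add: \<rho>_def emeasure_eq_measure)
  qed
  have "ennreal (prob A) <= (EE w. (\<Prod>k<?N. indicator {0..} (increment n k w)))"
  proof -
    have "ennreal (prob A) = (EE w. indicator A w)" using A by (simp add: emeasure_eq_measure)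
    also have "... <= (EE w. (\<Prod>k<?N. indicator {0..} (increment n k w)))"
    proof (rule nn_integral_mono)
      fix w
      have one: "indicator {0..} (increment n k w) = (1::ennreal)" if "w \<in> A" "k < ?N" for k
      proof -
        have "real (Suc k) <= 2 ^ n" using that(2) by (metis Suc_leI of_nat_le_iff of_nat_numeral of_nat_power)
        hence "h / 2 ^ n * real (Suc k) <= h / 2 ^ n * 2 ^ n" using h by (intro mult_left_mono) auto
        hence "h / 2 ^ n * real (Suc k) <= h" by simp
        moreover have "h / 2 ^ n * real k <= h / 2 ^ n * real (Suc k)" using h by (intro mult_left_mono) auto
        moreover have "0 <= h / 2 ^ n * real k" using h by simp
        ultimately have "X (h / 2 ^ n * real k) w <= X (h / 2 ^ n * real (Suc k)) w" by (intro monotone_onD[OF mono[OF that(1)]]) auto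
        thus ?thesis by simp
      qed
      show "indicator A w <= (\<Prod>k<?N. indicator {0..} (increment n k w) :: ennreal)"
      proof (cases "w \<in> A")
        case True
        hence "(\<Prod>k<?N. indicator {0..} (increment n k w) :: ennreal) = 1" by (intro prod.neutral ballI one) auto
        thus ?thesis by (simp only:) (simp add: indicator_def)
      qed simp
    qed
    finally show ?thesis .
  qed
  also have "... = ennreal \<rho> ^ ?N" using increments_product[of "h / 2 ^ n" ?N "indicator {0..}"] mesh(1) \<rho> by simp
  also have "... = ennreal (\<rho> ^ ?N)" by (simp add: \<rho>_def ennreal_power)
  finally have le: "prob A <= \<rho> ^ ?N" by (simp add: \<rho>_def)
  have \<rho>0: "0 < \<rho>"
  proof (rule ccontr)
    assume "~ 0 < \<rho>"
    hence "\<rho> = 0" by (simp add: \<rho>_def measure_le_0_iff not_less)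
    thus False using le A(2) by (simp add: power_0_left)
  qed
  have "real ?N * (1 - \<rho>) <= real ?N * (- ln \<rho>)" using ln_le_minus_one[OF \<rho>0] by (intro mult_left_mono) auto
  also have "... = - ln (\<rho> ^ ?N)" using \<rho>0 by (simp add: ln_realpow)
  also have "... <= - ln (prob A)" using le A(2) \<rho>0 by simp
  finally have bound: "real ?N * (1 - \<rho>) <= - ln (prob A)" .
  have neg: "(EE w. indicator {..<0} (?D w)) = ennreal (1 - \<rho>)"
  proof -
    have "(EE w. indicator {..<0} (?D w)) = (EE w. indicator {w\<in>space M. ~ 0 <= ?D w} w)"
      by (rule nn_integral_cong) (auto simp: indicator_def)
    also have "... = ennreal (prob {w\<in>space M. ~ 0 <= ?D w})" by (simp add: emeasure_eq_measure)
    also have "prob {w\<in>space M. ~ 0 <= ?D w} = 1 - \<rho>" unfolding \<rho>_def by (rule prob_neg) measurable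
    finally show ?thesis .
  qed
  have "(EE w. (\<Sum>k<m * ?N. indicator {..<0} (increment n k w)))
    = (\<Sum>k<m * ?N. \<integral>\<^sup>+w. indicator {..<0} (increment n k w) \<partial>M)" by (rule nn_integral_sum) measurable
  also have "... = (\<Sum>k<m * ?N. ennreal (1 - \<rho>))" by (intro sum.cong refl) (subst nn_integral_mesh, simp, rule neg)
  also have "... = ennreal (real (m * ?N) * (1 - \<rho>))" by (simp add: ennreal_of_nat_eq_real_of_nat ennreal_mult \<rho>_def)
  also have "... <= ennreal (real m * (- ln (prob A)))"
    using mult_left_mono[OF bound, of "real m"] by (intro ennreal_leI) (simp only: of_nat_mult mult.assoc of_nat_0_le_iff)
  finally show ?thesis .
qed

text \<open>Negative increments are few and of bounded size, so the variation is at most the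
  telescoping sum plus a multiple of their number. Fatou's lemma controls this number along
  infinitely many grids only; monotonicity of the variation under refinement covers the
  others.\<close>

lemma variation_finite: "AE w in M. \<exists>V. \<forall>n. (\<Sum>k<m * 2 ^ n. \<bar>increment n k w\<bar>) <= V"
proof -
  define C where "C n w = (\<Sum>k<m * 2 ^ n. indicator {..<0} (increment n k w) :: ennreal)" for n w
  have [measurable]: "C n \<in> borel_measurable M" for n unfolding C_def by measurable
  have "(EE w. liminf (%n. C n w)) <= liminf (%n. \<integral>\<^sup>+w. C n w \<partial>M)"
    by (rule nn_integral_liminf) measurable
  also have "... <= ennreal (real m * (- ln (prob A)))"
  proof (rule Liminf_le)
    show "\<forall>\<^sub>F n in sequentially. (EE w. C n w) <= ennreal (real m * (- ln (prob A)))"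
      unfolding C_def by (intro always_eventually allI) (rule negative_increments_bound)
  qed simp
  also have "... < \<top>" by simp
  finally have "AE w in M. liminf (%n. C n w) ~= \<infinity>" by (intro nn_integral_PInf_AE) (auto simp: top_unique)
  with AE_space show ?thesis
  proof eventually_elim
    case (elim w)
    let ?v = "%n. \<Sum>k<m * 2 ^ n. \<bar>increment n k w\<bar>"
    obtain c where c: "liminf (%n. C n w) = ennreal c" "0 <= c"
      using elim(2) by (cases "liminf (%n. C n w)") (auto simp: infinity_ennreal_def)
    obtain B where B: "0 <= B" "\<forall>x\<in>{0..real m * h}. \<bar>X x w\<bar> <= B"
      using cadlag_bounded[OF cadlag_X[OF elim(1)] order_refl, of "real m * h"] by blast
    have bnd: "\<bar>X (h / 2 ^ n * real k) w\<bar> <= B" if "k <= m * 2 ^ n" for n k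
    proof (rule bspec[OF B(2)])
      have "h / 2 ^ n * real k <= h / 2 ^ n * real (m * 2 ^ n)" using that h by (intro mult_left_mono) (auto simp only: of_nat_le_iff, simp)
      also have "... = real m * h" by simp
      finally show "h / 2 ^ n * real k \<in> {0..real m * h}" using h by simp
    qed
    have few: "?v n <= 2 * B + 4 * B * (c + 1)" if "C n w < ennreal (c + 1)" for n
    proof -
      have "C n w = ennreal (\<Sum>k<m * 2 ^ n. indicator {..<0} (increment n k w))"
        unfolding C_def by (subst sum_ennreal[symmetric]) (auto simp: ennreal_indicator)
      hence "ennreal (\<Sum>k<m * 2 ^ n. indicator {..<0} (increment n k w)) < ennreal (c + 1)" using that by (simp only:)
      hence "(\<Sum>k<m * 2 ^ n. indicator {..<0} (increment n k w) :: real) < c + 1" by (subst (asm) ennreal_less_iff) (auto intro: sum_nonneg)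
      hence c1: "(\<Sum>k<m * 2 ^ n. indicator {..<0} (increment n k w) :: real) <= c + 1" by (rule less_imp_le)
      \<comment> \<open>For a negative increment \<open>x\<close> the difference between
        \<open>\<bar>x\<bar>\<close> and \<open>x\<close> is \<open>2 * \<bar>x\<bar>\<close>, and
        \<open>\<bar>x\<bar>\<close> is at most \<open>2 * B\<close>: hence the factor
        \<open>4 * B\<close>.\<close>
      have "?v n <= (\<Sum>k<m * 2 ^ n. increment n k w + 4 * B * indicator {..<0} (increment n k w))"
      proof (rule sum_mono)
        fix k assume "k \<in> {..<m * 2 ^ n}"
        show "\<bar>increment n k w\<bar> <= increment n k w + 4 * B * indicator {..<0} (increment n k w)"
        proof -
          have "\<bar>X (h / 2 ^ n * real (Suc k)) w\<bar> <= B" "\<bar>X (h / 2 ^ n * real k) w\<bar> <= B"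
            using \<open>k \<in> {..<m * 2 ^ n}\<close> by (intro bnd; simp)+
          hence "- (2 * B) <= increment n k w" unfolding abs_le_iff by linarith
          thus ?thesis by (cases "increment n k w < 0") (simp_all add: indicator_def del: of_nat_Suc)
        qed
      qed
      also have "... = (X (h / 2 ^ n * real (m * 2 ^ n)) w - X 0 w)
          + 4 * B * (\<Sum>k<m * 2 ^ n. indicator {..<0} (increment n k w))"
        unfolding sum.distrib sum_distrib_left telescope[of "%t. X t w"] ..
      also have "... <= 2 * B + 4 * B * (c + 1)"
      proof (rule add_mono)
        show "X (h / 2 ^ n * real (m * 2 ^ n)) w - X 0 w <= 2 * B" using bnd[OF order_refl, of n] bnd[of 0 n] by simp
        show "4 * B * (\<Sum>k<m * 2 ^ n. indicator {..<0} (increment n k w)) <= 4 * B * (c + 1)" using c1 B(1) by (intro mult_left_mono) auto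
      qed
      finally show ?thesis .
    qed
    have inc: "incseq ?v" by (rule incseq_SucI) (rule finer_variation[of "%t. X t w"])
    have "\<exists>n'\<ge>n. C n' w < ennreal (c + 1)" for n
    proof (rule ccontr)
      assume "~ ?thesis"
      hence "\<forall>\<^sub>F n in sequentially. ennreal (c + 1) <= C n w" by (auto simp: eventually_sequentially not_less)
      hence "ennreal (c + 1) <= liminf (%n. C n w)" by (rule Liminf_bounded)
      thus False using c by simp
    qed
    hence "?v n <= 2 * B + 4 * B * (c + 1)" for n using few incseqD[OF inc] by (meson order_trans)
    thus ?case by blast
  qed
qed

text \<open>A bound in mean is extracted from almost sure finiteness. The variation stays below some
  \<open>r\<close> with positive probability, so the mean of the exponential of minus the truncated
  variation is bounded below. By independence that mean is a power of one factor, which is at most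
  \<open>exp (- (e / 2))\<close> with \<open>e\<close> the mean of one truncated increment.\<close>

lemma truncated_increments_bound:
  "\<exists>K. \<forall>n. real (m * 2 ^ n) * expectation (%w. min \<bar>X (h / 2 ^ n) w - X 0 w\<bar> 1) <= K"
proof (cases "m = 0")
  case False
  define G where "G r = {w\<in>space M. \<forall>n. (\<Sum>k<m * 2 ^ n. \<bar>increment n k w\<bar>) <= real r}" for r :: nat
  have G[measurable]: "G r \<in> events" for r unfolding G_def by measurable
  have "\<exists>r. prob (G r) ~= 0"
  proof (rule ccontr)
    assume "~ ?thesis"
    hence "AE w in M. w \<notin> G r" for r using G by (subst prob_eq_0[symmetric]) auto
    hence "AE w in M. \<forall>r. w \<notin> G r" by (simp add: AE_all_countable)
    with variation_finite[of m] AE_space have "AE w in M. False"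
    proof eventually_elim
      case (elim w)
      then obtain V where V: "\<And>n. (\<Sum>k<m * 2 ^ n. \<bar>increment n k w\<bar>) <= V" by blast
      obtain r where "V <= real r" using real_arch_simple by blast
      hence "w \<in> G r" using V order_trans elim(2) unfolding G_def by blast
      thus ?case using elim(3) by blast
    qed
    thus False by simp
  qed
  then obtain r where r: "0 < prob (G r)" by (auto simp: zero_less_measure_iff)
  define p where "p = exp (- real r) * prob (G r)"
  have p: "0 < p" using r by (simp add: p_def)
  show ?thesis
  proof (intro exI[of _ "2 * (- ln p)"] allI)
    fix n
    let ?N = "m * 2 ^ n" and ?D = "%w. X (h / 2 ^ n) w - X 0 w"
    have N: "0 < ?N" using False by simp
    define e where "e = expectation (%w. min \<bar>?D w\<bar> 1)"
    have int: "integrable M (%w. min \<bar>?D w\<bar> 1)" "integrable M (%w. exp (- min \<bar>?D w\<bar> 1))"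
      by (rule integrable_const_bound[where B = 1]; auto)+
    define u where "u = expectation (%w. exp (- min \<bar>?D w\<bar> 1))"
    \<comment> \<open>\<open>exp (- x) <= 1 - x / 2\<close> holds on the unit interval, which is why
      increments are truncated at 1.\<close>
    have "u <= expectation (%w. 1 - min \<bar>?D w\<bar> 1 / 2)" unfolding u_def
    proof (rule integral_mono[OF int(2)])
      show "integrable M (%w. 1 - min \<bar>?D w\<bar> 1 / 2)" using int(1) by auto
      fix w
      define x where "x = min \<bar>?D w\<bar> 1"
      have x: "0 <= x" "x <= 1" by (auto simp: x_def)
      have "1 + x <= exp x" by (rule exp_ge_add_one_self)
      hence "exp (- x) <= 1 / (1 + x)" using x by (simp add: exp_minus inverse_eq_divide frac_le)
      also have "... <= 1 - x / 2"
      proof -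
        have "x * x <= x * 1" using x by (intro mult_left_mono) auto
        hence "1 <= (1 - x / 2) * (1 + x)" by (simp add: algebra_simps)
        thus ?thesis using x by (simp add: pos_divide_le_eq)
      qed
      finally show "exp (- min \<bar>?D w\<bar> 1) <= 1 - min \<bar>?D w\<bar> 1 / 2" by (simp add: x_def)
    qed
    also have "... = 1 - e / 2" using int(1) by (simp add: e_def prob_space)
    also have "... <= exp (- (e / 2))" using exp_ge_add_one_self[of "- (e / 2)"] by simp
    finally have u: "u <= exp (- (e / 2))" .
    have u0: "0 <= u" unfolding u_def by simp
    have "ennreal p <= (EE w. (\<Prod>k<?N. ennreal (exp (- min \<bar>increment n k w\<bar> 1))))"
    proof -
      have "ennreal p = ennreal (exp (- real r)) * (EE w. indicator (G r) w)"
        by (simp add: p_def ennreal_mult emeasure_eq_measure)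
      also have "... = (EE w. ennreal (exp (- real r)) * indicator (G r) w)"
        by (rule nn_integral_cmult[symmetric]) measurable
      also have "... <= (EE w. (\<Prod>k<?N. ennreal (exp (- min \<bar>increment n k w\<bar> 1))))"
      proof (rule nn_integral_mono)
        fix w
        have "exp (- real r) <= (\<Prod>k<?N. exp (- min \<bar>increment n k w\<bar> 1))" if "w \<in> G r"
        proof -
          have "(\<Sum>k<?N. min \<bar>increment n k w\<bar> 1) <= (\<Sum>k<?N. \<bar>increment n k w\<bar>)" by (rule sum_mono) simp
          also have "... <= real r" using that unfolding G_def by blast
          finally have "exp (- real r) <= exp (\<Sum>k<?N. - min \<bar>increment n k w\<bar> 1)" by (simp add: sum_negf)
          thus ?thesis by (simp add: exp_sum)
        qed
        thus "ennreal (exp (- real r)) * indicator (G r) w <= (\<Prod>k<?N. ennreal (exp (- min \<bar>increment n k w\<bar> 1)))"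
          by (cases "w \<in> G r") (auto simp: prod_ennreal intro: ennreal_leI simp del: of_nat_Suc)
      qed
      finally show ?thesis .
    qed
    also have "... = (EE w. ennreal (exp (- min \<bar>?D w\<bar> 1))) ^ ?N"
      by (rule increments_product[OF mesh(1) N]) measurable
    also have "... = ennreal u ^ ?N" using int(2) by (simp add: u_def nn_integral_eq_integral)
    also have "... = ennreal (u ^ ?N)" using u0 by (simp add: ennreal_power)
    finally have "p <= u ^ ?N" using u0 by (simp add: zero_le_power)
    also have "... <= exp (- (e / 2)) ^ ?N" using u u0 by (rule power_mono)
    also have "... = exp (- (real ?N * e / 2))" by (simp add: exp_of_nat_mult[symmetric])
    finally have "ln p <= ln (exp (- (real ?N * e / 2)))" using p by (subst ln_le_cancel_iff) auto
    thus "real ?N * expectation (%w. min \<bar>?D w\<bar> 1) <= 2 * (- ln p)" by (simp add: e_def)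
  qed
qed auto

end

section \<open>The characteristic exponent\<close>

lemma one_minus_cos_le: "1 - cos x <= x\<^sup>2 / 2" for x :: real
proof -
  have "cos x = 1 - 2 * (sin (x / 2))\<^sup>2" using cos_double_sin[of "x / 2"] by simp
  moreover have "(sin (x / 2))\<^sup>2 <= (x / 2)\<^sup>2" using abs_sin_x_le_abs_x[of "x / 2"] by (simp only: abs_le_square_iff)
  ultimately show ?thesis by (simp add: power_divide)
qed

text \<open>Comparable to \<open>min \<bar>x\<bar> 1\<close>, and its integrals are read off the real part of the characteristic exponent:
  this turns a bound on the truncated increments into integrability of the small jumps.\<close>

definition dyadic_cos :: "nat => real => real" where
  "dyadic_cos J x = (\<Sum>j<J. (1 - cos (2 ^ j * x)) / 2 ^ j)"

lemma dyadic_cos_Suc: "dyadic_cos (Suc J) x = (1 - cos x) + dyadic_cos J (2 * x) / 2"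
  unfolding dyadic_cos_def sum.lessThan_Suc_shift by (simp add: sum_divide_distrib mult_ac)

text \<open>A purely linear bound is not reproduced by the doubling relation, since
  \<open>1 - cos x\<close> has to be absorbed as well. \<open>9 * \<bar>x\<bar> - x\<^sup>2\<close>
  leaves room for it, and 9 is large enough for the global bound 4 to take over once
  \<open>\<bar>x\<bar>\<close> exceeds one half.\<close>

lemma dyadic_cos_upper: "dyadic_cos J x <= 9 * min \<bar>x\<bar> 1"
proof -
  have four: "dyadic_cos J x <= 4" for J x
  proof (induction J arbitrary: x)
    case (Suc J)
    show ?case using Suc[of "2 * x"] cos_ge_minus_one[of x] unfolding dyadic_cos_Suc by linarith
  qed (simp add: dyadic_cos_def)
  have "dyadic_cos J x <= 9 * \<bar>x\<bar> - x\<^sup>2" if "\<bar>x\<bar> <= 1" for x using that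
  proof (induction J arbitrary: x)
    case 0
    have "\<bar>x\<bar> * \<bar>x\<bar> <= \<bar>x\<bar> * 1" using 0 by (intro mult_left_mono) auto
    thus ?case by (simp add: dyadic_cos_def power2_eq_square)
  next
    case (Suc J)
    show ?case
    proof (cases "\<bar>x\<bar> <= 1 / 2")
      case True
      hence "dyadic_cos J (2 * x) <= 9 * \<bar>2 * x\<bar> - (2 * x)\<^sup>2" by (intro Suc.IH) auto
      also have "... = 18 * \<bar>x\<bar> - 4 * x\<^sup>2" by (simp add: power_mult_distrib abs_mult)
      finally show ?thesis using one_minus_cos_le[of x] zero_le_power2[of x] unfolding dyadic_cos_Suc by linarith
    next
      case False
      have "\<bar>x\<bar> * \<bar>x\<bar> <= \<bar>x\<bar> * 1" using Suc.prems by (intro mult_left_mono) auto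
      hence "x\<^sup>2 <= \<bar>x\<bar>" by (simp add: power2_eq_square)
      hence "4 <= 9 * \<bar>x\<bar> - x\<^sup>2" using False by linarith
      moreover have "1 - cos x + dyadic_cos J (2 * x) / 2 <= 4" using four[of J "2 * x"] cos_ge_minus_one[of x] by linarith
      ultimately show ?thesis unfolding dyadic_cos_Suc by linarith
    qed
  qed
  note le = this[of x]
  show ?thesis
  proof (cases "\<bar>x\<bar> <= 1")
    case True
    hence "min \<bar>x\<bar> 1 = \<bar>x\<bar>" by simp
    thus ?thesis using le[OF True] zero_le_power2[of x] by linarith
  qed (use four[of J x] in simp)
qed

lemma dyadic_cos_nonneg: "0 <= dyadic_cos J x" unfolding dyadic_cos_def by (intro sum_nonneg) auto

lemma dyadic_cos_mono: "J <= J' ==> dyadic_cos J x <= dyadic_cos J' x" unfolding dyadic_cos_def by (intro sum_mono2) auto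

lemma cos_one_less: "cos (1 :: real) < 1" using cos_monotone_0_pi[of 0 1] pi_gt3 by simp

text \<open>One term suffices: double \<open>\<bar>x\<bar>\<close> until it lies in
  \<open>[1, 2]\<close>, where \<open>1 - cos\<close> is at least \<open>1 - cos 1\<close>; the
  factor \<open>1 / 2 ^ j\<close> is then at least half of \<open>\<bar>x\<bar>\<close>.\<close>

lemma dyadic_cos_lower:
  assumes x: "x ~= 0" "\<bar>x\<bar> < 1"
  shows "\<exists>J. \<bar>x\<bar> * (1 - cos 1) / 2 <= dyadic_cos J x"
proof -
  obtain n where "1 / \<bar>x\<bar> < 2 ^ n" using real_arch_pow[of 2 "1 / \<bar>x\<bar>"] by auto
  hence ex: "1 <= 2 ^ n * \<bar>x\<bar>" using x by (simp add: field_simps)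
  define j where "j = (LEAST n. 1 <= 2 ^ n * \<bar>x\<bar>)"
  have j: "1 <= 2 ^ j * \<bar>x\<bar>" unfolding j_def by (rule LeastI[of "%n. 1 <= 2 ^ n * \<bar>x\<bar>", OF ex])
  then obtain i where i: "j = Suc i" using x by (cases j) auto
  have "2 ^ i * \<bar>x\<bar> < 1" using not_less_Least[of i "%n. 1 <= 2 ^ n * \<bar>x\<bar>"] i unfolding j_def by simp
  hence j2: "2 ^ j * \<bar>x\<bar> <= 2" using i by simp
  have "cos (2 ^ j * x) = cos (2 ^ j * \<bar>x\<bar>)" by (cases "0 <= x") (auto simp: abs_if)
  also have "... <= cos 1" using j j2 pi_gt3 by (intro cos_monotone_0_pi_le) auto
  finally have c: "1 - cos 1 <= 1 - cos (2 ^ j * x)" by simp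
  have "\<bar>x\<bar> / 2 <= 1 / 2 ^ j" using j2 by (simp add: field_simps)
  hence "\<bar>x\<bar> / 2 * (1 - cos 1) <= 1 / 2 ^ j * (1 - cos (2 ^ j * x))" using c cos_one_less by (intro mult_mono) auto
  also have "... <= dyadic_cos (Suc j) x" unfolding dyadic_cos_def by (simp add: sum_nonneg)
  finally show ?thesis by (intro exI[of _ "Suc j"]) (simp add: mult.commute)
qed

lemma exp_increment_limit: "(%n. 2 ^ n * (1 - exp (- (z / 2 ^ n)))) \<longlonglongrightarrow> (z :: complex)"
proof -
  have "((%s. exp (- (s * z))) has_field_derivative - z) (at 0)" by (auto intro!: derivative_eq_intros)
  hence "(%s. (exp (- (s * z)) - 1) / s) \<midarrow>0\<rightarrow> - z" by (simp add: DERIV_def)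
  moreover have "filterlim (%n. 1 / 2 ^ n :: complex) (at 0) sequentially" unfolding filterlim_at using LIMSEQ_divide_realpow_zero[of 2 1]
    by (auto intro!: tendsto_norm_zero_cancel[of "%n. 1 / 2 ^ n :: complex"] simp: norm_divide norm_power)
  ultimately have "(%n. (exp (- (1 / 2 ^ n * z)) - 1) / (1 / 2 ^ n)) \<longlonglongrightarrow> - z" by (rule filterlim_compose)
  from tendsto_minus[OF this] show ?thesis by (simp add: algebra_simps)
qed

lemma sin_minus_le: "\<bar>sin x - x\<bar> <= x\<^sup>2 / 2" for x :: real
proof -
  have "cmod (iexp x - (\<Sum>k \<le> 1. (\<i> * x)^k / fact k)) <= \<bar>x\<bar>^(Suc 1) / fact (Suc 1)" by (rule iexp_approx1)
  moreover have "Im (iexp x - (\<Sum>k \<le> 1. (\<i> * x)^k / fact k)) = sin x - x" by (simp add: Im_exp)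
  ultimately show ?thesis using abs_Im_le_cmod[of "iexp x - (\<Sum>k \<le> 1. (\<i> * x)^k / fact k)"] by (simp add: power2_eq_square)
qed

section \<open>Integrals against the Levy measure\<close>

context
  fixes \<mu> :: "real measure"
  assumes levy: "levy_measure \<mu>"
begin

lemma sets_levy [measurable_cong]: "sets \<mu> = sets borel" using levy by (simp add: levy_measure_def)

lemma levy_integrable: "integrable \<mu> (%x. min 1 (x\<^sup>2))"
proof (rule integrableI_bounded)
  show "(\<integral>\<^sup>+x. ennreal (norm (min 1 (x\<^sup>2))) \<partial>\<mu>) < \<infinity>" using levy by (simp add: levy_measure_def)
qed measurable

abbreviation exponent_integrand :: "real => real => complex" where
  "exponent_integrand \<theta> x \<equiv> 1 - iexp (\<theta> * x) + \<i> * of_real (\<theta> * x * indicator {-1<..<1} x)"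

lemma exponent_integrable: "integrable \<mu> (exponent_integrand \<theta>)"
proof (rule Bochner_Integration.integrable_bound)
  show "integrable \<mu> (%x. (2 + \<theta>\<^sup>2) * min 1 (x\<^sup>2))" using levy_integrable by simp
  show "exponent_integrand \<theta> \<in> borel_measurable \<mu>" by measurable
  show "AE x in \<mu>. norm (exponent_integrand \<theta> x) <= norm ((2 + \<theta>\<^sup>2) * min 1 (x\<^sup>2))"
  proof (rule AE_I2)
    fix x :: real
    show "norm (exponent_integrand \<theta> x) <= norm ((2 + \<theta>\<^sup>2) * min 1 (x\<^sup>2))"
    proof (cases "\<bar>x\<bar> < 1")
      case True
      let ?y = "\<theta> * x"
      have "cmod (iexp ?y - (\<Sum>k \<le> 1. (\<i> * ?y)^k / fact k)) <= \<bar>?y\<bar>^(Suc 1) / fact (Suc 1)" by (rule iexp_approx1)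
      moreover have "exponent_integrand \<theta> x = - (iexp ?y - (\<Sum>k \<le> 1. (\<i> * ?y)^k / fact k))"
        using True by (simp add: indicator_def abs_less_iff)
      ultimately have "cmod (exponent_integrand \<theta> x) <= \<theta>\<^sup>2 * x\<^sup>2 / 2"
        by (simp only: norm_minus_cancel) (simp add: power2_eq_square abs_mult mult_ac)
      also have "... <= (2 + \<theta>\<^sup>2) * x\<^sup>2" by (simp add: distrib_right)
      also have "x\<^sup>2 = min 1 (x\<^sup>2)" using abs_square_less_1[of x] True by (simp add: min_def)
      finally show ?thesis by simp
    next
      case False
      hence "x \<notin> {-1<..<1}" by auto
      hence "exponent_integrand \<theta> x = 1 - iexp (\<theta> * x)" by simp
      moreover have "cmod (1 - iexp (\<theta> * x)) <= cmod 1 + cmod (iexp (\<theta> * x))" by (rule norm_triangle_ineq4)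
      ultimately have "cmod (exponent_integrand \<theta> x) <= 2" by (simp only: norm_exp_i_times norm_one one_add_one)
      also have "... <= (2 + \<theta>\<^sup>2) * min 1 (x\<^sup>2)"
      proof -
        have "min 1 (x\<^sup>2) = 1" using False by (simp add: min_def) (metis abs_square_less_1 linorder_not_le nle_le)
        thus ?thesis by simp
      qed
      finally show ?thesis by simp
    qed
  qed
qed

lemma Re_char_exponent: "Re (char_exponent \<gamma> \<sigma> \<mu> \<theta>) = \<sigma>\<^sup>2 * \<theta>\<^sup>2 / 2 + (\<integral>x. 1 - cos (\<theta> * x) \<partial>\<mu>)"
proof -
  have "Re (CLINT x|\<mu>. exponent_integrand \<theta> x) = (\<integral>x. Re (exponent_integrand \<theta> x) \<partial>\<mu>)"
    by (rule integral_Re[symmetric, OF exponent_integrable])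
  thus ?thesis by (simp add: char_exponent_def Re_exp)
qed

lemma Im_char_exponent:
  "Im (char_exponent \<gamma> \<sigma> \<mu> \<theta>) = - (\<gamma> * \<theta>) + (\<integral>x. \<theta> * x * indicator {-1<..<1} x - sin (\<theta> * x) \<partial>\<mu>)"
proof -
  have "Im (CLINT x|\<mu>. exponent_integrand \<theta> x) = (\<integral>x. Im (exponent_integrand \<theta> x) \<partial>\<mu>)"
    by (rule integral_Im[symmetric, OF exponent_integrable])
  thus ?thesis by (simp add: char_exponent_def Im_exp)
qed

lemma cos_integrable: "integrable \<mu> (%x. 1 - cos (\<theta> * x))"
proof -
  have "integrable \<mu> (%x. Re (exponent_integrand \<theta> x))" by (rule integrable_Re[OF exponent_integrable])
  thus ?thesis by (simp add: Re_exp)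
qed

lemma dyadic_cos_exponent:
  "integrable \<mu> (dyadic_cos J)"
  "(\<integral>x. dyadic_cos J x \<partial>\<mu>) <= (\<Sum>j<J. Re (char_exponent \<gamma> \<sigma> \<mu> (2 ^ j)) / 2 ^ j)"
proof -
  show "integrable \<mu> (dyadic_cos J)" unfolding dyadic_cos_def[abs_def] using cos_integrable by auto
  have "(\<integral>x. dyadic_cos J x \<partial>\<mu>) = (\<Sum>j<J. (\<integral>x. 1 - cos (2 ^ j * x) \<partial>\<mu>) / 2 ^ j)"
    unfolding dyadic_cos_def using cos_integrable by (subst Bochner_Integration.integral_sum) auto
  also have "... <= (\<Sum>j<J. Re (char_exponent \<gamma> \<sigma> \<mu> (2 ^ j)) / 2 ^ j)"
    unfolding Re_char_exponent by (intro sum_mono divide_right_mono) auto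
  finally show "(\<integral>x. dyadic_cos J x \<partial>\<mu>) <= (\<Sum>j<J. Re (char_exponent \<gamma> \<sigma> \<mu> (2 ^ j)) / 2 ^ j)" .
qed

text \<open>The Gaussian part of the real exponent is nonnegative, so the hypothesis bounds the
  integrals of \<open>dyadic_cos\<close>, whose supremum dominates a multiple of
  \<open>\<bar>x\<bar>\<close> near 0; away from 0 the Levy measure is finite.\<close>

lemma small_jumps_integrable:
  assumes bound: "\<And>J. (\<Sum>j<J. Re (char_exponent \<gamma> \<sigma> \<mu> (2 ^ j)) / 2 ^ j) <= C"
  shows "integrable \<mu> (%x. min \<bar>x\<bar> 1)"
proof -
  define c where "c = (1 - cos 1) / (2 :: real)"
  have c: "0 < c" using cos_one_less by (simp add: c_def)
  have dm[measurable]: "dyadic_cos J \<in> borel_measurable \<mu>" for J using dyadic_cos_exponent(1)[of J] by auto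
  have le: "ennreal (c * (\<bar>x\<bar> * indicator {-1<..<1} x)) <= (SUP J. ennreal (dyadic_cos J x))" for x
  proof (cases "x ~= 0 & \<bar>x\<bar> < 1")
    case True
    then obtain J where "\<bar>x\<bar> * (1 - cos 1) / 2 <= dyadic_cos J x" using dyadic_cos_lower by blast
    hence "c * (\<bar>x\<bar> * indicator {-1<..<1} x) <= dyadic_cos J x" using True by (simp add: c_def indicator_def abs_less_iff mult.commute)
    thus ?thesis by (intro SUP_upper2[of J] ennreal_leI) auto
  next
    case False
    hence "c * (\<bar>x\<bar> * indicator {-1<..<1} x) = 0" by (auto simp: indicator_def)
    thus ?thesis by (simp only: ennreal_0 zero_le)
  qed
  have "(\<integral>\<^sup>+x. ennreal (c * (\<bar>x\<bar> * indicator {-1<..<1} x)) \<partial>\<mu>) <= (\<integral>\<^sup>+x. (SUP J. ennreal (dyadic_cos J x)) \<partial>\<mu>)"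
    by (rule nn_integral_mono) (rule le)
  also have "... = (SUP J. \<integral>\<^sup>+x. ennreal (dyadic_cos J x) \<partial>\<mu>)"
    by (rule nn_integral_monotone_convergence_SUP) (auto intro!: incseq_SucI le_funI ennreal_leI dyadic_cos_mono)
  also have "... <= ennreal C"
  proof (rule SUP_least)
    fix J
    have "(\<integral>\<^sup>+x. ennreal (dyadic_cos J x) \<partial>\<mu>) = ennreal (\<integral>x. dyadic_cos J x \<partial>\<mu>)"
      by (rule nn_integral_eq_integral[OF dyadic_cos_exponent(1)]) (simp add: dyadic_cos_nonneg)
    also have "... <= ennreal C" using dyadic_cos_exponent(2)[of J \<gamma> \<sigma>] bound[of J] by (intro ennreal_leI) simp
    finally show "(\<integral>\<^sup>+x. ennreal (dyadic_cos J x) \<partial>\<mu>) <= ennreal C" .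
  qed
  also have "... < \<infinity>" by simp
  finally have "integrable \<mu> (%x. c * (\<bar>x\<bar> * indicator {-1<..<1} x))"
    using c by (intro integrableI_bounded) (auto simp: abs_mult)
  hence "integrable \<mu> (%x. \<bar>x\<bar> * indicator {-1<..<1} x)" using c by simp
  hence "integrable \<mu> (%x. \<bar>x\<bar> * indicator {-1<..<1} x + min 1 (x\<^sup>2))"
    using levy_integrable by (rule Bochner_Integration.integrable_add)
  thus ?thesis
  proof (rule Bochner_Integration.integrable_bound)
    show "AE x in \<mu>. norm (min \<bar>x\<bar> 1) <= norm (\<bar>x\<bar> * indicator {-1<..<1} x + min 1 (x\<^sup>2))"
    proof (rule AE_I2)
      fix x :: real
      show "norm (min \<bar>x\<bar> 1) <= norm (\<bar>x\<bar> * indicator {-1<..<1} x + min 1 (x\<^sup>2))"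
      proof (cases "\<bar>x\<bar> < 1")
        case True
        hence "x \<in> {-1<..<1}" by auto
        hence eq: "\<bar>x\<bar> * indicator {-1<..<1} x = \<bar>x\<bar>" "min \<bar>x\<bar> 1 = \<bar>x\<bar>" using True by auto
        have "0 <= min 1 (x\<^sup>2)" by simp
        thus ?thesis unfolding eq real_norm_def by linarith
      next
        case False
        hence "x \<notin> {-1<..<1}" by auto
        have "min 1 (x\<^sup>2) = 1" using False by (simp add: min_def) (metis abs_square_less_1 linorder_not_le nle_le)
        thus ?thesis using False \<open>x \<notin> {-1<..<1}\<close> by simp
      qed
    qed
  qed measurable
qed

context
  assumes small: "integrable \<mu> (%x. min \<bar>x\<bar> 1)"
begin

lemma sine_integrable:
  assumes "1 <= \<theta>"
  shows "integrable \<mu> (%x. sin (\<theta> * x) / \<theta>)" "\<bar>sin (\<theta> * x) / \<theta>\<bar> <= min \<bar>x\<bar> 1"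
proof -
  show le: "\<bar>sin (\<theta> * x) / \<theta>\<bar> <= min \<bar>x\<bar> 1" for x
  proof -
    have "\<bar>sin (\<theta> * x)\<bar> <= \<theta> * \<bar>x\<bar>" using abs_sin_x_le_abs_x[of "\<theta> * x"] assms by (simp add: abs_mult)
    moreover have "\<bar>sin (\<theta> * x)\<bar> <= \<theta>" using abs_sin_le_one[of "\<theta> * x"] assms by linarith
    ultimately show ?thesis using assms by (simp add: pos_divide_le_eq mult.commute)
  qed
  show "integrable \<mu> (%x. sin (\<theta> * x) / \<theta>)" by (rule Bochner_Integration.integrable_bound[OF small]) (use le in auto)
qed

text \<open>Once small jumps are integrable the compensator can be taken out of the integral. What
  separates from the drift is a sine term that vanishes as \<open>\<theta>\<close> grows.\<close>

lemma mean_exponent: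
  assumes \<theta>: "1 <= \<theta>"
  shows "- Im (char_exponent \<gamma> \<sigma> \<mu> \<theta>) / \<theta> = drift \<gamma> \<mu> + (\<integral>x. sin (\<theta> * x) / \<theta> \<partial>\<mu>)"
proof -
  have int: "integrable \<mu> (%x. x * indicator {-1<..<1} x)"
  proof (rule Bochner_Integration.integrable_bound[OF small])
    show "AE x in \<mu>. norm (x * indicator {-1<..<1} x) <= norm (min \<bar>x\<bar> 1)" by (rule AE_I2) (auto simp: indicator_def)
  qed measurable
  have i2: "integrable \<mu> (%x. sin (\<theta> * x))"
    using integrable_mult_right[OF sine_integrable(1)[OF \<theta>], of \<theta>] \<theta> by simp
  have "(\<integral>x. \<theta> * x * indicator {-1<..<1} x - sin (\<theta> * x) \<partial>\<mu>)
    = \<theta> * (\<integral>x. x * indicator {-1<..<1} x \<partial>\<mu>) - (\<integral>x. sin (\<theta> * x) \<partial>\<mu>)"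
    using Bochner_Integration.integral_diff[OF integrable_mult_right[OF int, of \<theta>] i2] by (simp add: mult.assoc)
  moreover have "(LINT x:{-1<..<1}|\<mu>. x) = (\<integral>x. x * indicator {-1<..<1} x \<partial>\<mu>)"
    by (simp add: set_lebesgue_integral_def mult.commute)
  ultimately show ?thesis using \<theta> by (simp add: Im_char_exponent drift_def field_simps)
qed

lemma mean_exponent_limit: "(%j. - Im (char_exponent \<gamma> \<sigma> \<mu> (real (Suc j))) / real (Suc j)) \<longlonglongrightarrow> drift \<gamma> \<mu>"
proof -
  have "(%j. \<integral>x. sin (real (Suc j) * x) / real (Suc j) \<partial>\<mu>) \<longlonglongrightarrow> (\<integral>x. 0 \<partial>\<mu>)"
  proof (rule integral_dominated_convergence[OF _ _ small])
    show "AE x in \<mu>. (%j. sin (real (Suc j) * x) / real (Suc j)) \<longlonglongrightarrow> 0"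
    proof (rule AE_I2, rule Lim_null_comparison[where g = "%j. inverse (real (Suc j))"])
      show "\<forall>\<^sub>F j in sequentially. norm (sin (real (Suc j) * x) / real (Suc j)) <= inverse (real (Suc j))" for x
        by (intro always_eventually allI) (simp add: divide_inverse mult_left_le_one_le abs_mult del: of_nat_Suc)
    qed (rule LIMSEQ_inverse_real_of_nat)
    show "AE x in \<mu>. norm (sin (real (Suc j) * x) / real (Suc j)) <= min \<bar>x\<bar> 1" for j
      using sine_integrable(2)[of "real (Suc j)"] by simp
  qed measurable
  from tendsto_add[OF tendsto_const[of "drift \<gamma> \<mu>"] this] show ?thesis using mean_exponent[of "real (Suc _)"] by (simp add: mean_exponent)
qed

end

end

section \<open>Second moments and identification of the drift\<close>

lemma (in prob_space) square_indep_sum: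
  fixes Z :: "'i => 'a => real"
  assumes I: "finite I" and indep: "indep_vars (%_. borel) Z I"
    and bound: "\<And>i w. i \<in> I ==> \<bar>Z i w\<bar> <= B" and mean: "\<And>i. i \<in> I ==> expectation (Z i) = 0"
  shows "expectation (%w. (\<Sum>i\<in>I. Z i w)\<^sup>2) = (\<Sum>i\<in>I. expectation (%w. (Z i w)\<^sup>2))"
proof -
  have m: "Z i \<in> borel_measurable M" if "i \<in> I" for i using indep that by (auto simp: indep_vars_def)
  have int: "integrable M (Z i)" if "i \<in> I" for i by (rule integrable_const_bound[where B = B]) (use m that bound in auto)
  have int2: "integrable M (%w. Z i w * Z j w)" if "i \<in> I" "j \<in> I" for i j
  proof (rule integrable_const_bound[where B = "B * B"])
    have B: "0 <= B" using bound[OF that(1)] abs_ge_zero order_trans by blast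
    show "AE w in M. norm (Z i w * Z j w) <= B * B" unfolding real_norm_def abs_mult using bound that B by (intro AE_I2 mult_mono) auto
    show "(%w. Z i w * Z j w) \<in> borel_measurable M" using m that by measurable
  qed
  have cross: "expectation (%w. Z i w * Z j w) = 0" if "i \<in> I" "j \<in> I" "i ~= j" for i j
  proof -
    have "indep_vars (%_. borel) Z {i, j}" by (rule indep_vars_subset[OF indep]) (use that in auto)
    from indep_vars_lebesgue_integral[OF _ this] int that mean show ?thesis by auto
  qed
  have "expectation (%w. (\<Sum>i\<in>I. Z i w)\<^sup>2) = expectation (%w. \<Sum>i\<in>I. \<Sum>j\<in>I. Z i w * Z j w)"
    by (simp add: power2_eq_square sum_product)
  also have "... = (\<Sum>i\<in>I. \<Sum>j\<in>I. expectation (%w. Z i w * Z j w))"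
    using int2 by (simp add: Bochner_Integration.integral_sum)
  also have "... = (\<Sum>i\<in>I. \<Sum>j\<in>I. if j = i then expectation (%w. Z i w * Z i w) else 0)"
    by (intro sum.cong refl) (use cross in auto)
  also have "... = (\<Sum>i\<in>I. expectation (%w. (Z i w)\<^sup>2))" using I by (simp add: power2_eq_square)
  finally show ?thesis .
qed

text \<open>All but finitely many terms contribute at most \<open>r / 2\<close> uniformly in
  \<open>j\<close>, since each is at most \<open>\<bar>J s\<bar>\<close>; the finitely many others
  are bounded by the inverse frequency.\<close>

lemma infsum_sine_limit:
  fixes J :: "'a => real"
  assumes J: "(%s. \<bar>J s\<bar>) summable_on S"
  shows "(%j. infsum (%s. sin (real (Suc j) * J s) / real (Suc j)) S) \<longlonglongrightarrow> 0"
proof (rule metric_LIMSEQ_I)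
  fix r :: real assume r: "0 < r"
  obtain G where G: "finite G" "G \<subseteq> S" "\<And>B. B \<subseteq> S - G ==> infsum (%s. \<bar>J s\<bar>) B <= r / 2"
    using infsum_tail[OF J, of "r / 2"] r by auto
  define g where "g j s = \<bar>sin (real (Suc j) * J s) / real (Suc j)\<bar>" for j s
  have gJ: "g j s <= \<bar>J s\<bar>" for j s
    using abs_sin_x_le_abs_x[of "real (Suc j) * J s"] by (simp add: g_def abs_mult pos_divide_le_eq mult.commute del: of_nat_Suc)
  have g1: "g j s <= inverse (real (Suc j))" for j s
    using abs_sin_le_one[of "real (Suc j) * J s"] by (simp add: g_def divide_inverse mult_left_le_one_le abs_mult del: of_nat_Suc)
  have gs: "g j summable_on S" for j by (rule summable_on_comparison_test[OF J]) (use gJ in \<open>auto simp: g_def\<close>)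
  have bound: "\<bar>infsum (%s. sin (real (Suc j) * J s) / real (Suc j)) S\<bar> <= real (card G) * inverse (real (Suc j)) + r / 2" for j
  proof -
    have sub: "g j summable_on S - G" "(%s. \<bar>J s\<bar>) summable_on S - G" "g j summable_on G"
      using G(1) by (auto intro: summable_on_subset_banach[OF gs] summable_on_subset_banach[OF J])
    have "\<bar>infsum (%s. sin (real (Suc j) * J s) / real (Suc j)) S\<bar> <= infsum (g j) S"
      using norm_infsum_bound[of "%s. sin (real (Suc j) * J s) / real (Suc j)" S] gs[of j] by (simp add: g_def[abs_def])
    also have "infsum (g j) S = infsum (g j) G + infsum (g j) (S - G)" using infsum_Un_disjoint[OF sub(3,1)] G(2) by (simp add: Un_absorb1)
    also have "infsum (g j) G <= real (card G) * inverse (real (Suc j))"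
      using G(1) sum_bounded_above[of G "g j" "inverse (real (Suc j))"] g1 by simp
    also have "infsum (g j) (S - G) <= infsum (%s. \<bar>J s\<bar>) (S - G)" by (rule infsum_mono[OF sub(1,2)]) (rule gJ)
    also have "... <= r / 2" by (rule G(3)) simp
    finally show ?thesis by simp
  qed
  have "(%j. real (card G) * inverse (real (Suc j))) \<longlonglongrightarrow> real (card G) * 0"
    by (intro tendsto_intros LIMSEQ_inverse_real_of_nat)
  hence "\<forall>\<^sub>F j in sequentially. real (card G) * inverse (real (Suc j)) < r / 2" using r by (intro order_tendstoD) auto
  then obtain j0 where j0: "\<And>j. j0 <= j ==> real (card G) * inverse (real (Suc j)) < r / 2"
    by (auto simp: eventually_sequentially)
  show "\<exists>no. \<forall>j\<ge>no. dist (infsum (%s. sin (real (Suc j) * J s) / real (Suc j)) S) 0 < r"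
  proof (intro exI[of _ j0] allI impI)
    fix j assume "j0 <= j"
    from j0[OF this] bound[of j] show "dist (infsum (%s. sin (real (Suc j) * J s) / real (Suc j)) S) 0 < r"
      unfolding dist_real_def by linarith
  qed
qed

locale levy_triplet_paths = monotone_start_paths +
  fixes \<gamma> \<sigma> :: real and \<mu> :: "real measure"
  assumes levy: "levy_measure \<mu>"
    and law: "\<And>t \<theta>. 0 <= t ==> char (distr M borel (%w. X t w - X 0 w)) \<theta> = exp (- of_real t * char_exponent \<gamma> \<sigma> \<mu> \<theta>)"
begin

abbreviation \<Psi> :: "real => complex" where "\<Psi> \<equiv> char_exponent \<gamma> \<sigma> \<mu>"

lemma trigonometric_means:
  assumes t: "0 <= t"
  shows "expectation (%w. cos (\<theta> * (X t w - X 0 w))) = Re (exp (- of_real t * \<Psi> \<theta>))"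
    and "expectation (%w. sin (\<theta> * (X t w - X 0 w))) = Im (exp (- of_real t * \<Psi> \<theta>))"
proof -
  have [measurable]: "X t \<in> borel_measurable M" "X 0 \<in> borel_measurable M" using t by auto
  have eq: "exp (- of_real t * \<Psi> \<theta>) = (CLINT w|M. iexp (\<theta> * (X t w - X 0 w)))"
    unfolding law[OF t, symmetric] char_def by (subst integral_distr) auto
  have int: "integrable M (%w. iexp (\<theta> * (X t w - X 0 w)))" by (rule integrable_const_bound[where B = 1]) auto
  show "expectation (%w. cos (\<theta> * (X t w - X 0 w))) = Re (exp (- of_real t * \<Psi> \<theta>))"
    unfolding eq integral_Re[OF int, symmetric] by (simp add: Re_exp)
  show "expectation (%w. sin (\<theta> * (X t w - X 0 w))) = Im (exp (- of_real t * \<Psi> \<theta>))"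
    unfolding eq integral_Im[OF int, symmetric] by (simp add: Im_exp)
qed

abbreviation "step n w \<equiv> X (h / 2 ^ n) w - X 0 w"

text \<open>The characteristic function over one mesh step is close to 1, and its deviation from 1
  multiplied by the number of steps tends to the exponent times the elapsed time.\<close>

lemma mesh_limits:
  "(%n. real (m * 2 ^ n) * expectation (%w. 1 - cos (\<theta> * step n w))) \<longlonglongrightarrow> real m * h * Re (\<Psi> \<theta>)"
  "(%n. real (m * 2 ^ n) * expectation (%w. sin (\<theta> * step n w))) \<longlonglongrightarrow> - (real m * h * Im (\<Psi> \<theta>))"
proof -
  let ?z = "of_real h * \<Psi> \<theta>"
  note lim = exp_increment_limit[of ?z]
  have pow: "2 ^ n = complex_of_real (2 ^ n)" for n by simp
  have e: "exp (- of_real (h / 2 ^ n) * \<Psi> \<theta>) = exp (- (?z / 2 ^ n))" for n by simp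
  have int: "integrable M (%w. cos (\<theta> * step n w))" for n by (rule integrable_const_bound[where B = 1]) auto
  have c: "real (m * 2 ^ n) * expectation (%w. 1 - cos (\<theta> * step n w)) = real m * Re (2 ^ n * (1 - exp (- (?z / 2 ^ n))))" for n
    using int[of n] trigonometric_means(1)[of "h / 2 ^ n" \<theta>] h unfolding pow e[unfolded pow] by (simp add: prob_space)
  have s: "real (m * 2 ^ n) * expectation (%w. sin (\<theta> * step n w)) = - (real m * Im (2 ^ n * (1 - exp (- (?z / 2 ^ n)))))" for n
    using trigonometric_means(2)[of "h / 2 ^ n" \<theta>] h unfolding pow e[unfolded pow] by simp
  have "(%n. real m * Re (2 ^ n * (1 - exp (- (?z / 2 ^ n))))) \<longlonglongrightarrow> real m * Re ?z" by (intro tendsto_intros lim)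
  thus "(%n. real (m * 2 ^ n) * expectation (%w. 1 - cos (\<theta> * step n w))) \<longlonglongrightarrow> real m * h * Re (\<Psi> \<theta>)"
    unfolding c by (simp add: mult.assoc)
  have "(%n. - (real m * Im (2 ^ n * (1 - exp (- (?z / 2 ^ n)))))) \<longlonglongrightarrow> - (real m * Im ?z)" by (intro tendsto_intros lim)
  thus "(%n. real (m * 2 ^ n) * expectation (%w. sin (\<theta> * step n w))) \<longlonglongrightarrow> - (real m * h * Im (\<Psi> \<theta>))"
    unfolding s by (simp add: mult.assoc)
qed

lemma min_integrable: "integrable M (%w. min \<bar>step n w\<bar> 1)" by (rule integrable_const_bound[where B = 1]) auto

text \<open>Refining the grid turns means of \<open>dyadic_cos\<close> into real parts of the
  exponent, and on every grid they are at most 9 times the bounded means of the truncated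
  increments.\<close>

lemma jumps_integrable: "integrable \<mu> (%x. min \<bar>x\<bar> 1)"
proof -
  obtain K where K: "\<And>n. real (1 * 2 ^ n) * expectation (%w. min \<bar>step n w\<bar> 1) <= K"
    using truncated_increments_bound[of 1] by blast
  show ?thesis
  proof (rule small_jumps_integrable[OF levy])
    fix J
    have cint: "integrable M (%w. 1 - cos (\<theta> * step n w))" for n \<theta>
      by (rule integrable_const_bound[where B = 2]) (auto simp: abs_le_iff intro!: AE_I2 order_trans[OF diff_left_mono[OF cos_ge_minus_one]])
    have lim: "(%n. \<Sum>j<J. (real (1 * 2 ^ n) * expectation (%w. 1 - cos (2 ^ j * step n w))) / 2 ^ j)
      \<longlonglongrightarrow> (\<Sum>j<J. (real 1 * h * Re (\<Psi> (2 ^ j))) / 2 ^ j)"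
      by (intro tendsto_sum tendsto_divide mesh_limits(1) tendsto_const) auto
    have "(\<Sum>j<J. (real 1 * h * Re (\<Psi> (2 ^ j))) / 2 ^ j) <= 9 * K"
    proof (rule LIMSEQ_le_const2[OF lim], intro exI allI impI)
      fix n :: nat
      have "(\<Sum>j<J. (real (1 * 2 ^ n) * expectation (%w. 1 - cos (2 ^ j * step n w))) / 2 ^ j)
        = real (1 * 2 ^ n) * (\<Sum>j<J. expectation (%w. (1 - cos (2 ^ j * step n w)) / 2 ^ j))" unfolding sum_distrib_left by simp
      also have "(\<Sum>j<J. expectation (%w. (1 - cos (2 ^ j * step n w)) / 2 ^ j)) = expectation (%w. dyadic_cos J (step n w))"
        unfolding dyadic_cos_def using cint by (subst Bochner_Integration.integral_sum) auto
      also have "... <= expectation (%w. 9 * min \<bar>step n w\<bar> 1)"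
      proof (rule integral_mono)
        show "integrable M (%w. dyadic_cos J (step n w))" unfolding dyadic_cos_def using cint by auto
        show "integrable M (%w. 9 * min \<bar>step n w\<bar> 1)" using min_integrable by simp
      qed (rule dyadic_cos_upper)
      also have "... = 9 * expectation (%w. min \<bar>step n w\<bar> 1)" by simp
      finally show "(\<Sum>j<J. (real (1 * 2 ^ n) * expectation (%w. 1 - cos (2 ^ j * step n w))) / 2 ^ j) <= 9 * K" using K[of n] by simp
    qed
    moreover have "(\<Sum>j<J. (real 1 * h * Re (\<Psi> (2 ^ j))) / 2 ^ j) = h * (\<Sum>j<J. Re (\<Psi> (2 ^ j)) / 2 ^ j)"
      unfolding sum_distrib_left by simp
    ultimately show "(\<Sum>j<J. Re (\<Psi> (2 ^ j)) / 2 ^ j) <= 9 * K / h" using h by (simp add: pos_le_divide_eq mult.commute)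
  qed
qed

lemma integral_mesh:
  fixes g :: "real => real"
  assumes g: "g \<in> borel_measurable borel"
  shows "expectation (%w. g (increment n k w)) = expectation (%w. g (step n w))"
proof -
  have e: "h / 2 ^ n * real (Suc k) = h / 2 ^ n * real k + h / 2 ^ n" by (simp only: of_nat_Suc distrib_left mult_1_right add.commute)
  have "distr M borel (increment n k) = distr M borel (step n)" unfolding e by (rule stationary) (use h in auto)
  hence "(\<integral>x. g x \<partial>distr M borel (increment n k)) = (\<integral>x. g x \<partial>distr M borel (step n))" by simp
  moreover have "(\<integral>x. g x \<partial>distr M borel (increment n k)) = expectation (%w. g (increment n k w))"
    by (rule integral_distr) (use g in measurable)
  moreover have "(\<integral>x. g x \<partial>distr M borel (step n)) = expectation (%w. g (step n w))"
    by (rule integral_distr) (use g in measurable)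
  ultimately show ?thesis by (simp only:)
qed

text \<open>In the square of \<open>sin (\<theta> * x) / \<theta>\<close> one factor is bounded by
  \<open>1 / \<theta>\<close> and the other by \<open>min \<bar>x\<bar> 1\<close>. So the variance
  of the sum is small for large \<open>\<theta>\<close>, uniformly in the grid.\<close>

lemma sine_variance:
  assumes \<theta>: "1 <= \<theta>" and K: "real (m * 2 ^ n) * expectation (%w. min \<bar>step n w\<bar> 1) <= K"
  shows "(EE w. ennreal (((\<Sum>k<m * 2 ^ n. sin (\<theta> * increment n k w) / \<theta>)
      - real (m * 2 ^ n) * expectation (%w. sin (\<theta> * step n w)) / \<theta>)\<^sup>2)) <= ennreal (K / \<theta>)"
proof -
  let ?N = "m * 2 ^ n"
  define g where "g x = sin (\<theta> * x) / \<theta>" for x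
  have g[measurable]: "g \<in> borel_measurable borel" unfolding g_def by measurable
  have gb: "\<bar>g x\<bar> <= min \<bar>x\<bar> 1" for x using sine_integrable(2)[OF levy jumps_integrable \<theta>] by (simp add: g_def)
  have gb': "\<bar>g x\<bar> <= 1 / \<theta>" for x using \<theta> abs_sin_le_one[of "\<theta> * x"] by (simp add: g_def abs_div divide_right_mono)
  have gint: "integrable M (%w. g (step n w))" "integrable M (%w. g (increment n k w))"
    "integrable M (%w. (g (step n w))\<^sup>2)" for k
  proof -
    have g1: "norm (g x) <= 1" for x using gb[of x] by simp
    show "integrable M (%w. g (step n w))" by (rule integrable_const_bound[where B = 1], rule AE_I2, rule g1, measurable)
    show "integrable M (%w. g (increment n k w))" by (rule integrable_const_bound[where B = 1], rule AE_I2, rule g1, measurable)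
    show "integrable M (%w. (g (step n w))\<^sup>2)"
      by (rule integrable_const_bound[where B = 1]) (use gb in \<open>auto simp: abs_square_le_1 min.bounded_iff\<close>)
  qed
  define c where "c = expectation (%w. g (step n w))"
  define Z where "Z k w = g (increment n k w) - c" for k w
  have "\<bar>c\<bar> <= expectation (%w. \<bar>g (step n w)\<bar>)" unfolding c_def by (rule integral_abs_bound)
  also have "... <= expectation (%w. 1)" by (rule integral_mono[OF integrable_abs[OF gint(1)]]) (use gb in auto)
  finally have cb: "\<bar>c\<bar> <= 1" by (simp add: prob_space)
  have indep: "indep_vars (%_. borel) Z {..<?N}"
  proof -
    have "mono (%k. h / 2 ^ n * real k)" by (rule monoI) (use h in \<open>auto intro!: mult_left_mono divide_right_mono\<close>)
    hence "indep_vars (%_. borel) (%k w. increment n k w) {..<?N}" by (rule indep_increments) simp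
    thus ?thesis unfolding Z_def by (rule indep_vars_compose2[where Y = "%_ x. g x - c"]) measurable
  qed
  have "expectation (%w. (\<Sum>k<?N. Z k w)\<^sup>2) = (\<Sum>k<?N. expectation (%w. (Z k w)\<^sup>2))"
  proof (rule square_indep_sum[OF _ indep, where B = 2])
    show "\<bar>Z k w\<bar> <= 2" for k w using gb[of "increment n k w"] cb unfolding Z_def min.bounded_iff by linarith
    show "expectation (Z k) = 0" for k using gint(2)[of k] integral_mesh[OF g, of n k] by (simp add: Z_def[abs_def] c_def prob_space del: of_nat_Suc)
  qed simp
  also have "... <= (\<Sum>k<?N. (1 / \<theta>) * expectation (%w. min \<bar>step n w\<bar> 1))"
  proof (rule sum_mono)
    fix k
    have "expectation (%w. (Z k w)\<^sup>2) = expectation (%w. (g (step n w) - c)\<^sup>2)"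
      unfolding Z_def using integral_mesh[of "%x. (g x - c)\<^sup>2"] by simp
    also have "... = expectation (%w. (g (step n w))\<^sup>2) - c\<^sup>2" unfolding c_def by (rule variance_eq[OF gint(1,3)])
    also have "... <= expectation (%w. (g (step n w))\<^sup>2)" by simp
    also have "... <= expectation (%w. (1 / \<theta>) * min \<bar>step n w\<bar> 1)"
    proof (rule integral_mono[OF gint(3)])
      show "integrable M (%w. (1 / \<theta>) * min \<bar>step n w\<bar> 1)" using min_integrable by simp
      fix w
      have "\<bar>g (step n w)\<bar> * \<bar>g (step n w)\<bar> <= (1 / \<theta>) * min \<bar>step n w\<bar> 1"
        by (intro mult_mono gb gb') (use \<theta> in auto)
      thus "(g (step n w))\<^sup>2 <= (1 / \<theta>) * min \<bar>step n w\<bar> 1" by (simp only: power2_eq_square abs_mult_self_eq)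
    qed
    finally show "expectation (%w. (Z k w)\<^sup>2) <= (1 / \<theta>) * expectation (%w. min \<bar>step n w\<bar> 1)" by simp
  qed
  also have "... = (1 / \<theta>) * (real ?N * expectation (%w. min \<bar>step n w\<bar> 1))" by simp
  also have "... <= (1 / \<theta>) * K" using \<theta> by (intro mult_left_mono K) auto
  finally have le: "expectation (%w. (\<Sum>k<?N. Z k w)\<^sup>2) <= K / \<theta>" by simp
  have [measurable]: "Z k \<in> borel_measurable M" for k unfolding Z_def[abs_def] by measurable
  have Zb: "\<bar>\<Sum>k<?N. Z k w\<bar> <= real ?N * 2" for w
  proof -
    have "\<bar>\<Sum>k<?N. Z k w\<bar> <= (\<Sum>k<?N. \<bar>Z k w\<bar>)" by (rule sum_abs)
    also have "... <= (\<Sum>k<?N. 2)"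
    proof (rule sum_mono)
      fix k show "\<bar>Z k w\<bar> <= 2" using gb[of "increment n k w"] cb unfolding Z_def min.bounded_iff by linarith
    qed
    finally show ?thesis by simp
  qed
  have "integrable M (%w. (\<Sum>k<?N. Z k w)\<^sup>2)"
  proof (rule integrable_const_bound[where B = "(real ?N * 2)\<^sup>2"])
    show "AE w in M. norm ((\<Sum>k<?N. Z k w)\<^sup>2) <= (real ?N * 2)\<^sup>2"
    proof (rule AE_I2)
      fix w show "norm ((\<Sum>k<?N. Z k w)\<^sup>2) <= (real ?N * 2)\<^sup>2" using Zb[of w] power_mono[OF Zb[of w], of 2] by simp
    qed
  qed measurable
  hence "(EE w. ennreal ((\<Sum>k<?N. Z k w)\<^sup>2)) <= ennreal (K / \<theta>)"
    using le by (simp add: nn_integral_eq_integral ennreal_leI)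
  moreover have "(\<Sum>k<?N. Z k w) = (\<Sum>k<?N. sin (\<theta> * increment n k w) / \<theta>) - real ?N * expectation (%w. sin (\<theta> * step n w)) / \<theta>" for w
    by (simp add: Z_def sum_subtractf c_def g_def del: of_nat_Suc)
  ultimately show ?thesis by (simp only:)
qed

text \<open>The order of the limits matters. For fixed \<open>\<theta>\<close>, refining the grid
  turns the sine sum into the increment of \<open>X\<close> minus a jump sum, and its mean into a
  multiple of the imaginary part of the exponent. Letting \<open>\<theta>\<close> grow afterwards
  removes the variance and the sine terms of the jumps, and the mean tends to the drift. Fatou's
  lemma serves both limits.\<close>

lemma decomposition_at_mesh:
  assumes m: "0 < m"
  shows "AE w in M. (%s. \<bar>jump (%t. X t w) s\<bar>) summable_on {0<..real m * h} &
    X (real m * h) w - X 0 w = drift \<gamma> \<mu> * (real m * h) + infsum (jump (%t. X t w)) {0<..real m * h}"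
proof -
  let ?T = "real m * h"
  have T: "0 < ?T" using m h by simp
  obtain K where K: "\<And>n. real (m * 2 ^ n) * expectation (%w. min \<bar>step n w\<bar> 1) <= K"
    using truncated_increments_bound[of m] by blast
  define \<theta> where "\<theta> j = real (Suc j)" for j
  have \<theta>: "1 <= \<theta> j" for j by (simp add: \<theta>_def)
  define S where "S j n w = (\<Sum>k<m * 2 ^ n. sin (\<theta> j * increment n k w) / \<theta> j)" for j n w
  define c where "c j n = real (m * 2 ^ n) * expectation (%w. sin (\<theta> j * step n w)) / \<theta> j" for j n
  define a where "a j = - Im (\<Psi> (\<theta> j)) / \<theta> j" for j
  have c: "c j \<longlonglongrightarrow> ?T * a j" for j
  proof -
    have "(%n. real (m * 2 ^ n) * expectation (%w. sin (\<theta> j * step n w)) / \<theta> j) \<longlonglongrightarrow> - (?T * Im (\<Psi> (\<theta> j))) / \<theta> j"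
      using \<theta>[of j] by (intro tendsto_divide mesh_limits(2) tendsto_const) auto
    thus ?thesis by (simp add: c_def[abs_def] a_def)
  qed
  have a: "a \<longlonglongrightarrow> drift \<gamma> \<mu>"
    using mean_exponent_limit[OF levy jumps_integrable] by (simp add: a_def[abs_def] \<theta>_def)
  define Q where "Q j w = liminf (%n. ennreal ((S j n w - c j n)\<^sup>2))" for j w
  have Sm[measurable]: "S j n \<in> borel_measurable M" for j n unfolding S_def[abs_def] by measurable
  have Qm[measurable]: "Q j \<in> borel_measurable M" for j unfolding Q_def[abs_def] by measurable
  have Qb: "(EE w. Q j w) <= ennreal (K / \<theta> j)" for j
  proof -
    have "(EE w. Q j w) <= liminf (%n. \<integral>\<^sup>+w. ennreal ((S j n w - c j n)\<^sup>2) \<partial>M)"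
      unfolding Q_def by (rule nn_integral_liminf) measurable
    also have "... <= ennreal (K / \<theta> j)"
    proof (rule Liminf_le)
      show "\<forall>\<^sub>F n in sequentially. (EE w. ennreal ((S j n w - c j n)\<^sup>2)) <= ennreal (K / \<theta> j)"
        unfolding S_def c_def by (intro always_eventually allI) (rule sine_variance[OF \<theta> K])
    qed simp
    finally show ?thesis .
  qed
  have "(EE w. liminf (%j. Q j w)) <= liminf (%j. \<integral>\<^sup>+w. Q j w \<partial>M)"
    by (rule nn_integral_liminf) measurable
  also have "... <= liminf (%j. ennreal (K / \<theta> j))" by (intro Liminf_mono always_eventually allI) (rule Qb)
  also have "... = 0"
  proof (rule lim_imp_Liminf)
    have "(%j. K * inverse (real (Suc j))) \<longlonglongrightarrow> K * 0" by (intro tendsto_intros LIMSEQ_inverse_real_of_nat)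
    hence "(%j. K / \<theta> j) \<longlonglongrightarrow> 0" by (simp add: \<theta>_def divide_inverse)
    thus "(%j. ennreal (K / \<theta> j)) \<longlonglongrightarrow> 0" using tendsto_ennrealI by fastforce
  qed simp
  finally have "(EE w. liminf (%j. Q j w)) = 0" by simp
  hence "AE w in M. liminf (%j. Q j w) = 0" by (subst (asm) nn_integral_0_iff_AE) auto
  with variation_finite[of m] AE_space show ?thesis
  proof eventually_elim
    case (elim w)
    obtain V where V: "\<And>n. (\<Sum>k<m * 2 ^ n. \<bar>increment n k w\<bar>) <= V" using elim(1) by blast
    let ?f = "%t. X t w" and ?A = "{0<..?T}"
    note path = cadlag_X[OF elim(2)] T mesh(1) mesh(2) mesh(3) V
    have js: "(%s. \<bar>jump ?f s\<bar>) summable_on ?A" by (rule abs_jumps_summable[OF path])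
    \<comment> \<open>The identity minus the scaled sine is quadratically small at 0 and of linear
      growth, as the convergence of grid sums to jump sums requires; the sine itself is not
      quadratically small. The identity is recovered by telescoping.\<close>
    define w' where "w' j x = x - sin (\<theta> j * x) / \<theta> j" for j x
    have sine: "\<bar>sin (\<theta> j * x) / \<theta> j\<bar> <= \<bar>x\<bar>" for j x
      using sine_integrable(2)[OF levy jumps_integrable \<theta>, of j x] by simp
    have w2: "\<bar>w' j x\<bar> <= \<theta> j * x\<^sup>2" for j x
    proof -
      have "w' j x = (\<theta> j * x - sin (\<theta> j * x)) / \<theta> j" using \<theta>[of j] by (simp add: w'_def diff_divide_distrib)
      hence "\<bar>w' j x\<bar> = \<bar>sin (\<theta> j * x) - \<theta> j * x\<bar> / \<theta> j"
        using \<theta>[of j] by (simp add: abs_divide abs_minus_commute)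
      also have "... <= ((\<theta> j * x)\<^sup>2 / 2) / \<theta> j" by (rule divide_right_mono[OF sin_minus_le]) (use \<theta>[of j] in simp)
      also have "... = \<theta> j * x\<^sup>2 / 2" using \<theta>[of j] by (simp add: power2_eq_square)
      also have "... <= \<theta> j * x\<^sup>2" using \<theta>[of j] by simp
      finally show ?thesis .
    qed
    have w1: "\<bar>w' j x\<bar> <= 2 * \<bar>x\<bar>" for j x using sine[of j x] unfolding w'_def by linarith
    have wc: "continuous_on UNIV (w' j)" for j unfolding w'_def using \<theta>[of j] by (intro continuous_intros) auto
    have Slim: "(%n. S j n w) \<longlonglongrightarrow> (X ?T w - X 0 w) - infsum (%s. w' j (jump ?f s)) ?A" for j
    proof -
      have "S j n w = (X ?T w - X 0 w) - (\<Sum>k<m * 2 ^ n. w' j (increment n k w))" for n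
      proof -
        have "h / 2 ^ n * real (m * 2 ^ n) = ?T" by simp
        thus ?thesis using telescope[of ?f "h / 2 ^ n" "m * 2 ^ n"] unfolding S_def w'_def sum_subtractf by (simp del: of_nat_Suc of_nat_mult)
      qed
      thus ?thesis using tendsto_diff[OF tendsto_const grid_jumps_variation[OF path wc w2 w1]] by simp
    qed
    have gsum: "(%s. sin (\<theta> j * jump ?f s) / \<theta> j) summable_on ?A" for j
      using jumps_summable(1)[OF path, of "%x. sin (\<theta> j * x) / \<theta> j" 1] sine by simp
    have jsum: "jump ?f summable_on ?A" using jumps_summable(1)[OF path, of "%x. x" 1] by simp
    have wsum: "(%s. w' j (jump ?f s)) summable_on ?A" for j by (rule jumps_summable(1)[OF path w1])
    have weq: "infsum (%s. w' j (jump ?f s)) ?A = infsum (jump ?f) ?A - infsum (%s. sin (\<theta> j * jump ?f s) / \<theta> j) ?A" for j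
      using infsum_add[OF wsum[of j] gsum[of j]] by (simp add: w'_def)
    let ?C = "(X ?T w - X 0 w) - infsum (jump ?f) ?A"
    have "Q j w = ennreal ((?C + infsum (%s. sin (\<theta> j * jump ?f s) / \<theta> j) ?A - ?T * a j)\<^sup>2)" for j
    proof -
      have "(%n. ennreal ((S j n w - c j n)\<^sup>2))
        \<longlonglongrightarrow> ennreal (((X ?T w - X 0 w) - infsum (%s. w' j (jump ?f s)) ?A - ?T * a j)\<^sup>2)"
        by (intro tendsto_ennrealI tendsto_intros Slim c)
      from lim_imp_Liminf[OF _ this] show ?thesis unfolding Q_def weq by (simp add: algebra_simps)
    qed
    moreover have "(%j. ennreal ((?C + infsum (%s. sin (\<theta> j * jump ?f s) / \<theta> j) ?A - ?T * a j)\<^sup>2))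
      \<longlonglongrightarrow> ennreal ((?C + 0 - ?T * drift \<gamma> \<mu>)\<^sup>2)"
      by (intro tendsto_ennrealI tendsto_intros a) (use infsum_sine_limit[OF js] in \<open>simp add: \<theta>_def\<close>)
    ultimately have "ennreal ((?C + 0 - ?T * drift \<gamma> \<mu>)\<^sup>2) = 0"
      using lim_imp_Liminf[of sequentially "%j. Q j w"] elim(3) by simp
    hence "?C = ?T * drift \<gamma> \<mu>" by (simp add: ennreal_eq_0_iff)
    thus ?case using js by (simp add: algebra_simps)
  qed
qed

text \<open>An initial part of a monotone start is again one, so the decomposition becomes available
  at all dyadic multiples of \<open>h\<close>.\<close>

lemma finer: "levy_triplet_paths M X x0 (h / 2 ^ i) A \<gamma> \<sigma> \<mu>"
proof unfold_locales
  show "mono_on {0..h / 2 ^ i} (%t. X t w)" if "w \<in> A" for w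
  proof (rule monotone_on_subset[OF mono[OF that]])
    have "h / 2 ^ i <= h / 1" using h by (intro divide_left_mono) auto
    thus "{0..h / 2 ^ i} \<subseteq> {0..h}" by auto
  qed
qed (use h A levy law in auto)

text \<open>Both sides are right continuous, the jump sum because it is a difference of two
  nondecreasing sum processes; so equality passes from the dyadic multiples of \<open>h\<close> to
  all times.\<close>

lemma path_decomposition:
  "AE w in M. (\<forall>T. (%s. \<bar>jump (%t. X t w) s\<bar>) summable_on {0<..T}) &
    (\<forall>t\<ge>0. X t w = X 0 w + drift \<gamma> \<mu> * t + infsum (jump (%t. X t w)) {0<..t})"
proof -
  have "AE w in M. \<forall>i m. (%s. \<bar>jump (%t. X t w) s\<bar>) summable_on {0<..real (Suc m) * (h / 2 ^ i)} &
    X (real (Suc m) * (h / 2 ^ i)) w - X 0 w = drift \<gamma> \<mu> * (real (Suc m) * (h / 2 ^ i))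
      + infsum (jump (%t. X t w)) {0<..real (Suc m) * (h / 2 ^ i)}"
    unfolding AE_all_countable by (intro allI levy_triplet_paths.decomposition_at_mesh[OF finer]) simp
  with AE_space show ?thesis
  proof eventually_elim
    case (elim w)
    let ?f = "%t. X t w"
    have f: "cadlag ?f" by (rule cadlag_X[OF elim(1)])
    have summable: "(%s. \<bar>jump ?f s\<bar>) summable_on {0<..T}" for T
    proof -
      obtain m where "T / h < real m" using reals_Archimedean2 by blast
      hence "T < real m * h" using h by (simp add: field_simps)
      also have "... <= real (Suc m) * h" using h by simp
      finally have "{0<..T} \<subseteq> {0<..real (Suc m) * (h / 2 ^ 0)}" by auto
      thus ?thesis using elim(2) summable_on_subset_banach by blast
    qed
    have parts: "(%s. max (jump ?f s) 0) summable_on {0<..T}" "(%s. max (- jump ?f s) 0) summable_on {0<..T}" for T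
      by (rule summable_on_comparison_test[OF summable]; auto)+
    have split: "infsum (jump ?f) {0<..t} = infsum (%s. max (jump ?f s) 0) {0<..t} - infsum (%s. max (- jump ?f s) 0) {0<..t}" for t
    proof -
      have "infsum (%s. max (jump ?f s) 0) {0<..t} = infsum (%s. jump ?f s + max (- jump ?f s) 0) {0<..t}"
        by (rule infsum_cong) (auto simp: max_def)
      also have "... = infsum (jump ?f) {0<..t} + infsum (%s. max (- jump ?f s) 0) {0<..t}"
      proof (rule infsum_add[OF _ parts(2)])
        show "jump ?f summable_on {0<..t}" using summable[of t] by (subst summable_on_iff_abs_summable_on_real) simp
      qed
      finally show ?thesis by simp
    qed
    have right: "((%t. infsum w' {0<..t}) \<longlongrightarrow> infsum w' {0<..t}) (at_right t)"
      if "0 <= t" "\<And>s. 0 <= w' s" "\<And>T. w' summable_on {0<..T}" for t and w' :: "real => real"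
      using cumulative_pathD(4)[OF sum_process_cumulative[of w' 0 0, OF that(2,3)] that(1)] by (simp add: continuous_within)
    have "X t w = X 0 w + drift \<gamma> \<mu> * t + infsum (jump ?f) {0<..t}" if t: "0 <= t" for t
    proof (cases "t = 0")
      case False
      define x where "x n = h / 2 ^ n * of_int \<lceil>t / (h / 2 ^ n)\<rceil>" for n
      note xx = grid_right[of "%n. h / 2 ^ n", OF mesh(1,2), where s = t, folded x_def]
      have eq: "X (x n) w = X 0 w + drift \<gamma> \<mu> * x n + infsum (jump ?f) {0<..x n}" for n
      proof -
        have "0 < t / (h / 2 ^ n)" using t False h by simp
        hence "0 < \<lceil>t / (h / 2 ^ n)\<rceil>" by (simp add: zero_less_ceiling)
        hence "\<lceil>t / (h / 2 ^ n)\<rceil> = int (Suc (nat (\<lceil>t / (h / 2 ^ n)\<rceil> - 1)))" by simp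
        hence "x n = real (Suc (nat (\<lceil>t / (h / 2 ^ n)\<rceil> - 1))) * (h / 2 ^ n)" unfolding x_def by (metis mult.commute of_int_of_nat_eq)
        thus ?thesis using elim(2)[rule_format, of "nat (\<lceil>t / (h / 2 ^ n)\<rceil> - 1)" n] by (simp only:) linarith
      qed
      define H where "H t = X 0 w + drift \<gamma> \<mu> * t + infsum (jump ?f) {0<..t}" for t
      have "(H \<longlongrightarrow> H t) (at_right t)" unfolding H_def split by (intro tendsto_intros right t parts) auto
      hence "(%n. H (x n)) \<longlonglongrightarrow> H t" by (rule right_continuous_seq[OF _ xx])
      moreover have "(%n. X (x n) w) \<longlonglongrightarrow> X t w" by (rule right_continuous_seq[OF cadlag_right[OF f t] xx])
      ultimately have "H t = X t w" unfolding eq H_def[symmetric] by (rule LIMSEQ_unique)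
      thus ?thesis by (simp add: H_def)
    qed simp
    thus ?case using summable by blast
  qed
qed

text \<open>On \<open>A\<close> the path is nondecreasing up to \<open>h\<close>, so its grid
  variations equal \<open>X h w - X 0 w\<close> and the jumps add up to no more; what is left for
  the drift is nonnegative.\<close>

lemma drift_nonneg: "0 <= drift \<gamma> \<mu>"
proof -
  have "\<exists>w\<in>A. X h w = X 0 w + drift \<gamma> \<mu> * h + infsum (jump (%t. X t w)) {0<..h}"
  proof (rule ccontr)
    assume no: "~ ?thesis"
    have "AE w in M. w \<notin> A" using path_decomposition
    proof eventually_elim
      case (elim w)
      have "X h w = X 0 w + drift \<gamma> \<mu> * h + infsum (jump (%t. X t w)) {0<..h}"
        by (rule conjunct2[OF elim, rule_format, OF less_imp_le[OF h]])
      thus ?case using no by blast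
    qed
    hence "prob A = 0" using A(1) by (simp add: prob_eq_0)
    thus False using A(2) by simp
  qed
  then obtain w where w: "w \<in> A" "X h w = X 0 w + drift \<gamma> \<mu> * h + infsum (jump (%t. X t w)) {0<..h}" by blast
  have sp: "w \<in> space M" using w(1) A(1) sets.sets_into_space by blast
  have "(\<Sum>k<2 ^ n. \<bar>increment n k w\<bar>) <= X h w - X 0 w" for n
  proof -
    have "(\<Sum>k<2 ^ n. \<bar>increment n k w\<bar>) = (\<Sum>k<2 ^ n. increment n k w)"
    proof (intro sum.cong refl)
      fix k assume "k \<in> {..<(2::nat) ^ n}"
      hence "real (Suc k) <= 2 ^ n" by (metis Suc_leI lessThan_iff of_nat_le_iff of_nat_numeral of_nat_power)
      hence "h / 2 ^ n * real (Suc k) <= h / 2 ^ n * 2 ^ n" using h by (intro mult_left_mono) auto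
      hence "h / 2 ^ n * real (Suc k) <= h" by simp
      moreover have "h / 2 ^ n * real k <= h / 2 ^ n * real (Suc k)" using h by (intro mult_left_mono) auto
      moreover have "0 <= h / 2 ^ n * real k" using h by simp
      ultimately have "X (h / 2 ^ n * real k) w <= X (h / 2 ^ n * real (Suc k)) w" by (intro monotone_onD[OF mono[OF w(1)]]) auto
      thus "\<bar>increment n k w\<bar> = increment n k w" by (simp del: of_nat_Suc)
    qed
    also have "... = X h w - X 0 w" using telescope[of "%t. X t w" "h / 2 ^ n" "2 ^ n"] by simp
    finally show ?thesis by simp
  qed
  from jumps_summable(2)[OF cadlag_X[OF sp] h mesh(1) mesh(2) dyadic_mesh(3)[of _ h] this, of "%x. x" 1]
  have "\<bar>infsum (jump (%t. X t w)) {0<..h}\<bar> <= X h w - X 0 w" by simp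
  hence "0 <= drift \<gamma> \<mu> * h" using w(2) by linarith
  thus ?thesis using h by (simp add: zero_le_mult_iff)
qed

end

lemma increment_char:
  assumes fam: "levy_family P X" and triplet: "levy_triplet (P 0) X \<gamma> \<sigma> \<mu>" and t: "0 <= t"
  shows "char (distr (P x) borel (%w. X t w - X 0 w)) \<theta> = exp (- of_real t * char_exponent \<gamma> \<sigma> \<mu> \<theta>)"
proof -
  interpret levy_paths "P 0" X 0 by (rule levy_family_paths[OF fam])
  have \<phi>: "(%w'. w' t - w' 0) \<in> measurable (Pi\<^sub>M {0..} (%_. borel)) (borel :: real measure)"
    using t by (intro borel_measurable_diff measurable_component_singleton) auto
  have [measurable]: "X t \<in> borel_measurable (P 0)" "X 0 \<in> borel_measurable (P 0)" using t by auto
  have "distr (P x) borel (%w. X t w - X 0 w) = distr (P 0) borel (%w. X t w - X 0 w)"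
    using levy_family_law(1)[OF fam \<phi>, of x] t by simp
  also have "... = distr (P 0) borel (X t)" by (rule distr_cong_AE) (use start in \<open>auto elim: eventually_mono\<close>)
  finally show ?thesis using triplet t by (simp add: levy_triplet_def)
qed

text \<open>At barrier 0 the optimality inequality and \<open>\<beta> > 1\<close> give
  \<open>\<nu>(0) < 1\<close>, hence a monotone start under every \<open>P x\<close>. The resulting
  path decomposition gives the reflection property, and the sign of the drift gives the slack
  condition.\<close>

lemma zero_barrier_optimal:
  fixes P :: "real => 'w measure" and X :: "real => 'w => real"
  assumes fam: "levy_family P X" and triplet: "levy_triplet (P 0) X \<gamma> \<sigma> \<mu>"
    and q: "0 < q" and \<beta>: "1 < \<beta>" and int: "integrable (P 0) (%w. \<bar>X 1 w\<bar>)"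
    and zero: "optimal_barrier P X q \<beta> = 0"
  shows "double_barrier X (drift \<gamma> \<mu>) 0 \<in> admissible P X q"
    "value_function P X q \<beta> x = strategy_value P q \<beta> (double_barrier X (drift \<gamma> \<mu>) 0) x"
proof -
  let ?\<delta> = "drift \<gamma> \<mu>"
  let ?L = "%t w. zero_barrier_L ?\<delta> (%s. X s w) t" and ?R = "%t w. zero_barrier_R ?\<delta> (%s. X s w) t"
  have opt: "\<beta> * nu_low P X q 0 <= 1" using optimal_barrier_le[OF fam q \<beta>] zero by simp
  have measurable: "?L t \<in> borel_measurable (natural_filtration (space (P 0)) X t)"
    "?R t \<in> borel_measurable (natural_filtration (space (P 0)) X t)" if "0 <= t" for t
  proof -
    interpret levy_paths "P 0" X 0 by (rule levy_family_paths[OF fam])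
    show "?L t \<in> borel_measurable (past t)" "?R t \<in> borel_measurable (past t)"
      by (rule zero_barrier_measurable[OF _ that X_past]; simp add: cadlag_X)+
  qed
  have path: "AE w in P x. skorokhod 0 (%t. X t w) (%t. ?L t w) (%t. ?R t w)"
    and slack: "AE w in P x. AE t in control_measure (%t. ?L t w). 0 <= t -->
      skorokhod_path.growth_discount (%t. ?R t w) q t <= drawdown q 0 (%t. X t w) t" for x
  proof -
    interpret levy_paths "P x" X x by (rule levy_family_paths[OF fam])
    have "nu_low P X q 0 <= 1 / \<beta>" using opt \<beta> by (simp add: field_simps)
    also have "... < 1" using \<beta> by simp
    finally have "nu q 0 < 1" unfolding levy_family_nu[OF fam q order_refl, of x] nu_low_eq[OF fam q order_refl, symmetric]
      using nu_low_nonneg[OF fam q \<beta>] by (simp add: ennreal_less_one_iff)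
    from monotone_start[OF q this] obtain h A where h: "0 < h" "A \<in> events" "0 < prob A" "\<forall>w\<in>A. mono_on {0..h} (%t. X t w)"
      by blast
    have "levy_measure \<mu>" using triplet by (simp add: levy_triplet_def)
    hence "levy_triplet_paths (P x) X x h A \<gamma> \<sigma> \<mu>" using h by unfold_locales (blast | rule increment_char[OF fam triplet])+
    then interpret levy_triplet_paths "P x" X x h A \<gamma> \<sigma> \<mu> .
    show "AE w in P x. skorokhod 0 (%t. X t w) (%t. ?L t w) (%t. ?R t w)" using path_decomposition AE_space
    proof eventually_elim
      case (elim w)
      note decomposition = conjunct1[OF elim(1), rule_format] conjunct2[OF elim(1), rule_format]
      from zero_barrier_skorokhod[OF cadlag_X[OF elim(2)] decomposition] show ?case .
    qed
    show "AE w in P x. AE t in control_measure (%t. ?L t w). 0 <= t -->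
      skorokhod_path.growth_discount (%t. ?R t w) q t <= drawdown q 0 (%t. X t w) t" using path_decomposition AE_space
    proof eventually_elim
      case (elim w)
      note decomposition = conjunct1[OF elim(1), rule_format] conjunct2[OF elim(1), rule_format]
      from zero_barrier_slack[OF cadlag_X[OF elim(2)] decomposition drift_nonneg q] show ?case .
    qed
  qed
  have eq: "double_barrier X ?\<delta> 0 = (?L, ?R)" by (simp add: double_barrier_def)
  note v = verification[where a = 0 and L = ?L and R = ?R, OF fam q \<beta> int order_refl opt disjI1[OF refl]]
  have "(?L, ?R) \<in> admissible P X q"
  proof (rule v(1), goal_cases)
    case (1 t) show ?case by (rule measurable(1)[OF 1]) next
    case (2 t) show ?case by (rule measurable(2)[OF 2]) next
    case (3 x) show ?case by (rule path) next
    case (4 x) show ?case by (rule slack)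
  qed
  thus "double_barrier X ?\<delta> 0 \<in> admissible P X q" unfolding eq .
  have "value_function P X q \<beta> x = strategy_value P q \<beta> (?L, ?R) x"
  proof (rule v(2), goal_cases)
    case (1 t) show ?case by (rule measurable(1)[OF 1]) next
    case (2 t) show ?case by (rule measurable(2)[OF 2]) next
    case (3 x) show ?case by (rule path) next
    case (4 x) show ?case by (rule slack)
  qed
  thus "value_function P X q \<beta> x = strategy_value P q \<beta> (double_barrier X ?\<delta> 0) x" unfolding eq .
qed

theorem theorem5p1:
  fixes P :: "real \<Rightarrow> 'w measure" and X :: "real \<Rightarrow> 'w \<Rightarrow> real"
    and \<gamma> \<sigma> q \<beta> :: real and \<mu> :: "real measure"
  assumes levy: "levy_family P X"
    and triplet: "levy_triplet (P 0) X \<gamma> \<sigma> \<mu>"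
    and not_monotone: "\<not> monotone_paths (P 0) X"
    and integrable: "integrable (P 0) (\<lambda>\<omega>. \<bar>X 1 \<omega>\<bar>)"
    and q: "0 < q"
    and \<beta>: "1 < \<beta>"
    and densities: "\<not> bounded_variation_paths (P 0) X \<Longrightarrow>
      \<forall>a>0. regular_density_on a (phi_up P X q a) \<and> regular_density_on a (phi_down P X q a)"
  shows "double_barrier X (drift \<gamma> \<mu>) (optimal_barrier P X q \<beta>) \<in> admissible P X q \<and>
    (\<forall>x. value_function P X q \<beta> x =
         strategy_value P q \<beta> (double_barrier X (drift \<gamma> \<mu>) (optimal_barrier P X q \<beta>)) x)"
proof (cases "optimal_barrier P X q \<beta> = 0")
  case True
  show ?thesis
    unfolding True using zero_barrier_optimal[OF levy triplet q \<beta> integrable True] by blast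
next
  case False
  then have "0 < optimal_barrier P X q \<beta>" using optimal_barrier_nonneg[OF levy q \<beta>] by simp
  then show ?thesis using positive_barrier_optimal[OF levy q \<beta> integrable] by blast
qed

end
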